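(* Let $(M,g)$ be an Einstein manifold of cohomogeneity one under the action of a compact, connected group $G$ with principal isotropy group $K$, such that the isotropy representation has two equivalent orthogonal summands $\mathfrak p_1\simeq\mathfrak p_2$ of dimension $d$, with all other summands distinct (pairwise inequivalent and inequivalent to $\mathfrak p_1$). The Einstein metric can be diagonalized if $$\sum_{k=1}^{d}[Y_k^1,Y_k^2]_{\mathfrak p}\neq 0 .$$
   Context: $(M^n,g)$ is of cohomogeneity one under $G$: $G$ acts by isometries and the principal orbits $G/K$ have codimension one. On the union of principal orbits $g=dt^2+g_t$, where $g_t$ is a one-parameter family of $G$-invariant metrics on $G/K$. Fix a bi-invariant inner product $Q$ on $\mathfrak g$ and an $\mathrm{Ad}(K)$-invariant decomposition $\mathfrak g=\mathfrak k\oplus\mathfrak p$, $\mathfrak p=\mathfrak p_1\oplus\dots\oplus\mathfrak p_m$, with the $\mathfrak p_i$ irreducible, $Q(\mathfrak k,\mathfrak p)=0$ and $Q(\mathfrak p_i,\mathfrak p_j)=0$ for $i\ne j$; $\mathfrak p$ is identified with the tangent space of $G/K$ and $[\cdot,\cdot]_{\mathfrak p}$ denotes the $\mathfrak p$-component of the bracket. A real irreducible representation $\mathfrak p_1$ is called orthogonal if $\mathfrak p_1\otimes\mathbb C$ is irreducible. $\{Y^i_k\}_{k=1,\dots,d}$ ($i=1,2$) are $Q$-orthonormal bases of $\mathfrak p_i$ corresponding to each other under an equivalence $\mathfrak p_1\simeq\mathfrak p_2$, so that every invariant metric has, on $\mathfrak p_1\oplus\mathfrak p_2$ in the basis $(Y^1_1,\dots,Y^1_d,Y^2_1,\dots,Y^2_d)$,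 the form $\begin{pmatrix} h_{11}\mathrm{Id}_d & h_{12}\mathrm{Id}_d \\ h_{12}\mathrm{Id}_d & h_{22}\mathrm{Id}_d \end{pmatrix}$ with $h_{ij}=h_{ij}(t)$, while on each $\mathfrak p_i$, $i\ge 3$, it is a multiple $A_i(t)Q|_{\mathfrak p_i}$. "The metric can be diagonalized" means that, for a suitable such choice of decomposition and basis (independent of $t$), the off-diagonal function satisfies $h_{12}(t)\equiv 0$. *)

theory Defs
  imports "HOL-Analysis.Analysis" "HOL-Algebra.Group_Action"
begin

section \<open>Smooth manifolds\<close>

primrec Ck_on :: "nat \<Rightarrow> 'a::euclidean_space set \<Rightarrow> ('a \<Rightarrow> 'b::real_normed_vector) \<Rightarrow> bool" where
  "Ck_on 0 S f \<longleftrightarrow> continuous_on S f"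
| "Ck_on (Suc k) S f \<longleftrightarrow>
     (\<forall>x\<in>S. f differentiable (at x)) \<and>
     (\<forall>b\<in>Basis. Ck_on k S (\<lambda>x. frechet_derivative f (at x) b))"

text \<open>Only used for open \<open>S\<close>.\<close>
definition smooth_on :: "'a::euclidean_space set \<Rightarrow> ('a \<Rightarrow> 'b::real_normed_vector) \<Rightarrow> bool" where
  "smooth_on S f \<longleftrightarrow> (\<forall>k. Ck_on k S f)"

text \<open>A chart is a pair \<open>(U, \<phi>)\<close>; the values of \<open>\<phi>\<close> outside \<open>U\<close> are irrelevant. A manifold is a
  whole (Hausdorff, second countable) type together with an atlas on it; its dimension is that of
  the model space \<open>'e\<close>.\<close>
type_synonym ('m, 'e) chart = "'m set \<times> ('m \<Rightarrow> 'e)"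

definition chart_inv :: "('m, 'e) chart \<Rightarrow> 'e \<Rightarrow> 'm" where
  "chart_inv c = inv_into (fst c) (snd c)"

definition coord_rep :: "('m, 'e) chart \<Rightarrow> ('n, 'f) chart \<Rightarrow> ('m \<Rightarrow> 'n) \<Rightarrow> 'e \<Rightarrow> 'f" where
  "coord_rep c c' f = snd c' \<circ> f \<circ> chart_inv c"

definition smooth_atlas ::
    "('m::{t2_space, second_countable_topology}, 'e::euclidean_space) chart set \<Rightarrow> bool" where
  "smooth_atlas A \<longleftrightarrow>
     (\<Union>c\<in>A. fst c) = UNIV \<and>
     (\<forall>c\<in>A. open (fst c) \<and> open (snd c ` fst c) \<and>
        homeomorphism (fst c) (snd c ` fst c) (snd c) (chart_inv c)) \<and>
     (\<forall>c\<in>A. \<forall>c'\<in>A. smooth_on (snd c ` (fst c \<inter> fst c')) (coord_rep c c' id))"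

definition prod_atlas ::
    "('m, 'e) chart set \<Rightarrow> ('n, 'f) chart set \<Rightarrow> ('m \<times> 'n, 'e \<times> 'f) chart set" where
  "prod_atlas A B = {(fst c \<times> fst c', map_prod (snd c) (snd c')) | c c'. c \<in> A \<and> c' \<in> B}"

definition real_atlas :: "(real, real) chart set" where
  "real_atlas = {(UNIV, id)}"

definition smooth_map ::
    "('m::topological_space, 'e::euclidean_space) chart set \<Rightarrow>
     ('n::topological_space, 'f::euclidean_space) chart set \<Rightarrow> 'm set \<Rightarrow> ('m \<Rightarrow> 'n) \<Rightarrow> bool" where
  "smooth_map A B S f \<longleftrightarrow>
     open S \<and> continuous_on S f \<and>
     (\<forall>c\<in>A. \<forall>c'\<in>B. smooth_on (snd c ` (fst c \<inter> S \<inter> f -` fst c')) (coord_rep c c' f))"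

text \<open>Tangent vectors at \<open>p\<close> are represented by their components in a chart around \<open>p\<close>;
  \<open>tangent_map c c' f p\<close> is the differential of \<open>f\<close> at \<open>p\<close> with respect to charts \<open>c\<close> around \<open>p\<close>
  and \<open>c'\<close> around \<open>f p\<close>.\<close>
definition tangent_map ::
    "('m, 'e::euclidean_space) chart \<Rightarrow> ('n, 'f::euclidean_space) chart \<Rightarrow> ('m \<Rightarrow> 'n) \<Rightarrow> 'm \<Rightarrow> 'e \<Rightarrow> 'f"
  where "tangent_map c c' f p = frechet_derivative (coord_rep c c' f) (at (snd c p))"

section \<open>Riemannian metrics and the Einstein condition\<close>

definition inner_product_form :: "('v::real_vector \<Rightarrow> 'v \<Rightarrow> real) \<Rightarrow> bool" where
  "inner_product_form B \<longleftrightarrow>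
     bilinear B \<and> (\<forall>u v. B u v = B v u) \<and> (\<forall>v. v \<noteq> 0 \<longrightarrow> B v v > 0)"

text \<open>\<open>g c p u v\<close> is the inner product at \<open>p\<close> of the tangent vectors with components \<open>u\<close>, \<open>v\<close> in
  the chart \<open>c\<close>.\<close>
type_synonym ('m, 'e) metric_tensor = "('m, 'e) chart \<Rightarrow> 'm \<Rightarrow> 'e \<Rightarrow> 'e \<Rightarrow> real"

definition metric_coeff :: "('m, 'e) metric_tensor \<Rightarrow> ('m, 'e) chart \<Rightarrow> 'e \<Rightarrow> 'e \<Rightarrow> 'e \<Rightarrow> real" where
  "metric_coeff g c x = g c (chart_inv c x)"

definition riemannian_metric ::
    "('m, 'e::euclidean_space) chart set \<Rightarrow> ('m, 'e) metric_tensor \<Rightarrow> bool" where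
  "riemannian_metric A g \<longleftrightarrow>
     (\<forall>c\<in>A. \<forall>p\<in>fst c. inner_product_form (g c p)) \<and>
     (\<forall>c\<in>A. \<forall>u v. smooth_on (snd c ` fst c) (\<lambda>x. metric_coeff g c x u v)) \<and>
     (\<forall>c\<in>A. \<forall>c'\<in>A. \<forall>p\<in>fst c \<inter> fst c'. \<forall>u v.
        g c' p (tangent_map c c' id p u) (tangent_map c c' id p v) = g c p u v)"

text \<open>In the following, \<open>h\<close> is a metric on an open subset of \<open>'e\<close> and \<open>u, v, w\<close> are constant vector
  fields. \<open>christoffel h x u v\<close> is the Levi-Civita derivative of \<open>v\<close> along \<open>u\<close>, given by the
  Koszul formula.\<close>
definition christoffel :: "('e::euclidean_space \<Rightarrow> 'e \<Rightarrow> 'e \<Rightarrow> real) \<Rightarrow> 'e \<Rightarrow> 'e \<Rightarrow> 'e \<Rightarrow> 'e" where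
  "christoffel h x u v = (THE z. \<forall>w. 2 * h x z w =
      frechet_derivative (\<lambda>y. h y v w) (at x) u
    + frechet_derivative (\<lambda>y. h y u w) (at x) v
    - frechet_derivative (\<lambda>y. h y u v) (at x) w)"

definition curvature ::
    "('e::euclidean_space \<Rightarrow> 'e \<Rightarrow> 'e \<Rightarrow> real) \<Rightarrow> 'e \<Rightarrow> 'e \<Rightarrow> 'e \<Rightarrow> 'e \<Rightarrow> 'e" where
  "curvature h x u v w =
      frechet_derivative (\<lambda>y. christoffel h y v w) (at x) u
    - frechet_derivative (\<lambda>y. christoffel h y u w) (at x) v
    + christoffel h x u (christoffel h x v w)
    - christoffel h x v (christoffel h x u w)"

text \<open>\<open>Ric(v, w)\<close> is the trace of \<open>u \<mapsto> R(u, v) w\<close>; the trace may be computed in any basis.\<close>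
definition ricci :: "('e::euclidean_space \<Rightarrow> 'e \<Rightarrow> 'e \<Rightarrow> real) \<Rightarrow> 'e \<Rightarrow> 'e \<Rightarrow> 'e \<Rightarrow> real" where
  "ricci h x v w = (\<Sum>b\<in>Basis. curvature h x b v w \<bullet> b)"

definition einstein_metric ::
    "('m, 'e::euclidean_space) chart set \<Rightarrow> ('m, 'e) metric_tensor \<Rightarrow> bool" where
  "einstein_metric A g \<longleftrightarrow> riemannian_metric A g \<and>
     (\<exists>\<Lambda>. \<forall>c\<in>A. \<forall>p\<in>fst c. \<forall>v w. ricci (metric_coeff g c) (snd c p) v w = \<Lambda> * g c p v w)"

section \<open>Lie groups\<close>

definition lie_group ::
    "('g::{t2_space, second_countable_topology}) monoid \<Rightarrow> ('g, 'l::euclidean_space) chart set \<Rightarrow> bool"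
  where
  "lie_group G AG \<longleftrightarrow>
     group G \<and> carrier G = UNIV \<and> smooth_atlas AG \<and>
     smooth_map (prod_atlas AG AG) AG UNIV (\<lambda>(a, b). a \<otimes>\<^bsub>G\<^esub> b) \<and>
     smooth_map AG AG UNIV (\<lambda>a. inv\<^bsub>G\<^esub> a)"

text \<open>Below, \<open>\<psi>\<close> is a chart of \<open>G\<close> around the identity, and the Lie algebra of \<open>G\<close> is the tangent
  space at the identity, identified with \<open>'l\<close> by means of \<open>\<psi>\<close>.\<close>

definition Ad :: "'g monoid \<Rightarrow> ('g, 'l::euclidean_space) chart \<Rightarrow> 'g \<Rightarrow> 'l \<Rightarrow> 'l" where
  "Ad G \<psi> a = tangent_map \<psi> \<psi> (\<lambda>b. a \<otimes>\<^bsub>G\<^esub> b \<otimes>\<^bsub>G\<^esub> inv\<^bsub>G\<^esub> a) \<one>\<^bsub>G\<^esub>"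

text \<open>The left-invariant vector field extending \<open>X\<close>, in the coordinates of \<open>\<psi>\<close>.\<close>
definition left_invariant_field ::
    "'g monoid \<Rightarrow> ('g, 'l::euclidean_space) chart \<Rightarrow> 'l \<Rightarrow> 'l \<Rightarrow> 'l" where
  "left_invariant_field G \<psi> X x = tangent_map \<psi> \<psi> (\<lambda>b. chart_inv \<psi> x \<otimes>\<^bsub>G\<^esub> b) \<one>\<^bsub>G\<^esub> X"

definition field_bracket ::
    "('l::euclidean_space \<Rightarrow> 'l) \<Rightarrow> ('l \<Rightarrow> 'l) \<Rightarrow> 'l \<Rightarrow> 'l" where
  "field_bracket V W x = frechet_derivative W (at x) (V x) - frechet_derivative V (at x) (W x)"

definition lie_bracket :: "'g monoid \<Rightarrow> ('g, 'l::euclidean_space) chart \<Rightarrow> 'l \<Rightarrow> 'l \<Rightarrow> 'l" where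
  "lie_bracket G \<psi> X Y =
     field_bracket (left_invariant_field G \<psi> X) (left_invariant_field G \<psi> Y) (snd \<psi> \<one>\<^bsub>G\<^esub>)"

text \<open>The Lie algebra of a closed subgroup: its tangent space at the identity.\<close>
definition lie_subalgebra ::
    "'g monoid \<Rightarrow> ('g, 'l::euclidean_space) chart \<Rightarrow> 'g set \<Rightarrow> 'l set" where
  "lie_subalgebra G \<psi> K = {X. \<exists>k :: real \<Rightarrow> 'g. (\<forall>s. k s \<in> K \<inter> fst \<psi>) \<and> k 0 = \<one>\<^bsub>G\<^esub> \<and>
     ((\<lambda>s. snd \<psi> (k s)) has_vector_derivative X) (at 0)}"

definition bi_invariant_inner_product ::
    "'g monoid \<Rightarrow> ('g, 'l::euclidean_space) chart \<Rightarrow> ('l \<Rightarrow> 'l \<Rightarrow> real) \<Rightarrow> bool" where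
  "bi_invariant_inner_product G \<psi> Q \<longleftrightarrow>
     inner_product_form Q \<and> (\<forall>a\<in>carrier G. \<forall>X Y. Q (Ad G \<psi> a X) (Ad G \<psi> a Y) = Q X Y)"

section \<open>Representations on subspaces\<close>

text \<open>\<open>\<rho> k\<close>, for \<open>k \<in> K\<close>, are linear maps.\<close>

definition irreducible_rep :: "'g set \<Rightarrow> ('g \<Rightarrow> 'v::real_vector \<Rightarrow> 'v) \<Rightarrow> 'v set \<Rightarrow> bool" where
  "irreducible_rep K \<rho> V \<longleftrightarrow>
     subspace V \<and> V \<noteq> {0} \<and> (\<forall>k\<in>K. \<rho> k ` V \<subseteq> V) \<and>
     (\<forall>W. subspace W \<and> W \<subseteq> V \<and> (\<forall>k\<in>K. \<rho> k ` W \<subseteq> W) \<longrightarrow> W = {0} \<or> W = V)"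

text \<open>The complexification of \<open>V\<close> is \<open>V \<times> V\<close>, where \<open>(v, w)\<close> stands for \<open>v + \<i>w\<close>. Its complex
  subspaces are the real subspaces closed under multiplication by \<open>\<i>\<close>, i.e.\ under
  \<open>(v, w) \<mapsto> (-w, v)\<close>.\<close>
definition complexification_irreducible ::
    "'g set \<Rightarrow> ('g \<Rightarrow> 'v::real_vector \<Rightarrow> 'v) \<Rightarrow> 'v set \<Rightarrow> bool" where
  "complexification_irreducible K \<rho> V \<longleftrightarrow>
     V \<noteq> {0} \<and>
     (\<forall>W. subspace W \<and> W \<subseteq> V \<times> V \<and> (\<lambda>(v, w). (- w, v)) ` W \<subseteq> W \<and>
        (\<forall>k\<in>K. map_prod (\<rho> k) (\<rho> k) ` W \<subseteq> W) \<longrightarrow> W = {0} \<or> W = V \<times> V)"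

definition orthogonal_rep :: "'g set \<Rightarrow> ('g \<Rightarrow> 'v::real_vector \<Rightarrow> 'v) \<Rightarrow> 'v set \<Rightarrow> bool" where
  "orthogonal_rep K \<rho> V \<longleftrightarrow> irreducible_rep K \<rho> V \<and> complexification_irreducible K \<rho> V"

definition rep_equivalence ::
    "'g set \<Rightarrow> ('g \<Rightarrow> 'v::real_vector \<Rightarrow> 'v) \<Rightarrow> 'v set \<Rightarrow> 'v set \<Rightarrow> ('v \<Rightarrow> 'v) \<Rightarrow> bool" where
  "rep_equivalence K \<rho> V W f \<longleftrightarrow>
     linear f \<and> bij_betw f V W \<and> (\<forall>k\<in>K. \<forall>v\<in>V. f (\<rho> k v) = \<rho> k (f v))"

definition equivalent_reps ::
    "'g set \<Rightarrow> ('g \<Rightarrow> 'v::real_vector \<Rightarrow> 'v) \<Rightarrow> 'v set \<Rightarrow> 'v set \<Rightarrow> bool" where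
  "equivalent_reps K \<rho> V W \<longleftrightarrow> (\<exists>f. rep_equivalence K \<rho> V W f)"

section \<open>Isometric actions of cohomogeneity one\<close>

definition isometric_action ::
    "('g::{t2_space, second_countable_topology}) monoid \<Rightarrow> ('g, 'l::euclidean_space) chart set \<Rightarrow>
     ('m::{t2_space, second_countable_topology}, 'e::euclidean_space) chart set \<Rightarrow>
     ('m, 'e) metric_tensor \<Rightarrow> ('g \<Rightarrow> 'm \<Rightarrow> 'm) \<Rightarrow> bool" where
  "isometric_action G AG AM g act \<longleftrightarrow>
     group_action G UNIV act \<and>
     smooth_map (prod_atlas AG AM) AM UNIV (\<lambda>(a, p). act a p) \<and>
     (\<forall>a\<in>carrier G. \<forall>c\<in>AM. \<forall>c'\<in>AM. \<forall>p\<in>fst c \<inter> act a -` fst c'. \<forall>u v.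
        g c' (act a p) (tangent_map c c' (act a) p u) (tangent_map c c' (act a) p v) = g c p u v)"

text \<open>\<open>p\<close> lies on a principal orbit: up to conjugation, its isotropy group is contained in that of
  every other point.\<close>
definition principal_point :: "'g monoid \<Rightarrow> ('g \<Rightarrow> 'm \<Rightarrow> 'm) \<Rightarrow> 'm \<Rightarrow> bool" where
  "principal_point G act p \<longleftrightarrow>
     (\<forall>q. \<exists>a\<in>carrier G.
        (\<lambda>k. a \<otimes>\<^bsub>G\<^esub> k \<otimes>\<^bsub>G\<^esub> inv\<^bsub>G\<^esub> a) ` stabilizer G act p \<subseteq> stabilizer G act q)"

text \<open>Components in \<open>c\<close> of the value at \<open>p\<close> of the action field generated by \<open>X\<close>.\<close>
definition action_field ::
    "'g monoid \<Rightarrow> ('g, 'l::euclidean_space) chart \<Rightarrow> ('g \<Rightarrow> 'm \<Rightarrow> 'm) \<Rightarrow>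
     ('m, 'e::euclidean_space) chart \<Rightarrow> 'm \<Rightarrow> 'l \<Rightarrow> 'e" where
  "action_field G \<psi> act c p = tangent_map \<psi> c (\<lambda>a. act a p) \<one>\<^bsub>G\<^esub>"

text \<open>The tangent space at \<open>p\<close> of the orbit of \<open>p\<close> is the range of \<open>action_field\<close>.\<close>
definition cohomogeneity_one ::
    "'g monoid \<Rightarrow> ('g, 'l::euclidean_space) chart \<Rightarrow> ('m, 'e::euclidean_space) chart set \<Rightarrow>
     ('g \<Rightarrow> 'm \<Rightarrow> 'm) \<Rightarrow> bool" where
  "cohomogeneity_one G \<psi> AM act \<longleftrightarrow>
     (\<forall>p. principal_point G act p \<longrightarrow>
        (\<forall>c\<in>AM. p \<in> fst c \<longrightarrow> dim (range (action_field G \<psi> act c p)) + 1 = DIM('e)))"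

text \<open>A unit speed curve \<open>\<gamma>\<close> on an open interval \<open>I\<close>, orthogonal to the orbits and meeting exactly
  the principal ones, with constant isotropy group \<open>K\<close>. It exhibits the union of the principal
  orbits as the image of \<open>I \<times> G/K\<close> under \<open>(t, aK) \<mapsto> a \<gamma>(t)\<close>, and the metric pulls back to
  \<open>dt\<^sup>2 + g\<^sub>t\<close>.\<close>
definition normal_curve ::
    "'g monoid \<Rightarrow> ('g, 'l::euclidean_space) chart \<Rightarrow>
     ('m::{t2_space, second_countable_topology}, 'e::euclidean_space) chart set \<Rightarrow>
     ('m, 'e) metric_tensor \<Rightarrow> ('g \<Rightarrow> 'm \<Rightarrow> 'm) \<Rightarrow> 'g set \<Rightarrow> real set \<Rightarrow> (real \<Rightarrow> 'm) \<Rightarrow> bool" where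
  "normal_curve G \<psi> AM g act K I \<gamma> \<longleftrightarrow>
     is_interval I \<and> open I \<and> I \<noteq> {} \<and>
     smooth_map real_atlas AM I \<gamma> \<and>
     (\<Union>t\<in>I. orbit G act (\<gamma> t)) = {p. principal_point G act p} \<and>
     (\<forall>t\<in>I. stabilizer G act (\<gamma> t) = K) \<and>
     (\<forall>t\<in>I. \<forall>c\<in>AM. \<gamma> t \<in> fst c \<longrightarrow>
        (let T = vector_derivative (\<lambda>s. snd c (\<gamma> s)) (at t) in
           g c (\<gamma> t) T T = 1 \<and> (\<forall>X. g c (\<gamma> t) T (action_field G \<psi> act c (\<gamma> t) X) = 0)))"

text \<open>The metric of the orbit \<open>G p\<close> as a form on the Lie algebra of \<open>G\<close>; it does not depend on the
  chart chosen. For \<open>p = \<gamma> t\<close>, its restriction to a complement of the isotropy algebra is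
  \<open>g\<^sub>t\<close>.\<close>
definition orbit_metric ::
    "'g monoid \<Rightarrow> ('g, 'l::euclidean_space) chart \<Rightarrow> ('m, 'e::euclidean_space) chart set \<Rightarrow>
     ('m, 'e) metric_tensor \<Rightarrow> ('g \<Rightarrow> 'm \<Rightarrow> 'm) \<Rightarrow> 'm \<Rightarrow> 'l \<Rightarrow> 'l \<Rightarrow> real" where
  "orbit_metric G \<psi> AM g act p X Y =
     (let c = (SOME c. c \<in> AM \<and> p \<in> fst c)
      in g c p (action_field G \<psi> act c p X) (action_field G \<psi> act c p Y))"

section \<open>The isotropy representation\<close>

definition isotropy_decomposition ::
    "'g monoid \<Rightarrow> ('g, 'l::euclidean_space) chart \<Rightarrow> 'g set \<Rightarrow> ('l \<Rightarrow> 'l \<Rightarrow> real) \<Rightarrow> nat \<Rightarrow>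
     (nat \<Rightarrow> 'l set) \<Rightarrow> bool" where
  "isotropy_decomposition G \<psi> K Q m P \<longleftrightarrow>
     (\<forall>i\<in>{1..m}. irreducible_rep K (Ad G \<psi>) (P i)) \<and>
     (\<forall>i\<in>{1..m}. \<forall>X\<in>lie_subalgebra G \<psi> K. \<forall>Y\<in>P i. Q X Y = 0) \<and>
     (\<forall>i\<in>{1..m}. \<forall>j\<in>{1..m}. i \<noteq> j \<longrightarrow> (\<forall>X\<in>P i. \<forall>Y\<in>P j. Q X Y = 0)) \<and>
     span (lie_subalgebra G \<psi> K \<union> (\<Union>i\<in>{1..m}. P i)) = UNIV"

text \<open>The component of \<open>Z\<close> in \<open>\<pp> = P 1 \<oplus> \<dots> \<oplus> P m\<close> along the Lie algebra of \<open>K\<close>.\<close>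
definition p_part ::
    "'g monoid \<Rightarrow> ('g, 'l::euclidean_space) chart \<Rightarrow> 'g set \<Rightarrow> nat \<Rightarrow> (nat \<Rightarrow> 'l set) \<Rightarrow> 'l \<Rightarrow> 'l" where
  "p_part G \<psi> K m P Z =
     (THE X. X \<in> span (\<Union>i\<in>{1..m}. P i) \<and> Z - X \<in> lie_subalgebra G \<psi> K)"

definition two_equivalent_orthogonal_summands ::
    "'g monoid \<Rightarrow> ('g, 'l::euclidean_space) chart \<Rightarrow> 'g set \<Rightarrow> nat \<Rightarrow> (nat \<Rightarrow> 'l set) \<Rightarrow> bool" where
  "two_equivalent_orthogonal_summands G \<psi> K m P \<longleftrightarrow>
     2 \<le> m \<and>
     orthogonal_rep K (Ad G \<psi>) (P 1) \<and> orthogonal_rep K (Ad G \<psi>) (P 2) \<and>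
     equivalent_reps K (Ad G \<psi>) (P 1) (P 2) \<and>
     (\<forall>i\<in>{3..m}. \<not> equivalent_reps K (Ad G \<psi>) (P 1) (P i)) \<and>
     (\<forall>i\<in>{3..m}. \<forall>j\<in>{3..m}. i \<noteq> j \<longrightarrow> \<not> equivalent_reps K (Ad G \<psi>) (P i) (P j))"

definition corresponding_bases ::
    "'g monoid \<Rightarrow> ('g, 'l::euclidean_space) chart \<Rightarrow> 'g set \<Rightarrow> ('l \<Rightarrow> 'l \<Rightarrow> real) \<Rightarrow>
     (nat \<Rightarrow> 'l set) \<Rightarrow> nat \<Rightarrow> (nat \<Rightarrow> 'l) \<Rightarrow> (nat \<Rightarrow> 'l) \<Rightarrow> bool" where
  "corresponding_bases G \<psi> K Q P d Y1 Y2 \<longleftrightarrow>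
     (\<forall>k\<in>{1..d}. \<forall>l\<in>{1..d}. Q (Y1 k) (Y1 l) = of_bool (k = l)) \<and> span (Y1 ` {1..d}) = P 1 \<and>
     (\<forall>k\<in>{1..d}. \<forall>l\<in>{1..d}. Q (Y2 k) (Y2 l) = of_bool (k = l)) \<and> span (Y2 ` {1..d}) = P 2 \<and>
     (\<exists>f. rep_equivalence K (Ad G \<psi>) (P 1) (P 2) f \<and> (\<forall>k\<in>{1..d}. f (Y1 k) = Y2 k))"

text \<open>\<open>B\<close> has the block matrix with blocks \<open>h\<^sub>i\<^sub>j Id\<^sub>d\<close> on \<open>P 1 \<oplus> P 2\<close>, is \<open>A i\<close> times
  \<open>Q\<close> on \<open>P i\<close> for \<open>i \<ge> 3\<close>, and has no further nonzero blocks.\<close>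
definition invariant_metric_form ::
    "('l::euclidean_space \<Rightarrow> 'l \<Rightarrow> real) \<Rightarrow> nat \<Rightarrow> (nat \<Rightarrow> 'l set) \<Rightarrow> nat \<Rightarrow>
     (nat \<Rightarrow> 'l) \<Rightarrow> (nat \<Rightarrow> 'l) \<Rightarrow> ('l \<Rightarrow> 'l \<Rightarrow> real) \<Rightarrow> real \<Rightarrow> real \<Rightarrow> real \<Rightarrow> (nat \<Rightarrow> real) \<Rightarrow> bool"
  where
  "invariant_metric_form Q m P d Y1 Y2 B h11 h12 h22 A \<longleftrightarrow>
     (\<forall>k\<in>{1..d}. \<forall>l\<in>{1..d}.
        B (Y1 k) (Y1 l) = h11 * of_bool (k = l) \<and> B (Y1 k) (Y2 l) = h12 * of_bool (k = l) \<and>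
        B (Y2 k) (Y1 l) = h12 * of_bool (k = l) \<and> B (Y2 k) (Y2 l) = h22 * of_bool (k = l)) \<and>
     (\<forall>i\<in>{3..m}. \<forall>X\<in>P i. \<forall>Y\<in>P i. B X Y = A i * Q X Y) \<and>
     (\<forall>i\<in>{1..m}. \<forall>j\<in>{1..m}. i \<noteq> j \<and> {i, j} \<noteq> {1, 2} \<longrightarrow> (\<forall>X\<in>P i. \<forall>Y\<in>P j. B X Y = 0))"

text \<open>The metric along \<open>\<gamma>\<close> can be diagonalized: some decomposition and bases, independent of
  \<open>t\<close>, make the off-diagonal function vanish identically.\<close>
definition diagonalizable_metric ::
    "'g monoid \<Rightarrow> ('g, 'l::euclidean_space) chart \<Rightarrow> ('m, 'e::euclidean_space) chart set \<Rightarrow>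
     ('m, 'e) metric_tensor \<Rightarrow> ('g \<Rightarrow> 'm \<Rightarrow> 'm) \<Rightarrow> 'g set \<Rightarrow> ('l \<Rightarrow> 'l \<Rightarrow> real) \<Rightarrow>
     nat \<Rightarrow> nat \<Rightarrow> real set \<Rightarrow> (real \<Rightarrow> 'm) \<Rightarrow> bool" where
  "diagonalizable_metric G \<psi> AM g act K Q m d I \<gamma> \<longleftrightarrow>
     (\<exists>P Y1 Y2 h11 h12 h22 A.
        isotropy_decomposition G \<psi> K Q m P \<and>
        two_equivalent_orthogonal_summands G \<psi> K m P \<and>
        corresponding_bases G \<psi> K Q P d Y1 Y2 \<and>
        (\<forall>t\<in>I. invariant_metric_form Q m P d Y1 Y2 (orbit_metric G \<psi> AM g act (\<gamma> t))
                 (h11 t) (h12 t) (h22 t) (A t)) \<and>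
        (\<forall>t\<in>I. h12 t = 0))"

end

theory Submission
  imports Defs "HOL-Computational_Algebra.Formal_Power_Series"
begin

text \<open>
  Every element of the Lie algebra acts by a Killing field, so covariant derivatives and curvature along
  the curve \<open>\<gamma>\<close> can be expressed through the orbit metrics \<open>B t\<close>, their time derivative
  \<open>- 2 \<Omega> t\<close> and the Lie bracket. The mixed Einstein equation \<open>Ric(X, \<gamma>') = 0\<close>, evaluated at
  \<open>X = \<Sum>k. [Y1 k, Y2 k]\<close>, becomes \<open>|X|\<^sup>2 (p q' - q p') = 0\<close> for \<open>p = h11 - h22\<close> and
  \<open>q = h12\<close>: the Wronskian of \<open>p\<close> and \<open>q\<close> vanishes. The tangential Einstein equations express the second
  derivatives of the metric coefficients as polynomials in the coefficients, their first derivatives and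
  the reciprocals of the determinants of the diagonal blocks. Hence the coefficients are analytic and
  the direction of \<open>(p, q)\<close> is constant, so one rotation in \<open>\<pp>\<^sub>1 \<oplus> \<pp>\<^sub>2\<close>, independent of time, diagonalizes
  all the metrics.\<close>

section \<open>Calculus\<close>

text \<open>Killing fields replace an adapted frame because the Lie derivative of the connection
  along them vanishes: their second derivatives drop out of the curvature, which becomes algebra in
  the skew maps \<open>nab X\<close>. Smoothness alone would not give the last step, since a
  vanishing Wronskian leaves the direction of (p, q) free to jump at a common zero. Analyticity
  comes from a majorant argument: the coefficients, their first derivatives and the reciprocals
  generate an algebra closed under differentiation, and in such a finitely generated algebra the
  Taylor coefficients of every element are geometrically bounded, uniformly on compact sets. The
  vector X is chosen because the mixed equation, paired with any X, carries the factor Q(X, Z) with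
  Z the sum of brackets. Another obstacle is that the Lie algebra of \<open>K\<close> is defined by
  curves in \<open>K\<close>, whereas the metric sees only the kernel of the action fields;
  identifying the two needs the constant rank of the orbit map. Local work is done in one chart and
  glued through the orbit metrics, which do not depend on charts.\<close>

abbreviation Dd :: "('a::real_normed_vector \<Rightarrow> 'b::real_normed_vector) \<Rightarrow> 'a \<Rightarrow> 'a \<Rightarrow> 'b" where
  "Dd f x u \<equiv> frechet_derivative f (at x) u"

lemma Dd_eq:
  assumes "(f has_derivative f') (at x)"
  shows "Dd f x u = f' u"
  using frechet_derivative_at[OF assms] by simp

lemma Ck_on_cong:
  assumes "open S" and "\<And>x. x \<in> S \<Longrightarrow> f x = g x" and "Ck_on k S f"
  shows "Ck_on k S g"
  using assms(2,3)
proof (induction k arbitrary: f g)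
  case 0
  then show ?case using continuous_on_cong by fastforce
next
  case (Suc k)
  have d: "(f has_derivative Dd f x) (at x)" if "x \<in> S" for x
    using Suc.prems(2) that frechet_derivative_works by fastforce
  have dg: "(g has_derivative Dd f x) (at x)" if "x \<in> S" for x
    using has_derivative_transform_within_open[OF d[OF that] assms(1) that] Suc.prems(1) by auto
  have eq: "Dd f x b = Dd g x b" if "x \<in> S" for x b
    using Dd_eq[OF dg[OF that]] by simp
  have "Ck_on k S (\<lambda>x. Dd g x b)" if "b \<in> Basis" for b
    by (rule Suc.IH[of "\<lambda>x. Dd f x b"]) (use that Suc.prems(2) eq in auto)
  then show ?case using dg by (auto simp: differentiable_def)
qed

lemma Ck_on_const: "open S \<Longrightarrow> Ck_on k S (\<lambda>x. c)"
  by (induction k arbitrary: c) (auto simp: frechet_derivative_const)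

lemma Ck_on_add:
  assumes "open S" and "Ck_on k S f" and "Ck_on k S g"
  shows "Ck_on k S (\<lambda>x. f x + g x)"
  using assms(2,3)
proof (induction k arbitrary: f g)
  case 0
  then show ?case by (simp add: continuous_on_add)
next
  case (Suc k)
  have d: "((\<lambda>x. f x + g x) has_derivative (\<lambda>u. Dd f x u + Dd g x u)) (at x)" if "x \<in> S" for x
    using Suc.prems that by (intro has_derivative_add) (auto simp: frechet_derivative_works[symmetric])
  have "Ck_on k S (\<lambda>x. Dd (\<lambda>x. f x + g x) x b)" if "b \<in> Basis" for b
    by (rule Ck_on_cong[OF assms(1) _ Suc.IH[of "\<lambda>x. Dd f x b" "\<lambda>x. Dd g x b"]])
      (use Suc.prems that Dd_eq[OF d] in auto)
  then show ?case using d by (auto simp: differentiable_def)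
qed

lemma Ck_on_scaleR:
  assumes "open S" and "Ck_on k S f"
  shows "Ck_on k S (\<lambda>x. c *\<^sub>R f x)"
  using assms(2)
proof (induction k arbitrary: f)
  case 0
  then show ?case by (auto intro: continuous_intros)
next
  case (Suc k)
  have d: "((\<lambda>x. c *\<^sub>R f x) has_derivative (\<lambda>u. c *\<^sub>R Dd f x u)) (at x)" if "x \<in> S" for x
    using Suc.prems that by (intro has_derivative_scaleR_right) (auto simp: frechet_derivative_works[symmetric])
  have "Ck_on k S (\<lambda>x. Dd (\<lambda>x. c *\<^sub>R f x) x b)" if "b \<in> Basis" for b
    by (rule Ck_on_cong[OF assms(1) _ Suc.IH[of "\<lambda>x. Dd f x b"]])
      (use Suc.prems that Dd_eq[OF d] in auto)
  then show ?case using d by (auto simp: differentiable_def)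
qed

lemma Ck_on_sum:
  assumes "open S" and "finite A" and "\<And>a. a \<in> A \<Longrightarrow> Ck_on k S (f a)"
  shows "Ck_on k S (\<lambda>x. \<Sum>a\<in>A. f a x)"
  using assms(2,3) by (induction A) (auto simp: Ck_on_const Ck_on_add assms(1))

lemma smooth_on_has_derivative:
  assumes "smooth_on S f" and "x \<in> S"
  shows "(f has_derivative Dd f x) (at x)"
  using assms unfolding smooth_on_def by (auto dest!: spec[of _ 1] simp: frechet_derivative_works[symmetric])

lemma smooth_on_linear_Dd:
  assumes "smooth_on S f" and "x \<in> S"
  shows "linear (Dd f x)"
  using smooth_on_has_derivative[OF assms] has_derivative_linear by blast

lemma linear_expand:
  fixes f :: "'a::euclidean_space \<Rightarrow> 'b::real_vector"
  assumes "linear f"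
  shows "f v = (\<Sum>b\<in>Basis. (v \<bullet> b) *\<^sub>R f b)"
proof -
  have "f v = f (\<Sum>b\<in>Basis. (v \<bullet> b) *\<^sub>R b)" by (simp add: euclidean_representation)
  also have "\<dots> = (\<Sum>b\<in>Basis. (v \<bullet> b) *\<^sub>R f b)"
    using assms by (simp add: linear_sum linear_cmul)
  finally show ?thesis .
qed

text \<open>\<open>Ck_on\<close> speaks of basis directions only; linearity of the differential
  supplies all the others.\<close>

lemma smooth_on_Dd:
  assumes "open S" and "smooth_on S f"
  shows "smooth_on S (\<lambda>x. Dd f x v)"
  unfolding smooth_on_def
proof
  fix k
  have "Ck_on k S (\<lambda>x. Dd f x b)" if "b \<in> Basis" for b
    using assms(2) that unfolding smooth_on_def by (auto dest!: spec[of _ "Suc k"])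
  then have "Ck_on k S (\<lambda>x. \<Sum>b\<in>Basis. (v \<bullet> b) *\<^sub>R Dd f x b)"
    by (intro Ck_on_sum Ck_on_scaleR assms(1)) auto
  then show "Ck_on k S (\<lambda>x. Dd f x v)"
    by (rule Ck_on_cong[OF assms(1), rotated])
      (use linear_expand[OF smooth_on_linear_Dd[OF assms(2)]] in metis)
qed

lemma smooth_on_continuous: "smooth_on S f \<Longrightarrow> continuous_on S f"
  unfolding smooth_on_def by (metis Ck_on.simps(1))

text \<open>The derivatives of the slice are those of \<open>f\<close> in the directions
  \<open>(0, b)\<close>, which are basis vectors of the product, so the induction on
  \<open>k\<close> goes through with \<open>f\<close> replaced by such a derivative.\<close>

lemma smooth_on_slice_right:
  fixes f :: "'a::euclidean_space \<times> 'b::euclidean_space \<Rightarrow> 'c::real_normed_vector"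
  assumes "smooth_on U f" and "open S" and "\<And>x. x \<in> S \<Longrightarrow> (a, x) \<in> U"
  shows "smooth_on S (\<lambda>x. f (a, x))"
proof -
  have "Ck_on k S (\<lambda>x. f (a, x))" if "Ck_on k U f" for k
    using that
  proof (induction k arbitrary: f)
    case 0
    then have "continuous_on S (f \<circ> (\<lambda>x. (a, x)))"
      using assms(3) by (intro continuous_on_compose) (auto intro!: continuous_intros elim: continuous_on_subset)
    then show ?case by (simp add: o_def)
  next
    case (Suc k)
    have d: "((\<lambda>x. f (a, x)) has_derivative (\<lambda>u. Dd f (a, x) (0, u))) (at x)" if "x \<in> S" for x
    proof -
      have "(f has_derivative Dd f (a, x)) (at (a, x))"
        using Suc.prems assms(3)[OF that] by (auto simp: frechet_derivative_works[symmetric])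
      moreover have "((\<lambda>x. (a, x)) has_derivative (\<lambda>u. (0, u))) (at x)"
        by (auto intro!: derivative_eq_intros)
      ultimately show ?thesis using has_derivative_compose by blast
    qed
    have "Ck_on k S (\<lambda>x. Dd (\<lambda>x. f (a, x)) x b)" if "b \<in> Basis" for b
      by (rule Ck_on_cong[OF assms(2) _ Suc.IH[of "\<lambda>z. Dd f z (0, b)"]])
        (use Suc.prems that Dd_eq[OF d] in \<open>auto simp: Basis_prod_def\<close>)
    then show ?case using d by (auto simp: differentiable_def)
  qed
  then show ?thesis using assms(1) unfolding smooth_on_def by blast
qed

lemma smooth_on_slice_left:
  fixes f :: "'a::euclidean_space \<times> 'b::euclidean_space \<Rightarrow> 'c::real_normed_vector"
  assumes "smooth_on U f" and "open S" and "\<And>x. x \<in> S \<Longrightarrow> (x, a) \<in> U"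
  shows "smooth_on S (\<lambda>x. f (x, a))"
proof -
  have "Ck_on k S (\<lambda>x. f (x, a))" if "Ck_on k U f" for k
    using that
  proof (induction k arbitrary: f)
    case 0
    then have "continuous_on S (f \<circ> (\<lambda>x. (x, a)))"
      using assms(3) by (intro continuous_on_compose) (auto intro!: continuous_intros elim: continuous_on_subset)
    then show ?case by (simp add: o_def)
  next
    case (Suc k)
    have d: "((\<lambda>x. f (x, a)) has_derivative (\<lambda>u. Dd f (x, a) (u, 0))) (at x)" if "x \<in> S" for x
    proof -
      have "(f has_derivative Dd f (x, a)) (at (x, a))"
        using Suc.prems assms(3)[OF that] by (auto simp: frechet_derivative_works[symmetric])
      moreover have "((\<lambda>x. (x, a)) has_derivative (\<lambda>u. (u, 0))) (at x)"
        by (auto intro!: derivative_eq_intros)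
      ultimately show ?thesis using has_derivative_compose by blast
    qed
    have "Ck_on k S (\<lambda>x. Dd (\<lambda>x. f (x, a)) x b)" if "b \<in> Basis" for b
      by (rule Ck_on_cong[OF assms(2) _ Suc.IH[of "\<lambda>z. Dd f z (b, 0)"]])
        (use Suc.prems that Dd_eq[OF d] in \<open>auto simp: Basis_prod_def\<close>)
    then show ?case using d by (auto simp: differentiable_def)
  qed
  then show ?thesis using assms(1) unfolding smooth_on_def by blast
qed

text \<open>Product rule for a family of linear maps applied to a moving vector. In finite
  dimension, differentiability at each fixed vector is enough: expand the moving vector in the
  basis.\<close>

lemma has_derivative_linear_field:
  fixes L :: "'a::real_normed_vector \<Rightarrow> 'e::euclidean_space \<Rightarrow> 'b::real_normed_vector"
  assumes "open S" and "x \<in> S" and lin: "\<And>y. y \<in> S \<Longrightarrow> linear (L y)"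
    and L: "\<And>v. ((\<lambda>y. L y v) has_derivative L' v) (at x)"
    and V: "(V has_derivative V') (at x)"
  shows "((\<lambda>y. L y (V y)) has_derivative (\<lambda>u. L' (V x) u + L x (V' u))) (at x)"
proof -
  have ex: "L y v = (\<Sum>b\<in>Basis. (v \<bullet> b) *\<^sub>R L y b)" if "y \<in> S" for y v
    by (rule linear_expand[OF lin[OF that]])
  \<comment> \<open>Linearity of \<open>L'\<close> in the vector \<open>v\<close> is not assumed; it
    follows from uniqueness of derivatives.\<close>
  have L'ex: "L' v u = (\<Sum>b\<in>Basis. (v \<bullet> b) *\<^sub>R L' b u)" for v u
  proof -
    have "((\<lambda>y. \<Sum>b\<in>Basis. (v \<bullet> b) *\<^sub>R L y b) has_derivative (\<lambda>u. \<Sum>b\<in>Basis. (v \<bullet> b) *\<^sub>R L' b u)) (at x)"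
      by (intro has_derivative_sum has_derivative_scaleR_right L)
    then have "((\<lambda>y. L y v) has_derivative (\<lambda>u. \<Sum>b\<in>Basis. (v \<bullet> b) *\<^sub>R L' b u)) (at x)"
      by (rule has_derivative_transform_within_open[OF _ assms(1,2)]) (rule ex[symmetric])
    from has_derivative_unique[OF this L] show ?thesis by metis
  qed
  have "((\<lambda>y. \<Sum>b\<in>Basis. (V y \<bullet> b) *\<^sub>R L y b) has_derivative
      (\<lambda>u. \<Sum>b\<in>Basis. (V x \<bullet> b) *\<^sub>R L' b u + (V' u \<bullet> b) *\<^sub>R L x b)) (at x)"
    by (intro has_derivative_sum has_derivative_scaleR L has_derivative_inner_left V)
  then have "((\<lambda>y. L y (V y)) has_derivative
      (\<lambda>u. \<Sum>b\<in>Basis. (V x \<bullet> b) *\<^sub>R L' b u + (V' u \<bullet> b) *\<^sub>R L x b)) (at x)"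
    by (rule has_derivative_transform_within_open[OF _ assms(1,2)]) (rule ex[symmetric])
  then show ?thesis
    using L'ex[of "V x"] ex[OF assms(2), of "V' u" for u] by (simp add: sum.distrib)
qed

text \<open>Mean value theorem in the direction \<open>u\<close> for the increment of
  \<open>f\<close> along \<open>v\<close>. Differentiability of the partial derivative at the single
  point \<open>x\<close> suffices; continuity of second derivatives is not involved.\<close>

lemma second_difference_bound:
  fixes f :: "'a::euclidean_space \<Rightarrow> 'b::real_normed_vector"
  assumes "open S" and "x \<in> S"
    and f: "\<And>y. y \<in> S \<Longrightarrow> (f has_derivative f' y) (at y)"
    and f'': "((\<lambda>y. f' y u) has_derivative f'') (at x)"
    and "e > 0"
  shows "\<exists>r>0. \<forall>s. 0 < s \<and> s < r \<longrightarrow>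
    norm (f (x + s *\<^sub>R u + s *\<^sub>R v) - f (x + s *\<^sub>R u) - f (x + s *\<^sub>R v) + f x - (s * s) *\<^sub>R f'' v) \<le> e * (s * s)"
proof -
  \<comment> \<open>All displacements that occur have norm at most \<open>s * C\<close>. The factor
    2 in \<open>e'\<close> pays for the two error terms \<open>a s\<close> and \<open>a 0\<close>
    below.\<close>
  define C where "C = norm u + norm v + 1"
  have C: "C > 0" unfolding C_def by (smt (verit) norm_ge_zero)
  define e' where "e' = e / (2 * C)"
  have e': "e' > 0" using C assms(5) by (simp add: e'_def)
  interpret f'': bounded_linear f'' using f'' by (rule has_derivative_bounded_linear)
  obtain r1 where r1: "r1 > 0" "\<And>y. norm (y - x) < r1 \<Longrightarrow>
      norm (f' y u - f' x u - f'' (y - x)) \<le> e' * norm (y - x)"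
    using f'' e' unfolding has_derivative_at_alt by blast
  obtain r2 where r2: "r2 > 0" "ball x r2 \<subseteq> S" using assms(1,2) openE by blast
  define r where "r = min r1 r2 / C"
  have "r > 0" using C r1 r2 by (simp add: r_def)
  moreover have "norm (f (x + s *\<^sub>R u + s *\<^sub>R v) - f (x + s *\<^sub>R u) - f (x + s *\<^sub>R v) + f x - (s * s) *\<^sub>R f'' v) \<le> e * (s * s)"
    if s: "0 < s" "s < r" for s
  proof -
    have small: "norm (\<tau> *\<^sub>R u + \<sigma> *\<^sub>R v) \<le> s * C \<and> s * C < r1 \<and> s * C < r2"
      if "\<tau> \<in> {0..s}" "\<sigma> \<in> {0..s}" for \<tau> \<sigma>
    proof -
      have "norm (\<tau> *\<^sub>R u + \<sigma> *\<^sub>R v) \<le> \<tau> * norm u + \<sigma> * norm v"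
        using norm_triangle_ineq[of "\<tau> *\<^sub>R u" "\<sigma> *\<^sub>R v"] that by simp
      also have "\<dots> \<le> s * norm u + s * norm v"
        using that by (intro add_mono mult_right_mono) auto
      also have "\<dots> \<le> s * C" using s by (simp add: C_def algebra_simps)
      finally show ?thesis using s C by (auto simp: r_def field_simps)
    qed
    \<comment> \<open>The increment \<open>g s - g 0\<close> is exactly the second difference minus
      its expected value.\<close>
    define g where "g \<tau> = f (x + \<tau> *\<^sub>R u + s *\<^sub>R v) - f (x + \<tau> *\<^sub>R u) - (\<tau> * s) *\<^sub>R f'' v" for \<tau>
    define g' where "g' \<tau> = f' (x + \<tau> *\<^sub>R u + s *\<^sub>R v) u - f' (x + \<tau> *\<^sub>R u) u - s *\<^sub>R f'' v" for \<tau>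
    have inS: "x + \<tau> *\<^sub>R u + \<sigma> *\<^sub>R v \<in> S" if "\<tau> \<in> {0..s}" "\<sigma> \<in> {0..s}" for \<tau> \<sigma>
    proof -
      have "dist x (x + (\<tau> *\<^sub>R u + \<sigma> *\<^sub>R v)) < r2"
      proof -
        have "dist x (x + (\<tau> *\<^sub>R u + \<sigma> *\<^sub>R v)) = norm (\<tau> *\<^sub>R u + \<sigma> *\<^sub>R v)"
          unfolding dist_norm norm_minus_commute[of x] by (simp only: add_diff_cancel_left')
        then show ?thesis using small[OF that] by linarith
      qed
      then show ?thesis using r2(2) by (auto simp: add.assoc)
    qed
    have dl: "((\<lambda>\<tau>. f (x + \<tau> *\<^sub>R u + \<sigma> *\<^sub>R v)) has_derivative (\<lambda>h. h *\<^sub>R f' (x + \<tau> *\<^sub>R u + \<sigma> *\<^sub>R v) u)) (at \<tau>)"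
      if "\<tau> \<in> {0..s}" "\<sigma> \<in> {0..s}" for \<tau> \<sigma>
    proof -
      have "((\<lambda>\<tau>. x + \<tau> *\<^sub>R u + \<sigma> *\<^sub>R v) has_derivative (\<lambda>h. h *\<^sub>R u)) (at \<tau>)"
        by (auto intro!: derivative_eq_intros)
      from has_derivative_compose[OF this f[OF inS[OF that]]]
      show ?thesis using linear_cmul[OF has_derivative_linear[OF f[OF inS[OF that]]]] by simp
    qed
    have dg: "(g has_derivative (\<lambda>h. h *\<^sub>R g' \<tau>)) (at \<tau> within {0..s})" if "\<tau> \<in> {0..s}" for \<tau>
    proof -
      have "((\<lambda>\<tau>. (\<tau> * s) *\<^sub>R f'' v) has_derivative (\<lambda>h. (h * s) *\<^sub>R f'' v)) (at \<tau>)"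
        by (auto intro!: derivative_eq_intros)
      then have "(g has_derivative (\<lambda>h. h *\<^sub>R f' (x + \<tau> *\<^sub>R u + s *\<^sub>R v) u - h *\<^sub>R f' (x + \<tau> *\<^sub>R u) u - (h * s) *\<^sub>R f'' v)) (at \<tau>)"
        unfolding g_def using dl[OF that, of s] dl[OF that, of 0] s(1)
        by (intro has_derivative_diff) auto
      moreover have "(\<lambda>h. h *\<^sub>R f' (x + \<tau> *\<^sub>R u + s *\<^sub>R v) u - h *\<^sub>R f' (x + \<tau> *\<^sub>R u) u - (h * s) *\<^sub>R f'' v) = (\<lambda>h. h *\<^sub>R g' \<tau>)"
        by (auto simp: g'_def algebra_simps)
      ultimately show ?thesis by (metis has_derivative_at_withinI)
    qed
    have g'b: "norm (g' \<tau>) \<le> e * s" if t: "\<tau> \<in> {0..s}" for \<tau>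
    proof -
      \<comment> \<open>Error of the linear approximation of the partial derivative at
        \<open>x\<close>; the difference \<open>a s - a 0\<close> is
        \<open>g' \<tau>\<close>.\<close>
      define a where "a \<sigma> = f' (x + \<tau> *\<^sub>R u + \<sigma> *\<^sub>R v) u - f' x u - f'' (\<tau> *\<^sub>R u + \<sigma> *\<^sub>R v)" for \<sigma>
      have "norm (a \<sigma>) \<le> e' * (s * C)" if "\<sigma> \<in> {0..s}" for \<sigma>
      proof -
        have "norm (a \<sigma>) \<le> e' * norm (\<tau> *\<^sub>R u + \<sigma> *\<^sub>R v)"
          using r1(2)[of "x + \<tau> *\<^sub>R u + \<sigma> *\<^sub>R v"] small[OF t that] by (simp add: a_def algebra_simps)
        also have "\<dots> \<le> e' * (s * C)" using small[OF t that] e' by (intro mult_left_mono) auto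
        finally show ?thesis .
      qed
      from this[of s] this[of 0] s have "norm (a s - a 0) \<le> 2 * (e' * (s * C))"
        using norm_triangle_ineq4[of "a s" "a 0"] by simp
      moreover have "a s - a 0 = g' \<tau>"
        unfolding a_def g'_def by (simp add: f''.add f''.scaleR)
      ultimately show ?thesis using C by (simp add: e'_def)
    qed
    have "norm (g s - g 0) \<le> e * s * norm (s - 0)"
    proof (rule differentiable_bound)
      show "convex {0..s}" by simp
      show "(g has_derivative (\<lambda>h. h *\<^sub>R g' \<tau>)) (at \<tau> within {0..s})" if "\<tau> \<in> {0..s}" for \<tau> by (rule dg[OF that])
      show "onorm (\<lambda>h. h *\<^sub>R g' \<tau>) \<le> e * s" if "\<tau> \<in> {0..s}" for \<tau>
        using onorm_scaleR_left[OF bounded_linear_ident, of "g' \<tau>"] g'b[OF that] by (simp add: onorm_id)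
    qed (use s in auto)
    then show ?thesis using s by (simp add: g_def algebra_simps)
  qed
  ultimately show ?thesis by blast
qed

text \<open>The second difference is symmetric in \<open>u\<close> and \<open>v\<close>, and both
  second derivatives are its limit after division by \<open>s * s\<close>.\<close>

lemma second_derivative_symmetric:
  fixes f :: "'a::euclidean_space \<Rightarrow> 'b::real_normed_vector"
  assumes "open S" and "x \<in> S"
    and f: "\<And>y. y \<in> S \<Longrightarrow> (f has_derivative f' y) (at y)"
    and u: "((\<lambda>y. f' y u) has_derivative fu) (at x)"
    and v: "((\<lambda>y. f' y v) has_derivative fv) (at x)"
  shows "fu v = fv u"
proof -
  have "norm (fu v - fv u) \<le> 2 * e" if e: "e > 0" for e
  proof -
    obtain r1 where r1: "r1 > 0" "\<And>s. 0 < s \<Longrightarrow> s < r1 \<Longrightarrow>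
      norm (f (x + s *\<^sub>R u + s *\<^sub>R v) - f (x + s *\<^sub>R u) - f (x + s *\<^sub>R v) + f x - (s * s) *\<^sub>R fu v) \<le> e * (s * s)"
      using second_difference_bound[OF assms(1,2) f u e, of v] by blast
    obtain r2 where r2: "r2 > 0" "\<And>s. 0 < s \<Longrightarrow> s < r2 \<Longrightarrow>
      norm (f (x + s *\<^sub>R v + s *\<^sub>R u) - f (x + s *\<^sub>R v) - f (x + s *\<^sub>R u) + f x - (s * s) *\<^sub>R fv u) \<le> e * (s * s)"
      using second_difference_bound[OF assms(1,2) f v e, of u] by blast
    define s where "s = min r1 r2 / 2"
    have s: "0 < s" "s < r1" "s < r2" using r1(1) r2(1) by (auto simp: s_def)
    let ?d = "f (x + s *\<^sub>R u + s *\<^sub>R v) - f (x + s *\<^sub>R u) - f (x + s *\<^sub>R v) + f x"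
    have "norm (?d - (s * s) *\<^sub>R fu v) \<le> e * (s * s)" using r1(2)[OF s(1,2)] .
    moreover have "norm (?d - (s * s) *\<^sub>R fv u) \<le> e * (s * s)"
      using r2(2)[OF s(1,3)] by (simp add: diff_diff_eq add_ac)
    moreover have "(s * s) *\<^sub>R (fu v - fv u) = (D - (s * s) *\<^sub>R fv u) - (D - (s * s) *\<^sub>R fu v)" for D
      by (simp add: scaleR_diff_right)
    ultimately have "norm ((s * s) *\<^sub>R (fu v - fv u)) \<le> e * (s * s) + e * (s * s)"
      using norm_triangle_le_diff[of "?d - (s * s) *\<^sub>R fv u" "?d - (s * s) *\<^sub>R fu v"]
      by (metis add_mono)
    then have "(s * s) * norm (fu v - fv u) \<le> (s * s) * (2 * e)"
      using s(1) by (simp only: norm_scaleR) (simp add: algebra_simps)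
    then show ?thesis using s(1) by simp
  qed
  from this[of "norm (fu v - fv u) / 4"] show ?thesis by (cases "fu v = fv u") auto
qed

lemma Dd_symmetric:
  assumes "open S" and "smooth_on S f" and "x \<in> S"
  shows "Dd (\<lambda>y. Dd f y v) x u = Dd (\<lambda>y. Dd f y u) x v"
  using second_derivative_symmetric[OF assms(1,3) smooth_on_has_derivative[OF assms(2)]
    smooth_on_has_derivative[OF smooth_on_Dd[OF assms(1,2)] assms(3)]
    smooth_on_has_derivative[OF smooth_on_Dd[OF assms(1,2)] assms(3)]] by metis

lemma has_derivative_Dd_field:
  assumes "open S" and "smooth_on S f" and "x \<in> S" and "(V has_derivative V') (at x)"
  shows "((\<lambda>y. Dd f y (V y)) has_derivative (\<lambda>u. Dd (\<lambda>y. Dd f y (V x)) x u + Dd f x (V' u))) (at x)"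
  by (rule has_derivative_linear_field[OF assms(1,3) smooth_on_linear_Dd[OF assms(2)] _ assms(4)])
    (auto intro!: smooth_on_has_derivative[OF smooth_on_Dd[OF assms(1,2)] assms(3)])

text \<open>The solution \<open>z\<close> of a linear system \<open>H y (z y) = b y\<close> inherits differentiability: subtracting the
  equation at \<open>x\<close> expresses \<open>H x (z y - z x)\<close> by differentiable terms plus a product of two small ones.\<close>
lemma linear_system_differentiable:
  fixes H :: "'a::real_normed_vector \<Rightarrow> 'e::euclidean_space \<Rightarrow> 'f::euclidean_space"
  assumes "open S" and "x \<in> S" and lin: "\<And>y. y \<in> S \<Longrightarrow> linear (H y)"
    and H: "\<And>v. ((\<lambda>y. H y v) has_derivative H' v) (at x)"
    and b: "(b has_derivative b') (at x)"
    and eq: "\<And>y. y \<in> S \<Longrightarrow> H y (z y) = b y"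
    and inj: "inj (H x)"
  shows "z differentiable (at x)"
proof -
  obtain G where G: "linear G" "G \<circ> H x = id"
    using linear_injective_left_inverse[OF lin[OF assms(2)] inj] by blast
  interpret G: bounded_linear G using G(1) linear_conv_bounded_linear by blast
  have GH: "G (H x v) = v" for v using G(2) by (metis comp_apply id_apply)
  \<comment> \<open>The differentiable part of \<open>z y - z x\<close>. What is missing is
    \<open>G (H y (d y) - H x (d y))\<close>, a product of the two small quantities
    \<open>H y - H x\<close> and \<open>d y\<close>.\<close>
  define r where "r y = G (b y - b x - (H y (z x) - H x (z x)))" for y
  define r' where "r' u = G (b' u - H' (z x) u)" for u
  have r: "(r has_derivative r') (at x)"
    unfolding r_def r'_def
    by (rule G.has_derivative) (auto intro!: derivative_eq_intros b H)
  obtain Kc where Kc: "Kc > 0" "\<And>w. norm (G w) \<le> norm w * Kc" using G.pos_bounded by blast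
  define E where "E y = (\<Sum>b\<in>Basis. norm (H y b - H x b))" for y
  have E0: "(E \<longlongrightarrow> 0) (at x)"
  proof -
    have "((\<lambda>y. norm (H y b - H x b)) \<longlongrightarrow> 0) (at x)" for b
      using has_derivative_continuous[OF H[of b]] unfolding continuous_at
      by (metis LIM_zero tendsto_norm_zero)
    then show ?thesis unfolding E_def by (intro tendsto_null_sum)
  qed
  have Ebound: "norm (H y v - H x v) \<le> E y * norm v" if "y \<in> S" for y v
  proof -
    have "H y v - H x v = (\<Sum>b\<in>Basis. (v \<bullet> b) *\<^sub>R (H y b - H x b))"
      using linear_expand[OF lin[OF that], of v] linear_expand[OF lin[OF assms(2)], of v]
      by (simp add: sum_subtractf scaleR_diff_right)
    also have "norm \<dots> \<le> (\<Sum>b\<in>Basis. norm v * norm (H y b - H x b))"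
      by (rule sum_norm_le) (auto intro!: mult_right_mono Basis_le_norm)
    also have "\<dots> = E y * norm v" by (simp add: E_def sum_distrib_left mult.commute)
    finally show ?thesis .
  qed
  have E_ge: "E y \<ge> 0" for y unfolding E_def by (simp add: sum_nonneg)
  define d where "d y = z y - z x" for y
  have d_eq: "d y = r y - G (H y (d y) - H x (d y))" if "y \<in> S" for y
  proof -
    have l: "H y (d y) = H y (z y) - H y (z x)" unfolding d_def by (rule linear_diff[OF lin[OF that]])
    have "r y - G (H y (d y) - H x (d y)) = G (H x (d y))"
      unfolding r_def l G.diff[symmetric] eq[OF that] eq[OF assms(2)] by simp
    then show ?thesis by (simp add: GH)
  qed
  have S_ev: "\<forall>\<^sub>F y in at x. y \<in> S" using assms(1,2) eventually_at_topological by blast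
  have E_ev: "\<forall>\<^sub>F y in at x. E y < e" if "e > 0" for e
    using order_tendstoD(2)[OF E0 that] .
  \<comment> \<open>Near \<open>x\<close> the missing term is at most half of \<open>d y\<close>, so
    it can be absorbed; this makes \<open>d y\<close> of the order of \<open>r y\<close>, hence of
    \<open>y - x\<close>.\<close>
  have d_le: "\<forall>\<^sub>F y in at x. norm (d y) \<le> 2 * norm (r y)"
  proof -
    have "\<forall>\<^sub>F y in at x. y \<in> S \<and> E y < 1 / (2 * Kc)"
      using S_ev E_ev[of "1 / (2 * Kc)"] Kc(1) by (simp add: eventually_conj_iff)
    then show ?thesis
    proof (rule eventually_mono)
      fix y assume y: "y \<in> S \<and> E y < 1 / (2 * Kc)"
      have "norm (G (H y (d y) - H x (d y))) \<le> E y * norm (d y) * Kc"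
        using Kc(2)[of "H y (d y) - H x (d y)"] Ebound[of y "d y"] y Kc(1)
        by (meson less_imp_le mult_right_mono order_trans)
      also have "\<dots> = (E y * Kc) * norm (d y)" by simp
      also have "\<dots> \<le> (1/2) * norm (d y)"
        using y Kc(1) by (intro mult_right_mono) (auto simp: field_simps)
      finally have "norm (G (H y (d y) - H x (d y))) \<le> (1/2) * norm (d y)" .
      moreover have "norm (d y) \<le> norm (r y) + norm (G (H y (d y) - H x (d y)))"
        using norm_triangle_ineq4 y by (subst d_eq) auto
      ultimately have "norm (d y) \<le> norm (r y) + (1/2) * norm (d y)" by simp
      then show "norm (d y) \<le> 2 * norm (r y)" by simp
    qed
  qed
  have ne_ev: "\<forall>\<^sub>F y in at x. y \<noteq> x" by (simp add: eventually_at_filter)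
  have r0: "r x = 0" by (simp add: r_def)
  interpret r': bounded_linear r' using r by (rule has_derivative_bounded_linear)
  obtain Rc where Rc: "Rc > 0" "\<And>w. norm (r' w) \<le> norm w * Rc" using r'.pos_bounded by blast
  have r_lim: "((\<lambda>y. norm (r y - r' (y - x)) / norm (y - x)) \<longlongrightarrow> 0) (at x)"
    using r unfolding has_derivative_iff_norm by (simp add: r0)
  have r_le: "\<forall>\<^sub>F y in at x. norm (r y) \<le> (Rc + 1) * norm (y - x)"
  proof -
    have "\<forall>\<^sub>F y in at x. norm (r y - r' (y - x)) / norm (y - x) < 1 \<and> y \<noteq> x"
      using order_tendstoD(2)[OF r_lim, of 1] ne_ev by (auto intro: eventually_conj)
    then show ?thesis
    proof (rule eventually_mono)
      fix y assume "norm (r y - r' (y - x)) / norm (y - x) < 1 \<and> y \<noteq> x"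
      then have "norm (r y - r' (y - x)) < 1 * norm (y - x)" by (subst pos_divide_less_eq[symmetric]) auto
      then show "norm (r y) \<le> (Rc + 1) * norm (y - x)"
        using Rc(2)[of "y - x"] norm_triangle_sub[of "r y" "r' (y - x)"] by (simp add: algebra_simps)
    qed
  qed
  have "((\<lambda>y. norm (r y - r' (y - x)) / norm (y - x) + Kc * 2 * (Rc + 1) * E y) \<longlongrightarrow> 0 + Kc * 2 * (Rc + 1) * 0) (at x)"
    by (intro tendsto_intros r_lim E0)
  then have "((\<lambda>y. norm (r y - r' (y - x)) / norm (y - x) + Kc * 2 * (Rc + 1) * E y) \<longlongrightarrow> 0) (at x)" by simp
  moreover have "\<forall>\<^sub>F y in at x. norm (norm (d y - r' (y - x)) / norm (y - x))
      \<le> norm (r y - r' (y - x)) / norm (y - x) + Kc * 2 * (Rc + 1) * E y"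
    using S_ev d_le r_le ne_ev
  proof (eventually_elim)
    case (elim y)
    then have yx: "norm (y - x) > 0" by auto
    have "norm (d y - r' (y - x)) \<le> norm (r y - r' (y - x)) + norm (G (H y (d y) - H x (d y)))"
    proof -
      have "d y - r' (y - x) = (r y - r' (y - x)) - G (H y (d y) - H x (d y))"
        using elim(1) by (subst d_eq) auto
      then show ?thesis by (metis norm_triangle_ineq4)
    qed
    also have "norm (G (H y (d y) - H x (d y))) \<le> E y * norm (d y) * Kc"
      using Kc(2)[of "H y (d y) - H x (d y)"] Ebound[OF elim(1), of "d y"] Kc(1)
      by (meson less_imp_le mult_right_mono order_trans)
    also have "\<dots> \<le> E y * (2 * ((Rc + 1) * norm (y - x))) * Kc"
      using elim(2,3) E_ge Kc(1) by (intro mult_right_mono mult_left_mono) auto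
    finally have "norm (d y - r' (y - x)) \<le> norm (r y - r' (y - x)) + Kc * 2 * (Rc + 1) * E y * norm (y - x)"
      by (simp add: algebra_simps)
    then show ?case using yx by (simp add: field_simps)
  qed
  ultimately have "((\<lambda>y. norm (d y - r' (y - x)) / norm (y - x)) \<longlongrightarrow> 0) (at x)"
    by (rule Lim_null_comparison[rotated])
  then have "(z has_derivative r') (at x)"
    unfolding has_derivative_iff_norm d_def using r'.bounded_linear_axioms by simp
  then show ?thesis by (auto simp: differentiable_def)
qed

section \<open>Killing fields of a local Riemannian metric\<close>

lemma inner_product_formD:
  assumes "inner_product_form B"
  shows "bilinear B" and "B u v = B v u" and "v \<noteq> 0 \<Longrightarrow> B v v > 0"
  using assms by (auto simp: inner_product_form_def)

lemma inner_product_form_nondegenerate: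
  fixes B :: "'v::real_vector \<Rightarrow> 'v \<Rightarrow> real"
  assumes "inner_product_form B" and "\<And>w. B z w = B z' w"
  shows "z = z'"
proof (rule ccontr)
  assume "z \<noteq> z'"
  then have "B (z - z') (z - z') > 0" using inner_product_formD(3)[OF assms(1)] by simp
  moreover have "B (z - z') (z - z') = 0"
    using assms(2)[of "z - z'"] bilinear_lsub[OF inner_product_formD(1)[OF assms(1)], of z z' "z - z'"] by simp
  ultimately show False by simp
qed

lemma bilinear_iff:
  assumes "bilinear B"
  shows "B (a + b) c = B a c + B b c" "B a (b + c) = B a b + B a c"
    "B (r *\<^sub>R a) b = r *\<^sub>R B a b" "B a (r *\<^sub>R b) = r *\<^sub>R B a b"
    "B (a - b) c = B a c - B b c" "B a (b - c) = B a b - B a c"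
    "B (- a) c = - B a c" "B a (- c) = - B a c" "B 0 c = 0" "B a 0 = 0"
  using assms by (simp_all add: bilinear_ladd bilinear_radd bilinear_lmul bilinear_rmul bilinear_lsub
      bilinear_rsub bilinear_lneg bilinear_rneg bilinear_lzero bilinear_rzero)

lemma bilinear_sum_left: "bilinear B \<Longrightarrow> B (sum f A) c = (\<Sum>a\<in>A. B (f a) c)"
  unfolding bilinear_def using linear_sum by blast

lemma bilinear_sum_right: "bilinear B \<Longrightarrow> B c (sum f A) = (\<Sum>a\<in>A. B c (f a))"
  unfolding bilinear_def using linear_sum by blast

text \<open>Sending \<open>z\<close> to the coordinates of \<open>B z\<close> is injective by
  definiteness, hence surjective by dimension.\<close>

lemma inner_product_form_riesz:
  fixes B :: "'e::euclidean_space \<Rightarrow> 'e \<Rightarrow> real"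
  assumes B: "inner_product_form B" and "linear f"
  obtains z where "\<And>w. B z w = f w"
proof -
  note bl = inner_product_formD(1)[OF B]
  define H where "H z = (\<Sum>b\<in>Basis. B z b *\<^sub>R b)" for z
  have Hb: "H z \<bullet> b = B z b" if "b \<in> Basis" for z b
    using that by (simp add: H_def inner_sum_left inner_Basis if_distrib[of "\<lambda>x. _ * x"] sum.delta cong: if_cong)
  have "linear H"
    by (rule linearI) (auto simp: H_def bilinear_iff[OF bl] scaleR_add_left sum.distrib scaleR_sum_right)
  moreover have "inj H"
  proof (rule injI)
    fix z z' assume eq: "H z = H z'"
    have "B z w = B z' w" for w
      using linear_expand[of "B z" w] linear_expand[of "B z'" w] Hb[of _ z] Hb[of _ z'] eq bl
      by (auto simp: bilinear_def intro!: sum.cong)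
    then show "z = z'" by (rule inner_product_form_nondegenerate[OF B])
  qed
  ultimately have "surj H" using linear_injective_imp_surjective by blast
  then obtain z where z: "H z = (\<Sum>b\<in>Basis. f b *\<^sub>R b)" by (metis surjE)
  have "B z b = f b" if "b \<in> Basis" for b
    using Hb[OF that, of z] that unfolding z
    by (simp add: inner_sum_left inner_Basis if_distrib[of "\<lambda>x. _ * x"] sum.delta cong: if_cong)
  then have "B z w = f w" for w
    using linear_expand[of "B z" w] linear_expand[OF assms(2), of w] bl by (simp add: bilinear_def)
  then show thesis by (rule that)
qed

locale local_metric =
  fixes S :: "'e::euclidean_space set" and h :: "'e \<Rightarrow> 'e \<Rightarrow> 'e \<Rightarrow> real"
  assumes open_S: "open S"
    and inner_form: "x \<in> S \<Longrightarrow> inner_product_form (h x)"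
    and smooth_h: "smooth_on S (\<lambda>x. h x u v)"
begin

abbreviation "\<Gamma> \<equiv> christoffel h"
abbreviation "dh x w u v \<equiv> Dd (\<lambda>y. h y u v) x w"
abbreviation "ddh x w z u v \<equiv> Dd (\<lambda>y. Dd (\<lambda>y. h y u v) y z) x w"
abbreviation "d\<Gamma> x w u v \<equiv> Dd (\<lambda>y. christoffel h y u v) x w"

lemma bil: "x \<in> S \<Longrightarrow> bilinear (h x)" using inner_form inner_product_formD(1) by blast

lemmas h_lin = bilinear_iff[OF bil]

lemma h_sym: "x \<in> S \<Longrightarrow> h x u v = h x v u" using inner_form inner_product_formD(2) by blast

lemma h_eqI: "x \<in> S \<Longrightarrow> (\<And>w. h x z w = h x z' w) \<Longrightarrow> z = z'"
  using inner_form inner_product_form_nondegenerate by blast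

lemma h_deriv: "x \<in> S \<Longrightarrow> ((\<lambda>y. h y u v) has_derivative (\<lambda>w. dh x w u v)) (at x)"
  using smooth_on_has_derivative[OF smooth_h] by blast

lemma dh_eqI:
  assumes "x \<in> S" and "(f has_derivative f') (at x)" and "\<And>y. y \<in> S \<Longrightarrow> f y = h y u v"
  shows "dh x w u v = f' w"
proof -
  have "((\<lambda>y. h y u v) has_derivative f') (at x)"
    by (rule has_derivative_transform_within_open[OF assms(2) open_S assms(1,3)])
  then show ?thesis using Dd_eq by blast
qed

lemma dh_sym: "x \<in> S \<Longrightarrow> dh x w u v = dh x w v u"
  by (rule dh_eqI[OF _ h_deriv]) (auto simp: h_sym)

lemma dh_add: "x \<in> S \<Longrightarrow> dh x w (u + u') v = dh x w u v + dh x w u' v"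
  by (rule dh_eqI[OF _ has_derivative_add[OF h_deriv h_deriv]]) (auto simp: h_lin)

lemma dh_cmul: "x \<in> S \<Longrightarrow> dh x w (r *\<^sub>R u) v = r * dh x w u v"
  using dh_eqI[OF _ has_derivative_scaleR_right[OF h_deriv]] by (auto simp: h_lin)

lemma dh_linear: "x \<in> S \<Longrightarrow> linear (\<lambda>w. dh x w u v)"
  using smooth_on_linear_Dd[OF smooth_h] by blast

lemma dh_linear1: "x \<in> S \<Longrightarrow> linear (\<lambda>u. dh x w u v)"
  by (rule linearI) (auto simp: dh_add dh_cmul)

lemma dh_linear2: "x \<in> S \<Longrightarrow> linear (\<lambda>v. dh x w u v)"
  using dh_linear1[of x u w] by (simp add: dh_sym[of x u])

text \<open>The definite description in \<open>christoffel\<close> denotes: the right-hand side is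
  linear in \<open>w\<close>, so a solution exists by Riesz representation, and nondegeneracy makes
  it unique.\<close>

lemma christoffel_koszul:
  assumes "x \<in> S"
  shows "2 * h x (\<Gamma> x u v) w = dh x u v w + dh x v u w - dh x w u v"
proof -
  let ?P = "\<lambda>z. \<forall>w. 2 * h x z w = dh x u v w + dh x v u w - dh x w u v"
  have "linear (\<lambda>w. (dh x u v w + dh x v u w - dh x w u v) / 2)"
    using linear_add[OF dh_linear2[OF assms]] linear_cmul[OF dh_linear2[OF assms]]
      linear_add[OF dh_linear[OF assms]] linear_cmul[OF dh_linear[OF assms]]
    by (intro linearI) (auto simp: field_simps)
  then obtain z where z: "\<And>w. h x z w = (dh x u v w + dh x v u w - dh x w u v) / 2"
    using inner_product_form_riesz[OF inner_form[OF assms]] by blast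
  have "?P z" unfolding z by simp
  moreover have "z' = z" if "?P z'" for z'
    using that \<open>?P z\<close> by (intro h_eqI[OF assms]) (metis mult_cancel_left zero_neq_numeral)
  ultimately have "?P (THE z. ?P z)" by (rule theI)
  then show ?thesis unfolding christoffel_def by blast
qed

lemma christoffel_eqI:
  assumes "x \<in> S" and "\<And>w. 2 * h x z w = dh x u v w + dh x v u w - dh x w u v"
  shows "\<Gamma> x u v = z"
  by (rule h_eqI[OF assms(1)]) (use christoffel_koszul[OF assms(1), of u v] assms(2) in \<open>metis mult_cancel_left zero_neq_numeral\<close>)

lemma christoffel_sym: "x \<in> S \<Longrightarrow> \<Gamma> x u v = \<Gamma> x v u"
  by (rule christoffel_eqI) (auto simp: christoffel_koszul dh_sym[of x u v])

lemma christoffel_linear: "x \<in> S \<Longrightarrow> linear (\<lambda>u. \<Gamma> x u v)"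
  by (intro linearI christoffel_eqI)
    (auto simp: h_lin christoffel_koszul dh_add dh_cmul linear_add[OF dh_linear] linear_cmul[OF dh_linear] algebra_simps)

lemma christoffel_bilinear:
  assumes "x \<in> S" shows "bilinear (\<Gamma> x)"
proof -
  have "linear (\<Gamma> x u)" for u
    using christoffel_linear[OF assms, of u] unfolding christoffel_sym[OF assms, of _ u] by simp
  then show ?thesis using christoffel_linear[OF assms] by (simp add: bilinear_def)
qed

lemmas G_lin = bilinear_iff[OF christoffel_bilinear]

lemma metric_compat: "x \<in> S \<Longrightarrow> dh x w u v = h x (\<Gamma> x w u) v + h x u (\<Gamma> x w v)"
  using christoffel_koszul[of x w u v] christoffel_koszul[of x w v u] h_sym[of x u "\<Gamma> x w v"] dh_sym[of x u v w]
    dh_sym[of x w u v] dh_sym[of x w v u]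
  by simp

text \<open>The Koszul formula is a linear system for the Christoffel vector, with matrix
  \<open>h\<close> and smooth right-hand side, so its solution is differentiable. One derivative is
  all that the curvature requires.\<close>

lemma christoffel_deriv:
  assumes "x \<in> S"
  shows "((\<lambda>y. \<Gamma> y u v) has_derivative (\<lambda>w. d\<Gamma> x w u v)) (at x)"
proof -
  define H where "H y z = (\<Sum>b\<in>Basis. h y z b *\<^sub>R b)" for y z
  define k where "k y = (\<Sum>b\<in>Basis. ((1/2) * (dh y u v b + dh y v u b - dh y b u v)) *\<^sub>R b)" for y
  have Hb: "H y z \<bullet> b = h y z b" if "b \<in> Basis" for y z b
    using that by (simp add: H_def inner_sum_left inner_Basis if_distrib[of "\<lambda>x. _ * x"] sum.delta cong: if_cong)
  have "(\<lambda>y. \<Gamma> y u v) differentiable (at x)"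
  proof (rule linear_system_differentiable[OF open_S assms])
    show "linear (H y)" if "y \<in> S" for y
      by (rule linearI) (auto simp: H_def h_lin[OF that] scaleR_add_left sum.distrib scaleR_sum_right)
    show "((\<lambda>y. H y z) has_derivative (\<lambda>w. \<Sum>b\<in>Basis. dh x w z b *\<^sub>R b)) (at x)" for z
      unfolding H_def by (intro has_derivative_sum has_derivative_scaleR_left h_deriv assms)
    have d: "((\<lambda>y. dh y w u v) has_derivative (\<lambda>z. ddh x z w u v)) (at x)" for w u v
      by (rule smooth_on_has_derivative[OF smooth_on_Dd[OF open_S smooth_h] assms])
    show "(k has_derivative (\<lambda>z. \<Sum>b\<in>Basis. ((1/2) * (ddh x z u v b + ddh x z v u b - ddh x z b u v)) *\<^sub>R b)) (at x)"
      unfolding k_def by (intro has_derivative_sum has_derivative_scaleR_left has_derivative_mult_right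
          has_derivative_add has_derivative_diff d)
    show "H y (\<Gamma> y u v) = k y" if "y \<in> S" for y
    proof -
      have e: "h y (\<Gamma> y u v) b = (1/2) * (dh y u v b + dh y v u b - dh y b u v)" for b
        using christoffel_koszul[OF that, of u v b] by simp
      show ?thesis unfolding H_def k_def e ..
    qed
    show "inj (H x)"
    proof (rule injI)
      fix z z' assume eq: "H x z = H x z'"
      have "h x z w = h x z' w" for w
        using linear_expand[of "h x z" w] linear_expand[of "h x z'" w] Hb[of _ x z] Hb[of _ x z'] eq bil[OF assms]
        by (auto simp: bilinear_def intro!: sum.cong)
      then show "z = z'" by (rule h_eqI[OF assms])
    qed
  qed
  then show ?thesis using frechet_derivative_works by blast
qed

text \<open>The base point moves through an arbitrary normed space, so that one rule serves vector
  fields (\<open>c\<close> the identity), curves (a real parameter) and orbit maps (a group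
  parameter).\<close>

lemma h_map_deriv:
  fixes c :: "'a::real_normed_vector \<Rightarrow> 'e"
  assumes "c t \<in> S" and c: "(c has_derivative c') (at t)"
    and U: "(U has_derivative U') (at t)" and V: "(V has_derivative V') (at t)"
  shows "((\<lambda>t. h (c t) (U t) (V t)) has_derivative
    (\<lambda>r. dh (c t) (c' r) (U t) (V t) + h (c t) (U' r) (V t) + h (c t) (U t) (V' r))) (at t)"
proof -
  have "\<forall>\<^sub>F s in at t. c s \<in> S"
    using has_derivative_continuous[OF c] open_S assms(1) unfolding continuous_at by (rule topological_tendstoD)
  then obtain T where T: "open T" "t \<in> T" "\<And>s. s \<in> T \<Longrightarrow> s \<noteq> t \<Longrightarrow> c s \<in> S"
    unfolding eventually_at_topological by blast
  have TS: "c s \<in> S" if "s \<in> T" for s using T(3)[OF that] assms(1) by (cases "s = t") auto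
  have lin: "linear (h (c s) a)" "linear (\<lambda>u. h (c s) u a)" if "s \<in> T" for s a
    using bil[OF TS[OF that]] by (auto simp: bilinear_def)
  have 0: "((\<lambda>s. h (c s) u v) has_derivative (\<lambda>r. dh (c t) (c' r) u v)) (at t)" for u v
    using has_derivative_compose[OF c h_deriv[OF assms(1)]] .
  have "((\<lambda>s. h (c s) a (V s)) has_derivative (\<lambda>r. dh (c t) (c' r) a (V t) + h (c t) a (V' r))) (at t)" for a
    by (rule has_derivative_linear_field[OF T(1,2) _ 0 V]) (rule lin)
  from has_derivative_linear_field[OF T(1,2) lin(2) this U]
  show ?thesis by (simp add: algebra_simps)
qed

lemmas h_field_deriv = h_map_deriv[OF _ has_derivative_ident]

lemma christoffel_field_deriv:
  assumes "x \<in> S" and U: "(U has_derivative U') (at x)" and V: "(V has_derivative V') (at x)"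
  shows "((\<lambda>y. \<Gamma> y (U y) (V y)) has_derivative
    (\<lambda>w. d\<Gamma> x w (U x) (V x) + \<Gamma> x (U' w) (V x) + \<Gamma> x (U x) (V' w))) (at x)"
proof -
  have lin: "linear (\<Gamma> y a)" "linear (\<lambda>u. \<Gamma> y u a)" if "y \<in> S" for y a
    using christoffel_bilinear[OF that] by (auto simp: bilinear_def)
  have "((\<lambda>y. \<Gamma> y a (V y)) has_derivative (\<lambda>w. d\<Gamma> x w a (V x) + \<Gamma> x a (V' w))) (at x)" for a
    by (rule has_derivative_linear_field[OF open_S assms(1) _ christoffel_deriv[OF assms(1)] V]) (rule lin)
  from has_derivative_linear_field[OF open_S assms(1) lin(2) this U]
  show ?thesis by (simp add: algebra_simps)
qed

text \<open>The equation says that the Lie derivative of \<open>h\<close> along \<open>X\<close>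
  vanishes, evaluated on constant fields \<open>u\<close>, \<open>v\<close>.\<close>

definition killing :: "('e \<Rightarrow> 'e) \<Rightarrow> bool" where
  "killing X \<longleftrightarrow> smooth_on S X \<and>
    (\<forall>x\<in>S. \<forall>u v. dh x (X x) u v + h x (Dd X x u) v + h x u (Dd X x v) = 0)"

abbreviation "ddX X x u v \<equiv> Dd (\<lambda>y. Dd X y v) x u"

lemma killing_deriv: "killing X \<Longrightarrow> x \<in> S \<Longrightarrow> (X has_derivative Dd X x) (at x)"
  unfolding killing_def using smooth_on_has_derivative by blast

lemma killing_linear: "killing X \<Longrightarrow> x \<in> S \<Longrightarrow> linear (Dd X x)"
  using killing_deriv has_derivative_linear by blast

lemma killing_deriv2: "killing X \<Longrightarrow> x \<in> S \<Longrightarrow> ((\<lambda>y. Dd X y v) has_derivative (\<lambda>u. ddX X x u v)) (at x)"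
  unfolding killing_def using smooth_on_has_derivative[OF smooth_on_Dd[OF open_S]] by blast

lemma killing_eq: "killing X \<Longrightarrow> x \<in> S \<Longrightarrow> dh x (X x) u v + h x (Dd X x u) v + h x u (Dd X x v) = 0"
  unfolding killing_def by blast

lemma killing_sym2: "killing X \<Longrightarrow> x \<in> S \<Longrightarrow> ddX X x u v = ddX X x v u"
  unfolding killing_def using Dd_symmetric[OF open_S] by blast

text \<open>Three permuted instances of this identity combine, as in the Koszul formula, to isolate
  the second derivative of \<open>X\<close>.\<close>

lemma killing_eq_deriv:
  assumes "killing X" and "x \<in> S"
  shows "ddh x w (X x) u v + dh x (Dd X x w) u v + dh x w (Dd X x u) v + dh x w u (Dd X x v)
    + h x (ddX X x w u) v + h x u (ddX X x w v) = 0"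
proof -
  have d: "((\<lambda>y. dh y (X y) u v + h y (Dd X y u) v + h y u (Dd X y v)) has_derivative
      (\<lambda>w. (ddh x w (X x) u v + dh x (Dd X x w) u v)
        + (dh x w (Dd X x u) v + h x (ddX X x w u) v + h x (Dd X x u) 0)
        + (dh x w u (Dd X x v) + h x 0 (Dd X x v) + h x u (ddX X x w v)))) (at x)"
    by (intro has_derivative_add has_derivative_Dd_field[OF open_S smooth_h assms(2)]
        h_field_deriv[OF assms(2)] killing_deriv[OF assms] killing_deriv2[OF assms] has_derivative_const)
  have "((\<lambda>y. 0) has_derivative
      (\<lambda>w. (ddh x w (X x) u v + dh x (Dd X x w) u v)
        + (dh x w (Dd X x u) v + h x (ddX X x w u) v + h x (Dd X x u) 0)
        + (dh x w u (Dd X x v) + h x 0 (Dd X x v) + h x u (ddX X x w v)))) (at x)"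
    by (rule has_derivative_transform_within_open[OF d open_S assms(2)]) (simp add: killing_eq[OF assms(1)])
  from has_derivative_unique[OF this has_derivative_const]
  show ?thesis by (simp add: fun_eq_iff h_lin[OF assms(2)] algebra_simps)
qed

text \<open>\<open>L\<^sub>X \<Gamma> = 0\<close>, written out.\<close>
lemma killing_connection:
  assumes X: "killing X" and x: "x \<in> S"
  shows "ddX X x u v = Dd X x (\<Gamma> x u v) - d\<Gamma> x (X x) u v - \<Gamma> x (Dd X x u) v - \<Gamma> x u (Dd X x v)"
proof (rule h_eqI[OF x])
  fix w
  have "((\<lambda>y. 2 * h y (\<Gamma> y u v) w) has_derivative
      (\<lambda>z. 2 * (dh x z (\<Gamma> x u v) w + h x (d\<Gamma> x z u v) w + h x (\<Gamma> x u v) 0))) (at x)"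
    by (intro has_derivative_mult_right h_field_deriv[OF x] christoffel_deriv x has_derivative_const)
  then have "((\<lambda>y. dh y u v w + dh y v u w - dh y w u v) has_derivative
      (\<lambda>z. 2 * (dh x z (\<Gamma> x u v) w + h x (d\<Gamma> x z u v) w + h x (\<Gamma> x u v) 0))) (at x)"
    by (rule has_derivative_transform_within_open[OF _ open_S x]) (rule christoffel_koszul)
  moreover have "((\<lambda>y. dh y u v w + dh y v u w - dh y w u v) has_derivative
      (\<lambda>z. ddh x z u v w + ddh x z v u w - ddh x z w u v)) (at x)"
    by (intro has_derivative_add has_derivative_diff smooth_on_has_derivative[OF smooth_on_Dd[OF open_S smooth_h] x])
  ultimately have "(\<lambda>z. 2 * (dh x z (\<Gamma> x u v) w + h x (d\<Gamma> x z u v) w + h x (\<Gamma> x u v) 0))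
      = (\<lambda>z. ddh x z u v w + ddh x z v u w - ddh x z w u v)"
    by (rule has_derivative_unique)
  then have 1: "2 * (dh x (X x) (\<Gamma> x u v) w + h x (d\<Gamma> x (X x) u v) w)
      = ddh x (X x) u v w + ddh x (X x) v u w - ddh x (X x) w u v"
    by (simp add: fun_eq_iff h_lin[OF x])
  have s: "ddh x (X x) z a b = ddh x z (X x) a b" for z a b
    by (rule Dd_symmetric[OF open_S smooth_h x])
  note k = killing_eq_deriv[OF X x]
  note c = christoffel_koszul[OF x]
  have e: "dh x (X x) (\<Gamma> x u v) w = - h x (Dd X x (\<Gamma> x u v)) w - h x (\<Gamma> x u v) (Dd X x w)"
    using killing_eq[OF X x, of "\<Gamma> x u v" w] by simp
  have hs: "h x v (ddX X x u w) = h x (ddX X x w u) v" "h x u (ddX X x v w) = h x (ddX X x w v) u"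
    "h x u (ddX X x w v) = h x (ddX X x w v) u" "h x (ddX X x v u) w = h x (ddX X x u v) w"
    using killing_sym2[OF X x] h_sym[OF x] by metis+
  have "2 * h x (ddX X x u v) w = 2 * (h x (Dd X x (\<Gamma> x u v)) w - h x (d\<Gamma> x (X x) u v) w
      - h x (\<Gamma> x (Dd X x u) v) w - h x (\<Gamma> x u (Dd X x v)) w)"
  proof -
    \<comment> \<open>The Koszul combination of the differentiated Killing equation: derivative
      along \<open>u\<close> on \<open>(v, w)\<close>, plus along \<open>v\<close> on
      \<open>(u, w)\<close>, minus along \<open>w\<close> on \<open>(u, v)\<close>.\<close>
    have "ddh x u (X x) v w + ddh x v (X x) u w - ddh x w (X x) u v
      + (2 * h x (\<Gamma> x (Dd X x u) v) w + 2 * h x (\<Gamma> x u (Dd X x v)) w + 2 * h x (\<Gamma> x u v) (Dd X x w))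
      + 2 * h x (ddX X x u v) w = 0"
      using k[of v w u] k[of u w v] k[of u v w] hs
      unfolding c[of "Dd X x u" v w] c[of u "Dd X x v" w] c[of u v "Dd X x w"] by linarith
    then show ?thesis
      using 1 unfolding e s[of v w u] s[of u w v] s[of u v w] by (simp add: algebra_simps)
  qed
  then show "h x (ddX X x u v) w = h x (Dd X x (\<Gamma> x u v) - d\<Gamma> x (X x) u v - \<Gamma> x (Dd X x u) v - \<Gamma> x u (Dd X x v)) w"
    by (simp add: h_lin[OF x])
qed

text \<open>The covariant derivative of \<open>X\<close> in the direction \<open>v\<close>.\<close>

definition nab :: "('e \<Rightarrow> 'e) \<Rightarrow> 'e \<Rightarrow> 'e \<Rightarrow> 'e" where
  "nab X x v = Dd X x v + \<Gamma> x v (X x)"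

text \<open>Killing's equation, after the derivative of \<open>h\<close> is rewritten by metric
  compatibility.\<close>

lemma nab_skew:
  assumes "killing X" and "x \<in> S"
  shows "h x (nab X x u) v = - h x u (nab X x v)"
  using killing_eq[OF assms, of u v] metric_compat[OF assms(2), of u v "X x"]
  unfolding nab_def h_lin[OF assms(2)] christoffel_sym[OF assms(2), of "X x"] by linarith

lemma dGamma_sym:
  assumes "x \<in> S"
  shows "d\<Gamma> x w u v = d\<Gamma> x w v u"
proof -
  have "((\<lambda>y. \<Gamma> y v u) has_derivative (\<lambda>w. d\<Gamma> x w u v)) (at x)"
    by (rule has_derivative_transform_within_open[OF christoffel_deriv[OF assms] open_S assms]) (rule christoffel_sym)
  from Dd_eq[OF this] show ?thesis by simp
qed

text \<open>The first Bianchi identity, which rests on the symmetry of the Christoffel vectors. It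
  is arranged so that a curvature with two Killing fields splits into curvatures with one Killing
  field in the second slot, where Kostant's formula applies.\<close>

lemma curvature_bianchi:
  assumes "x \<in> S"
  shows "curvature h x u v w = curvature h x w v u - curvature h x w u v"
  unfolding curvature_def
  using dGamma_sym[OF assms, of v w u] dGamma_sym[OF assms, of u w v] dGamma_sym[OF assms, of u v w]
    christoffel_sym[OF assms, of u w] christoffel_sym[OF assms, of v w] christoffel_sym[OF assms, of u v]
  by simp

text \<open>Kostant's formula \<open>R(u, X) v = (\<nabla>\<^sub>u \<nabla>X) v\<close>.\<close>
lemma curvature_killing:
  assumes X: "killing X" and x: "x \<in> S"
  shows "curvature h x u (X x) v =
    ddX X x u v + d\<Gamma> x u v (X x) + \<Gamma> x v (Dd X x u) + \<Gamma> x u (nab X x v) - nab X x (\<Gamma> x u v)"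
  unfolding curvature_def nab_def killing_connection[OF X x]
  using dGamma_sym[OF x, of "X x" v u] christoffel_sym[OF x, of v "X x"]
    christoffel_sym[OF x, of "\<Gamma> x u v" "X x"] christoffel_sym[OF x, of v "Dd X x u"]
  by (simp add: G_lin[OF x])

text \<open>Bianchi and Kostant express the curvature by second derivatives of \<open>X\<close> and
  \<open>Y\<close>; these are the ones that occur in the derivative of \<open>W\<close>. In the
  usual sign convention \<open>W\<close> is the field bracket of \<open>Y\<close> with
  \<open>X\<close>.\<close>

lemma curvature_killing_pair:
  assumes X: "killing X" and Y: "killing Y" and W: "killing W" and x: "x \<in> S"
    and br: "\<And>y. y \<in> S \<Longrightarrow> Dd X y (Y y) - Dd Y y (X y) = W y"
  shows "curvature h x (X x) (Y x) v = nab X x (nab Y x v) - nab Y x (nab X x v) - nab W x v"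
proof -
  have d1: "((\<lambda>y. Dd X y (Y y) - Dd Y y (X y)) has_derivative
     (\<lambda>u. (ddX X x u (Y x) + Dd X x (Dd Y x u)) - (ddX Y x u (X x) + Dd Y x (Dd X x u)))) (at x)"
    using X Y unfolding killing_def
    by (intro has_derivative_diff has_derivative_Dd_field[OF open_S _ x] killing_deriv X Y x) auto
  have "(W has_derivative
     (\<lambda>u. (ddX X x u (Y x) + Dd X x (Dd Y x u)) - (ddX Y x u (X x) + Dd Y x (Dd X x u)))) (at x)"
    by (rule has_derivative_transform_within_open[OF d1 open_S x]) (rule br)
  then have dW: "Dd W x v = (ddX X x v (Y x) + Dd X x (Dd Y x v)) - (ddX Y x v (X x) + Dd Y x (Dd X x v))"
    by (rule Dd_eq)
  have "curvature h x (X x) (Y x) v = curvature h x v (Y x) (X x) - curvature h x v (X x) (Y x)"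
    by (rule curvature_bianchi[OF x])
  also have "\<dots> = nab X x (nab Y x v) - nab Y x (nab X x v) - nab W x v"
    unfolding curvature_killing[OF X x] curvature_killing[OF Y x]
    unfolding nab_def dW br[OF x, symmetric]
    using dGamma_sym[OF x, of "X x" "Y x" v] christoffel_sym[OF x, of "X x" "Y x"]
      christoffel_sym[OF x, of "X x" "Dd Y x v"] christoffel_sym[OF x, of "Y x" "Dd X x v"]
    by (simp add: G_lin[OF x] linear_add[OF killing_linear[OF X x]] linear_add[OF killing_linear[OF Y x]])
  finally show ?thesis .
qed

text \<open>A trace may be computed with any frame \<open>e\<close> and its dual \<open>f\<close>
  with respect to the metric; the frame needed later consists of action fields and the
  normal.\<close>

lemma ricci_trace:
  assumes x: "x \<in> S" and dual: "\<And>w. w = (\<Sum>k\<in>K. h x w (f k) *\<^sub>R e k)"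
    and L: "\<And>u. curvature h x u v w = L u" "linear L"
  shows "ricci h x v w = (\<Sum>k\<in>K. h x (L (e k)) (f k))"
proof -
  have "ricci h x v w = (\<Sum>b\<in>Basis. L b \<bullet> b)" unfolding ricci_def L ..
  also have "\<dots> = (\<Sum>b\<in>Basis. L (\<Sum>k\<in>K. h x b (f k) *\<^sub>R e k) \<bullet> b)"
    using dual by simp
  also have "\<dots> = (\<Sum>b\<in>Basis. \<Sum>k\<in>K. h x b (f k) * (L (e k) \<bullet> b))"
    by (simp add: linear_sum[OF L(2)] linear_cmul[OF L(2)] inner_sum_left)
  also have "\<dots> = (\<Sum>k\<in>K. \<Sum>b\<in>Basis. h x b (f k) * (L (e k) \<bullet> b))"
    by (rule sum.swap)
  also have "\<dots> = (\<Sum>k\<in>K. h x (L (e k)) (f k))"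
  proof (rule sum.cong[OF refl])
    fix k
    have "linear (\<lambda>u. h x u (f k))" using bil[OF x] by (simp add: bilinear_def)
    from linear_expand[OF this, of "L (e k)"]
    show "(\<Sum>b\<in>Basis. h x b (f k) * (L (e k) \<bullet> b)) = h x (L (e k)) (f k)" by (simp add: mult.commute)
  qed
  finally show ?thesis .
qed

lemma curvature_killing_linear:
  assumes X: "killing X" and x: "x \<in> S"
  shows "linear (\<lambda>u. curvature h x u (X x) v)"
proof (rule linearI)
  have dl: "linear (\<lambda>u. d\<Gamma> x u a b)" for a b using has_derivative_linear[OF christoffel_deriv[OF x]] .
  have dl2: "linear (\<lambda>u. d\<Gamma> x w u a)" for a w
  proof (rule linearI)
    fix b c r
    have "((\<lambda>y. \<Gamma> y (b + c) a) has_derivative (\<lambda>w. d\<Gamma> x w b a + d\<Gamma> x w c a)) (at x)"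
      by (rule has_derivative_transform_within_open[OF has_derivative_add[OF christoffel_deriv[OF x] christoffel_deriv[OF x]] open_S x])
        (simp add: G_lin)
    from Dd_eq[OF this] show "d\<Gamma> x w (b + c) a = d\<Gamma> x w b a + d\<Gamma> x w c a" .
    have "((\<lambda>y. \<Gamma> y (r *\<^sub>R b) a) has_derivative (\<lambda>w. r *\<^sub>R d\<Gamma> x w b a)) (at x)"
      by (rule has_derivative_transform_within_open[OF has_derivative_scaleR_right[OF christoffel_deriv[OF x]] open_S x])
        (simp add: G_lin)
    from Dd_eq[OF this] show "d\<Gamma> x w (r *\<^sub>R b) a = r *\<^sub>R d\<Gamma> x w b a" .
  qed
  fix b c r
  show "curvature h x (b + c) (X x) v = curvature h x b (X x) v + curvature h x c (X x) v"
    unfolding curvature_def by (simp add: linear_add[OF dl] linear_add[OF dl2] G_lin[OF x])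
  show "curvature h x (r *\<^sub>R b) (X x) v = r *\<^sub>R curvature h x b (X x) v"
    unfolding curvature_def by (simp add: linear_cmul[OF dl] linear_cmul[OF dl2] G_lin[OF x] algebra_simps)
qed

end

section \<open>The Einstein equation along a normal curve\<close>

context local_metric
begin

lemma nab_self: "killing X \<Longrightarrow> x \<in> S \<Longrightarrow> h x (nab X x v) v = 0"
  using nab_skew[of X x v v] h_sym[of x v "nab X x v"] by linarith

lemma nab_field_deriv:
  assumes X: "killing X" and Y: "killing Y" and x: "x \<in> S"
  shows "((\<lambda>y. nab X y (Y y)) has_derivative
    (\<lambda>u. ddX X x u (Y x) + Dd X x (Dd Y x u) +
      (d\<Gamma> x u (Y x) (X x) + \<Gamma> x (Dd Y x u) (X x) + \<Gamma> x (Y x) (Dd X x u)))) (at x)"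
  unfolding nab_def
  using X Y unfolding killing_def
  by (intro has_derivative_add has_derivative_Dd_field[OF open_S _ x] christoffel_field_deriv[OF x]
      killing_deriv X Y x) auto

text \<open>Differentiate the skewness of \<open>\<nabla>X\<close>.\<close>
lemma curvature_killing_skew:
  assumes X: "killing X" and x: "x \<in> S"
  shows "h x (curvature h x u (X x) v) v = 0"
proof -
  have d: "((\<lambda>y. nab X y v) has_derivative
      (\<lambda>u. ddX X x u v + (d\<Gamma> x u v (X x) + \<Gamma> x 0 (X x) + \<Gamma> x v (Dd X x u)))) (at x)"
    unfolding nab_def
    by (intro has_derivative_add killing_deriv2[OF X x] christoffel_field_deriv[OF x] has_derivative_const
        killing_deriv[OF X x])
  have "((\<lambda>y. h y (nab X y v) v) has_derivative
     (\<lambda>u. dh x u (nab X x v) v + h x (ddX X x u v + (d\<Gamma> x u v (X x) + \<Gamma> x 0 (X x) + \<Gamma> x v (Dd X x u))) v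
        + h x (nab X x v) 0)) (at x)"
    by (intro h_field_deriv[OF x] d has_derivative_const)
  moreover have "h y (nab X y v) v = 0" if "y \<in> S" for y
    by (rule nab_self[OF X that])
  ultimately have "((\<lambda>y. 0) has_derivative
     (\<lambda>u. dh x u (nab X x v) v + h x (ddX X x u v + (d\<Gamma> x u v (X x) + \<Gamma> x 0 (X x) + \<Gamma> x v (Dd X x u))) v
        + h x (nab X x v) 0)) (at x)"
    using has_derivative_transform_within_open[OF _ open_S x] by (metis (no_types, lifting))
  from has_derivative_unique[OF this has_derivative_const]
  have "dh x u (nab X x v) v + h x (ddX X x u v + (d\<Gamma> x u v (X x) + \<Gamma> x v (Dd X x u))) v = 0"
    by (simp add: fun_eq_iff h_lin[OF x] G_lin[OF x])
  then show ?thesis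
    unfolding curvature_killing[OF X x] metric_compat[OF x]
    using nab_skew[OF X x, of v "\<Gamma> x u v"] nab_skew[OF X x, of "\<Gamma> x u v" v] h_sym[OF x, of v]
    by (simp add: h_lin[OF x])
qed

end

text \<open>The picture in one chart: \<open>V X\<close> are the action fields and \<open>c\<close>
  is the unit normal curve with velocity \<open>c1\<close>. The order in \<open>V_bracket\<close>
  reflects that a left action sends brackets to negative field brackets. \<open>c1_span\<close>
  encodes codimension one: only the zero vector is orthogonal to the orbit and to the
  normal.\<close>

locale killing_curve = local_metric S h
  for S :: "'e::euclidean_space set" and h +
  fixes V :: "'l::euclidean_space \<Rightarrow> 'e \<Rightarrow> 'e" and br :: "'l \<Rightarrow> 'l \<Rightarrow> 'l"
    and J :: "real set" and c c1 c2 :: "real \<Rightarrow> 'e"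
  assumes killing_V: "killing (V X)"
    and V_linear: "x \<in> S \<Longrightarrow> linear (\<lambda>X. V X x)"
    and V_bracket: "x \<in> S \<Longrightarrow> Dd (V X) x (V Y x) - Dd (V Y) x (V X x) = V (br X Y) x"
    and open_J: "open J"
    and c_S: "t \<in> J \<Longrightarrow> c t \<in> S"
    and c_deriv: "t \<in> J \<Longrightarrow> (c has_vector_derivative c1 t) (at t)"
    and c1_deriv: "t \<in> J \<Longrightarrow> (c1 has_vector_derivative c2 t) (at t)"
    and c1_orth: "t \<in> J \<Longrightarrow> h (c t) (V X (c t)) (c1 t) = 0"
    and c1_unit: "t \<in> J \<Longrightarrow> h (c t) (c1 t) (c1 t) = 1"
    and c1_span: "t \<in> J \<Longrightarrow> (\<And>X. h (c t) (V X (c t)) w = 0) \<Longrightarrow> h (c t) (c1 t) w = 0 \<Longrightarrow> w = 0"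
begin

definition "b t X Y = h (c t) (V X (c t)) (V Y (c t))"
text \<open>Tangential components of the covariant derivatives of action fields, that is, the
  Levi-Civita connection of the orbit.\<close>

definition "\<alpha> t X Y Z = h (c t) (nab (V X) (c t) (V Y (c t))) (V Z (c t))"
text \<open>The second fundamental form of the orbit with respect to the normal
  \<open>c1 t\<close>.\<close>

definition "\<Omega> t X Y = h (c t) (nab (V X) (c t) (V Y (c t))) (c1 t)"

lemma nab_bracket: "x \<in> S \<Longrightarrow> nab (V X) x (V Y x) - nab (V Y) x (V X x) = V (br X Y) x"
  using V_bracket[of x X Y] christoffel_sym[of x "V X x" "V Y x"] by (simp add: nab_def)

lemma h_curve_deriv:
  assumes "t \<in> J" and U: "(U has_vector_derivative U') (at t)" and W: "(W has_vector_derivative W') (at t)"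
  shows "((\<lambda>t. h (c t) (U t) (W t)) has_real_derivative
    dh (c t) (c1 t) (U t) (W t) + h (c t) U' (W t) + h (c t) (U t) W') (at t)"
  using h_map_deriv[OF c_S[OF assms(1)] c_deriv[OF assms(1), unfolded has_vector_derivative_def]
      U[unfolded has_vector_derivative_def] W[unfolded has_vector_derivative_def]]
  unfolding has_field_derivative_def
  by (rule has_derivative_eq_rhs)
    (auto simp: fun_eq_iff h_lin[OF c_S[OF assms(1)]] linear_cmul[OF dh_linear[OF c_S[OF assms(1)]]] algebra_simps)

lemma field_along:
  assumes "t \<in> J" and "(F has_derivative F') (at (c t))"
  shows "((\<lambda>t. F (c t)) has_vector_derivative F' (c1 t)) (at t)"
  using has_derivative_compose[OF c_deriv[OF assms(1), unfolded has_vector_derivative_def] assms(2)]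
    linear_cmul[OF has_derivative_linear[OF assms(2)]]
  by (simp add: has_vector_derivative_def)

lemma eq_along:
  assumes "t \<in> J" and "\<And>s. s \<in> J \<Longrightarrow> f s = (k::real)" and "(f has_real_derivative D) (at t)"
  shows "D = 0"
proof -
  have "((\<lambda>_. k) has_real_derivative D) (at t)"
    by (rule has_field_derivative_transform_within_open[OF assms(3) open_J assms(1)]) (simp add: assms(2))
  then show ?thesis using DERIV_const DERIV_unique by blast
qed

text \<open>The acceleration is orthogonal to every action field, because the pairing of the
  velocity with a Killing field is constant and \<open>nab\<close> is skew; it is orthogonal to the
  velocity because the speed is constant.\<close>

lemma geodesic:
  assumes t: "t \<in> J"
  shows "c2 t + \<Gamma> (c t) (c1 t) (c1 t) = 0"
proof (rule c1_span[OF t])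
  note S = c_S[OF t]
  fix X
  have "dh (c t) (c1 t) (V X (c t)) (c1 t) + h (c t) (Dd (V X) (c t) (c1 t)) (c1 t) + h (c t) (V X (c t)) (c2 t) = 0"
    by (rule eq_along[OF t c1_orth h_curve_deriv[OF t field_along[OF t killing_deriv[OF killing_V S]] c1_deriv[OF t]]])
  then have "h (c t) (nab (V X) (c t) (c1 t)) (c1 t) + h (c t) (V X (c t)) (c2 t + \<Gamma> (c t) (c1 t) (c1 t)) = 0"
    unfolding nab_def metric_compat[OF S] by (simp add: h_lin[OF S])
  then show "h (c t) (V X (c t)) (c2 t + \<Gamma> (c t) (c1 t) (c1 t)) = 0"
    using nab_self[OF killing_V S] by simp
next
  note S = c_S[OF t]
  have "dh (c t) (c1 t) (c1 t) (c1 t) + h (c t) (c2 t) (c1 t) + h (c t) (c1 t) (c2 t) = 0"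
    by (rule eq_along[OF t c1_unit h_curve_deriv[OF t c1_deriv[OF t] c1_deriv[OF t]]])
  then show "h (c t) (c1 t) (c2 t + \<Gamma> (c t) (c1 t) (c1 t)) = 0"
    unfolding metric_compat[OF S] using h_sym[OF S, of _ "c1 t"] by (simp add: h_lin[OF S])
qed

text \<open>The antisymmetric part comes from a bracket, whose action field is tangent to the orbit
  and so orthogonal to the normal.\<close>

lemma Omega_sym:
  assumes t: "t \<in> J"
  shows "\<Omega> t X Y = \<Omega> t Y X"
proof -
  have "h (c t) (nab (V X) (c t) (V Y (c t)) - nab (V Y) (c t) (V X (c t))) (c1 t) = 0"
    unfolding nab_bracket[OF c_S[OF t]] by (rule c1_orth[OF t])
  then show ?thesis unfolding \<Omega>_def by (simp add: h_lin[OF c_S[OF t]])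
qed

lemma c1_orth': "t \<in> J \<Longrightarrow> h (c t) (c1 t) (V X (c t)) = 0"
  using c1_orth h_sym[OF c_S] by metis

lemma nab_c1: "t \<in> J \<Longrightarrow> h (c t) (nab (V X) (c t) (c1 t)) (V Y (c t)) = - \<Omega> t X Y"
  unfolding \<Omega>_def using nab_skew[OF killing_V c_S, of t X "c1 t" "V Y (c t)"] h_sym[OF c_S, of t "c1 t"] by simp

lemma nab_c1_c1: "t \<in> J \<Longrightarrow> h (c t) (nab (V X) (c t) (c1 t)) (c1 t) = 0"
  by (rule nab_self[OF killing_V c_S])

lemma b_deriv:
  assumes t: "t \<in> J"
  shows "((\<lambda>t. b t X Y) has_real_derivative - 2 * \<Omega> t X Y) (at t)"
proof -
  note S = c_S[OF t]
  have "((\<lambda>t. b t X Y) has_real_derivative dh (c t) (c1 t) (V X (c t)) (V Y (c t))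
     + h (c t) (Dd (V X) (c t) (c1 t)) (V Y (c t)) + h (c t) (V X (c t)) (Dd (V Y) (c t) (c1 t))) (at t)"
    unfolding b_def by (rule h_curve_deriv[OF t field_along[OF t killing_deriv[OF killing_V S]] field_along[OF t killing_deriv[OF killing_V S]]])
  moreover have "dh (c t) (c1 t) (V X (c t)) (V Y (c t))
     + h (c t) (Dd (V X) (c t) (c1 t)) (V Y (c t)) + h (c t) (V X (c t)) (Dd (V Y) (c t) (c1 t))
    = h (c t) (nab (V X) (c t) (c1 t)) (V Y (c t)) + h (c t) (nab (V Y) (c t) (c1 t)) (V X (c t))"
    unfolding metric_compat[OF S] using h_sym[OF S, of "V X (c t)"] by (simp add: nab_def h_lin[OF S])
  ultimately show ?thesis using Omega_sym[OF t, of X Y] by (simp add: nab_c1[OF t])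
qed

text \<open>The Riccati equation of the orbits. The geodesic equation removes the acceleration
  \<open>c2\<close>, and Kostant's formula turns the derivative of \<open>nab\<close> along the
  curve into curvature.\<close>

lemma Omega_deriv:
  assumes t: "t \<in> J"
  shows "((\<lambda>t. \<Omega> t X Y) has_real_derivative
    h (c t) (curvature h (c t) (c1 t) (V X (c t)) (V Y (c t))) (c1 t)
    - h (c t) (nab (V Y) (c t) (c1 t)) (nab (V X) (c t) (c1 t))) (at t)"
proof -
  note S = c_S[OF t]
  let ?x = "c t" and ?\<tau> = "c1 t"
  let ?Z = "nab (V X) ?x (V Y ?x)"
  let ?Z' = "ddX (V X) ?x ?\<tau> (V Y ?x) + Dd (V X) ?x (Dd (V Y) ?x ?\<tau>) +
      (d\<Gamma> ?x ?\<tau> (V Y ?x) (V X ?x) + \<Gamma> ?x (Dd (V Y) ?x ?\<tau>) (V X ?x) + \<Gamma> ?x (V Y ?x) (Dd (V X) ?x ?\<tau>))"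
  have d: "((\<lambda>t. \<Omega> t X Y) has_real_derivative dh ?x ?\<tau> ?Z ?\<tau> + h ?x ?Z' ?\<tau> + h ?x ?Z (c2 t)) (at t)"
    unfolding \<Omega>_def
    by (rule h_curve_deriv[OF t field_along[OF t nab_field_deriv[OF killing_V killing_V S]] c1_deriv[OF t]])
  have c2: "c2 t = - \<Gamma> ?x ?\<tau> ?\<tau>" using geodesic[OF t] by (simp add: eq_neg_iff_add_eq_0)
  have 1: "dh ?x ?\<tau> ?Z ?\<tau> + h ?x ?Z' ?\<tau> + h ?x ?Z (c2 t) = h ?x (?Z' + \<Gamma> ?x ?\<tau> ?Z) ?\<tau>"
    unfolding metric_compat[OF S] c2 by (simp add: h_lin[OF S])
  have 2: "?Z' + \<Gamma> ?x ?\<tau> ?Z = curvature h ?x ?\<tau> (V X ?x) (V Y ?x) + nab (V X) ?x (nab (V Y) ?x ?\<tau>)"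
    unfolding curvature_killing[OF killing_V S] nab_def
    by (simp add: G_lin[OF S] linear_add[OF killing_linear[OF killing_V S]])
  have 3: "h ?x (nab (V X) ?x (nab (V Y) ?x ?\<tau>)) ?\<tau> = - h ?x (nab (V Y) ?x ?\<tau>) (nab (V X) ?x ?\<tau>)"
    by (rule nab_skew[OF killing_V S])
  show ?thesis using d unfolding 1 2 by (simp add: h_lin(1)[OF S] 3)
qed

lemma b_sym: "t \<in> J \<Longrightarrow> b t X Y = b t Y X"
  unfolding b_def using h_sym[OF c_S] by blast

lemma b_bilinear:
  assumes "t \<in> J" shows "bilinear (b t)"
  unfolding bilinear_def b_def
  using linear_add[OF V_linear[OF c_S[OF assms]]] linear_cmul[OF V_linear[OF c_S[OF assms]]]
  by (auto intro!: linearI simp: h_lin[OF c_S[OF assms]])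

lemma b_br_skew:
  assumes t: "t \<in> J"
  shows "b t (br X Y) Z = - b t (br Y X) Z"
  unfolding b_def V_bracket[OF c_S[OF t], symmetric] by (simp add: h_lin[OF c_S[OF t]])

lemma alpha_skew: "t \<in> J \<Longrightarrow> \<alpha> t X Y Z = - \<alpha> t X Z Y"
  unfolding \<alpha>_def using nab_skew[OF killing_V c_S, of t X "V Y (c t)"] h_sym[OF c_S, of t "V Y (c t)"] by simp

lemma alpha_bracket: "t \<in> J \<Longrightarrow> \<alpha> t X Y Z - \<alpha> t Y X Z = b t (br X Y) Z"
  unfolding \<alpha>_def b_def nab_bracket[OF c_S, symmetric] by (simp add: h_lin[OF c_S])

text \<open>Koszul's argument: \<open>\<alpha>\<close> is skew in its last two arguments, and its
  antisymmetrization in the first two is given by the bracket; together these determine it.\<close>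

lemma alpha_eq:
  assumes t: "t \<in> J"
  shows "\<alpha> t X Y Z = (b t (br X Y) Z - b t (br Y Z) X - b t (br X Z) Y) / 2"
  using alpha_bracket[OF t, of X Y Z] alpha_bracket[OF t, of Y Z X] alpha_bracket[OF t, of Z X Y]
    alpha_skew[OF t, of X Y Z] alpha_skew[OF t, of Y Z X] alpha_skew[OF t, of Z X Y]
    b_br_skew[OF t, of Z X Y]
  by simp

end

text \<open>\<open>K\<close> is a \<open>Q\<close>-orthonormal basis of a complement of the isotropy algebra, and \<open>N k\<close> the element
  dual to \<open>k \<in> K\<close> with respect to the orbit metric at time \<open>t\<close>.\<close>
locale dual_frame = killing_curve S h V br J c c1 c2
  for S :: "'e::euclidean_space set" and h and V :: "'l::euclidean_space \<Rightarrow> 'e \<Rightarrow> 'e" and br J c c1 c2 +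
  fixes t :: real and Q :: "'l \<Rightarrow> 'l \<Rightarrow> real" and K :: "'l set" and N :: "'l \<Rightarrow> 'l"
  assumes t: "t \<in> J" and finite_K: "finite K"
    and Q_inner: "inner_product_form Q"
    and Q_ad: "Q (br X Y) Z = - Q Y (br X Z)"
    and br_skew: "br X Y = - br Y X"
    and br_lin: "bilinear br"
    and Q_orth: "k \<in> K \<Longrightarrow> l \<in> K \<Longrightarrow> Q k l = of_bool (k = l)"
    and V_frame: "V X (c t) = (\<Sum>k\<in>K. Q X k *\<^sub>R V k (c t))"
    and N_dual: "k \<in> K \<Longrightarrow> b t X (N k) = Q X k"
    and N_expand: "k \<in> K \<Longrightarrow> N k = (\<Sum>l\<in>K. Q (N k) l *\<^sub>R l)"
    and N_sym: "k \<in> K \<Longrightarrow> l \<in> K \<Longrightarrow> Q (N k) l = Q (N l) k"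
begin

lemma S: "c t \<in> S" by (rule c_S[OF t])

lemma Qbil: "bilinear Q" using inner_product_formD(1)[OF Q_inner] .

text \<open>The difference of the two sides is orthogonal to the dual frame and to the normal, hence
  zero by \<open>c1_span\<close> once the dual frame is known to span the orbit directions.\<close>

lemma frame_expand: "w = (\<Sum>k\<in>K. h (c t) w (V (N k) (c t)) *\<^sub>R V k (c t)) + h (c t) w (c1 t) *\<^sub>R c1 t"
proof -
  define w' where "w' = w - ((\<Sum>k\<in>K. h (c t) w (V (N k) (c t)) *\<^sub>R V k (c t)) + h (c t) w (c1 t) *\<^sub>R c1 t)"
  note hl = h_lin[OF S]
  have hs1: "h (c t) (sum f K) v = (\<Sum>k\<in>K. h (c t) (f k) v)" for f v
    by (rule bilinear_sum_left[OF bil[OF S]])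
  have hs2: "h (c t) v (sum f K) = (\<Sum>k\<in>K. h (c t) v (f k))" for f v
    by (rule bilinear_sum_right[OF bil[OF S]])
  have 1: "h (c t) w' (V (N l) (c t)) = 0" if l: "l \<in> K" for l
  proof -
    have "(\<Sum>k\<in>K. h (c t) w (V (N k) (c t)) * h (c t) (V k (c t)) (V (N l) (c t)))
        = (\<Sum>k\<in>K. if k = l then h (c t) w (V (N k) (c t)) else 0)"
      by (rule sum.cong) (auto simp: N_dual[OF l, of _, unfolded b_def] Q_orth l)
    then show ?thesis
      unfolding w'_def using l finite_K c1_orth'[OF t]
      by (simp add: hl hs1 sum.delta)
  qed
  \<comment> \<open>The frame written through the dual frame; this transfers orthogonality from the
    fields of \<open>N l\<close> to all action fields.\<close>
  have Vk: "V l (c t) = (\<Sum>m\<in>K. b t l m *\<^sub>R V (N m) (c t))" if l: "l \<in> K" for l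
  proof -
    define z where "z = V l (c t) - (\<Sum>m\<in>K. b t l m *\<^sub>R V (N m) (c t))"
    have zk: "h (c t) (V k (c t)) z = 0" if k: "k \<in> K" for k
    proof -
      have "(\<Sum>m\<in>K. b t l m * h (c t) (V k (c t)) (V (N m) (c t))) = (\<Sum>m\<in>K. if m = k then b t l m else 0)"
        by (rule sum.cong) (use k in \<open>auto simp: N_dual[unfolded b_def] Q_orth\<close>)
      then show ?thesis unfolding z_def using k finite_K b_sym[OF t, of l k]
        by (simp add: hl hs2 sum.delta) (simp add: b_def)
    qed
    have "h (c t) (V X (c t)) z = 0" for X
      by (subst V_frame) (simp add: hs1 hl zk)
    moreover have "h (c t) (c1 t) z = 0"
      unfolding z_def using c1_orth'[OF t] by (simp add: hl hs2)
    ultimately have "z = 0" by (rule c1_span[OF t])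
    then show ?thesis by (simp add: z_def)
  qed
  have "h (c t) (V l (c t)) w' = 0" if "l \<in> K" for l
    by (subst Vk[OF that]) (simp add: hs1 hl 1 h_sym[OF S, of "V (N _) (c t)" w'])
  then have "h (c t) (V X (c t)) w' = 0" for X
    by (subst V_frame) (simp add: hs1 hl)
  moreover have "h (c t) (c1 t) w' = 0"
    unfolding w'_def using c1_orth'[OF t] c1_unit[OF t] h_sym[OF S, of "c1 t" w] by (simp add: hl hs1 hs2)
  ultimately have "w' = 0" by (rule c1_span[OF t])
  then show ?thesis by (simp add: w'_def)
qed

lemma h_expand:
  "h (c t) w v = (\<Sum>k\<in>K. h (c t) w (V (N k) (c t)) * h (c t) (V k (c t)) v) + h (c t) w (c1 t) * h (c t) (c1 t) v"
  by (subst frame_expand[of w]) (simp add: h_lin[OF S] bilinear_sum_left[OF bil[OF S]])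

text \<open>Frame and dual frame exchanged. \<open>mixed_ricci\<close> uses both versions; this one
  brings a contraction into the form of a symmetric matrix against a skew one.\<close>

lemma h_expand':
  "h (c t) w v = (\<Sum>k\<in>K. h (c t) w (V k (c t)) * h (c t) (V (N k) (c t)) v) + h (c t) w (c1 t) * h (c t) (c1 t) v"
proof -
  have "(\<Sum>k\<in>K. h (c t) v (V (N k) (c t)) * h (c t) (V k (c t)) w) = (\<Sum>k\<in>K. h (c t) w (V k (c t)) * h (c t) (V (N k) (c t)) v)"
    by (intro sum.cong refl) (metis S h_sym mult.commute)
  then show ?thesis
    using h_expand[of v w] h_sym[OF S, of w v] h_sym[OF S, of v "c1 t"] h_sym[OF S, of w "c1 t"] by (simp only: mult.commute)
qed

lemma ricci_frame:
  "ricci h (c t) (V X (c t)) w =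
    (\<Sum>k\<in>K. h (c t) (curvature h (c t) (V k (c t)) (V X (c t)) w) (V (N k) (c t)))
    + h (c t) (curvature h (c t) (c1 t) (V X (c t)) w) (c1 t)"
proof -
  \<comment> \<open>\<open>None\<close> indexes the normal direction, \<open>Some k\<close> the
    orbit direction of \<open>k\<close>.\<close>
  define e where "e i = (case i of None \<Rightarrow> c1 t | Some k \<Rightarrow> V k (c t))" for i
  define f where "f i = (case i of None \<Rightarrow> c1 t | Some k \<Rightarrow> V (N k) (c t))" for i
  have sum: "(\<Sum>i\<in>insert None (Some ` K). F i) = F None + (\<Sum>k\<in>K. F (Some k))" for F :: "'l option \<Rightarrow> 'z::comm_monoid_add"
    using finite_K by (subst sum.insert) (auto simp: sum.reindex)
  have "ricci h (c t) (V X (c t)) w = (\<Sum>i\<in>insert None (Some ` K). h (c t) (curvature h (c t) (e i) (V X (c t)) w) (f i))"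
  proof (rule ricci_trace[OF S _ refl curvature_killing_linear[OF killing_V S]])
    fix v show "v = (\<Sum>i\<in>insert None (Some ` K). h (c t) v (f i) *\<^sub>R e i)"
      unfolding sum e_def f_def using frame_expand[of v] by (simp add: add.commute)
  qed
  then show ?thesis unfolding sum by (simp add: e_def f_def add.commute)
qed

text \<open>\<open>N\<close> has a symmetric matrix in the \<open>Q\<close>-orthonormal basis
  \<open>K\<close>, so contraction with it does not see the order of the two arguments.\<close>

lemma sum_N_swap:
  fixes \<beta> :: "'l \<Rightarrow> 'l \<Rightarrow> real"
  assumes "bilinear \<beta>"
  shows "(\<Sum>k\<in>K. \<beta> k (N k)) = (\<Sum>k\<in>K. \<beta> (N k) k)"
proof -
  have "(\<Sum>k\<in>K. \<beta> k (N k)) = (\<Sum>k\<in>K. \<Sum>l\<in>K. Q (N k) l * \<beta> k l)"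
    by (rule sum.cong[OF refl], subst N_expand) (auto simp: bilinear_sum_right[OF assms] bilinear_iff[OF assms])
  also have "\<dots> = (\<Sum>l\<in>K. \<Sum>k\<in>K. Q (N k) l * \<beta> k l)" by (rule sum.swap)
  also have "\<dots> = (\<Sum>l\<in>K. \<Sum>k\<in>K. Q (N l) k * \<beta> k l)"
    by (intro sum.cong refl) (auto simp: N_sym)
  also have "\<dots> = (\<Sum>l\<in>K. \<beta> (N l) l)"
    by (rule sum.cong[OF refl], subst (2) N_expand) (auto simp: bilinear_sum_left[OF assms] bilinear_iff[OF assms])
  finally show ?thesis .
qed

text \<open>The trace of \<open>ad\<close> vanishes because \<open>ad\<close> is \<open>Q\<close>-skew.\<close>
lemma alpha_trace: "(\<Sum>k\<in>K. \<alpha> t k (N k) Z) = 0"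
proof -
  note bl = bilinear_iff[OF b_bilinear[OF t]] and brl = bilinear_iff[OF br_lin]
  have 1: "(\<Sum>k\<in>K. b t (br k Z) (N k)) = 0"
  proof (rule sum.neutral, rule ballI)
    fix k assume k: "k \<in> K"
    have "Q (br k Z) k = - Q (br Z k) k" using br_skew[of k Z] bilinear_iff(7)[OF Qbil] by simp
    moreover have "Q (br Z k) k = - Q (br Z k) k" using Q_ad[of Z k k] inner_product_formD(2)[OF Q_inner] by metis
    ultimately show "b t (br k Z) (N k) = 0" using N_dual[OF k] by simp
  qed
  have "bilinear (\<lambda>k l. b t (br k Z) l)"
    unfolding bilinear_def by (auto intro!: linearI simp: bl brl)
  from sum_N_swap[OF this] have 2: "(\<Sum>k\<in>K. b t (br (N k) Z) k) = 0" using 1 by simp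
  have "bilinear (\<lambda>k l. b t (br k l) Z)"
    unfolding bilinear_def by (auto intro!: linearI simp: bl brl)
  \<comment> \<open>An antisymmetric expression contracted with the symmetric \<open>N\<close>
    equals its own negative.\<close>
  from sum_N_swap[OF this]
  have "(\<Sum>k\<in>K. b t (br k (N k)) Z) = (\<Sum>k\<in>K. - b t (br k (N k)) Z)"
    by (simp add: b_br_skew[OF t, of "N _" _ Z])
  then have 3: "(\<Sum>k\<in>K. b t (br k (N k)) Z) = 0" by (simp add: sum_negf)
  have "(\<Sum>k\<in>K. \<alpha> t k (N k) Z) = ((\<Sum>k\<in>K. b t (br k (N k)) Z) - (\<Sum>k\<in>K. b t (br (N k) Z) k) - (\<Sum>k\<in>K. b t (br k Z) (N k))) / 2"
    by (simp add: alpha_eq[OF t] sum_divide_distrib[symmetric] sum_subtractf)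
  then show ?thesis using 1 2 3 by simp
qed

lemma curvature_V: "curvature h (c t) (V X (c t)) (V Y (c t)) v =
    nab (V X) (c t) (nab (V Y) (c t) v) - nab (V Y) (c t) (nab (V X) (c t) v) - nab (V (br X Y)) (c t) v"
  by (rule curvature_killing_pair[OF killing_V killing_V killing_V S V_bracket])

lemma curvature_V_inner: "h (c t) (curvature h (c t) (V X (c t)) (V Y (c t)) v) w =
   - h (c t) (nab (V Y) (c t) v) (nab (V X) (c t) w) + h (c t) (nab (V X) (c t) v) (nab (V Y) (c t) w)
   - h (c t) (nab (V (br X Y)) (c t) v) w"
  unfolding curvature_V using nab_skew[OF killing_V S] by (simp add: h_lin[OF S])

text \<open>In the contracted curvature the normal term vanishes by skewness, \<open>A\<close> by
  the vanishing trace of \<open>\<alpha>\<close>, and \<open>B\<close> because it contracts the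
  symmetric \<open>\<Omega>\<close> with the skew \<open>\<alpha>\<close>. Only the bracket term
  survives.\<close>

lemma mixed_ricci:
  "ricci h (c t) (V X (c t)) (c1 t) = (\<Sum>k\<in>K. \<Omega> t (br k X) (N k))"
proof -
  have e: "h (c t) (nab (V Y) (c t) (c1 t)) v = - (\<Sum>l\<in>K. \<Omega> t Y (N l) * h (c t) (V l (c t)) v)" for Y v
    by (subst h_expand) (simp add: nab_c1[OF t] nab_c1_c1[OF t] sum_negf)
  have e': "h (c t) (nab (V Y) (c t) (c1 t)) v = - (\<Sum>l\<in>K. \<Omega> t Y l * h (c t) (V (N l) (c t)) v)" for Y v
    by (subst h_expand') (simp add: nab_c1[OF t] nab_c1_c1[OF t] sum_negf)
  have A: "(\<Sum>k\<in>K. h (c t) (nab (V X) (c t) (c1 t)) (nab (V k) (c t) (V (N k) (c t)))) = 0"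
  proof -
    have "(\<Sum>k\<in>K. h (c t) (nab (V X) (c t) (c1 t)) (nab (V k) (c t) (V (N k) (c t))))
       = - (\<Sum>k\<in>K. \<Sum>l\<in>K. \<Omega> t X (N l) * \<alpha> t k (N k) l)"
      by (simp add: e \<alpha>_def h_sym[OF S, of "V _ (c t)"] sum_negf)
    also have "\<dots> = - (\<Sum>l\<in>K. \<Sum>k\<in>K. \<Omega> t X (N l) * \<alpha> t k (N k) l)" by (subst sum.swap) simp
    also have "\<dots> = 0" by (simp add: sum_distrib_left[symmetric] alpha_trace)
    finally show ?thesis .
  qed
  have B: "(\<Sum>k\<in>K. h (c t) (nab (V k) (c t) (c1 t)) (nab (V X) (c t) (V (N k) (c t)))) = 0" (is "?B = 0")
  proof -
    have "?B = - (\<Sum>k\<in>K. \<Sum>l\<in>K. \<Omega> t k l * \<alpha> t X (N k) (N l))"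
      by (simp add: e' \<alpha>_def h_sym[OF S, of "V (N _) (c t)"] sum_negf)
    moreover have "(\<Sum>k\<in>K. \<Sum>l\<in>K. \<Omega> t k l * \<alpha> t X (N k) (N l)) = - (\<Sum>k\<in>K. \<Sum>l\<in>K. \<Omega> t k l * \<alpha> t X (N k) (N l))"
    proof -
      have "(\<Sum>k\<in>K. \<Sum>l\<in>K. \<Omega> t k l * \<alpha> t X (N k) (N l)) = (\<Sum>l\<in>K. \<Sum>k\<in>K. \<Omega> t k l * \<alpha> t X (N k) (N l))"
        by (rule sum.swap)
      also have "\<dots> = (\<Sum>l\<in>K. \<Sum>k\<in>K. - (\<Omega> t l k * \<alpha> t X (N l) (N k)))"
      proof (intro sum.cong refl)
        fix k l
        show "\<Omega> t k l * \<alpha> t X (N k) (N l) = - (\<Omega> t l k * \<alpha> t X (N l) (N k))"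
          using alpha_skew[OF t, of X "N k" "N l"] Omega_sym[OF t, of k l] by simp
      qed
      finally show ?thesis by (simp add: sum_negf)
    qed
    ultimately show ?thesis by simp
  qed
  have "ricci h (c t) (V X (c t)) (c1 t) =
    - (\<Sum>k\<in>K. h (c t) (nab (V X) (c t) (c1 t)) (nab (V k) (c t) (V (N k) (c t))))
    + (\<Sum>k\<in>K. h (c t) (nab (V k) (c t) (c1 t)) (nab (V X) (c t) (V (N k) (c t))))
    - (\<Sum>k\<in>K. h (c t) (nab (V (br k X)) (c t) (c1 t)) (V (N k) (c t)))"
    unfolding ricci_frame curvature_killing_skew[OF killing_V S] curvature_V_inner
    by (simp add: sum.distrib sum_subtractf sum_negf)
  then show ?thesis unfolding A B by (simp add: nab_c1[OF t] sum_negf)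
qed

lemma nab_inner: "h (c t) (nab (V X) (c t) (V Y (c t))) (nab (V Z) (c t) (V W (c t))) =
    (\<Sum>l\<in>K. \<alpha> t X Y (N l) * \<alpha> t Z W l) + \<Omega> t X Y * \<Omega> t Z W"
  by (subst h_expand) (simp add: \<alpha>_def \<Omega>_def h_sym[OF S, of "V _ (c t)"] h_sym[OF S, of "c1 t"])

lemma nab_c1_inner: "h (c t) (nab (V X) (c t) (c1 t)) (nab (V Y) (c t) (c1 t)) = (\<Sum>l\<in>K. \<Omega> t X (N l) * \<Omega> t Y l)"
  by (subst h_expand) (simp add: nab_c1[OF t] nab_c1_c1[OF t] h_sym[OF S, of "V _ (c t)"])

text \<open>The orbit curvatures in the Ricci trace are replaced by expressions in
  \<open>\<alpha>\<close> and \<open>\<Omega>\<close>, as in the Gauss equation, and the radial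
  curvature that remains is the one in \<open>Omega_deriv\<close>. With the Ricci tensor known, this
  is a differential equation for \<open>\<Omega>\<close>.\<close>

lemma Omega_ode:
  "((\<lambda>t. \<Omega> t X Y) has_real_derivative
    ricci h (c t) (V X (c t)) (V Y (c t))
    - (\<Sum>k\<in>K. (\<Sum>l\<in>K. \<alpha> t k Y (N l) * \<alpha> t X (N k) l) + \<Omega> t k Y * \<Omega> t X (N k)
        - ((\<Sum>l\<in>K. \<alpha> t X Y (N l) * \<alpha> t k (N k) l) + \<Omega> t X Y * \<Omega> t k (N k))
        - \<alpha> t (br k X) Y (N k))
    - (\<Sum>l\<in>K. \<Omega> t Y (N l) * \<Omega> t X l)) (at t)"
proof -
  have "h (c t) (curvature h (c t) (V k (c t)) (V X (c t)) (V Y (c t))) (V (N k) (c t)) =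
     (\<Sum>l\<in>K. \<alpha> t k Y (N l) * \<alpha> t X (N k) l) + \<Omega> t k Y * \<Omega> t X (N k)
        - ((\<Sum>l\<in>K. \<alpha> t X Y (N l) * \<alpha> t k (N k) l) + \<Omega> t X Y * \<Omega> t k (N k))
        - \<alpha> t (br k X) Y (N k)" for k
    unfolding curvature_V_inner nab_inner by (simp add: \<alpha>_def)
  then show ?thesis
    using Omega_deriv[OF t, of X Y] unfolding ricci_frame nab_c1_inner by simp
qed

end

section \<open>Algebras of functions closed under differentiation\<close>

text \<open>The real algebra generated by \<open>G\<close>. The rule \<open>cong\<close> makes only
  the values on \<open>I\<close> count, which is needed because \<open>deriv\<close> is unspecified
  where no derivative is known.\<close>

inductive_set function_algebra :: "real set \<Rightarrow> (real \<Rightarrow> real) set \<Rightarrow> (real \<Rightarrow> real) set"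
  for I :: "real set" and G :: "(real \<Rightarrow> real) set" where
  gen: "f \<in> G \<Longrightarrow> f \<in> function_algebra I G"
| const: "(\<lambda>_. c) \<in> function_algebra I G"
| add: "f \<in> function_algebra I G \<Longrightarrow> g \<in> function_algebra I G \<Longrightarrow> (\<lambda>t. f t + g t) \<in> function_algebra I G"
| mult: "f \<in> function_algebra I G \<Longrightarrow> g \<in> function_algebra I G \<Longrightarrow> (\<lambda>t. f t * g t) \<in> function_algebra I G"
| cong: "f \<in> function_algebra I G \<Longrightarrow> (\<And>t. t \<in> I \<Longrightarrow> f t = g t) \<Longrightarrow> g \<in> function_algebra I G"

lemma function_algebra_cmul: "f \<in> function_algebra I G \<Longrightarrow> (\<lambda>t. c * f t) \<in> function_algebra I G"
  using function_algebra.mult[OF function_algebra.const] by blast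

lemma function_algebra_minus: "f \<in> function_algebra I G \<Longrightarrow> (\<lambda>t. - f t) \<in> function_algebra I G"
  using function_algebra_cmul[of f I G "-1"] by simp

lemma function_algebra_diff:
  "f \<in> function_algebra I G \<Longrightarrow> g \<in> function_algebra I G \<Longrightarrow> (\<lambda>t. f t - g t) \<in> function_algebra I G"
  using function_algebra.add[OF _ function_algebra_minus] by force

lemma function_algebra_sum:
  "finite A \<Longrightarrow> (\<And>a. a \<in> A \<Longrightarrow> f a \<in> function_algebra I G) \<Longrightarrow> (\<lambda>t. \<Sum>a\<in>A. f a t) \<in> function_algebra I G"
  by (induction A rule: finite_induct) (auto intro: function_algebra.const function_algebra.add)

lemmas function_algebra_intros = function_algebra.const function_algebra.add function_algebra.mult
  function_algebra_cmul function_algebra_minus function_algebra_diff function_algebra_sum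

text \<open>A truncated weighted l1 norm. It is a finite sum, so no convergence has to be known in
  advance, and it is still submultiplicative.\<close>

definition fps_weight :: "real \<Rightarrow> nat \<Rightarrow> real fps \<Rightarrow> real" where
  "fps_weight r n A = (\<Sum>j\<le>n. \<bar>fps_nth A j\<bar> * r ^ j)"

lemma fps_weight_nonneg: "r \<ge> 0 \<Longrightarrow> fps_weight r n A \<ge> 0"
  unfolding fps_weight_def by (intro sum_nonneg) auto

lemma fps_weight_add:
  assumes "r \<ge> 0" shows "fps_weight r n (A + B) \<le> fps_weight r n A + fps_weight r n B"
  unfolding fps_weight_def sum.distrib[symmetric]
proof (rule sum_mono)
  fix j
  have "\<bar>fps_nth (A + B) j\<bar> * r ^ j \<le> (\<bar>fps_nth A j\<bar> + \<bar>fps_nth B j\<bar>) * r ^ j"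
    using assms by (intro mult_right_mono) auto
  then show "\<bar>fps_nth (A + B) j\<bar> * r ^ j \<le> \<bar>fps_nth A j\<bar> * r ^ j + \<bar>fps_nth B j\<bar> * r ^ j"
    by (simp add: distrib_right)
qed

lemma fps_weight_const: "fps_weight r n (fps_const c) = \<bar>c\<bar>"
proof -
  have "fps_weight r n (fps_const c) = (\<Sum>j\<le>n. if j = 0 then \<bar>c\<bar> else 0)"
    unfolding fps_weight_def by (intro sum.cong) auto
  then show ?thesis by simp
qed

text \<open>The Cauchy product up to degree \<open>n\<close> runs over the triangle of indices with
  sum at most \<open>n\<close>, which lies in the square of the product of the two
  truncations.\<close>

lemma fps_weight_mult:
  assumes r: "r \<ge> 0"
  shows "fps_weight r n (A * B) \<le> fps_weight r n A * fps_weight r n B"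
proof -
  define a where "a i = \<bar>fps_nth A i\<bar> * r ^ i" for i
  define b where "b i = \<bar>fps_nth B i\<bar> * r ^ i" for i
  have nn: "a i \<ge> 0" "b i \<ge> 0" for i using r by (auto simp: a_def b_def)
  have "fps_weight r n (A * B) \<le> (\<Sum>k\<le>n. \<Sum>i\<le>k. a i * b (k - i))"
    unfolding fps_weight_def
  proof (rule sum_mono)
    fix k
    have "\<bar>fps_nth (A * B) k\<bar> * r ^ k \<le> (\<Sum>i\<le>k. \<bar>fps_nth A i * fps_nth B (k - i)\<bar>) * r ^ k"
      unfolding fps_mult_nth atLeast0AtMost using r by (intro mult_right_mono sum_abs) auto
    also have "\<dots> = (\<Sum>i\<le>k. a i * b (k - i))"
      unfolding sum_distrib_right
      by (intro sum.cong refl) (auto simp: a_def b_def abs_mult power_add[symmetric])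
    finally show "\<bar>fps_nth (A * B) k\<bar> * r ^ k \<le> (\<Sum>i\<le>k. a i * b (k - i))" .
  qed
  also have "\<dots> = (\<Sum>(i, j)\<in>{(i, j). i + j \<le> n}. a i * b j)"
    by (rule sum.triangle_reindex_eq[symmetric])
  also have "\<dots> \<le> (\<Sum>(i, j)\<in>{..n} \<times> {..n}. a i * b j)"
    by (rule sum_mono2) (auto simp: nn)
  also have "\<dots> = fps_weight r n A * fps_weight r n B"
    by (simp add: fps_weight_def a_def b_def sum_product sum.cartesian_product)
  finally show ?thesis .
qed

section \<open>Analyticity in a finitely generated algebra closed under differentiation\<close>

locale differential_algebra =
  fixes I :: "real set" and G :: "(real \<Rightarrow> real) set"
  assumes open_I: "open I" and finite_G: "finite G"
    and gen_deriv: "g \<in> G \<Longrightarrow> \<exists>g'\<in>function_algebra I G. \<forall>t\<in>I. (g has_real_derivative g' t) (at t)"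
begin

abbreviation "\<A> \<equiv> function_algebra I G"

lemma deriv_exists:
  assumes "f \<in> \<A>"
  shows "\<exists>f'\<in>\<A>. \<forall>t\<in>I. (f has_real_derivative f' t) (at t)"
  using assms
proof (induction rule: function_algebra.induct)
  case (gen f)
  then show ?case by (rule gen_deriv)
next
  case (const c)
  show ?case by (rule bexI[OF _ function_algebra.const[of 0]]) auto
next
  case (add f g)
  then obtain f' g' where "f' \<in> \<A>" "g' \<in> \<A>" "\<forall>t\<in>I. (f has_real_derivative f' t) (at t)" "\<forall>t\<in>I. (g has_real_derivative g' t) (at t)"
    by blast
  then show ?case by (intro bexI[of _ "\<lambda>t. f' t + g' t"]) (auto intro!: function_algebra_intros derivative_intros)
next
  case (mult f g)
  then obtain f' g' where *: "f' \<in> \<A>" "g' \<in> \<A>" "\<forall>t\<in>I. (f has_real_derivative f' t) (at t)" "\<forall>t\<in>I. (g has_real_derivative g' t) (at t)"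
    by blast
  have "(\<lambda>t. f' t * g t + g' t * f t) \<in> \<A>" using * mult(1,2) by (intro function_algebra_intros)
  moreover have "\<forall>t\<in>I. ((\<lambda>t. f t * g t) has_real_derivative f' t * g t + g' t * f t) (at t)"
    using * by (auto intro!: derivative_eq_intros)
  ultimately show ?case by (intro bexI[of _ "\<lambda>t. f' t * g t + g' t * f t"])
next
  case (cong f g)
  then obtain f' where f': "f' \<in> \<A>" "\<forall>t\<in>I. (f has_real_derivative f' t) (at t)" by blast
  have "(g has_real_derivative f' t) (at t)" if "t \<in> I" for t
    by (rule has_field_derivative_transform_within_open[of f _ _ I]) (use f' that open_I cong(2) in auto)
  then show ?case using f'(1) by blast
qed

lemma deriv_algebra: "f \<in> \<A> \<Longrightarrow> deriv f \<in> \<A>"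
  using deriv_exists function_algebra.cong DERIV_imp_deriv by metis

lemma has_deriv: "f \<in> \<A> \<Longrightarrow> t \<in> I \<Longrightarrow> (f has_real_derivative deriv f t) (at t)"
  using deriv_exists DERIV_imp_deriv by metis

lemma higher_deriv_algebra: "f \<in> \<A> \<Longrightarrow> (deriv ^^ n) f \<in> \<A>"
  by (induction n) (auto intro: deriv_algebra)

text \<open>Iterated derivatives at a point depend only on the germ there; this lets
  \<open>taylor\<close> respect equality on \<open>I\<close>.\<close>

lemma deriv_germ:
  assumes "open U" and "\<And>t. t \<in> U \<Longrightarrow> f t = g t" and "t \<in> U"
  shows "(deriv ^^ n) f t = (deriv ^^ n) g (t :: real)"
  using assms(2,3)
proof (induction n arbitrary: f g t)
  case (Suc n)
  have "deriv f t = deriv g t" if "t \<in> U" for t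
  proof (rule deriv_cong_ev[OF _ refl])
    show "\<forall>\<^sub>F x in nhds t. f x = g x" using that assms(1) Suc.prems(1) eventually_nhds by blast
  qed
  then have "(deriv ^^ n) (deriv f) t = (deriv ^^ n) (deriv g) t" using Suc by blast
  then show ?case by (simp add: funpow_swap1)
qed simp

definition taylor :: "real \<Rightarrow> (real \<Rightarrow> real) \<Rightarrow> real fps" where
  "taylor t f = Abs_fps (\<lambda>n. (deriv ^^ n) f t / fact n)"

lemma taylor_nth_0: "fps_nth (taylor t f) 0 = f t" by (simp add: taylor_def)

lemma taylor_deriv: "fps_deriv (taylor t f) = taylor t (deriv f)"
  by (rule fps_ext) (simp add: taylor_def funpow_swap1 field_simps del: of_nat_Suc)

lemma taylor_cong: "(\<And>s. s \<in> I \<Longrightarrow> f s = g s) \<Longrightarrow> t \<in> I \<Longrightarrow> taylor t f = taylor t g"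
  unfolding taylor_def using deriv_germ[OF open_I] by metis

lemma taylor_nth_Suc: "fps_nth (taylor t f) (Suc n) = fps_nth (taylor t (deriv f)) n / real (Suc n)"
  using arg_cong[OF taylor_deriv, of "\<lambda>A. fps_nth A n" t f] by (simp add: field_simps)

lemma taylor_const: "taylor t (\<lambda>_. c) = fps_const c"
proof -
  have "(deriv ^^ n) (\<lambda>_. 0 :: real) = (\<lambda>_. 0)" for n by (induction n) auto
  then have "(deriv ^^ n) (\<lambda>_. c) = (\<lambda>_. if n = 0 then c else 0)" for n
    by (cases n) (auto simp: funpow_swap1 fun_eq_iff)
  then show ?thesis by (auto simp: taylor_def fps_eq_iff)
qed

lemma taylor_add:
  assumes "f \<in> \<A>" and "g \<in> \<A>" and t: "t \<in> I"
  shows "taylor t (\<lambda>s. f s + g s) = taylor t f + taylor t g"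
proof -
  have "fps_nth (taylor t (\<lambda>s. f s + g s)) n = fps_nth (taylor t f + taylor t g) n" for n
    using assms(1,2)
  proof (induction n arbitrary: f g)
    case 0
    show ?case by (simp add: taylor_nth_0)
  next
    case (Suc n)
    have "deriv (\<lambda>s. f s + g s) s = deriv f s + deriv g s" if "s \<in> I" for s
      by (rule DERIV_imp_deriv) (intro DERIV_add has_deriv that Suc.prems)
    then have "taylor t (deriv (\<lambda>s. f s + g s)) = taylor t (\<lambda>s. deriv f s + deriv g s)"
      by (rule taylor_cong[OF _ t])
    then show ?case using Suc.IH[OF deriv_algebra deriv_algebra] Suc.prems by (simp add: taylor_nth_Suc add_divide_distrib)
  qed
  then show ?thesis by (simp add: fps_eq_iff)
qed

text \<open>Coefficient \<open>Suc n\<close> of a Taylor series is, up to the factor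
  \<open>Suc n\<close>, coefficient \<open>n\<close> of the series of the derivative. The Leibniz
  rule holds on both sides, so induction on the coefficient works.\<close>

lemma taylor_mult:
  assumes "f \<in> \<A>" and "g \<in> \<A>" and t: "t \<in> I"
  shows "taylor t (\<lambda>s. f s * g s) = taylor t f * taylor t g"
proof -
  have "fps_nth (taylor t (\<lambda>s. f s * g s)) n = fps_nth (taylor t f * taylor t g) n" for n
    using assms(1,2)
  proof (induction n arbitrary: f g)
    case 0
    show ?case by (simp add: taylor_nth_0)
  next
    case (Suc n)
    have "deriv (\<lambda>s. f s * g s) s = f s * deriv g s + deriv f s * g s" if "s \<in> I" for s
      by (rule DERIV_imp_deriv) (auto intro!: derivative_eq_intros has_deriv that Suc.prems)
    then have "taylor t (deriv (\<lambda>s. f s * g s)) = taylor t (\<lambda>s. f s * deriv g s + deriv f s * g s)"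
      by (rule taylor_cong[OF _ t])
    also have "\<dots> = taylor t (\<lambda>s. f s * deriv g s) + taylor t (\<lambda>s. deriv f s * g s)"
      by (intro taylor_add function_algebra_intros deriv_algebra Suc.prems t)
    finally have "fps_nth (taylor t (deriv (\<lambda>s. f s * g s))) n
        = fps_nth (taylor t f * taylor t (deriv g) + taylor t (deriv f) * taylor t g) n"
      using Suc.IH[OF Suc.prems(1) deriv_algebra[OF Suc.prems(2)]] Suc.IH[OF deriv_algebra[OF Suc.prems(1)] Suc.prems(2)] by simp
    also have "\<dots> = fps_nth (fps_deriv (taylor t f * taylor t g)) n"
      by (simp add: taylor_deriv)
    finally show ?case unfolding taylor_nth_Suc by (simp add: field_simps del: of_nat_Suc fps_deriv_mult)
  qed
  then show ?thesis by (simp add: fps_eq_iff)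
qed

text \<open>Sums and products respect weights, so a bound on the generators propagates to
  \<open>f\<close>. The point is the uniformity: \<open>L\<close> depends on \<open>f\<close> and
  \<open>M\<close> but not on \<open>t\<close>, \<open>n\<close> or \<open>r\<close>, which allows
  \<open>r\<close> to be chosen afterwards.\<close>

lemma weight_bound:
  assumes "f \<in> \<A>" and "M \<ge> 0"
  shows "\<exists>L. \<forall>t\<in>I. \<forall>n. \<forall>r\<ge>0. (\<forall>g\<in>G. fps_weight r n (taylor t g) \<le> M) \<longrightarrow> fps_weight r n (taylor t f) \<le> L"
  using assms(1)
proof (induction rule: function_algebra.induct)
  case (gen f)
  then show ?case by blast
next
  case (const c)
  show ?case by (rule exI[of _ "\<bar>c\<bar>"]) (simp add: taylor_const fps_weight_const)
next
  case (add f g)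
  then obtain L L' where *:
    "\<forall>t\<in>I. \<forall>n. \<forall>r\<ge>0. (\<forall>g\<in>G. fps_weight r n (taylor t g) \<le> M) \<longrightarrow> fps_weight r n (taylor t f) \<le> L"
    "\<forall>t\<in>I. \<forall>n. \<forall>r\<ge>0. (\<forall>g\<in>G. fps_weight r n (taylor t g) \<le> M) \<longrightarrow> fps_weight r n (taylor t g) \<le> L'"
    by blast
  show ?case
  proof (intro exI[of _ "L + L'"] ballI allI impI)
    fix t n r assume "t \<in> I" "(r::real) \<ge> 0" "\<forall>g\<in>G. fps_weight r n (taylor t g) \<le> M"
    then show "fps_weight r n (taylor t (\<lambda>t. f t + g t)) \<le> L + L'"
      using * fps_weight_add[of r n "taylor t f" "taylor t g"] add(1,2) by (fastforce simp: taylor_add)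
  qed
next
  case (mult f g)
  then obtain L L' where *:
    "\<forall>t\<in>I. \<forall>n. \<forall>r\<ge>0. (\<forall>g\<in>G. fps_weight r n (taylor t g) \<le> M) \<longrightarrow> fps_weight r n (taylor t f) \<le> L"
    "\<forall>t\<in>I. \<forall>n. \<forall>r\<ge>0. (\<forall>g\<in>G. fps_weight r n (taylor t g) \<le> M) \<longrightarrow> fps_weight r n (taylor t g) \<le> L'"
    by blast
  show ?case
  proof (intro exI[of _ "L * L'"] ballI allI impI)
    fix t n r assume a: "t \<in> I" "(r::real) \<ge> 0" "\<forall>g\<in>G. fps_weight r n (taylor t g) \<le> M"
    have "fps_weight r n (taylor t f) * fps_weight r n (taylor t g) \<le> L * L'"
    proof (rule mult_mono)
      show f: "fps_weight r n (taylor t f) \<le> L" and "fps_weight r n (taylor t g) \<le> L'" using * a by auto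
      show "0 \<le> L" using f fps_weight_nonneg[OF a(2)] order_trans by blast
    qed (rule fps_weight_nonneg[OF a(2)])
    then show "fps_weight r n (taylor t (\<lambda>t. f t * g t)) \<le> L * L'"
      using fps_weight_mult[OF a(2), of n "taylor t f" "taylor t g"] taylor_mult[OF mult(1,2) a(1)] by simp
  qed
next
  case (cong f g)
  then show ?case using taylor_cong by metis
qed

lemma algebra_continuous: "f \<in> \<A> \<Longrightarrow> J \<subseteq> I \<Longrightarrow> continuous_on J f"
  by (intro DERIV_continuous_on) (use has_deriv has_field_derivative_at_within in blast)

text \<open>The weights of the generators stay below \<open>M\<close> because integrating the differential equation
  costs one factor \<open>r\<close>.\<close>
lemma taylor_bounded:
  assumes J: "compact J" "J \<subseteq> I"
  shows "\<exists>r>0. \<forall>f\<in>\<A>. \<exists>L. \<forall>t\<in>J. \<forall>n. \<bar>(deriv ^^ n) f t\<bar> / fact n * r ^ n \<le> L"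
proof -
  have "\<exists>C. \<forall>t\<in>J. \<bar>g t\<bar> \<le> C" if "g \<in> G" for g
  proof -
    have "compact (g ` J)"
      using compact_continuous_image[OF algebra_continuous J(1)] that J(2) function_algebra.gen by blast
    then have "bounded (g ` J)" by (rule compact_imp_bounded)
    then show ?thesis by (auto simp: bounded_iff)
  qed
  then obtain C where C: "\<And>g t. g \<in> G \<Longrightarrow> t \<in> J \<Longrightarrow> \<bar>g t\<bar> \<le> C g" by metis
  \<comment> \<open>Half of \<open>M\<close> covers the values of the generators on
    \<open>J\<close>; the other half is reserved for the higher coefficients.\<close>
  define M where "M = 2 * (1 + (\<Sum>g\<in>G. \<bar>C g\<bar>))"
  have M0: "M > 0" unfolding M_def by (smt (verit) sum_nonneg abs_ge_zero)
  have M: "\<bar>g t\<bar> \<le> M / 2" if "g \<in> G" "t \<in> J" for g t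
  proof -
    have "\<bar>C g\<bar> \<le> (\<Sum>g\<in>G. \<bar>C g\<bar>)" using finite_G that by (intro member_le_sum) auto
    then show ?thesis using C[OF that] by (simp add: M_def)
  qed
  have "\<exists>L. \<forall>t\<in>I. \<forall>n. \<forall>r\<ge>0. (\<forall>g\<in>G. fps_weight r n (taylor t g) \<le> M) \<longrightarrow> fps_weight r n (taylor t f) \<le> L"
    if "f \<in> \<A>" for f using weight_bound[OF that] M0 by simp
  then obtain L where L: "\<And>f t n r. f \<in> \<A> \<Longrightarrow> t \<in> I \<Longrightarrow> r \<ge> 0 \<Longrightarrow>
      (\<forall>g\<in>G. fps_weight r n (taylor t g) \<le> M) \<Longrightarrow> fps_weight r n (taylor t f) \<le> L f"
    by metis
  define L' where "L' = 1 + (\<Sum>g\<in>G. \<bar>L (deriv g)\<bar>)"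
  have L'0: "L' > 0" unfolding L'_def by (smt (verit) sum_nonneg abs_ge_zero)
  have L': "L (deriv g) \<le> L'" if "g \<in> G" for g
  proof -
    have "\<bar>L (deriv g)\<bar> \<le> (\<Sum>g\<in>G. \<bar>L (deriv g)\<bar>)" using finite_G that by (intro member_le_sum) auto
    then show ?thesis by (simp add: L'_def)
  qed
  \<comment> \<open>Chosen so that \<open>r * L'\<close> is the reserved half of \<open>M\<close>,
    where \<open>L'\<close> bounds the weights of the derivatives of all generators.\<close>
  define r where "r = M / (2 * L')"
  have r: "r > 0" using M0 L'0 by (simp add: r_def)
  have gens: "\<forall>g\<in>G. fps_weight r n (taylor t g) \<le> M" if t: "t \<in> J" for t n
  proof (induction n)
    case 0
    have "\<bar>g t\<bar> \<le> M" if "g \<in> G" for g using M[OF that t] M0 by linarith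
    then show ?case by (simp add: fps_weight_def taylor_nth_0)
  next
    case (Suc n)
    show ?case
    proof
      fix g assume g: "g \<in> G"
      have "fps_weight r (Suc n) (taylor t g) = \<bar>g t\<bar> + (\<Sum>j\<le>n. \<bar>fps_nth (taylor t g) (Suc j)\<bar> * r ^ Suc j)"
        unfolding fps_weight_def by (subst sum.atMost_Suc_shift) (simp add: taylor_nth_0)
      also have "(\<Sum>j\<le>n. \<bar>fps_nth (taylor t g) (Suc j)\<bar> * r ^ Suc j) \<le> r * fps_weight r n (taylor t (deriv g))"
        unfolding fps_weight_def sum_distrib_left
      proof (rule sum_mono)
        fix j
        \<comment> \<open>The gain \<open>1 / Suc j\<close> from integration is dropped; the extra
          factor \<open>r\<close> suffices.\<close>
        have "\<bar>fps_nth (taylor t (deriv g)) j\<bar> / real (Suc j) \<le> \<bar>fps_nth (taylor t (deriv g)) j\<bar> / 1"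
          by (intro divide_left_mono) auto
        then have "\<bar>fps_nth (taylor t g) (Suc j)\<bar> * r ^ Suc j \<le> \<bar>fps_nth (taylor t (deriv g)) j\<bar> * r ^ Suc j"
          unfolding taylor_nth_Suc abs_divide using r by (intro mult_right_mono) auto
        then show "\<bar>fps_nth (taylor t g) (Suc j)\<bar> * r ^ Suc j \<le> r * (\<bar>fps_nth (taylor t (deriv g)) j\<bar> * r ^ j)"
          by (simp add: ac_simps)
      qed
      also have "r * fps_weight r n (taylor t (deriv g)) \<le> r * L'"
        using L[OF deriv_algebra[OF function_algebra.gen[OF g]] _ _ Suc.IH] L'[OF g] r t J(2)
        by (intro mult_left_mono) (auto intro: order_trans)
      also have "\<bar>g t\<bar> + r * L' \<le> M" using M[OF g t] L'0 by (simp add: r_def)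
      finally show "fps_weight r (Suc n) (taylor t g) \<le> M" by simp
    qed
  qed
  show ?thesis
  proof (rule exI[of _ r], rule conjI[OF r], rule ballI)
    fix f assume f: "f \<in> \<A>"
    have "\<bar>(deriv ^^ n) f t\<bar> / fact n * r ^ n \<le> L f" if "t \<in> J" for t n
    proof -
      have "\<bar>fps_nth (taylor t f) n\<bar> * r ^ n \<le> fps_weight r n (taylor t f)"
        unfolding fps_weight_def using r by (intro member_le_sum[of n "{..n}" "\<lambda>j. \<bar>fps_nth (taylor t f) j\<bar> * r ^ j"]) auto
      also have "\<dots> \<le> L f" by (rule L[OF f]) (use that J r gens in auto)
      finally show ?thesis by (simp add: taylor_def)
    qed
    then show "\<exists>L. \<forall>t\<in>J. \<forall>n. \<bar>(deriv ^^ n) f t\<bar> / fact n * r ^ n \<le> L" by blast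
  qed
qed

text \<open>With all derivatives zero at \<open>t0\<close>, Taylor's formula leaves a remainder
  bounded by \<open>L\<close> times the n-th power of |t - t0| / r, which tends to 0 within the
  radius \<open>r\<close>.\<close>

lemma flat_imp_locally_zero:
  assumes f: "f \<in> \<A>" and t0: "t0 \<in> I" and flat: "\<And>n. (deriv ^^ n) f t0 = 0"
  shows "\<exists>e>0. \<forall>t. \<bar>t - t0\<bar> < e \<longrightarrow> t \<in> I \<and> f t = 0"
proof -
  obtain d where d: "d > 0" "cball t0 d \<subseteq> I" using open_I t0 open_contains_cball by blast
  obtain r where r: "r > 0" "\<forall>f\<in>\<A>. \<exists>L. \<forall>t\<in>cball t0 d. \<forall>n. \<bar>(deriv ^^ n) f t\<bar> / fact n * r ^ n \<le> L"
    using taylor_bounded[OF compact_cball d(2)] by blast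
  then obtain L where L: "\<And>t n. t \<in> cball t0 d \<Longrightarrow> \<bar>(deriv ^^ n) f t\<bar> / fact n * r ^ n \<le> L"
    using f by blast
  have "t \<in> I \<and> f t = 0" if t: "\<bar>t - t0\<bar> < min d r" for t
  proof
    show "t \<in> I" using d(2) t by (auto simp: subset_iff dist_real_def)
    show "f t = 0"
    proof (cases "t = t0")
      case True
      then show ?thesis using flat[of 0] by simp
    next
      case False
      have bound: "\<bar>f t\<bar> \<le> L * (\<bar>t - t0\<bar> / r) ^ n" if n: "n > 0" for n
      proof -
        have "\<exists>s. (if t < t0 then t < s \<and> s < t0 else t0 < s \<and> s < t) \<and>
            f t = (\<Sum>m<n. (deriv ^^ m) f t0 / fact m * (t - t0) ^ m) + (deriv ^^ n) f s / fact n * (t - t0) ^ n"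
        proof (rule Taylor[OF n, of _ f "t0 - d" "t0 + d"])
          show "\<forall>m s. m < n \<and> t0 - d \<le> s \<and> s \<le> t0 + d \<longrightarrow>
              ((deriv ^^ m) f has_real_derivative (deriv ^^ Suc m) f s) (at s)"
          proof (intro allI impI)
            fix m s assume "m < n \<and> t0 - d \<le> s \<and> s \<le> t0 + d"
            then have "s \<in> I" using d(2) by (auto simp: subset_iff dist_real_def abs_le_iff)
            then show "((deriv ^^ m) f has_real_derivative (deriv ^^ Suc m) f s) (at s)"
              using has_deriv[OF higher_deriv_algebra[OF f]] by simp
          qed
        qed (use t False d in \<open>auto simp: abs_less_iff\<close>)
        then obtain s where s': "if t < t0 then t < s \<and> s < t0 else t0 < s \<and> s < t"
          and s2: "f t = (deriv ^^ n) f s / fact n * (t - t0) ^ n"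
          by (auto simp: flat)
        have "s \<in> cball t0 d" using s' t by (auto simp: dist_real_def split: if_splits)
        note s = this s2
        have "\<bar>f t\<bar> = (\<bar>(deriv ^^ n) f s\<bar> / fact n * r ^ n) * (\<bar>t - t0\<bar> / r) ^ n"
          using r(1) by (simp add: s(2) abs_mult power_abs power_divide)
        also have "\<dots> \<le> L * (\<bar>t - t0\<bar> / r) ^ n"
          using r(1) by (intro mult_right_mono L s(1)) auto
        finally show ?thesis .
      qed
      have "(\<lambda>n. L * (\<bar>t - t0\<bar> / r) ^ n) \<longlonglongrightarrow> L * 0"
        using t r(1) by (intro tendsto_mult_left LIMSEQ_realpow_zero) auto
      then have "\<bar>f t\<bar> \<le> L * 0"
        by (rule LIMSEQ_le_const) (use bound in \<open>auto intro: exI[of _ 1]\<close>)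
      then show ?thesis by simp
    qed
  qed
  then show ?thesis using d(1) r(1) by (intro exI[of _ "min d r"]) auto
qed

text \<open>The points where all derivatives vanish form a closed set by continuity and an open one
  by the preceding lemma.\<close>

lemma identity_theorem:
  assumes f: "f \<in> \<A>" and conn: "connected I" and U: "open U" "U \<noteq> {}" "U \<subseteq> I" "\<And>t. t \<in> U \<Longrightarrow> f t = 0"
    and t: "t \<in> I"
  shows "f t = 0"
proof -
  define Z where "Z = {t\<in>I. \<forall>n. (deriv ^^ n) f t = 0}"
  have zero: "(deriv ^^ n) f t = 0" if "open W" "\<And>t. t \<in> W \<Longrightarrow> f t = 0" "t \<in> W" for W t n
  proof -
    have "(deriv ^^ n) f t = (deriv ^^ n) (\<lambda>_. 0) t" by (rule deriv_germ[OF that(1)]) (use that in auto)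
    moreover have "(deriv ^^ n) (\<lambda>_. 0 :: real) = (\<lambda>_. 0)" by (induction n) auto
    ultimately show ?thesis by simp
  qed
  have "openin (top_of_set I) Z"
  proof -
    have "\<exists>W. open W \<and> t \<in> W \<and> W \<subseteq> Z" if "t \<in> Z" for t
    proof -
      have "t \<in> I" and "\<And>n. (deriv ^^ n) f t = 0" using that by (auto simp: Z_def)
      from flat_imp_locally_zero[OF f this]
      obtain e where e: "e > 0" "\<forall>s. \<bar>s - t\<bar> < e \<longrightarrow> s \<in> I \<and> f s = 0" by blast
      have "ball t e \<subseteq> Z"
      proof
        fix s assume s: "s \<in> ball t e"
        have "(deriv ^^ n) f s = 0" for n
          by (rule zero[OF open_ball _ s]) (use e(2) in \<open>auto simp: dist_real_def abs_minus_commute\<close>)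
        then show "s \<in> Z" using e(2) s by (auto simp: Z_def dist_real_def abs_minus_commute)
      qed
      then show ?thesis using e(1) by (intro exI[of _ "ball t e"]) auto
    qed
    then have "open Z" by (subst open_subopen) blast
    moreover have "Z \<subseteq> I" by (auto simp: Z_def)
    ultimately show ?thesis using openin_open_eq[OF open_I] by blast
  qed
  moreover have "closedin (top_of_set I) Z"
  proof -
    have "Z = (\<Inter>n. {t\<in>I. (deriv ^^ n) f t = 0})" by (auto simp: Z_def)
    also have "closedin (top_of_set I) \<dots>"
      by (intro closedin_INT continuous_closedin_preimage_constant algebra_continuous higher_deriv_algebra f) auto
    finally show ?thesis .
  qed
  moreover have "Z \<noteq> {}" using U zero[OF U(1,4)] by (auto simp: Z_def)
  ultimately have "Z = I" using conn connected_clopen by blast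
  then show ?thesis using t by (auto simp: Z_def dest!: spec[of _ 0])
qed

text \<open>Linear dependence holds near a point where one of the functions does not vanish, and spreads by
  analyticity.\<close>
lemma wronskian_dependent:
  assumes p: "p \<in> \<A>" and q: "q \<in> \<A>" and conn: "connected I"
    and W: "\<And>t. t \<in> I \<Longrightarrow> p t * deriv q t = q t * deriv p t"
  shows "\<exists>x y. (x, y) \<noteq> (0, 0) \<and> (\<forall>t\<in>I. x * p t + y * q t = 0)"
proof -
  have key: "\<exists>x. \<forall>t\<in>I. q t + x * p t = 0"
    if p: "p \<in> \<A>" and q: "q \<in> \<A>" and W: "\<And>t. t \<in> I \<Longrightarrow> p t * deriv q t = q t * deriv p t"
      and t1: "t1 \<in> I" "p t1 \<noteq> 0" for p q t1
  proof -
    have "open {t\<in>I. p t \<noteq> 0}"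
    proof -
      have "openin (top_of_set I) (I \<inter> p -` (- {0}))"
        by (rule continuous_openin_preimage_gen[OF algebra_continuous[OF p]]) auto
      moreover have "I \<inter> p -` (- {0}) = {t\<in>I. p t \<noteq> 0}" by auto
      ultimately show ?thesis using openin_open_eq[OF open_I] by auto
    qed
    then obtain e where e: "e > 0" "ball t1 e \<subseteq> {t\<in>I. p t \<noteq> 0}" using t1 open_contains_ball by blast
    have "((\<lambda>t. q t / p t) has_real_derivative 0) (at t)" if "t \<in> ball t1 e" for t
    proof -
      have t: "t \<in> I" "p t \<noteq> 0" using that e(2) by auto
      have "((\<lambda>t. q t / p t) has_real_derivative (deriv q t * p t - q t * deriv p t) / (p t * p t)) (at t)"
        by (intro DERIV_divide has_deriv p q t)
      moreover have "deriv q t * p t - q t * deriv p t = 0" using W[OF t(1)] by (simp add: mult.commute)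
      ultimately show ?thesis by simp
    qed
    then obtain k where k: "\<And>t. t \<in> ball t1 e \<Longrightarrow> q t / p t = k"
      using has_field_derivative_zero_constant[of "ball t1 e" "\<lambda>t. q t / p t"]
      by (metis convex_ball has_field_derivative_at_within)
    have "q t + (- k) * p t = 0" if "t \<in> I" for t
    proof (rule identity_theorem[OF _ conn _ _ _ _ that, of _ "ball t1 e"])
      show "(\<lambda>t. q t + (- k) * p t) \<in> \<A>" by (intro function_algebra_intros p q)
      show "q t + (- k) * p t = 0" if "t \<in> ball t1 e" for t
        using k[OF that] e(2) that by (auto simp: field_simps)
    qed (use e in auto)
    then show ?thesis by blast
  qed
  show ?thesis
  proof (cases "\<exists>t\<in>I. p t \<noteq> 0")
    case True
    then obtain x where "\<forall>t\<in>I. q t + x * p t = 0" using key[OF p q W] by blast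
    then show ?thesis by (intro exI[of _ x] exI[of _ 1]) (auto simp: add.commute)
  next
    case False
    then show ?thesis by (intro exI[of _ 1] exI[of _ 0]) auto
  qed
qed

end

section \<open>Local Lie groups and their actions\<close>

lemma open_slice:
  assumes "open (U :: ('a::topological_space \<times> 'b::topological_space) set)"
  shows "open {z. (z, x) \<in> U}" and "open {x. (z, x) \<in> U}"
proof -
  have "open ((\<lambda>z. (z, x)) -` U)" "open ((\<lambda>x. (z, x)) -` U)"
    by (intro open_vimage assms continuous_intros)+
  then show "open {z. (z, x) \<in> U}" "open {x. (z, x) \<in> U}" by (simp_all add: vimage_def)
qed

text \<open>\<open>\<mu>\<close> is the multiplication in a chart around the identity \<open>e\<close>.\<close>
locale local_group =
  fixes E :: "'l::euclidean_space set" and e :: 'l and U :: "('l \<times> 'l) set" and \<mu> :: "'l \<times> 'l \<Rightarrow> 'l"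
  assumes open_E: "open E" and e_E: "e \<in> E"
    and open_U: "open U" and smooth_mu: "smooth_on U \<mu>"
    and unit_U: "z \<in> E \<Longrightarrow> (e, z) \<in> U \<and> (z, e) \<in> U"
    and unit: "z \<in> E \<Longrightarrow> \<mu> (e, z) = z \<and> \<mu> (z, e) = z"
begin

text \<open>The mixed second derivative of the multiplication at the identity, \<open>X\<close>
  acting on the left factor and \<open>Y\<close> on the right one. Its antisymmetrization is the Lie
  bracket.\<close>

definition "\<beta> X Y = Dd (\<lambda>w. Dd \<mu> w (X, 0)) (e, e) (0, Y)"
definition "br X Y = \<beta> X Y - \<beta> Y X"

lemma ee_U: "(e, e) \<in> U" using unit_U[OF e_E] by blast

lemma beta_sym: "\<beta> X Y = Dd (\<lambda>w. Dd \<mu> w (0, Y)) (e, e) (X, 0)"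
  unfolding \<beta>_def by (rule Dd_symmetric[OF open_U smooth_mu ee_U])

lemma mu_deriv: "w \<in> U \<Longrightarrow> (\<mu> has_derivative Dd \<mu> w) (at w)"
  by (rule smooth_on_has_derivative[OF smooth_mu])

lemma Dmu_left: "((\<lambda>z. \<mu> (z, y)) has_derivative (\<lambda>X. Dd \<mu> (z, y) (X, 0))) (at z)" if "(z, y) \<in> U"
proof -
  have "((\<lambda>z. (z, y)) has_derivative (\<lambda>X. (X, 0))) (at z)" by (auto intro!: derivative_eq_intros)
  from has_derivative_compose[OF this mu_deriv[OF that]] show ?thesis .
qed

lemma Dmu_right: "((\<lambda>z. \<mu> (y, z)) has_derivative (\<lambda>X. Dd \<mu> (y, z) (0, X))) (at z)" if "(y, z) \<in> U"
proof -
  have "((\<lambda>z. (y, z)) has_derivative (\<lambda>X. (0, X))) (at z)" by (auto intro!: derivative_eq_intros)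
  from has_derivative_compose[OF this mu_deriv[OF that]] show ?thesis .
qed

lemma Dmu_e: "Dd \<mu> (e, e) (X, 0) = X" "Dd \<mu> (e, e) (0, X) = X"
proof -
  have "((\<lambda>z. z) has_derivative (\<lambda>X. Dd \<mu> (e, e) (X, 0))) (at e)"
    by (rule has_derivative_transform_within_open[OF Dmu_left[OF ee_U] open_E e_E]) (simp add: unit)
  from has_derivative_unique[OF this has_derivative_ident] show "Dd \<mu> (e, e) (X, 0) = X" by metis
  have "((\<lambda>z. z) has_derivative (\<lambda>X. Dd \<mu> (e, e) (0, X))) (at e)"
    by (rule has_derivative_transform_within_open[OF Dmu_right[OF ee_U] open_E e_E]) (simp add: unit)
  from has_derivative_unique[OF this has_derivative_ident] show "Dd \<mu> (e, e) (0, X) = X" by metis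
qed

lemma right_field_deriv: "((\<lambda>z. Dd \<mu> (e, z) (X, 0)) has_derivative (\<lambda>Y. \<beta> X Y)) (at e)"
proof -
  have "((\<lambda>z. (e, z)) has_derivative (\<lambda>X. (0, X))) (at e)" by (auto intro!: derivative_eq_intros)
  from has_derivative_compose[OF this smooth_on_has_derivative[OF smooth_on_Dd[OF open_U smooth_mu] ee_U]]
  show ?thesis unfolding \<beta>_def .
qed

lemma left_field_deriv: "((\<lambda>z. Dd \<mu> (z, e) (0, Y)) has_derivative (\<lambda>X. \<beta> X Y)) (at e)"
proof -
  have "((\<lambda>z. (z, e)) has_derivative (\<lambda>X. (X, 0))) (at e)" by (auto intro!: derivative_eq_intros)
  from has_derivative_compose[OF this smooth_on_has_derivative[OF smooth_on_Dd[OF open_U smooth_mu] ee_U]]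
  show ?thesis unfolding beta_sym .
qed

lemma mu_linear: "w \<in> U \<Longrightarrow> linear (Dd \<mu> w)" by (rule smooth_on_linear_Dd[OF smooth_mu])

lemma mu_linear_left: "w \<in> U \<Longrightarrow> linear (\<lambda>X. Dd \<mu> w (X, 0))"
  using linear_add[OF mu_linear, of w "(_, 0)" "(_, 0)"] linear_cmul[OF mu_linear, of w _ "(_, 0)"]
  by (intro linearI) auto

lemma beta_bilinear: "bilinear \<beta>"
  unfolding bilinear_def
proof (intro conjI allI)
  fix X show "linear (\<lambda>Y. \<beta> X Y)" using has_derivative_linear[OF right_field_deriv] .
  show "linear (\<lambda>Y. \<beta> Y X)" using has_derivative_linear[OF left_field_deriv] .
qed

lemma br_skew: "br X Y = - br Y X" by (simp add: br_def)

lemma br_bilinear: "bilinear br"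
  unfolding bilinear_def br_def using bilinear_iff[OF beta_bilinear]
  by (auto intro!: linearI simp: algebra_simps)

text \<open>\<open>T z\<close> plays the role of \<open>Ad\<close> at the group element with coordinate \<open>z\<close>; its derivative at the
  identity is the bracket.\<close>
lemma ad_skew:
  assumes Q: "inner_product_form Q" and W: "open W" "e \<in> W" "W \<subseteq> E"
    and T: "\<And>z X. z \<in> W \<Longrightarrow> Dd \<mu> (e, z) (T z X, 0) = Dd \<mu> (z, e) (0, X)"
    and inv: "\<And>z X Y. z \<in> W \<Longrightarrow> Q (T z X) (T z Y) = Q X Y"
  shows "Q (br X Y) Z = - Q Y (br X Z)"
proof -
  have Te: "T e X = X" for X using T[OF W(2), of X] by (simp add: Dmu_e)
  have dT: "((\<lambda>z. T z Y) has_derivative (\<lambda>X. br X Y)) (at e)" for Y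
  proof -
    \<comment> \<open>No regularity of \<open>T\<close> in \<open>z\<close> is assumed; it comes
      from the linear system that defines \<open>T\<close>, whose matrix at \<open>e\<close> is the
      identity.\<close>
    have "(\<lambda>z. T z Y) differentiable (at e)"
    proof (rule linear_system_differentiable[OF W(1,2)])
      show "linear (\<lambda>X. Dd \<mu> (e, z) (X, 0))" if "z \<in> W" for z
        using mu_linear_left unit_U that W(3) by blast
      show "((\<lambda>z. Dd \<mu> (e, z) (X, 0)) has_derivative (\<lambda>Y. \<beta> X Y)) (at e)" for X by (rule right_field_deriv)
      show "((\<lambda>z. Dd \<mu> (z, e) (0, Y)) has_derivative (\<lambda>X. \<beta> X Y)) (at e)" by (rule left_field_deriv)
      show "Dd \<mu> (e, z) (T z Y, 0) = Dd \<mu> (z, e) (0, Y)" if "z \<in> W" for z by (rule T[OF that])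
      show "inj (\<lambda>X. Dd \<mu> (e, e) (X, 0))" by (simp add: Dmu_e)
    qed
    then have d: "((\<lambda>z. T z Y) has_derivative Dd (\<lambda>z. T z Y) e) (at e)"
      using frechet_derivative_works by blast
    have "((\<lambda>z. Dd \<mu> (e, z) (T z Y, 0)) has_derivative
        (\<lambda>X. \<beta> (T e Y) X + Dd \<mu> (e, e) (Dd (\<lambda>z. T z Y) e X, 0))) (at e)"
      by (rule has_derivative_linear_field[OF W(1,2) _ right_field_deriv d])
        (use mu_linear_left unit_U W(3) in blast)
    then have "((\<lambda>z. Dd \<mu> (z, e) (0, Y)) has_derivative (\<lambda>X. \<beta> Y X + Dd (\<lambda>z. T z Y) e X)) (at e)"
      unfolding Dmu_e Te by (rule has_derivative_transform_within_open[OF _ W(1,2)]) (rule T)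
    from has_derivative_unique[OF this left_field_deriv]
    have "\<beta> Y X + Dd (\<lambda>z. T z Y) e X = \<beta> X Y" for X by metis
    then have "Dd (\<lambda>z. T z Y) e X = br X Y" for X unfolding br_def by (metis add_diff_cancel_left')
    then have "Dd (\<lambda>z. T z Y) e = (\<lambda>X. br X Y)" by blast
    then show ?thesis using d by simp
  qed
  have bQ: "bounded_bilinear Q"
    using inner_product_formD(1)[OF Q] bilinear_conv_bounded_bilinear by blast
  have "((\<lambda>z. Q (T z Y) (T z Z)) has_derivative (\<lambda>X. Q (T e Y) (br X Z) + Q (br X Y) (T e Z))) (at e)"
    by (rule bounded_bilinear.FDERIV[OF bQ dT dT])
  then have "((\<lambda>z. Q Y Z) has_derivative (\<lambda>X. Q (T e Y) (br X Z) + Q (br X Y) (T e Z))) (at e)"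
    by (rule has_derivative_transform_within_open[OF _ W(1,2)]) (rule inv)
  from has_derivative_unique[OF this has_derivative_const]
  have "Q Y (br X Z) + Q (br X Y) Z = 0" unfolding Te by metis
  then show ?thesis by simp
qed

end

text \<open>A group action read in one chart is defined only on \<open>R\<close>. Compatibility with
  \<open>\<mu>\<close> is therefore asked only for left factors near the identity, which is all that
  differentiation at \<open>e\<close> sees.\<close>

locale local_action = local_group E e U \<mu>
  for E :: "'l::euclidean_space set" and e U \<mu> +
  fixes S :: "'e::euclidean_space set" and R :: "('l \<times> 'e) set" and F :: "'l \<times> 'e \<Rightarrow> 'e"
  assumes open_S': "open S" and open_R: "open R" and smooth_F: "smooth_on R F"
    and F_S: "(z, x) \<in> R \<Longrightarrow> x \<in> S \<and> z \<in> E \<and> F (z, x) \<in> S"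
    and e_R: "x \<in> S \<Longrightarrow> (e, x) \<in> R" and F_e: "x \<in> S \<Longrightarrow> F (e, x) = x"
    and F_mu: "(z, x) \<in> R \<Longrightarrow>
      \<exists>W. open W \<and> e \<in> W \<and> (\<forall>w\<in>W. (w, z) \<in> U \<and> (\<mu> (w, z), x) \<in> R \<and> F (\<mu> (w, z), x) = F (w, F (z, x)))"
begin

definition "V X x = Dd F (e, x) (X, 0)"

lemma F_deriv: "w \<in> R \<Longrightarrow> (F has_derivative Dd F w) (at w)"
  by (rule smooth_on_has_derivative[OF smooth_F])

lemma DF_left: "((\<lambda>z. F (z, x)) has_derivative (\<lambda>X. Dd F (z, x) (X, 0))) (at z)" if "(z, x) \<in> R"
proof -
  have "((\<lambda>z. (z, x)) has_derivative (\<lambda>X. (X, 0))) (at z)" by (auto intro!: derivative_eq_intros)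
  from has_derivative_compose[OF this F_deriv[OF that]] show ?thesis .
qed

lemma DF_right: "((\<lambda>x. F (z, x)) has_derivative (\<lambda>X. Dd F (z, x) (0, X))) (at x)" if "(z, x) \<in> R"
proof -
  have "((\<lambda>x. (z, x)) has_derivative (\<lambda>X. (0, X))) (at x)" by (auto intro!: derivative_eq_intros)
  from has_derivative_compose[OF this F_deriv[OF that]] show ?thesis .
qed

lemma V_deriv_e: "x \<in> S \<Longrightarrow> ((\<lambda>z. F (z, x)) has_derivative (\<lambda>X. V X x)) (at e)"
  unfolding V_def by (rule DF_left[OF e_R])

lemma V_smooth: "smooth_on S (V X)"
  unfolding V_def
  by (rule smooth_on_slice_right[OF smooth_on_Dd[OF open_R smooth_F] open_S']) (rule e_R)

lemma V_linear: "x \<in> S \<Longrightarrow> linear (\<lambda>X. V X x)"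
  using has_derivative_linear[OF V_deriv_e] .

lemma DF_e_right: "x \<in> S \<Longrightarrow> Dd F (e, x) (0, u) = u"
proof -
  assume x: "x \<in> S"
  have "((\<lambda>x. x) has_derivative (\<lambda>X. Dd F (e, x) (0, X))) (at x)"
    by (rule has_derivative_transform_within_open[OF DF_right[OF e_R[OF x]] open_S' x]) (rule F_e)
  from has_derivative_unique[OF this has_derivative_ident] show ?thesis by metis
qed

text \<open>\<open>z \<mapsto> Dd \<mu> (e, z) (X, 0)\<close> is the right-invariant field of \<open>X\<close>.\<close>
lemma orbit_map_equivariant:
  assumes zx: "(z, x) \<in> R"
  shows "Dd F (z, x) (Dd \<mu> (e, z) (X, 0), 0) = V X (F (z, x))"
proof -
  obtain W where W: "open W" "e \<in> W"
    "\<And>w. w \<in> W \<Longrightarrow> (w, z) \<in> U \<and> (\<mu> (w, z), x) \<in> R \<and> F (\<mu> (w, z), x) = F (w, F (z, x))"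
    using F_mu[OF zx] by blast
  have z: "z \<in> E" and Fz: "F (z, x) \<in> S" using F_S[OF zx] by auto
  have 1: "((\<lambda>w. \<mu> (w, z)) has_derivative (\<lambda>X. Dd \<mu> (e, z) (X, 0))) (at e)"
    using Dmu_left unit_U[OF z] by blast
  have "((\<lambda>z. F (z, x)) has_derivative (\<lambda>X. Dd F (z, x) (X, 0))) (at (\<mu> (e, z)))"
    using DF_left[OF zx] unit[OF z] by simp
  from has_derivative_compose[OF 1 this]
  have "((\<lambda>w. F (w, F (z, x))) has_derivative (\<lambda>X. Dd F (z, x) (Dd \<mu> (e, z) (X, 0), 0))) (at e)"
    by (rule has_derivative_transform_within_open[OF _ W(1,2)]) (use W(3) in blast)
  from has_derivative_unique[OF this V_deriv_e[OF Fz]] show ?thesis by metis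
qed

text \<open>Differentiating the equivariance of the orbit map at \<open>e\<close> gives a second
  derivative of that map plus \<open>V (\<beta> X Y) x\<close>. The second derivative is symmetric
  in \<open>X\<close> and \<open>Y\<close> and cancels in the commutator.\<close>

lemma V_bracket:
  assumes x: "x \<in> S"
  shows "Dd (V X) x (V Y x) - Dd (V Y) x (V X x) = V (br X Y) x"
proof -
  define Z where "Z = {z. (z, x) \<in> R}"
  have Z: "open Z" "e \<in> Z" using open_slice(1)[OF open_R] e_R[OF x] by (auto simp: Z_def)
  define f where "f z = F (z, x)" for z
  have f: "smooth_on Z f" unfolding f_def
    by (rule smooth_on_slice_left[OF smooth_F Z(1)]) (simp add: Z_def)
  have Df: "Dd f z u = Dd F (z, x) (u, 0)" if "z \<in> Z" for z u
    using Dd_eq[OF DF_left, of z x u] that by (simp add: Z_def f_def[abs_def])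
  have *: "Dd (V X) x (V Y x) = Dd (\<lambda>z. Dd f z X) e Y + V (\<beta> X Y) x" for X Y
  proof -
    have "((\<lambda>z. Dd f z (Dd \<mu> (e, z) (X, 0))) has_derivative
        (\<lambda>Y. Dd (\<lambda>z. Dd f z (Dd \<mu> (e, e) (X, 0))) e Y + Dd f e (\<beta> X Y))) (at e)"
      by (rule has_derivative_Dd_field[OF Z(1) f Z(2) right_field_deriv])
    then have "((\<lambda>z. V X (F (z, x))) has_derivative
        (\<lambda>Y. Dd (\<lambda>z. Dd f z (Dd \<mu> (e, e) (X, 0))) e Y + Dd f e (\<beta> X Y))) (at e)"
      by (rule has_derivative_transform_within_open[OF _ Z]) (use orbit_map_equivariant Df in \<open>simp add: Z_def\<close>)
    moreover have "((\<lambda>z. V X (F (z, x))) has_derivative (\<lambda>Y. Dd (V X) x (V Y x))) (at e)"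
    proof -
      have "(V X has_derivative Dd (V X) x) (at (F (e, x)))"
        using smooth_on_has_derivative[OF V_smooth x] F_e[OF x] by simp
      from has_derivative_compose[OF V_deriv_e[OF x] this] show ?thesis .
    qed
    ultimately have "(\<lambda>Y. Dd (\<lambda>z. Dd f z (Dd \<mu> (e, e) (X, 0))) e Y + Dd f e (\<beta> X Y)) = (\<lambda>Y. Dd (V X) x (V Y x))"
      by (rule has_derivative_unique)
    from fun_cong[OF this, of Y] show ?thesis by (simp add: Dmu_e Df[OF Z(2)] V_def)
  qed
  show ?thesis
    unfolding * br_def linear_diff[OF V_linear[OF x]]
    using Dd_symmetric[OF Z(1) f Z(2), of X Y] by simp
qed

text \<open>Differentiate the isometry condition in the group variable at \<open>e\<close>.\<close>

lemma V_killing: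
  assumes met: "local_metric S h"
    and iso: "\<And>z x u v. (z, x) \<in> R \<Longrightarrow> h (F (z, x)) (Dd F (z, x) (0, u)) (Dd F (z, x) (0, v)) = h x u v"
  shows "local_metric.killing S h (V X)"
proof -
  interpret local_metric S h by (rule met)
  show ?thesis
    unfolding killing_def
  proof (intro conjI V_smooth ballI allI)
    fix x u v assume x: "x \<in> S"
    define Z where "Z = {z. (z, x) \<in> R}"
    have Z: "open Z" "e \<in> Z" using open_slice(1)[OF open_R] e_R[OF x] by (auto simp: Z_def)
    \<comment> \<open>Symmetry of the mixed derivatives of \<open>F\<close>: varying the group
      element in the spatial differential gives the spatial differential of
      \<open>V X\<close>.\<close>
    have U: "((\<lambda>z. Dd F (z, x) (0, u)) has_derivative (\<lambda>X. Dd (V X) x u)) (at e)" for u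
    proof -
      have "((\<lambda>z. (z, x)) has_derivative (\<lambda>X. (X, 0))) (at e)" by (auto intro!: derivative_eq_intros)
      from has_derivative_compose[OF this smooth_on_has_derivative[OF smooth_on_Dd[OF open_R smooth_F] e_R[OF x]]]
      have "((\<lambda>z. Dd F (z, x) (0, u)) has_derivative (\<lambda>X. Dd (\<lambda>w. Dd F w (0, u)) (e, x) (X, 0))) (at e)" .
      moreover have "Dd (\<lambda>w. Dd F w (0, u)) (e, x) (X, 0) = Dd (V X) x u" for X
      proof -
        have "((\<lambda>x. (e, x)) has_derivative (\<lambda>X. (0, X))) (at x)" by (auto intro!: derivative_eq_intros)
        from has_derivative_compose[OF this smooth_on_has_derivative[OF smooth_on_Dd[OF open_R smooth_F] e_R[OF x]]]
        have "(V X has_derivative (\<lambda>u. Dd (\<lambda>w. Dd F w (X, 0)) (e, x) (0, u))) (at x)"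
          unfolding V_def[abs_def] .
        then have "Dd (V X) x u = Dd (\<lambda>w. Dd F w (X, 0)) (e, x) (0, u)" by (rule Dd_eq)
        then show ?thesis using Dd_symmetric[OF open_R smooth_F e_R[OF x]] by metis
      qed
      ultimately show ?thesis by simp
    qed
    have Fe: "F (e, x) \<in> S" using F_e[OF x] x by simp
    have "((\<lambda>z. h (F (z, x)) (Dd F (z, x) (0, u)) (Dd F (z, x) (0, v))) has_derivative
      (\<lambda>X. dh (F (e, x)) (V X x) (Dd F (e, x) (0, u)) (Dd F (e, x) (0, v))
        + h (F (e, x)) (Dd (V X) x u) (Dd F (e, x) (0, v)) + h (F (e, x)) (Dd F (e, x) (0, u)) (Dd (V X) x v))) (at e)"
      by (rule h_map_deriv[OF Fe V_deriv_e[OF x] U U])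
    then have "((\<lambda>z. h x u v) has_derivative
      (\<lambda>X. dh (F (e, x)) (V X x) (Dd F (e, x) (0, u)) (Dd F (e, x) (0, v))
        + h (F (e, x)) (Dd (V X) x u) (Dd F (e, x) (0, v)) + h (F (e, x)) (Dd F (e, x) (0, u)) (Dd (V X) x v))) (at e)"
      by (rule has_derivative_transform_within_open[OF _ Z]) (simp add: Z_def iso)
    from has_derivative_unique[OF this has_derivative_const]
    show "dh x (V X x) u v + h x (Dd (V X) x u) v + h x u (Dd (V X) x v) = 0"
      unfolding F_e[OF x] DF_e_right[OF x] by metis
  qed
qed

end

text \<open>Once \<open>T z\<close> differs from \<open>T e\<close> by less than 1 in operator norm,
  no nonzero vector of \<open>C\<close>, where \<open>T e\<close> is the identity, can be sent to 0.
  The sum over the basis bounds the operator norm.\<close>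

lemma linear_perturbation_inj:
  fixes T :: "'a::real_normed_vector \<Rightarrow> 'l::euclidean_space \<Rightarrow> 'l"
  assumes W: "open W" "e \<in> W" and lin: "\<And>z. z \<in> W \<Longrightarrow> linear (T z)"
    and cont: "\<And>v. ((\<lambda>z. T z v) \<longlongrightarrow> T e v) (at e)"
    and C: "subspace C" and id: "\<And>c. c \<in> C \<Longrightarrow> T e c = c"
  shows "\<exists>W'. open W' \<and> e \<in> W' \<and> W' \<subseteq> W \<and> (\<forall>z\<in>W'. inj_on (T z) C)"
proof -
  have "((\<lambda>z. \<Sum>b\<in>Basis. norm (T z b - T e b)) \<longlongrightarrow> 0) (at e)"
    by (intro tendsto_null_sum tendsto_norm_zero LIM_zero cont)
  then have "\<forall>\<^sub>F z in at e. (\<Sum>b\<in>Basis. norm (T z b - T e b)) < 1"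
    by (rule order_tendstoD(2)) simp
  then obtain W0 where W0: "open W0" "e \<in> W0" "\<And>z. z \<in> W0 \<Longrightarrow> z \<noteq> e \<Longrightarrow> (\<Sum>b\<in>Basis. norm (T z b - T e b)) < 1"
    unfolding eventually_at_topological by blast
  have "inj_on (T z) C" if z: "z \<in> W0 \<inter> W" for z
  proof -
    have s: "(\<Sum>b\<in>Basis. norm (T z b - T e b)) < 1" using W0(3)[of z] z by (cases "z = e") auto
    have lz: "linear (T z)" "linear (T e)" using lin z W(2) by auto
    have "c = 0" if c: "c \<in> C" "T z c = 0" for c
    proof (rule ccontr)
      assume "c \<noteq> 0"
      have "T z c - T e c = (\<Sum>b\<in>Basis. (c \<bullet> b) *\<^sub>R (T z b - T e b))"
        using linear_expand[OF lz(1), of c] linear_expand[OF lz(2), of c]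
        by (simp add: sum_subtractf scaleR_diff_right)
      also have "norm \<dots> \<le> (\<Sum>b\<in>Basis. norm c * norm (T z b - T e b))"
        by (rule sum_norm_le) (auto intro!: mult_right_mono Basis_le_norm)
      also have "\<dots> = norm c * (\<Sum>b\<in>Basis. norm (T z b - T e b))" by (simp add: sum_distrib_left)
      also have "\<dots> < norm c * 1" using s \<open>c \<noteq> 0\<close> by (intro mult_strict_left_mono) auto
      finally show False using c id by simp
    qed
    then show ?thesis using linear_inj_on_iff_eq_0[OF lz(1)] C subspace_def
      by (metis (no_types, lifting) eq_iff_diff_eq_0 inj_on_def linear_diff lz(1) subspace_diff)
  qed
  then show ?thesis using W W0 by (intro exI[of _ "W0 \<inter> W"]) auto
qed

section \<open>Curves in the isotropy group tangent to the kernel of the orbit map\<close>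

context local_action
begin

text \<open>Constant rank: near \<open>e\<close> the level set of the orbit map \<open>\<phi>\<close> is that of \<open>g0 \<circ> \<phi>\<close>, where \<open>g0\<close> is a left
  inverse of the differential at \<open>e\<close> on a complement of its kernel; the inverse function theorem
  provides a curve in it.\<close>
lemma orbit_map_kernel:
  assumes x: "x \<in> S" and rank: "\<And>z. (z, x) \<in> R \<Longrightarrow> dim (range (\<lambda>X. V X (F (z, x)))) = dim (range (\<lambda>X. V X x))"
    and X: "V X x = 0"
  shows "\<exists>k r. r > 0 \<and> (\<forall>s. \<bar>s\<bar> < r \<longrightarrow> (k s, x) \<in> R \<and> F (k s, x) = x) \<and> k 0 = e \<and>
    (k has_vector_derivative X) (at (0::real))"
proof -
  define Z where "Z = {z. (z, x) \<in> R}"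
  have Z: "open Z" "e \<in> Z" using open_slice(1)[OF open_R] e_R[OF x] by (auto simp: Z_def)
  define \<phi> where "\<phi> z = F (z, x)" for z
  define d\<phi> where "d\<phi> z u = Dd F (z, x) (u, 0)" for z u
  have \<phi>: "smooth_on Z \<phi>" unfolding \<phi>_def
    by (rule smooth_on_slice_left[OF smooth_F Z(1)]) (simp add: Z_def)
  have \<phi>d: "(\<phi> has_derivative d\<phi> z) (at z)" if "z \<in> Z" for z
    using DF_left[of z x] that by (simp add: \<phi>_def[abs_def] d\<phi>_def[abs_def] Z_def)
  have d\<phi>eq: "Dd \<phi> z u = d\<phi> z u" if "z \<in> Z" for z u using Dd_eq[OF \<phi>d[OF that]] by simp
  have lin: "linear (d\<phi> z)" if "z \<in> Z" for z using has_derivative_linear[OF \<phi>d[OF that]] .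
  define L where "L = d\<phi> e"
  have L: "linear L" "L u = V u x" for u using lin[OF Z(2)] by (auto simp: L_def d\<phi>_def V_def)
  define N where "N = {u. L u = 0}"
  have N: "subspace N" unfolding N_def
    by (rule subspaceI) (auto simp: linear_0[OF L(1)] linear_add[OF L(1)] linear_cmul[OF L(1)])
  define C where "C = {y. \<forall>u\<in>N. orthogonal u y}"
  have C: "subspace C" unfolding C_def by (rule subspace_orthogonal_to_vectors)
  have NC: "u = 0" if "u \<in> N" "u \<in> C" for u
    using that by (auto simp: C_def orthogonal_self)
  have decomp: "\<exists>n\<in>N. \<exists>c\<in>C. u = n + c" for u
  proof -
    obtain n c where n: "n \<in> span N" and c: "\<And>w. w \<in> span N \<Longrightarrow> orthogonal c w" and u: "u = n + c"
      using orthogonal_subspace_decomp_exists[of N u] by metis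
    have "n \<in> N" using n N by (simp add: span_eq_iff[THEN iffD2])
    moreover have "c \<in> C" using c span_base orthogonal_commute unfolding C_def by blast
    ultimately show ?thesis using u by blast
  qed
  have Linj: "inj_on L C"
  proof (rule inj_onI)
    fix a b assume ab: "a \<in> C" "b \<in> C" "L a = L b"
    then have "a - b \<in> N" by (simp add: N_def linear_diff[OF L(1)])
    then show "a = b" using NC subspace_diff[OF C ab(1,2)] by fastforce
  qed
  obtain g0 where g0: "range g0 \<subseteq> C" "linear g0" "\<And>c. c \<in> C \<Longrightarrow> g0 (L c) = c"
    using linear_exists_left_inverse_on[OF L(1) C Linj] by blast
  \<comment> \<open>The projection onto \<open>C\<close> along the kernel \<open>N\<close>.\<close>
  define p where "p u = g0 (L u)" for u
  have p_lin: "linear p" unfolding p_def using linear_compose[OF L(1) g0(2)] by (simp add: o_def)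
  have p_C: "p u \<in> C" for u using g0(1) by (auto simp: p_def)
  have p_id: "p c = c" if "c \<in> C" for c using g0(3)[OF that] by (simp add: p_def)
  have p_N: "p u = 0" if "u \<in> N" for u using that linear_0[OF g0(2)] by (simp add: p_def N_def)
  have rangeL: "range L = L ` C"
  proof -
    have "L u \<in> L ` C" for u
    proof -
      obtain n c where "n \<in> N" "c \<in> C" "u = n + c" using decomp by blast
      then show ?thesis by (auto simp: N_def linear_add[OF L(1)])
    qed
    then show ?thesis by auto
  qed
  have spanC: "span C = C" using C by simp
  have dimC: "dim C = dim (range (\<lambda>X. V X x))"
    using dim_image_eq[OF L(1), of C] Linj rangeL L(2) spanC by simp
  have contD: "((\<lambda>z. Dd f z v) \<longlongrightarrow> Dd f e v) (at e)" if "smooth_on Z f" for f :: "'l \<Rightarrow> 'c::real_normed_vector" and v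
    using smooth_on_continuous[OF smooth_on_Dd[OF Z(1) that]] Z continuous_on_eq_continuous_at isCont_def by blast
  \<comment> \<open>\<open>M z\<close> is the differential of right translation, hence invertible near \<open>e\<close>.\<close>
  define M where "M z u = Dd \<mu> (e, z) (u, 0)" for z u
  obtain W1 where W1: "open W1" "e \<in> W1" "W1 \<subseteq> E" "\<And>z. z \<in> W1 \<Longrightarrow> inj_on (M z) UNIV"
  proof -
    have "\<exists>W'. open W' \<and> e \<in> W' \<and> W' \<subseteq> E \<and> (\<forall>z\<in>W'. inj_on (M z) UNIV)"
    proof (rule linear_perturbation_inj[OF open_E e_E])
      show "linear (M z)" if "z \<in> E" for z unfolding M_def using mu_linear_left unit_U that by blast
      show "((\<lambda>z. M z v) \<longlongrightarrow> M e v) (at e)" for v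
        unfolding M_def using has_derivative_continuous[OF right_field_deriv] by (simp add: continuous_at)
    qed (auto simp: M_def Dmu_e)
    then show thesis using that by blast
  qed
  obtain W2 where W2: "open W2" "e \<in> W2" "W2 \<subseteq> Z" "\<And>z. z \<in> W2 \<Longrightarrow> inj_on (\<lambda>u. g0 (d\<phi> z u)) C"
  proof -
    have "\<exists>W'. open W' \<and> e \<in> W' \<and> W' \<subseteq> Z \<and> (\<forall>z\<in>W'. inj_on (\<lambda>u. g0 (d\<phi> z u)) C)"
    proof (rule linear_perturbation_inj[OF Z])
      show "linear (\<lambda>u. g0 (d\<phi> z u))" if "z \<in> Z" for z
        using linear_compose[OF lin[OF that] g0(2)] by (simp add: o_def)
      show "((\<lambda>z. g0 (d\<phi> z v)) \<longlongrightarrow> g0 (d\<phi> e v)) (at e)" for v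
      proof -
        have "((\<lambda>z. Dd \<phi> z v) \<longlongrightarrow> d\<phi> e v) (at e)" using contD[OF \<phi>] d\<phi>eq[OF Z(2)] by simp
        then have "((\<lambda>z. d\<phi> z v) \<longlongrightarrow> d\<phi> e v) (at e)"
          by (rule Lim_transform_within_open[OF _ Z]) (simp add: d\<phi>eq)
        then show ?thesis
          using bounded_linear.tendsto g0(2) linear_conv_bounded_linear by blast
      qed
      show "g0 (d\<phi> e c) = c" if "c \<in> C" for c using g0(3)[OF that] by (simp add: L_def)
    qed (rule C)
    then show thesis using that by blast
  qed
  \<comment> \<open>By constant rank \<open>d\<phi> z\<close> already maps \<open>C\<close> onto its
    whole range; since \<open>g0\<close> after \<open>d\<phi> z\<close> is injective on
    \<open>C\<close>, \<open>g0\<close> is injective on that range.\<close>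
  have g0_inj: "w = 0" if z: "z \<in> W1 \<inter> W2" and w: "w \<in> range (d\<phi> z)" "g0 w = 0" for z w
  proof -
    have zZ: "z \<in> Z" and zE: "z \<in> E" using z W2(3) W1(3) by auto
    note lz = lin[OF zZ]
    have Mlin: "linear (M z)" unfolding M_def using mu_linear_left unit_U zE by blast
    have "surj (M z)" using linear_injective_imp_surjective[OF Mlin] W1(4) z by auto
    then have "range (d\<phi> z) = (\<lambda>X. d\<phi> z (M z X)) ` UNIV" by (metis image_image)
    also have "\<dots> = range (\<lambda>X. V X (F (z, x)))"
      using orbit_map_equivariant[of z x] zZ by (simp add: d\<phi>_def M_def Z_def)
    finally have dz: "dim (range (d\<phi> z)) = dim C" using rank[of z] zZ dimC by (simp add: Z_def)
    have "inj_on (d\<phi> z) C"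
      using W2(4)[of z] z by (auto simp: inj_on_def)
    then have "dim (d\<phi> z ` C) = dim C" using dim_image_eq[OF lz, of C] spanC by simp
    then have "d\<phi> z ` C = range (d\<phi> z)"
      using dz by (intro subspace_dim_equal linear_subspace_image[OF lz] C subspace_UNIV) auto
    then obtain c where c: "c \<in> C" "w = d\<phi> z c" using w(1) by blast
    have "g0 (d\<phi> z 0) = 0" using linear_0[OF lz] linear_0[OF g0(2)] by simp
    then have "c = 0"
      using inj_onD[OF W2(4)[of z], of c 0] z w(2) c subspace_0[OF C] by simp
    then show ?thesis using c(2) linear_0[OF lz] by simp
  qed
  \<comment> \<open>Keeps the \<open>N\<close>-component of \<open>z - e\<close> and puts
    \<open>g0 (\<phi> z - x)\<close> in place of its \<open>C\<close>-component; the differential at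
    \<open>e\<close> is the identity.\<close>
  define \<Psi> where "\<Psi> z = (z - e) - p (z - e) + g0 (\<phi> z - x)" for z
  define \<Psi>' where "\<Psi>' z u = u - p u + g0 (d\<phi> z u)" for z u
  have bl: "bounded_linear p" "bounded_linear g0" using p_lin g0(2) linear_conv_bounded_linear by auto
  have \<Psi>d: "(\<Psi> has_derivative \<Psi>' z) (at z)" if "z \<in> Z" for z
    unfolding \<Psi>_def \<Psi>'_def
    by (intro has_derivative_add has_derivative_diff bounded_linear.has_derivative[OF bl(1)]
        bounded_linear.has_derivative[OF bl(2)])
      (auto intro!: derivative_eq_intros \<phi>d[OF that])
  have \<Psi>'bl: "bounded_linear (\<Psi>' z)" if "z \<in> Z" for z using has_derivative_bounded_linear[OF \<Psi>d[OF that]] .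
  have \<Psi>'e: "\<Psi>' e u = u" for u unfolding \<Psi>'_def by (simp add: p_def L_def)
  have "\<exists>U' V' g g'. open U' \<and> U' \<subseteq> Z \<and> e \<in> U' \<and> open V' \<and> \<Psi> e \<in> V' \<and> homeomorphism U' V' \<Psi> g \<and>
    (\<forall>y\<in>V'. (g has_derivative (g' y)) (at y)) \<and> (\<forall>y\<in>V'. g' y = inv_into UNIV (blinfun_apply (Blinfun (\<Psi>' (g y)))))"
  proof -
    have ba: "blinfun_apply (Blinfun (\<Psi>' z)) = \<Psi>' z" if "z \<in> Z" for z
      by (rule bounded_linear_Blinfun_apply[OF \<Psi>'bl[OF that]])
    show ?thesis
    proof (rule inverse_function_theorem[of Z \<Psi> "\<lambda>z. Blinfun (\<Psi>' z)" e id_blinfun, OF Z(1)])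
      show "(\<Psi> has_derivative blinfun_apply (Blinfun (\<Psi>' z))) (at z)" if "z \<in> Z" for z
        unfolding ba[OF that] by (rule \<Psi>d[OF that])
      show "continuous_on Z (\<lambda>z. Blinfun (\<Psi>' z))"
      proof (rule continuous_on_blinfun_componentwise)
        fix i :: 'l
        have "continuous_on Z (\<lambda>z. i - p i + g0 (Dd \<phi> z i))"
          by (intro continuous_intros bounded_linear.continuous_on[OF bl(2)] smooth_on_continuous[OF smooth_on_Dd[OF Z(1) \<phi>]])
        then show "continuous_on Z (\<lambda>z. blinfun_apply (Blinfun (\<Psi>' z)) i)"
          by (rule continuous_on_eq) (simp add: ba \<Psi>'_def d\<phi>eq)
      qed
      show "id_blinfun o\<^sub>L Blinfun (\<Psi>' e) = id_blinfun"
        by (rule blinfun_eqI) (simp add: ba[OF Z(2)] \<Psi>'e)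
    qed (use Z(2) in blast)+
  qed
  then obtain U' V' g g' where U': "open U'" "U' \<subseteq> Z" "e \<in> U'" and V': "open V'" "\<Psi> e \<in> V'"
    and hom: "homeomorphism U' V' \<Psi> g"
    and gd: "\<And>y. y \<in> V' \<Longrightarrow> (g has_derivative (g' y)) (at y)"
    and g': "\<And>y. y \<in> V' \<Longrightarrow> g' y = inv_into UNIV (blinfun_apply (Blinfun (\<Psi>' (g y))))" by metis
  have \<Psi>e: "\<Psi> e = 0" using F_e[OF x] linear_0[OF p_lin] linear_0[OF g0(2)] by (simp add: \<Psi>_def \<phi>_def)
  have ge: "g 0 = e" using hom U'(3) \<Psi>e unfolding homeomorphism_def by metis
  \<comment> \<open>The preimage of the line through \<open>X\<close> under \<open>\<Psi>\<close>.
    As \<open>X\<close> lies in \<open>N\<close>, the line has no \<open>C\<close>-component, so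
    \<open>g0 (\<phi> z - x)\<close> vanishes along the curve.\<close>
  define k where "k s = g (s *\<^sub>R X)" for s :: real
  have k0: "k 0 = e" by (simp add: k_def ge)
  have sd: "((\<lambda>s. s *\<^sub>R X) has_derivative (\<lambda>h. h *\<^sub>R X)) (at s)" for s
    by (auto intro!: derivative_eq_intros)
  have kd: "(k has_derivative (\<lambda>h. g' (s *\<^sub>R X) (h *\<^sub>R X))) (at s)" if "s *\<^sub>R X \<in> V'" for s
    using has_derivative_compose[OF sd gd[OF that]] by (simp add: k_def[abs_def])
  have "g' 0 = id"
  proof -
    have "blinfun_apply (Blinfun (\<Psi>' e)) = id"
      using bounded_linear_Blinfun_apply[OF \<Psi>'bl[OF Z(2)]] \<Psi>'e by (simp add: fun_eq_iff)
    then show ?thesis using g'[of 0] V'(2) \<Psi>e ge by simp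
  qed
  then have k'0: "(k has_vector_derivative X) (at 0)"
    using kd[of 0] V'(2) \<Psi>e by (simp add: has_vector_derivative_def)
  have cont_k: "continuous (at 0) k" using k'0 has_vector_derivative_continuous by blast
  have "open ((\<lambda>s. s *\<^sub>R X) -` V')" by (intro open_vimage V' continuous_intros)
  moreover have "0 \<in> (\<lambda>s. s *\<^sub>R X) -` V'" using V'(2) \<Psi>e by simp
  ultimately obtain r1 where r1: "r1 > 0" "ball 0 r1 \<subseteq> (\<lambda>s. s *\<^sub>R X) -` V'" using open_contains_ball by blast
  have "\<forall>\<^sub>F s in at 0. k s \<in> W1 \<inter> W2"
    by (rule topological_tendstoD[OF cont_k[unfolded continuous_at]]) (use W1 W2 k0 in auto)
  then obtain r2 where r2: "r2 > 0" "\<And>s. s \<noteq> 0 \<Longrightarrow> dist s 0 < r2 \<Longrightarrow> k s \<in> W1 \<inter> W2"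
    unfolding eventually_at by auto
  define r where "r = min r1 r2"
  have r: "r > 0" using r1 r2 by (simp add: r_def)
  have ks: "s *\<^sub>R X \<in> V' \<and> k s \<in> W1 \<inter> W2 \<and> k s \<in> Z \<and> \<Psi> (k s) = s *\<^sub>R X" if s: "s \<in> ball 0 r" for s
  proof -
    have v: "s *\<^sub>R X \<in> V'" using r1(2) s by (auto simp: r_def)
    have "k s \<in> W1 \<inter> W2" using r2(2)[of s] s k0 W1(2) W2(2) by (cases "s = 0") (auto simp: r_def)
    moreover have "\<Psi> (k s) = s *\<^sub>R X" "k s \<in> U'" using hom v unfolding homeomorphism_def k_def by auto
    ultimately show ?thesis using v U'(2) by auto
  qed
  have g0\<phi>: "g0 (\<phi> (k s) - x) = 0" if s: "s \<in> ball 0 r" for s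
  proof -
    have "p (s *\<^sub>R X) = 0" using linear_cmul[OF p_lin] p_N[of X] X L(2) by (simp add: N_def)
    moreover have "p (\<Psi> (k s)) = g0 (\<phi> (k s) - x)"
      unfolding \<Psi>_def linear_add[OF p_lin] linear_diff[OF p_lin] using p_id[OF p_C] p_id g0(1)
      by (simp add: range_subsetD)
    ultimately show ?thesis using ks[OF s] by simp
  qed
  \<comment> \<open>The velocity of \<open>\<phi>\<close> along the curve lies in the range of
    \<open>d\<phi>\<close> and is killed by \<open>g0\<close>; by \<open>g0_inj\<close> it is zero,
    so \<open>\<phi>\<close> itself is constant there.\<close>
  have \<phi>k: "((\<lambda>s. \<phi> (k s)) has_derivative (\<lambda>h. 0)) (at s)" if s: "s \<in> ball 0 r" for s
  proof -
    have d: "((\<lambda>s. \<phi> (k s)) has_derivative (\<lambda>h. d\<phi> (k s) (g' (s *\<^sub>R X) (h *\<^sub>R X)))) (at s)"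
      using has_derivative_compose[OF kd \<phi>d] ks[OF s] by blast
    have "((\<lambda>s. g0 (\<phi> (k s) - x)) has_derivative (\<lambda>h. g0 (d\<phi> (k s) (g' (s *\<^sub>R X) (h *\<^sub>R X)) - 0))) (at s)"
      by (intro bounded_linear.has_derivative[OF bl(2)] has_derivative_diff d has_derivative_const)
    then have "((\<lambda>s. 0) has_derivative (\<lambda>h. g0 (d\<phi> (k s) (g' (s *\<^sub>R X) (h *\<^sub>R X)) - 0))) (at s)"
      by (rule has_derivative_transform_within_open[OF _ open_ball s]) (rule g0\<phi>)
    from has_derivative_unique[OF this has_derivative_const]
    have "g0 (d\<phi> (k s) (g' (s *\<^sub>R X) (h *\<^sub>R X))) = 0" for h by (simp add: fun_eq_iff)
    then have "d\<phi> (k s) (g' (s *\<^sub>R X) (h *\<^sub>R X)) = 0" for h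
      using g0_inj[of "k s"] ks[OF s] by blast
    then show ?thesis using d by simp
  qed
  have "F (k s, x) = x" if s: "s \<in> ball 0 r" for s
  proof -
    have "\<phi> (k s) = \<phi> (k 0)"
      by (rule has_derivative_zero_unique[of "ball 0 r" "\<lambda>s. \<phi> (k s)"])
        (use s r in \<open>auto intro!: has_derivative_at_withinI[OF \<phi>k]\<close>)
    then show ?thesis using F_e[OF x] by (simp add: \<phi>_def k0)
  qed
  then show ?thesis
    using r k0 k'0 ks by (intro exI[of _ k] exI[of _ r]) (auto simp: Z_def dist_real_def)
qed

end

section \<open>From manifolds to charts\<close>

lemma smooth_on_cong:
  "open S \<Longrightarrow> smooth_on S f \<Longrightarrow> (\<And>x. x \<in> S \<Longrightarrow> f x = g x) \<Longrightarrow> smooth_on S g"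
  unfolding smooth_on_def using Ck_on_cong by blast

lemma Dd_cong_open:
  assumes "open W" and "x \<in> W" and "\<And>y. y \<in> W \<Longrightarrow> f y = g y" and "(f has_derivative f') (at x)"
  shows "Dd g x u = f' u"
  by (rule Dd_eq[OF has_derivative_transform_within_open[OF assms(4,1,2,3)]])

locale atlas =
  fixes A :: "('m::{t2_space, second_countable_topology}, 'e::euclidean_space) chart set"
  assumes smooth_atlas: "smooth_atlas A"
begin

lemma chart_hom:
  assumes "c \<in> A"
  shows "open (fst c)" "open (snd c ` fst c)" "homeomorphism (fst c) (snd c ` fst c) (snd c) (chart_inv c)"
  using smooth_atlas assms by (auto simp: smooth_atlas_def)

lemma chart_inv_chart: "c \<in> A \<Longrightarrow> p \<in> fst c \<Longrightarrow> chart_inv c (snd c p) = p"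
  using chart_hom(3) by (auto simp: homeomorphism_def)

lemma chart_chart_inv: "c \<in> A \<Longrightarrow> x \<in> snd c ` fst c \<Longrightarrow> snd c (chart_inv c x) = x \<and> chart_inv c x \<in> fst c"
  using chart_hom(3)[of c] unfolding homeomorphism_def by blast

lemma chart_open_image:
  assumes "c \<in> A" and "open W"
  shows "open (snd c ` (fst c \<inter> W))"
proof -
  have "snd c ` (fst c \<inter> W) = chart_inv c -` W \<inter> snd c ` fst c"
    using chart_inv_chart[OF assms(1)] by auto
  then show ?thesis
    using chart_hom[OF assms(1)] assms(2) continuous_on_open_vimage unfolding homeomorphism_def by metis
qed

lemma chart_exists: "\<exists>c\<in>A. p \<in> fst c"
  using smooth_atlas unfolding smooth_atlas_def by blast

end

text \<open>Unpacks smoothness with respect to the product atlas into smoothness of an explicit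
  function on an open set of coordinate pairs; used for the multiplication and for the
  action.\<close>

lemma smooth_map_prod_coordinates:
  assumes A: "smooth_atlas A" and B: "smooth_atlas B" and C: "smooth_atlas C"
    and sm: "smooth_map (prod_atlas A B) C UNIV (\<lambda>(a, p). f a p)"
    and c: "cA \<in> A" "cB \<in> B" "cC \<in> C"
    and R: "R = {(z, x). z \<in> snd cA ` fst cA \<and> x \<in> snd cB ` fst cB \<and> f (chart_inv cA z) (chart_inv cB x) \<in> fst cC}"
  shows "open R" and "smooth_on R (\<lambda>(z, x). snd cC (f (chart_inv cA z) (chart_inv cB x)))"
proof -
  interpret A: atlas A by unfold_locales (rule A)
  interpret B: atlas B by unfold_locales (rule B)
  interpret C: atlas C by unfold_locales (rule C)
  define pc where "pc = (fst cA \<times> fst cB, map_prod (snd cA) (snd cB))"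
  have pc: "pc \<in> prod_atlas A B" unfolding prod_atlas_def pc_def using c by blast
  have inj: "inj_on (snd pc) (fst pc)"
    using A.chart_inv_chart[OF c(1)] B.chart_inv_chart[OF c(2)]
    by (intro inj_on_inverseI[of _ "map_prod (chart_inv cA) (chart_inv cB)"]) (auto simp: pc_def)
  have pinv: "chart_inv pc (z, x) = (chart_inv cA z, chart_inv cB x)"
    if "z \<in> snd cA ` fst cA" "x \<in> snd cB ` fst cB" for z x
  proof -
    have "(z, x) = snd pc (chart_inv cA z, chart_inv cB x)" "(chart_inv cA z, chart_inv cB x) \<in> fst pc"
      using that A.chart_chart_inv[OF c(1)] B.chart_chart_inv[OF c(2)] by (auto simp: pc_def)
    then show ?thesis unfolding chart_inv_def[of pc] using inv_into_f_f[OF inj] by metis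
  qed
  have Req: "snd pc ` (fst pc \<inter> UNIV \<inter> (\<lambda>(a, p). f a p) -` fst cC) = R"
  proof
    show "snd pc ` (fst pc \<inter> UNIV \<inter> (\<lambda>(a, p). f a p) -` fst cC) \<subseteq> R"
      using A.chart_inv_chart[OF c(1)] B.chart_inv_chart[OF c(2)] by (auto simp: pc_def R)
    show "R \<subseteq> snd pc ` (fst pc \<inter> UNIV \<inter> (\<lambda>(a, p). f a p) -` fst cC)"
    proof
      fix w assume "w \<in> R"
      then obtain z x where w: "w = (z, x)" "z \<in> snd cA ` fst cA" "x \<in> snd cB ` fst cB"
        "f (chart_inv cA z) (chart_inv cB x) \<in> fst cC" by (auto simp: R)
      then have "w = snd pc (chart_inv cA z, chart_inv cB x)"
        "(chart_inv cA z, chart_inv cB x) \<in> fst pc \<inter> UNIV \<inter> (\<lambda>(a, p). f a p) -` fst cC"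
        using A.chart_chart_inv[OF c(1)] B.chart_chart_inv[OF c(2)] by (auto simp: pc_def)
      then show "w \<in> snd pc ` (fst pc \<inter> UNIV \<inter> (\<lambda>(a, p). f a p) -` fst cC)" by (rule image_eqI)
    qed
  qed
  show "open R"
  proof -
    have "continuous_on UNIV (\<lambda>(a, p). f a p)" using sm by (simp add: smooth_map_def)
    then have W: "open ((\<lambda>(a, p). f a p) -` fst cC)" using C.chart_hom(1)[OF c(3)] open_vimage by blast
    have "continuous_on (snd cA ` fst cA \<times> snd cB ` fst cB) (\<lambda>w. (chart_inv cA (fst w), chart_inv cB (snd w)))"
    proof (rule continuous_on_Pair)
      show "continuous_on (snd cA ` fst cA \<times> snd cB ` fst cB) (\<lambda>w. chart_inv cA (fst w))"
        by (rule continuous_on_compose2[of "snd cA ` fst cA"])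
          (use A.chart_hom(3)[OF c(1)] in \<open>auto simp: homeomorphism_def intro!: continuous_intros\<close>)
      show "continuous_on (snd cA ` fst cA \<times> snd cB ` fst cB) (\<lambda>w. chart_inv cB (snd w))"
        by (rule continuous_on_compose2[of "snd cB ` fst cB"])
          (use B.chart_hom(3)[OF c(2)] in \<open>auto simp: homeomorphism_def intro!: continuous_intros\<close>)
    qed
    moreover have "open (snd cA ` fst cA \<times> snd cB ` fst cB)"
      using A.chart_hom(2)[OF c(1)] B.chart_hom(2)[OF c(2)] by (rule open_Times)
    ultimately have "open ((\<lambda>w. (chart_inv cA (fst w), chart_inv cB (snd w))) -` ((\<lambda>(a, p). f a p) -` fst cC)
        \<inter> (snd cA ` fst cA \<times> snd cB ` fst cB))"
      using W continuous_on_open_vimage by blast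
    moreover have "(\<lambda>w. (chart_inv cA (fst w), chart_inv cB (snd w))) -` ((\<lambda>(a, p). f a p) -` fst cC)
        \<inter> (snd cA ` fst cA \<times> snd cB ` fst cB) = R" by (auto simp: R)
    ultimately show ?thesis by simp
  qed
  have "smooth_on R (coord_rep pc cC (\<lambda>(a, p). f a p))"
    using sm pc c(3) unfolding smooth_map_def Req[symmetric] by blast
  then show "smooth_on R (\<lambda>(z, x). snd cC (f (chart_inv cA z) (chart_inv cB x)))"
    by (rule smooth_on_cong[OF \<open>open R\<close>]) (auto simp: R coord_rep_def pinv)
qed

text \<open>\<open>coord_rep\<close> is a total function whose values are arbitrary where
  \<open>f\<close> leaves the chart \<open>c'\<close>. The neighbourhood \<open>W\<close> ensures
  that its germ at the point is that of a genuine coordinate expression, which the chain rule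
  needs.\<close>

definition chart_differentiable ::
  "('m, 'e::euclidean_space) chart \<Rightarrow> ('n, 'f::euclidean_space) chart \<Rightarrow> ('m \<Rightarrow> 'n) \<Rightarrow> 'm \<Rightarrow> bool" where
  "chart_differentiable c c' f p \<longleftrightarrow> p \<in> fst c \<and>
    (\<exists>W. open W \<and> snd c p \<in> W \<and> W \<subseteq> snd c ` fst c \<and> (\<forall>x\<in>W. f (chart_inv c x) \<in> fst c')) \<and>
    coord_rep c c' f differentiable (at (snd c p))"

lemma tangent_map_has_derivative:
  "chart_differentiable c c' f p \<Longrightarrow> (coord_rep c c' f has_derivative tangent_map c c' f p) (at (snd c p))"
  by (simp add: chart_differentiable_def tangent_map_def frechet_derivative_works[symmetric])

lemma tangent_map_linear: "chart_differentiable c c' f p \<Longrightarrow> linear (tangent_map c c' f p)"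
  by (rule has_derivative_linear[OF tangent_map_has_derivative])

lemma tangent_map_compose:
  assumes A: "smooth_atlas A" "c \<in> A" and B: "smooth_atlas B" "c' \<in> B"
    and f: "chart_differentiable c c' f p" and g: "chart_differentiable c' c'' g (f p)"
  shows "chart_differentiable c c'' (\<lambda>p. g (f p)) p"
    and "tangent_map c c'' (\<lambda>p. g (f p)) p u = tangent_map c' c'' g (f p) (tangent_map c c' f p u)"
proof -
  interpret A: atlas A by unfold_locales (rule A)
  interpret B: atlas B by unfold_locales (rule B)
  let ?x = "snd c p"
  obtain W where W: "open W" "?x \<in> W" "W \<subseteq> snd c ` fst c" "\<And>x. x \<in> W \<Longrightarrow> f (chart_inv c x) \<in> fst c'"
    using f by (auto simp: chart_differentiable_def)
  obtain W' where W': "open W'" "snd c' (f p) \<in> W'" "W' \<subseteq> snd c' ` fst c'" "\<And>y. y \<in> W' \<Longrightarrow> g (chart_inv c' y) \<in> fst c''"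
    using g by (auto simp: chart_differentiable_def)
  have p: "p \<in> fst c" "chart_inv c ?x = p" using f A.chart_inv_chart[OF A(2)] by (auto simp: chart_differentiable_def)
  have fx: "coord_rep c c' f ?x = snd c' (f p)" by (simp add: coord_rep_def p)
  have df: "(coord_rep c c' f has_derivative tangent_map c c' f p) (at ?x)"
    by (rule tangent_map_has_derivative[OF f])
  have dg: "(coord_rep c' c'' g has_derivative tangent_map c' c'' g (f p)) (at (coord_rep c c' f ?x))"
    unfolding fx by (rule tangent_map_has_derivative[OF g])
  have eq: "coord_rep c' c'' g (coord_rep c c' f x) = coord_rep c c'' (\<lambda>p. g (f p)) x" if "x \<in> W" for x
    using B.chart_inv_chart[OF B(2) W(4)[OF that]] by (simp add: coord_rep_def)
  have d: "(coord_rep c c'' (\<lambda>p. g (f p)) has_derivative (\<lambda>u. tangent_map c' c'' g (f p) (tangent_map c c' f p u))) (at ?x)"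
    by (rule has_derivative_transform_within_open[OF has_derivative_compose[OF df dg] W(1,2)]) (rule eq)
  show "tangent_map c c'' (\<lambda>p. g (f p)) p u = tangent_map c' c'' g (f p) (tangent_map c c' f p u)"
    unfolding tangent_map_def[of c c''] by (rule Dd_eq[OF d])
  have "\<forall>\<^sub>F x in at ?x. coord_rep c c' f x \<in> W'"
    using has_derivative_continuous[OF df] W'(1,2) fx unfolding continuous_at by (intro topological_tendstoD) auto
  then obtain T where T: "open T" "?x \<in> T" "\<And>x. x \<in> T \<Longrightarrow> x \<noteq> ?x \<Longrightarrow> coord_rep c c' f x \<in> W'"
    unfolding eventually_at_topological by blast
  have "g (f (chart_inv c x)) \<in> fst c''" if "x \<in> T \<inter> W" for x
  proof -
    have "coord_rep c c' f x \<in> W'" using T(3)[of x] that W'(2) fx by (cases "x = ?x") auto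
    then have "g (chart_inv c' (coord_rep c c' f x)) \<in> fst c''" by (rule W'(4))
    moreover have "chart_inv c' (coord_rep c c' f x) = f (chart_inv c x)"
      using B.chart_inv_chart[OF B(2) W(4)] that by (simp add: coord_rep_def)
    ultimately show ?thesis by simp
  qed
  then show "chart_differentiable c c'' (\<lambda>p. g (f p)) p"
    unfolding chart_differentiable_def using p(1) d T(1,2) W(1,2,3)
    by (intro conjI exI[of _ "T \<inter> W"]) (auto simp: differentiable_def)
qed

lemma smooth_map_prod_slices:
  assumes A: "smooth_atlas A" and B: "smooth_atlas B" and C: "smooth_atlas C"
    and sm: "smooth_map (prod_atlas A B) C UNIV (\<lambda>(a, p). f a p)"
    and c: "cA \<in> A" "cB \<in> B" "cC \<in> C" and a: "a \<in> fst cA" "p \<in> fst cB" "f a p \<in> fst cC"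
  shows "chart_differentiable cB cC (f a) p" and "chart_differentiable cA cC (\<lambda>a. f a p) a"
proof -
  interpret A: atlas A by unfold_locales (rule A)
  interpret B: atlas B by unfold_locales (rule B)
  define R where "R = {(z, x). z \<in> snd cA ` fst cA \<and> x \<in> snd cB ` fst cB \<and> f (chart_inv cA z) (chart_inv cB x) \<in> fst cC}"
  define F where "F = (\<lambda>(z, x). snd cC (f (chart_inv cA z) (chart_inv cB x)))"
  have R: "open R" and F: "smooth_on R F"
    unfolding F_def using smooth_map_prod_coordinates[OF A B C sm c R_def] by auto
  have ap: "(snd cA a, snd cB p) \<in> R" using a A.chart_inv_chart[OF c(1)] B.chart_inv_chart[OF c(2)] by (simp add: R_def)
  have inv: "chart_inv cA (snd cA a) = a" "chart_inv cB (snd cB p) = p"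
    using a A.chart_inv_chart[OF c(1)] B.chart_inv_chart[OF c(2)] by auto
  have dF: "(F has_derivative Dd F (snd cA a, snd cB p)) (at (snd cA a, snd cB p))"
    by (rule smooth_on_has_derivative[OF F ap])
  have "((\<lambda>x. (snd cA a, x)) has_derivative (\<lambda>u. (0, u))) (at (snd cB p))" by (auto intro!: derivative_eq_intros)
  from has_derivative_compose[OF this dF] have "coord_rep cB cC (f a) differentiable (at (snd cB p))"
    by (auto simp: differentiable_def F_def coord_rep_def o_def inv)
  then show "chart_differentiable cB cC (f a) p"
    unfolding chart_differentiable_def using a(2) open_slice(2)[OF R, of "snd cA a"] ap
    by (intro conjI exI[of _ "{x. (snd cA a, x) \<in> R}"]) (auto simp: R_def inv)
  have "((\<lambda>x. (x, snd cB p)) has_derivative (\<lambda>u. (u, 0))) (at (snd cA a))" by (auto intro!: derivative_eq_intros)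
  from has_derivative_compose[OF this dF] have "coord_rep cA cC (\<lambda>a. f a p) differentiable (at (snd cA a))"
    by (auto simp: differentiable_def F_def coord_rep_def o_def inv)
  then show "chart_differentiable cA cC (\<lambda>a. f a p) a"
    unfolding chart_differentiable_def using a(1) open_slice(1)[OF R, of "snd cB p"] ap
    by (intro conjI exI[of _ "{x. (x, snd cB p) \<in> R}"]) (auto simp: R_def inv)
qed

section \<open>Isometric Lie group actions read in charts\<close>

locale lie_action =
  fixes G :: "('g::{t2_space, second_countable_topology}) monoid"
    and AG :: "('g, 'l::euclidean_space) chart set" and \<psi> :: "('g, 'l) chart"
    and AM :: "('m::{t2_space, second_countable_topology}, 'e::euclidean_space) chart set"
    and g :: "('m, 'e) metric_tensor" and act :: "'g \<Rightarrow> 'm \<Rightarrow> 'm"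
  assumes lie: "lie_group G AG" and psi: "\<psi> \<in> AG" and one_psi: "\<one>\<^bsub>G\<^esub> \<in> fst \<psi>"
    and AM: "smooth_atlas AM" and metric: "riemannian_metric AM g"
    and action: "isometric_action G AG AM g act"
begin

lemma AG: "smooth_atlas AG" using lie by (simp add: lie_group_def)
lemma grp: "group G" and carr: "carrier G = UNIV" using lie by (auto simp: lie_group_def)

sublocale G: group G by (rule grp)
sublocale AG: atlas AG by unfold_locales (rule AG)
sublocale AM: atlas AM by unfold_locales (rule AM)
sublocale act: group_action G UNIV act using action by (simp add: isometric_action_def)

lemma mult_smooth: "smooth_map (prod_atlas AG AG) AG UNIV (\<lambda>(a, b). a \<otimes>\<^bsub>G\<^esub> b)"
  using lie by (simp add: lie_group_def)

lemma act_smooth: "smooth_map (prod_atlas AG AM) AM UNIV (\<lambda>(a, p). act a p)"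
  using action by (simp add: isometric_action_def)

lemma in_carr [simp]: "a \<in> carrier G" by (simp add: carr)

lemma act_one [simp]: "act \<one>\<^bsub>G\<^esub> p = p"
  using act.id_eq_one by (metis UNIV_I restrict_apply')

lemma act_mult: "act (a \<otimes>\<^bsub>G\<^esub> b) p = act a (act b p)"
  by (rule act.composition_rule) auto

definition "E = snd \<psi> ` fst \<psi>"
definition "e = snd \<psi> \<one>\<^bsub>G\<^esub>"
definition "U = {(z, w). z \<in> snd \<psi> ` fst \<psi> \<and> w \<in> snd \<psi> ` fst \<psi> \<and> chart_inv \<psi> z \<otimes>\<^bsub>G\<^esub> chart_inv \<psi> w \<in> fst \<psi>}"
definition "\<mu> = (\<lambda>(z, w). snd \<psi> (chart_inv \<psi> z \<otimes>\<^bsub>G\<^esub> chart_inv \<psi> w))"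

lemma inv_e [simp]: "chart_inv \<psi> e = \<one>\<^bsub>G\<^esub>"
  unfolding e_def by (rule AG.chart_inv_chart[OF psi one_psi])

lemma e_in_E: "e \<in> E" using one_psi by (simp add: E_def e_def)

sublocale local_group E e U \<mu>
proof
  show "open E" unfolding E_def by (rule AG.chart_hom(2)[OF psi])
  show "e \<in> E" by (rule e_in_E)
  show "open U" "smooth_on U \<mu>"
    unfolding \<mu>_def using smooth_map_prod_coordinates[OF AG AG AG mult_smooth psi psi psi U_def] by auto
  fix z assume z: "z \<in> E"
  then have "snd \<psi> (chart_inv \<psi> z) = z" "chart_inv \<psi> z \<in> fst \<psi>"
    using AG.chart_chart_inv[OF psi] by (auto simp: E_def)
  then show "(e, z) \<in> U \<and> (z, e) \<in> U" "\<mu> (e, z) = z \<and> \<mu> (z, e) = z"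
    using z e_in_E by (auto simp: U_def \<mu>_def E_def)
qed

text \<open>In coordinates the left-invariant field of \<open>X\<close> is the partial derivative of
  \<open>\<mu>\<close> in the right factor, so its derivative at the identity is given by
  \<open>\<beta>\<close>.\<close>

lemma lie_bracket_eq: "lie_bracket G \<psi> X Y = br X Y"
proof -
  have L: "left_invariant_field G \<psi> X z = Dd \<mu> (z, e) (0, X)" if "z \<in> E" for X z
  proof -
    have "coord_rep \<psi> \<psi> (\<lambda>b. chart_inv \<psi> z \<otimes>\<^bsub>G\<^esub> b) = (\<lambda>w. \<mu> (z, w))"
      by (auto simp: coord_rep_def \<mu>_def)
    then show ?thesis
      unfolding left_invariant_field_def tangent_map_def e_def[symmetric]
      using Dd_eq[OF Dmu_right, of z e X] unit_U[OF that] by simp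
  qed
  have D: "Dd (left_invariant_field G \<psi> X) e u = \<beta> u X" for X u
    by (rule Dd_cong_open[OF open_E e_E _ left_field_deriv]) (simp add: L)
  show ?thesis
    unfolding lie_bracket_def field_bracket_def e_def[symmetric] D L[OF e_E] Dmu_e br_def ..
qed

definition "chart_act c = (\<lambda>(z, x). snd c (act (chart_inv \<psi> z) (chart_inv c x)))"
definition "chart_dom c = {(z, x). z \<in> snd \<psi> ` fst \<psi> \<and> x \<in> snd c ` fst c \<and> act (chart_inv \<psi> z) (chart_inv c x) \<in> fst c}"

lemma local_action_chart:
  assumes c: "c \<in> AM"
  shows "local_action E e U \<mu> (snd c ` fst c) (chart_dom c) (chart_act c)"
proof
  note ci = AM.chart_chart_inv[OF c] and ic = AM.chart_inv_chart[OF c]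
  show "open (snd c ` fst c)" by (rule AM.chart_hom(2)[OF c])
  show R: "open (chart_dom c)" "smooth_on (chart_dom c) (chart_act c)"
    unfolding chart_act_def using smooth_map_prod_coordinates[OF AG AM AM act_smooth psi c c chart_dom_def] by auto
  show eR: "(e, x) \<in> chart_dom c" if "x \<in> snd c ` fst c" for x
    using that ci e_in_E by (auto simp: chart_dom_def E_def)
  show "chart_act c (e, x) = x" if "x \<in> snd c ` fst c" for x
    using that ci by (auto simp: chart_act_def)
  show F_S: "x \<in> snd c ` fst c \<and> z \<in> E \<and> chart_act c (z, x) \<in> snd c ` fst c" if "(z, x) \<in> chart_dom c" for z x
    using that by (auto simp: chart_dom_def chart_act_def E_def)
  show "\<exists>W. open W \<and> e \<in> W \<and> (\<forall>w\<in>W. (w, z) \<in> U \<and> (\<mu> (w, z), x) \<in> chart_dom c \<and>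
      chart_act c (\<mu> (w, z), x) = chart_act c (w, chart_act c (z, x)))"
    if zx: "(z, x) \<in> chart_dom c" for z x
  proof (intro exI conjI ballI)
    let ?W = "{w. (w, z) \<in> U} \<inter> {w. (w, chart_act c (z, x)) \<in> chart_dom c}"
    show "open ?W" using open_slice(1)[OF open_U] open_slice(1)[OF R(1)] by blast
    show "e \<in> ?W" using unit_U F_S[OF zx] eR by auto
    fix w assume w: "w \<in> ?W"
    have m: "chart_inv \<psi> (\<mu> (w, z)) = chart_inv \<psi> w \<otimes>\<^bsub>G\<^esub> chart_inv \<psi> z"
      using w AG.chart_inv_chart[OF psi] by (auto simp: U_def \<mu>_def)
    have a: "chart_inv c (chart_act c (z, x)) = act (chart_inv \<psi> z) (chart_inv c x)"
      using zx ic by (auto simp: chart_act_def chart_dom_def)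
    show "(w, z) \<in> U" using w by simp
    show "(\<mu> (w, z), x) \<in> chart_dom c"
      using w zx a m by (auto simp: chart_dom_def act_mult) (auto simp: U_def \<mu>_def)
    show "chart_act c (\<mu> (w, z), x) = chart_act c (w, chart_act c (z, x))"
      unfolding chart_act_def[of c] prod.case m act_mult a[unfolded chart_act_def prod.case] ..
  qed
qed

lemma local_metric_chart:
  assumes c: "c \<in> AM"
  shows "local_metric (snd c ` fst c) (metric_coeff g c)"
proof
  show "open (snd c ` fst c)" by (rule AM.chart_hom(2)[OF c])
  show "inner_product_form (metric_coeff g c x)" if "x \<in> snd c ` fst c" for x
    using metric c AM.chart_chart_inv[OF c that] unfolding riemannian_metric_def metric_coeff_def by blast
  show "smooth_on (snd c ` fst c) (\<lambda>x. metric_coeff g c x u v)" for u v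
    using metric c unfolding riemannian_metric_def by blast
qed

lemma action_field_eq:
  assumes "c \<in> AM" and "p \<in> fst c"
  shows "action_field G \<psi> act c p X = local_action.V e (chart_act c) X (snd c p)"
proof -
  interpret local_action E e U \<mu> "snd c ` fst c" "chart_dom c" "chart_act c" by (rule local_action_chart[OF assms(1)])
  have "coord_rep \<psi> c (\<lambda>a. act a p) = (\<lambda>z. chart_act c (z, snd c p))"
    using AM.chart_inv_chart[OF assms] by (auto simp: coord_rep_def chart_act_def)
  then show ?thesis
    unfolding action_field_def tangent_map_def e_def[symmetric] using Dd_eq[OF V_deriv_e] assms(2) by simp
qed

lemma isometry:
  assumes "c \<in> AM" "c' \<in> AM" "p \<in> fst c" "act a p \<in> fst c'"
  shows "g c' (act a p) (tangent_map c c' (act a) p u) (tangent_map c c' (act a) p v) = g c p u v"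
  using action assms unfolding isometric_action_def by (auto simp: carr)

lemma killing_chart:
  assumes c: "c \<in> AM"
  shows "local_metric.killing (snd c ` fst c) (metric_coeff g c) (local_action.V e (chart_act c) X)"
proof -
  interpret local_action E e U \<mu> "snd c ` fst c" "chart_dom c" "chart_act c" by (rule local_action_chart[OF c])
  show ?thesis
  proof (rule V_killing[OF local_metric_chart[OF c]])
    fix z x u v assume zx: "(z, x) \<in> chart_dom c"
    define a p where "a = chart_inv \<psi> z" and "p = chart_inv c x"
    have p: "p \<in> fst c" "snd c p = x" "act a p \<in> fst c"
      using zx AM.chart_chart_inv[OF c] by (auto simp: chart_dom_def a_def p_def)
    have t: "tangent_map c c (act a) p w = Dd (chart_act c) (z, x) (0, w)" for w
    proof -
      have "coord_rep c c (act a) = (\<lambda>x. chart_act c (z, x))" by (auto simp: coord_rep_def chart_act_def a_def)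
      then show ?thesis unfolding tangent_map_def p(2) using Dd_eq[OF DF_right[OF zx]] by simp
    qed
    have "chart_inv c (chart_act c (z, x)) = act a p"
      using p AM.chart_inv_chart[OF c] by (simp add: chart_act_def a_def p_def)
    then show "metric_coeff g c (chart_act c (z, x)) (Dd (chart_act c) (z, x) (0, u)) (Dd (chart_act c) (z, x) (0, v)) =
        metric_coeff g c x u v"
      using isometry[OF c c p(1,3), of u v] unfolding metric_coeff_def t by (simp add: p_def)
  qed
qed

text \<open>The element \<open>a\<close> need not lie in the chart \<open>\<psi>\<close>, so
  conjugation is factored through a chart around \<open>a\<close>.\<close>

lemma conj_differentiable: "chart_differentiable \<psi> \<psi> (\<lambda>b. a \<otimes>\<^bsub>G\<^esub> b \<otimes>\<^bsub>G\<^esub> inv\<^bsub>G\<^esub> a) \<one>\<^bsub>G\<^esub>"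
proof -
  obtain \<kappa> where \<kappa>: "\<kappa> \<in> AG" "a \<in> fst \<kappa>" using AG.chart_exists by blast
  obtain \<kappa>' where \<kappa>': "\<kappa>' \<in> AG" "inv\<^bsub>G\<^esub> a \<in> fst \<kappa>'" using AG.chart_exists by blast
  have 1: "chart_differentiable \<psi> \<kappa> (\<lambda>b. a \<otimes>\<^bsub>G\<^esub> b) \<one>\<^bsub>G\<^esub>"
    using smooth_map_prod_slices(1)[OF AG AG AG mult_smooth \<kappa>(1) psi \<kappa>(1) \<kappa>(2) one_psi] \<kappa>(2) by simp
  have 2: "chart_differentiable \<kappa> \<psi> (\<lambda>b. b \<otimes>\<^bsub>G\<^esub> inv\<^bsub>G\<^esub> a) (a \<otimes>\<^bsub>G\<^esub> \<one>\<^bsub>G\<^esub>)"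
    using smooth_map_prod_slices(2)[OF AG AG AG mult_smooth \<kappa>(1) \<kappa>'(1) psi \<kappa>(2) \<kappa>'(2)] one_psi by simp
  show ?thesis by (rule tangent_map_compose(1)[OF AG psi AG \<kappa>(1) 1 2])
qed

lemma Ad_linear: "linear (Ad G \<psi> a)"
  unfolding Ad_def by (rule tangent_map_linear[OF conj_differentiable])

text \<open>The derivative at the identity of the relation \<open>(a b a^-1) a = a b\<close>; this
  is the linear system that \<open>ad_skew\<close> asks for.\<close>

lemma Ad_eq:
  assumes z: "z \<in> E"
  shows "Dd \<mu> (e, z) (Ad G \<psi> (chart_inv \<psi> z) X, 0) = Dd \<mu> (z, e) (0, X)"
proof -
  define a where "a = chart_inv \<psi> z"
  have a: "a \<in> fst \<psi>" "snd \<psi> a = z" using AG.chart_chart_inv[OF psi] z by (auto simp: E_def a_def)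
  define C where "C = coord_rep \<psi> \<psi> (\<lambda>b. a \<otimes>\<^bsub>G\<^esub> b \<otimes>\<^bsub>G\<^esub> inv\<^bsub>G\<^esub> a)"
  have dC: "(C has_derivative Ad G \<psi> a) (at e)"
    using tangent_map_has_derivative[OF conj_differentiable] unfolding C_def Ad_def e_def .
  obtain W where W: "open W" "e \<in> W" "W \<subseteq> E" "\<And>w. w \<in> W \<Longrightarrow> a \<otimes>\<^bsub>G\<^esub> chart_inv \<psi> w \<otimes>\<^bsub>G\<^esub> inv\<^bsub>G\<^esub> a \<in> fst \<psi>"
    using conj_differentiable[of a] unfolding chart_differentiable_def e_def[symmetric] E_def[symmetric] by blast
  have Ce: "C e = e" by (simp add: C_def coord_rep_def) (simp add: e_def)
  have eq: "\<mu> (C w, z) = \<mu> (z, w)" if "w \<in> W" for w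
  proof -
    have "chart_inv \<psi> (C w) = a \<otimes>\<^bsub>G\<^esub> chart_inv \<psi> w \<otimes>\<^bsub>G\<^esub> inv\<^bsub>G\<^esub> a"
      unfolding C_def coord_rep_def using AG.chart_inv_chart[OF psi W(4)[OF that]] by simp
    then show ?thesis by (simp add: \<mu>_def a_def[symmetric] G.m_assoc)
  qed
  have "((\<lambda>w. \<mu> (C w, z)) has_derivative (\<lambda>X. Dd \<mu> (e, z) (Ad G \<psi> a X, 0))) (at e)"
    using has_derivative_compose[OF dC, of "\<lambda>w. \<mu> (w, z)"] Dmu_left[of e z] unit_U[OF z] Ce by simp
  then have "((\<lambda>w. \<mu> (z, w)) has_derivative (\<lambda>X. Dd \<mu> (e, z) (Ad G \<psi> a X, 0))) (at e)"
    by (rule has_derivative_transform_within_open[OF _ W(1,2)]) (rule eq)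
  from has_derivative_unique[OF this Dmu_right] unit_U[OF z] show ?thesis unfolding a_def by metis
qed

lemma Q_ad_skew:
  assumes "bi_invariant_inner_product G \<psi> Q"
  shows "Q (br X Y) Z = - Q Y (br X Z)"
  by (rule ad_skew[OF _ open_E e_E order_refl, where T = "\<lambda>z. Ad G \<psi> (chart_inv \<psi> z)"])
    (use assms Ad_eq in \<open>auto simp: bi_invariant_inner_product_def carr\<close>)

lemma orbit_map_differentiable:
  assumes "c \<in> AM" "p \<in> fst c"
  shows "chart_differentiable \<psi> c (\<lambda>a. act a p) \<one>\<^bsub>G\<^esub>"
  using smooth_map_prod_slices(2)[OF AG AM AM act_smooth psi assms(1) assms(1) one_psi] assms(2) by simp

text \<open>For \<open>k\<close> fixing \<open>p\<close>, acting with \<open>k\<close> after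
  \<open>b\<close> on \<open>p\<close> is acting with the conjugate of \<open>b\<close>;
  differentiate in \<open>b\<close>.\<close>

lemma action_field_Ad:
  assumes c: "c \<in> AM" "p \<in> fst c" and k: "act k p = p"
  shows "action_field G \<psi> act c p (Ad G \<psi> k X) = tangent_map c c (act k) p (action_field G \<psi> act c p X)"
proof -
  obtain \<kappa> where \<kappa>: "\<kappa> \<in> AG" "k \<in> fst \<kappa>" using AG.chart_exists by blast
  have dk: "chart_differentiable c c (act k) (act \<one>\<^bsub>G\<^esub> p)"
    using smooth_map_prod_slices(1)[OF AG AM AM act_smooth \<kappa>(1) c(1) c(1) \<kappa>(2) c(2)] k c(2) by simp
  have "act (inv\<^bsub>G\<^esub> k) p = p" using act.orbit_sym_aux[of k p p] k by simp
  then have eq: "act k (act b p) = act (k \<otimes>\<^bsub>G\<^esub> b \<otimes>\<^bsub>G\<^esub> inv\<^bsub>G\<^esub> k) p" for b by (simp add: act_mult)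
  have d1: "chart_differentiable \<psi> c (\<lambda>a. act a p) (k \<otimes>\<^bsub>G\<^esub> \<one>\<^bsub>G\<^esub> \<otimes>\<^bsub>G\<^esub> inv\<^bsub>G\<^esub> k)"
    using orbit_map_differentiable[OF c] by simp
  have "tangent_map c c (act k) p (action_field G \<psi> act c p X) = tangent_map \<psi> c (\<lambda>b. act k (act b p)) \<one>\<^bsub>G\<^esub> X"
    unfolding action_field_def using tangent_map_compose(2)[OF AG psi AM c(1) orbit_map_differentiable[OF c] dk] by simp
  also have "\<dots> = tangent_map \<psi> c (\<lambda>b. act (k \<otimes>\<^bsub>G\<^esub> b \<otimes>\<^bsub>G\<^esub> inv\<^bsub>G\<^esub> k) p) \<one>\<^bsub>G\<^esub> X" unfolding eq ..
  also have "\<dots> = action_field G \<psi> act c p (Ad G \<psi> k X)"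
    unfolding action_field_def Ad_def
    using tangent_map_compose(2)[OF AG psi AG psi conj_differentiable d1] by simp
  finally show ?thesis by simp
qed

text \<open>Frees the orbit metric from the chart selected by \<open>SOME\<close> in its
  definition.\<close>

lemma orbit_metric_eq:
  assumes c: "c \<in> AM" "p \<in> fst c"
  shows "orbit_metric G \<psi> AM g act p X Y = g c p (action_field G \<psi> act c p X) (action_field G \<psi> act c p Y)"
proof -
  define c' where "c' = (SOME c. c \<in> AM \<and> p \<in> fst c)"
  have c': "c' \<in> AM" "p \<in> fst c'"
    using someI[of "\<lambda>c. c \<in> AM \<and> p \<in> fst c" c] c unfolding c'_def by auto
  have "chart_differentiable c c' id p"
  proof -
    have sm: "smooth_on (snd c ` (fst c \<inter> fst c')) (coord_rep c c' id)"
      using AM c(1) c'(1) unfolding smooth_atlas_def by blast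
    have "snd c p \<in> snd c ` (fst c \<inter> fst c')" using c c' by auto
    moreover have "open (snd c ` (fst c \<inter> fst c'))"
      by (rule AM.chart_open_image[OF c(1) AM.chart_hom(1)[OF c'(1)]])
    ultimately show ?thesis
      unfolding chart_differentiable_def using c(2) smooth_on_has_derivative[OF sm] AM.chart_inv_chart[OF c(1)]
      by (intro conjI exI[of _ "snd c ` (fst c \<inter> fst c')"]) (auto simp: differentiable_def)
  qed
  then have d: "chart_differentiable c c' id (act \<one>\<^bsub>G\<^esub> p)" by simp
  have "action_field G \<psi> act c' p X = tangent_map c c' id p (action_field G \<psi> act c p X)" for X
    unfolding action_field_def
    using tangent_map_compose(2)[OF AG psi AM c(1) orbit_map_differentiable[OF c] d] by (simp add: id_def)
  then show ?thesis
    unfolding orbit_metric_def Let_def c'_def[symmetric]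
    using metric c c' unfolding riemannian_metric_def by auto
qed

lemma orbit_metric_Ad:
  assumes k: "act k p = p"
  shows "orbit_metric G \<psi> AM g act p (Ad G \<psi> k X) (Ad G \<psi> k Y) = orbit_metric G \<psi> AM g act p X Y"
proof -
  obtain c where c: "c \<in> AM" "p \<in> fst c" using AM.chart_exists by blast
  show ?thesis
    unfolding orbit_metric_eq[OF c] action_field_Ad[OF c k]
    using isometry[OF c(1) c(1) c(2), of k] c(2) k by simp
qed

end

section \<open>The normal curve of an Einstein manifold of cohomogeneity one\<close>

locale einstein_normal = lie_action G AG \<psi> AM g act
  for G :: "('g::{t2_space, second_countable_topology}) monoid"
    and AG :: "('g, 'l::euclidean_space) chart set" and \<psi> :: "('g, 'l) chart"
    and AM :: "('m::{t2_space, second_countable_topology}, 'e::euclidean_space) chart set"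
    and g :: "('m, 'e) metric_tensor" and act :: "'g \<Rightarrow> 'm \<Rightarrow> 'm" +
  fixes K :: "'g set" and I :: "real set" and \<gamma> :: "real \<Rightarrow> 'm" and \<Lambda> :: real
  assumes cohom: "cohomogeneity_one G \<psi> AM act"
    and normal: "normal_curve G \<psi> AM g act K I \<gamma>"
    and einstein: "c \<in> AM \<Longrightarrow> p \<in> fst c \<Longrightarrow> ricci (metric_coeff g c) (snd c p) v w = \<Lambda> * g c p v w"
begin

lemma I_props: "is_interval I" "open I" "I \<noteq> {}"
  using normal by (auto simp: normal_curve_def)

lemma stabilizer_K: "t \<in> I \<Longrightarrow> k \<in> K \<longleftrightarrow> act k (\<gamma> t) = \<gamma> t"
  using normal unfolding normal_curve_def stabilizer_def by auto

lemma principal_act: "t \<in> I \<Longrightarrow> principal_point G act (act a (\<gamma> t))"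
  using normal unfolding normal_curve_def orbit_def by fastforce

lemma orbit_rank:
  assumes "t \<in> I" and "c \<in> AM" and "act a (\<gamma> t) \<in> fst c"
  shows "dim (range (action_field G \<psi> act c (act a (\<gamma> t)))) + 1 = DIM('e)"
  using cohom principal_act[OF assms(1)] assms(2,3) unfolding cohomogeneity_one_def by blast

definition "J c = {t \<in> I. \<gamma> t \<in> fst c}"
definition "cur c t = snd c (\<gamma> t)"
definition "cur1 c t = Dd (cur c) t 1"
definition "cur2 c t = Dd (cur1 c) t 1"

abbreviation "S c \<equiv> snd c ` fst c"
abbreviation "Vf c \<equiv> local_action.V e (chart_act c)"

lemma
  assumes c: "c \<in> AM"
  shows open_J: "open (J c)" and cur_smooth: "smooth_on (J c) (cur c)"
proof -
  have sm: "smooth_map real_atlas AM I \<gamma>" using normal by (simp add: normal_curve_def)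
  have "open (I \<inter> \<gamma> -` fst c)"
    using sm AM.chart_hom(1)[OF c] I_props(2) continuous_on_open_vimage[of I \<gamma>]
    unfolding smooth_map_def by (metis inf_commute)
  moreover have "I \<inter> \<gamma> -` fst c = J c" by (auto simp: J_def)
  ultimately show "open (J c)" by simp
  have "smooth_on (id ` (UNIV \<inter> I \<inter> \<gamma> -` fst c)) (coord_rep (UNIV, id) c \<gamma>)"
    using sm c unfolding smooth_map_def real_atlas_def by force
  moreover have "coord_rep (UNIV, id :: real \<Rightarrow> real) c \<gamma> = cur c"
    by (auto simp: coord_rep_def cur_def chart_inv_def fun_eq_iff)
  ultimately show "smooth_on (J c) (cur c)" using \<open>I \<inter> \<gamma> -` fst c = J c\<close> by simp
qed

lemma real_smooth_vector_derivative:
  assumes "smooth_on T f" and "t \<in> T"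
  shows "(f has_vector_derivative Dd f t 1) (at (t::real))"
proof -
  have d: "(f has_derivative Dd f t) (at t)" by (rule smooth_on_has_derivative[OF assms])
  have "Dd f t h = h *\<^sub>R Dd f t 1" for h
    using linear_cmul[OF has_derivative_linear[OF d], of h 1] by simp
  then show ?thesis using d unfolding has_vector_derivative_def by (metis ext)
qed

lemma Vf_eq: "c \<in> AM \<Longrightarrow> t \<in> J c \<Longrightarrow> Vf c X (cur c t) = action_field G \<psi> act c (\<gamma> t) X"
  by (simp add: cur_def J_def action_field_eq)

lemma metric_cur: "c \<in> AM \<Longrightarrow> t \<in> J c \<Longrightarrow> metric_coeff g c (cur c t) = g c (\<gamma> t)"
  by (simp add: cur_def J_def metric_coeff_def AM.chart_inv_chart)

lemma killing_curve_chart: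
  assumes c: "c \<in> AM"
  shows "killing_curve (S c) (metric_coeff g c) (Vf c) br (J c) (cur c) (cur1 c) (cur2 c)"
proof -
  interpret local_metric "S c" "metric_coeff g c" by (rule local_metric_chart[OF c])
  interpret la: local_action E e U \<mu> "S c" "chart_dom c" "chart_act c" by (rule local_action_chart[OF c])
  note oJ = open_J[OF c] and sm = cur_smooth[OF c]
  have in_S: "cur c t \<in> S c" if "t \<in> J c" for t using that by (auto simp: cur_def J_def)
  have d1: "(cur c has_vector_derivative cur1 c t) (at t)" if "t \<in> J c" for t
    unfolding cur1_def by (rule real_smooth_vector_derivative[OF sm that])
  have n: "metric_coeff g c (cur c t) (cur1 c t) (cur1 c t) = 1 \<and>
      (\<forall>X. metric_coeff g c (cur c t) (cur1 c t) (Vf c X (cur c t)) = 0)" if t: "t \<in> J c" for t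
  proof -
    have "vector_derivative (\<lambda>s. snd c (\<gamma> s)) (at t) = cur1 c t"
      using vector_derivative_at[OF d1[OF t]] by (simp add: cur_def[abs_def])
    moreover have "t \<in> I" "\<gamma> t \<in> fst c" using t by (auto simp: J_def)
    moreover have "\<forall>t\<in>I. \<forall>c\<in>AM. \<gamma> t \<in> fst c \<longrightarrow> (let T = vector_derivative (\<lambda>s. snd c (\<gamma> s)) (at t) in
        g c (\<gamma> t) T T = 1 \<and> (\<forall>X. g c (\<gamma> t) T (action_field G \<psi> act c (\<gamma> t) X) = 0))"
      using normal unfolding normal_curve_def by blast
    ultimately show ?thesis
      using c unfolding Let_def metric_cur[OF c t] Vf_eq[OF c t] by metis
  qed
  show ?thesis
  proof (rule killing_curve.intro[OF local_metric_chart[OF c] killing_curve_axioms.intro])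
    show "killing (Vf c X)" for X by (rule killing_chart[OF c])
    show "linear (\<lambda>X. Vf c X x)" if "x \<in> S c" for x by (rule la.V_linear[OF that])
    show "Dd (Vf c X) x (Vf c Y x) - Dd (Vf c Y) x (Vf c X x) = Vf c (br X Y) x" if "x \<in> S c" for x X Y
      by (rule la.V_bracket[OF that])
    show "open (J c)" by (rule oJ)
    show "cur c t \<in> S c" if "t \<in> J c" for t by (rule in_S[OF that])
    show "(cur c has_vector_derivative cur1 c t) (at t)" if "t \<in> J c" for t by (rule d1[OF that])
    show "(cur1 c has_vector_derivative cur2 c t) (at t)" if "t \<in> J c" for t
      unfolding cur1_def[abs_def] cur2_def
      by (rule real_smooth_vector_derivative[OF smooth_on_Dd[OF oJ sm] that])
    show "metric_coeff g c (cur c t) (Vf c X (cur c t)) (cur1 c t) = 0" if "t \<in> J c" for t X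
      using n[OF that] h_sym[OF in_S[OF that]] by metis
    show "metric_coeff g c (cur c t) (cur1 c t) (cur1 c t) = 1" if "t \<in> J c" for t using n[OF that] by blast
    show "w = 0" if t: "t \<in> J c" and w: "\<And>X. metric_coeff g c (cur c t) (Vf c X (cur c t)) w = 0"
      "metric_coeff g c (cur c t) (cur1 c t) w = 0" for t w
    proof -
      let ?h = "metric_coeff g c (cur c t)"
      let ?T = "range (\<lambda>X. Vf c X (cur c t))"
      note hb = bil[OF in_S[OF t]]
      have sub: "subspace ?T" by (rule linear_subspace_image[OF la.V_linear[OF in_S[OF t]] subspace_UNIV])
      \<comment> \<open>The velocity is orthogonal to \<open>?T\<close> and has length 1. Since the
        orbit has codimension one, adding it to \<open>?T\<close> fills the tangent space.\<close>
      have "cur1 c t \<notin> span ?T"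
        using n[OF t] sub by (auto simp: span_eq_iff[THEN iffD2])
      moreover have "?T = range (action_field G \<psi> act c (act \<one>\<^bsub>G\<^esub> (\<gamma> t)))"
        using Vf_eq[OF c t] by simp
      then have "dim ?T + 1 = DIM('e)" using orbit_rank[of t c "\<one>\<^bsub>G\<^esub>"] t c by (simp add: J_def)
      ultimately have "dim (insert (cur1 c t) ?T) = DIM('e)" by (simp add: dim_insert)
      then have "span (insert (cur1 c t) ?T) = UNIV" by (simp add: dim_eq_full)
      then have "w \<in> span (insert (cur1 c t) ?T)" by simp
      moreover have "subspace {v. ?h v w = 0}"
        by (rule subspaceI) (auto simp: bilinear_iff[OF hb])
      then have "span (insert (cur1 c t) ?T) \<subseteq> {v. ?h v w = 0}"
        using w by (intro span_minimal) auto
      ultimately have "?h w w = 0" by blast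
      then show ?thesis using inner_form[OF in_S[OF t]] unfolding inner_product_form_def by force
    qed
  qed
qed

lemma chart_at:
  assumes "t \<in> I"
  obtains c where "c \<in> AM" and "t \<in> J c"
  using AM.chart_exists[of "\<gamma> t"] assms by (auto simp: J_def)

abbreviation "\<kk> \<equiv> lie_subalgebra G \<psi> K"

text \<open>A curve in \<open>K\<close> fixes the point, so its velocity generates a field vanishing
  there. Conversely \<open>orbit_map_kernel\<close> supplies the curve; its rank hypothesis holds
  because all points of the orbit are principal.\<close>

lemma isotropy_kernel:
  assumes c: "c \<in> AM" and t: "t \<in> J c"
  shows "X \<in> \<kk> \<longleftrightarrow> Vf c X (cur c t) = 0"
proof -
  interpret la: local_action E e U \<mu> "S c" "chart_dom c" "chart_act c" by (rule local_action_chart[OF c])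
  have tI: "t \<in> I" "\<gamma> t \<in> fst c" using t by (auto simp: J_def)
  have x: "cur c t \<in> S c" using tI by (auto simp: cur_def)
  have inv: "chart_inv c (cur c t) = \<gamma> t" using AM.chart_inv_chart[OF c tI(2)] by (simp add: cur_def)
  show ?thesis
  proof
    assume "X \<in> \<kk>"
    then obtain k :: "real \<Rightarrow> 'g" where k: "\<And>s. k s \<in> K \<inter> fst \<psi>" "k 0 = \<one>\<^bsub>G\<^esub>"
      "((\<lambda>s. snd \<psi> (k s)) has_vector_derivative X) (at 0)"
      unfolding lie_subalgebra_def by blast
    have "chart_act c (snd \<psi> (k s), cur c t) = cur c t" for s
      using k(1)[of s] stabilizer_K[OF tI(1), of "k s"] AG.chart_inv_chart[OF psi, of "k s"] inv
      by (simp add: chart_act_def cur_def)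
    moreover have "((\<lambda>s. chart_act c (snd \<psi> (k s), cur c t)) has_derivative (\<lambda>r. Vf c (r *\<^sub>R X) (cur c t))) (at 0)"
      using has_derivative_compose[OF k(3)[unfolded has_vector_derivative_def], of "\<lambda>z. chart_act c (z, cur c t)"]
        la.V_deriv_e[OF x] k(2) by (simp add: e_def)
    ultimately have "((\<lambda>s::real. cur c t) has_derivative (\<lambda>r. Vf c (r *\<^sub>R X) (cur c t))) (at 0)" by simp
    from fun_cong[OF has_derivative_unique[OF this has_derivative_const], of 1]
    show "Vf c X (cur c t) = 0" by simp
  next
    assume 0: "Vf c X (cur c t) = 0"
    have rank: "dim (range (\<lambda>X. Vf c X (chart_act c (z, cur c t)))) = dim (range (\<lambda>X. Vf c X (cur c t)))"
      if z: "(z, cur c t) \<in> chart_dom c" for z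
    proof -
      have p: "act (chart_inv \<psi> z) (\<gamma> t) \<in> fst c" using z inv by (simp add: chart_dom_def)
      have 1: "(\<lambda>X. Vf c X (chart_act c (z, cur c t))) = action_field G \<psi> act c (act (chart_inv \<psi> z) (\<gamma> t))"
        using action_field_eq[OF c p] inv by (simp add: chart_act_def fun_eq_iff)
      have 2: "(\<lambda>X. Vf c X (cur c t)) = action_field G \<psi> act c (act \<one>\<^bsub>G\<^esub> (\<gamma> t))"
        using Vf_eq[OF c t] by (simp add: fun_eq_iff)
      have "act \<one>\<^bsub>G\<^esub> (\<gamma> t) \<in> fst c" using tI(2) by simp
      from orbit_rank[OF tI(1) c p] orbit_rank[OF tI(1) c this] show ?thesis unfolding 1 2 by linarith
    qed
    obtain k r where r: "r > 0" and k: "\<And>s. \<bar>s\<bar> < r \<Longrightarrow> (k s, cur c t) \<in> chart_dom c \<and> chart_act c (k s, cur c t) = cur c t"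
      and k0: "k 0 = e" and kd: "(k has_vector_derivative X) (at (0::real))"
      using la.orbit_map_kernel[OF x rank 0] by blast
    \<comment> \<open>\<open>lie_subalgebra\<close> asks for a curve on all of the reals inside
      \<open>K\<close> and the chart. Outside the short interval it is set to the identity, which
      leaves the derivative at 0 untouched.\<close>
    define k' where "k' s = (if \<bar>s\<bar> < r then chart_inv \<psi> (k s) else \<one>\<^bsub>G\<^esub>)" for s
    have "k' s \<in> K \<inter> fst \<psi>" for s
    proof (cases "\<bar>s\<bar> < r")
      case True
      note ks = k[OF True]
      have "act (chart_inv \<psi> (k s)) (\<gamma> t) = \<gamma> t"
      proof -
        have m: "act (chart_inv \<psi> (k s)) (\<gamma> t) \<in> fst c" using ks inv by (simp add: chart_dom_def)
        have "snd c (act (chart_inv \<psi> (k s)) (\<gamma> t)) = snd c (\<gamma> t)" using ks inv by (simp add: chart_act_def cur_def)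
        then show ?thesis using AM.chart_inv_chart[OF c m] AM.chart_inv_chart[OF c tI(2)] by metis
      qed
      moreover have "chart_inv \<psi> (k s) \<in> fst \<psi>"
        using ks AG.chart_chart_inv[OF psi] by (auto simp: chart_dom_def)
      ultimately show ?thesis using stabilizer_K[OF tI(1)] True by (simp add: k'_def)
    next
      case False
      then show ?thesis using stabilizer_K[OF tI(1)] one_psi by (simp add: k'_def)
    qed
    moreover have "k' 0 = \<one>\<^bsub>G\<^esub>" using r k0 by (simp add: k'_def)
    moreover have "((\<lambda>s. snd \<psi> (k' s)) has_vector_derivative X) (at 0)"
    proof (rule has_vector_derivative_transform_within_open[OF kd, of "ball 0 r"])
      show "k s = snd \<psi> (k' s)" if "s \<in> ball 0 r" for s
        using k[of s] that AG.chart_chart_inv[OF psi, of "k s"] by (auto simp: k'_def chart_dom_def)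
    qed (use r in auto)
    ultimately show "X \<in> \<kk>" unfolding lie_subalgebra_def by blast
  qed
qed

definition "B t X Y = orbit_metric G \<psi> AM g act (\<gamma> t) X Y"
text \<open>By \<open>b_deriv\<close> this agrees with the second fundamental form in every chart;
  defined without charts, it makes sense on all of \<open>I\<close>.\<close>

definition "\<Omega> t X Y = - deriv (\<lambda>s. B s X Y) t / 2"

lemma B_chart:
  assumes c: "c \<in> AM" and t: "t \<in> J c"
  shows "B t X Y = metric_coeff g c (cur c t) (Vf c X (cur c t)) (Vf c Y (cur c t))"
  using orbit_metric_eq[OF c, of "\<gamma> t"] t unfolding B_def metric_cur[OF c t] Vf_eq[OF c t] by (simp add: J_def)

lemma B_Ad: "t \<in> I \<Longrightarrow> k \<in> K \<Longrightarrow> B t (Ad G \<psi> k X) (Ad G \<psi> k Y) = B t X Y"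
  unfolding B_def using orbit_metric_Ad stabilizer_K by blast

lemma
  assumes t: "t \<in> I"
  shows B_bilinear: "bilinear (B t)" and B_sym: "B t X Y = B t Y X"
    and B_kernel: "X \<in> \<kk> \<Longrightarrow> B t X Y = 0" and B_pos: "X \<notin> \<kk> \<Longrightarrow> B t X X > 0"
    and B_deriv: "((\<lambda>s. B s X Y) has_real_derivative - 2 * \<Omega> t X Y) (at t)"
proof -
  obtain c where c: "c \<in> AM" and tc: "t \<in> J c" using chart_at[OF t] .
  interpret kc: killing_curve "S c" "metric_coeff g c" "Vf c" br "J c" "cur c" "cur1 c" "cur2 c"
    by (rule killing_curve_chart[OF c])
  have b: "B s = kc.b s" if "s \<in> J c" for s using B_chart[OF c that] by (auto simp: kc.b_def fun_eq_iff)
  note x = kc.c_S[OF tc]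
  show "bilinear (B t)" "B t X Y = B t Y X" using kc.b_bilinear kc.b_sym tc by (auto simp: b)
  show "B t X Y = 0" if "X \<in> \<kk>"
    using that isotropy_kernel[OF c tc] B_chart[OF c tc] kc.h_lin(9)[OF x] by simp
  show "B t X X > 0" if "X \<notin> \<kk>"
    using that isotropy_kernel[OF c tc] B_chart[OF c tc] inner_product_formD(3)[OF kc.inner_form[OF x]] by simp
  have "((\<lambda>s. B s X Y) has_real_derivative - 2 * kc.\<Omega> t X Y) (at t)"
    by (rule has_field_derivative_transform_within_open[OF kc.b_deriv[OF tc] kc.open_J tc]) (simp add: b)
  then show "((\<lambda>s. B s X Y) has_real_derivative - 2 * \<Omega> t X Y) (at t)"
    using DERIV_imp_deriv[of "\<lambda>s. B s X Y"] by (simp add: \<Omega>_def)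
qed

lemma isotropy_subspace: "subspace \<kk>"
proof -
  obtain t where t: "t \<in> I" using I_props(3) by blast
  obtain c where c: "c \<in> AM" and tc: "t \<in> J c" using chart_at[OF t] .
  interpret kc: killing_curve "S c" "metric_coeff g c" "Vf c" br "J c" "cur c" "cur1 c" "cur2 c"
    by (rule killing_curve_chart[OF c])
  note l = kc.V_linear[OF kc.c_S[OF tc]]
  show ?thesis
    by (rule subspaceI) (auto simp: isotropy_kernel[OF c tc] linear_0[OF l] linear_add[OF l] linear_cmul[OF l])
qed

text \<open>\<open>N k\<close> is dual to \<open>k\<close> with respect to \<open>B t\<close>, where the \<open>Q\<close>-orthonormal set \<open>F\<close> spans a complement of
  the isotropy algebra.\<close>
definition dual_basis :: "('l \<Rightarrow> 'l \<Rightarrow> real) \<Rightarrow> real \<Rightarrow> 'l set \<Rightarrow> ('l \<Rightarrow> 'l) \<Rightarrow> bool" where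
  "dual_basis Q t F N \<longleftrightarrow> finite F \<and> (\<forall>k\<in>F. \<forall>l\<in>F. Q k l = of_bool (k = l)) \<and>
    (\<forall>X. X - (\<Sum>k\<in>F. Q X k *\<^sub>R k) \<in> \<kk>) \<and>
    (\<forall>k\<in>F. (\<forall>X. B t X (N k) = Q X k) \<and> N k = (\<Sum>l\<in>F. Q (N k) l *\<^sub>R l) \<and> (\<forall>l\<in>F. Q (N k) l = Q (N l) k))"

text \<open>The right-hand side of \<open>alpha_eq\<close>, so that \<open>\<alpha>\<close> is
  available without a chart and is visibly linear in \<open>B\<close>.\<close>

definition "\<alpha> t X Y Z = (B t (br X Y) Z - B t (br Y Z) X - B t (br X Z) Y) / 2"

text \<open>The Ricci tensor is \<open>\<Lambda>\<close> times the metric. In the mixed direction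
  the metric vanishes, as the normal is orthogonal to the orbit; in orbit directions it is
  \<open>B\<close>.\<close>

lemma
  assumes t: "t \<in> I" and Q: "bi_invariant_inner_product G \<psi> Q" and dual: "dual_basis Q t F N"
  shows mixed_einstein: "(\<Sum>k\<in>F. \<Omega> t (br k X) (N k)) = 0"
    and Omega_einstein: "((\<lambda>t. \<Omega> t X Y) has_real_derivative
    \<Lambda> * B t X Y
    - (\<Sum>k\<in>F. (\<Sum>l\<in>F. \<alpha> t k Y (N l) * \<alpha> t X (N k) l) + \<Omega> t k Y * \<Omega> t X (N k)
        - ((\<Sum>l\<in>F. \<alpha> t X Y (N l) * \<alpha> t k (N k) l) + \<Omega> t X Y * \<Omega> t k (N k))
        - \<alpha> t (br k X) Y (N k))
    - (\<Sum>l\<in>F. \<Omega> t Y (N l) * \<Omega> t X l)) (at t)"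
proof -
  obtain c where c: "c \<in> AM" and tc: "t \<in> J c" using chart_at[OF t] .
  interpret kc: killing_curve "S c" "metric_coeff g c" "Vf c" br "J c" "cur c" "cur1 c" "cur2 c"
    by (rule killing_curve_chart[OF c])
  have b: "B s = kc.b s" if "s \<in> J c" for s using B_chart[OF c that] by (auto simp: kc.b_def fun_eq_iff)
  have Om: "\<Omega> s X Y = kc.\<Omega> s X Y" if s: "s \<in> J c" for s X Y
  proof -
    have "((\<lambda>s. B s X Y) has_real_derivative - 2 * kc.\<Omega> s X Y) (at s)"
      by (rule has_field_derivative_transform_within_open[OF kc.b_deriv[OF s] kc.open_J s]) (simp add: b)
    from DERIV_imp_deriv[OF this] show ?thesis by (simp add: \<Omega>_def)
  qed
  have al: "\<alpha> t X Y Z = kc.\<alpha> t X Y Z" for X Y Z using kc.alpha_eq[OF tc] b[OF tc] by (simp add: \<alpha>_def)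
  note l = kc.V_linear[OF kc.c_S[OF tc]]
  interpret df: dual_frame "S c" "metric_coeff g c" "Vf c" br "J c" "cur c" "cur1 c" "cur2 c" t Q F N
  proof unfold_locales
    show "Q (br X Y) Z = - Q Y (br X Z)" for X Y Z by (rule Q_ad_skew[OF Q])
    show "br X Y = - br Y X" for X Y by (rule br_skew)
    show "Vf c X (cur c t) = (\<Sum>k\<in>F. Q X k *\<^sub>R Vf c k (cur c t))" for X
    proof -
      have "Vf c (X - (\<Sum>k\<in>F. Q X k *\<^sub>R k)) (cur c t) = 0"
        using dual isotropy_kernel[OF c tc] unfolding dual_basis_def by blast
      then show ?thesis by (simp add: linear_diff[OF l] linear_sum[OF l] linear_cmul[OF l])
    qed
    show "N k = (\<Sum>l\<in>F. Q (N k) l *\<^sub>R l)" if "k \<in> F" for k using dual that unfolding dual_basis_def by blast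
    show "Q (N k) l = Q (N l) k" if "k \<in> F" "l \<in> F" for k l using dual that unfolding dual_basis_def by blast
  qed (use tc dual Q br_bilinear in \<open>auto simp: dual_basis_def bi_invariant_inner_product_def b[OF tc]\<close>)
  have "ricci (metric_coeff g c) (cur c t) v w = \<Lambda> * g c (\<gamma> t) v w" for v w
    unfolding cur_def using einstein[OF c] tc by (simp add: J_def)
  then have ric: "ricci (metric_coeff g c) (cur c t) v w = \<Lambda> * metric_coeff g c (cur c t) v w" for v w
    unfolding metric_cur[OF c tc] .
  show "(\<Sum>k\<in>F. \<Omega> t (br k X) (N k)) = 0"
    using df.mixed_ricci[of X] kc.c1_orth[OF tc] unfolding ric Om[OF tc] by simp
  show "((\<lambda>t. \<Omega> t X Y) has_real_derivative
    \<Lambda> * B t X Y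
    - (\<Sum>k\<in>F. (\<Sum>l\<in>F. \<alpha> t k Y (N l) * \<alpha> t X (N k) l) + \<Omega> t k Y * \<Omega> t X (N k)
        - ((\<Sum>l\<in>F. \<alpha> t X Y (N l) * \<alpha> t k (N k) l) + \<Omega> t X Y * \<Omega> t k (N k))
        - \<alpha> t (br k X) Y (N k))
    - (\<Sum>l\<in>F. \<Omega> t Y (N l) * \<Omega> t X l)) (at t)"
    unfolding al Om[OF tc] B_chart[OF c tc] ric[symmetric]
    by (rule has_field_derivative_transform_within_open[OF df.Omega_ode kc.open_J tc]) (simp add: Om)
qed

end

section \<open>Schur's lemma for orthogonal representations\<close>

lemma orthonormal_expansion:
  fixes Q :: "'l::real_vector \<Rightarrow> 'l \<Rightarrow> real"
  assumes Q: "inner_product_form Q" and F: "finite F" "\<And>k l. k \<in> F \<Longrightarrow> l \<in> F \<Longrightarrow> Q k l = of_bool (k = l)"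
    and X: "X \<in> span F"
  shows "X = (\<Sum>k\<in>F. Q X k *\<^sub>R k)"
proof -
  note bl = bilinear_iff[OF inner_product_formD(1)[OF Q]]
  have "subspace {X. X = (\<Sum>k\<in>F. Q X k *\<^sub>R k)}"
  proof (rule subspaceI; clarify?)
    show "0 = (\<Sum>k\<in>F. Q 0 k *\<^sub>R k)" by (simp add: bl)
  next
    fix x y assume "x = (\<Sum>k\<in>F. Q x k *\<^sub>R k)" "y = (\<Sum>k\<in>F. Q y k *\<^sub>R k)"
    then show "x + y = (\<Sum>k\<in>F. Q (x + y) k *\<^sub>R k)" by (simp add: bl scaleR_add_left sum.distrib)
  next
    fix r x assume "x = (\<Sum>k\<in>F. Q x k *\<^sub>R k)"
    moreover have "(\<Sum>k\<in>F. Q (r *\<^sub>R x) k *\<^sub>R k) = r *\<^sub>R (\<Sum>k\<in>F. Q x k *\<^sub>R k)"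
      by (simp add: bl scaleR_sum_right)
    ultimately show "r *\<^sub>R x = (\<Sum>k\<in>F. Q (r *\<^sub>R x) k *\<^sub>R k)" by metis
  qed
  moreover have "F \<subseteq> {X. X = (\<Sum>k\<in>F. Q X k *\<^sub>R k)}"
  proof
    fix l assume l: "l \<in> F"
    have "(\<Sum>k\<in>F. Q l k *\<^sub>R k) = (\<Sum>k\<in>F. if k = l then k else 0)"
      by (rule sum.cong) (auto simp: F(2) l)
    then show "l \<in> {X. X = (\<Sum>k\<in>F. Q X k *\<^sub>R k)}" using l F(1) by simp
  qed
  ultimately show ?thesis using span_minimal X by blast
qed

text \<open>Take an orthonormal subset of greatest cardinality; if it did not span, one Gram-Schmidt
  step would enlarge it.\<close>

lemma orthonormal_basis_exists:
  fixes Q :: "'l::euclidean_space \<Rightarrow> 'l \<Rightarrow> real"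
  assumes Q: "inner_product_form Q" and V: "subspace V"
  obtains F where "finite F" "F \<subseteq> V" "\<And>k l. k \<in> F \<Longrightarrow> l \<in> F \<Longrightarrow> Q k l = of_bool (k = l)" "span F = V"
proof -
  note bl = bilinear_iff[OF inner_product_formD(1)[OF Q]]
  define P where "P F \<longleftrightarrow> finite F \<and> F \<subseteq> V \<and> (\<forall>k\<in>F. \<forall>l\<in>F. Q k l = of_bool (k = l))" for F
  have ind: "independent F" if "P F" for F
  proof
    assume d: "dependent F"
    have "finite F" using that by (simp add: P_def)
    from d[unfolded dependent_finite[OF this]] obtain u v where u: "v \<in> F" "u v \<noteq> 0" "(\<Sum>v\<in>F. u v *\<^sub>R v) = 0"
      by auto
    have "Q (\<Sum>v\<in>F. u v *\<^sub>R v) v = (\<Sum>w\<in>F. if w = v then u w else 0)"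
      unfolding bilinear_sum_left[OF inner_product_formD(1)[OF Q]]
      using that u(1) by (intro sum.cong) (auto simp: P_def bl)
    then show False using u that by (simp add: P_def bl)
  qed
  have "card F < Suc (DIM('l))" if "P F" for F
    using independent_bound[OF ind[OF that]] by simp
  moreover have "P {}" by (simp add: P_def)
  ultimately obtain F where F: "P F" and max: "\<And>F'. P F' \<Longrightarrow> card F' \<le> card F"
    using ex_has_greatest_nat[of P "{}" card "Suc (DIM('l))"] by (meson less_imp_le)
  have "v \<in> span F" if v: "v \<in> V" for v
  proof (rule ccontr)
    assume nv: "v \<notin> span F"
    define w where "w = v - (\<Sum>k\<in>F. Q v k *\<^sub>R k)"
    have "(\<Sum>k\<in>F. Q v k *\<^sub>R k) \<in> span F" by (intro span_sum span_scale span_base)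
    then have w0: "w \<noteq> 0" using nv by (auto simp: w_def)
    have "(\<Sum>k\<in>F. Q v k *\<^sub>R k) \<in> V" using F V unfolding P_def by (intro subspace_sum) (auto intro: subspace_scale)
    then have wV: "w \<in> V" unfolding w_def using v V by (intro subspace_diff)
    have wk: "Q w k = 0" if k: "k \<in> F" for k
    proof -
      have "Q (\<Sum>l\<in>F. Q v l *\<^sub>R l) k = (\<Sum>l\<in>F. if l = k then Q v l else 0)"
        unfolding bilinear_sum_left[OF inner_product_formD(1)[OF Q]]
        using F k by (intro sum.cong) (auto simp: P_def bl)
      then show ?thesis unfolding w_def using F k by (simp add: P_def bl)
    qed
    have Qw: "Q w w > 0" by (rule inner_product_formD(3)[OF Q w0])
    define w' where "w' = (1 / sqrt (Q w w)) *\<^sub>R w"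
    have "Q w' w' = 1" using Qw by (simp add: w'_def bl)
    moreover have "Q w' k = 0" "Q k w' = 0" if "k \<in> F" for k
      using wk[OF that] inner_product_formD(2)[OF Q, of k w'] by (auto simp: w'_def bl)
    moreover have "w' \<in> V" unfolding w'_def by (rule subspace_scale[OF V wV])
    moreover have "w' \<notin> F" using calculation(1,2) by force
    ultimately have "P (insert w' F)" "card (insert w' F) = Suc (card F)" using F by (auto simp: P_def)
    then show False using max by fastforce
  qed
  moreover have "span F \<subseteq> V" using F V unfolding P_def by (intro span_minimal) auto
  ultimately show thesis using that[of F] F unfolding P_def by blast
qed

locale invariant_inner_product =
  fixes K :: "'g set" and \<rho> :: "'g \<Rightarrow> 'l::euclidean_space \<Rightarrow> 'l" and Q :: "'l \<Rightarrow> 'l \<Rightarrow> real"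
  assumes rho_linear: "k \<in> K \<Longrightarrow> linear (\<rho> k)" and Q: "inner_product_form Q"
    and Q_inv: "k \<in> K \<Longrightarrow> Q (\<rho> k X) (\<rho> k Y) = Q X Y"
begin

lemma Qb: "bilinear Q" by (rule inner_product_formD(1)[OF Q])
lemmas Ql = bilinear_iff[OF Qb]
lemma Q_sym: "Q X Y = Q Y X" by (rule inner_product_formD(2)[OF Q])
lemma Q_pos: "X \<noteq> 0 \<Longrightarrow> Q X X > 0" by (rule inner_product_formD(3)[OF Q])

definition invariant_form :: "('l \<Rightarrow> 'l \<Rightarrow> real) \<Rightarrow> bool" where
  "invariant_form b \<longleftrightarrow> bilinear b \<and> (\<forall>k\<in>K. \<forall>X Y. b (\<rho> k X) (\<rho> k Y) = b X Y)"

text \<open>\<open>K\<close> is an arbitrary set here, so inverses are not at hand. A map preserving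
  \<open>Q\<close> is injective, and a dimension count replaces the inverse.\<close>

lemma rho_surj:
  assumes k: "k \<in> K" and V: "subspace V" "\<rho> k ` V \<subseteq> V"
  shows "\<rho> k ` V = V"
proof -
  have "inj (\<rho> k)"
  proof (rule injI)
    fix X Y assume "\<rho> k X = \<rho> k Y"
    then have "Q (X - Y) (X - Y) = 0"
      using Q_inv[OF k, of "X - Y" "X - Y"] by (simp add: linear_diff[OF rho_linear[OF k]] Ql)
    then show "X = Y" using Q_pos[of "X - Y"] by force
  qed
  then have "dim (\<rho> k ` V) = dim V" using dim_image_eq[OF rho_linear[OF k], of V] inj_on_subset by blast
  then show ?thesis
    using V by (intro subspace_dim_equal linear_subspace_image rho_linear k) auto
qed

lemma rho_preimage:
  assumes "k \<in> K" "subspace V" "\<rho> k ` V \<subseteq> V" "Y \<in> V"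
  obtains Y' where "Y' \<in> V" and "Y = \<rho> k Y'"
proof -
  have "Y \<in> \<rho> k ` V" unfolding rho_surj[OF assms(1-3)] by (rule assms(4))
  then show thesis using that by blast
qed

text \<open>A symmetric form has a real eigenvalue on \<open>V\<close>, found as the maximum of the
  Rayleigh quotient; its eigenspace is invariant and nonzero, hence all of \<open>V\<close>.\<close>

lemma schur_symmetric:
  assumes V: "irreducible_rep K \<rho> V" and b: "invariant_form b" and sym: "\<And>X Y. b X Y = b Y X"
  shows "\<exists>a. \<forall>X\<in>V. \<forall>Y\<in>V. b X Y = a * Q X Y"
proof -
  have sV: "subspace V" and V0: "V \<noteq> {0}" and inv: "\<And>k. k \<in> K \<Longrightarrow> \<rho> k ` V \<subseteq> V"
    and irr: "\<And>W. subspace W \<Longrightarrow> W \<subseteq> V \<Longrightarrow> (\<And>k. k \<in> K \<Longrightarrow> \<rho> k ` W \<subseteq> W) \<Longrightarrow> W = {0} \<or> W = V"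
    using V unfolding irreducible_rep_def by blast+
  have bb: "bilinear b" and binv: "\<And>k X Y. k \<in> K \<Longrightarrow> b (\<rho> k X) (\<rho> k Y) = b X Y"
    using b by (auto simp: invariant_form_def)
  note bl = bilinear_iff[OF bb]
  define C where "C = V \<inter> sphere 0 1"
  have cont: "continuous_on UNIV (\<lambda>X. b X X)" "continuous_on UNIV (\<lambda>X. Q X X)"
    using bounded_bilinear.continuous_on[OF bilinear_conv_bounded_bilinear[THEN iffD1, OF bb]]
      bounded_bilinear.continuous_on[OF bilinear_conv_bounded_bilinear[THEN iffD1, OF Qb]]
      continuous_on_id by blast+
  obtain v where v: "v \<in> V" "v \<noteq> 0" using V0 subspace_0[OF sV] by blast
  have "(1 / norm v) *\<^sub>R v \<in> C" using v sV by (auto simp: C_def subspace_scale)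
  then have Cne: "C \<noteq> {}" by blast
  have Cc: "compact C" unfolding C_def using closed_subspace[OF sV] by (simp add: closed_Int_compact)
  have Ccont: "continuous_on C (\<lambda>X. b X X / Q X X)"
  proof (rule continuous_on_divide)
    show "continuous_on C (\<lambda>X. b X X)" "continuous_on C (\<lambda>X. Q X X)" using cont continuous_on_subset by blast+
    have "Q X X > 0" if "X \<in> C" for X using that by (intro Q_pos) (auto simp: C_def)
    then show "\<forall>X\<in>C. Q X X \<noteq> 0" by force
  qed
  obtain u where u: "u \<in> C" and umax: "\<And>X. X \<in> C \<Longrightarrow> b X X / Q X X \<le> b u u / Q u u"
    using continuous_attains_sup[OF Cc Cne Ccont] by blast
  define a where "a = b u u / Q u u"
  have u0: "u \<noteq> 0" "u \<in> V" using u by (auto simp: C_def)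
  have le: "b X X \<le> a * Q X X" if "X \<in> V" for X
  proof (cases "X = 0")
    case False
    have "(1 / norm X) *\<^sub>R X \<in> C" using that False sV by (auto simp: C_def subspace_scale)
    from umax[OF this] have "b X X / Q X X \<le> a" using False by (simp add: bl Ql a_def)
    then show ?thesis using Q_pos[OF False] by (simp add: pos_divide_le_eq)
  qed (simp add: bl Ql)
  have eq: "b u u = a * Q u u" using Q_pos[OF u0(1)] by (simp add: a_def)
  \<comment> \<open>The eigenspace for the eigenvalue \<open>a\<close>.\<close>
  define W where "W = {X \<in> V. \<forall>Y\<in>V. b X Y = a * Q X Y}"
  have "subspace W"
  proof (rule subspaceI)
    show "0 \<in> W" by (simp add: W_def bl Ql subspace_0[OF sV])
    show "x + y \<in> W" if "x \<in> W" "y \<in> W" for x y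
      using that subspace_add[OF sV] by (simp add: W_def bl Ql distrib_left)
    show "r *\<^sub>R x \<in> W" if "x \<in> W" for r x
      using that subspace_scale[OF sV] by (simp add: W_def bl Ql)
  qed
  moreover have "W \<subseteq> V" by (auto simp: W_def)
  moreover have "\<rho> k ` W \<subseteq> W" if k: "k \<in> K" for k
  proof
    fix X assume "X \<in> \<rho> k ` W"
    then obtain X' where X': "X' \<in> W" "X = \<rho> k X'" by blast
    have "b X Y = a * Q X Y" if Y: "Y \<in> V" for Y
    proof -
      obtain Y' where "Y' \<in> V" "Y = \<rho> k Y'" using rho_preimage[OF k sV inv[OF k] Y] by metis
      then show ?thesis using X' by (simp add: binv[OF k] Q_inv[OF k] W_def)
    qed
    moreover have "X \<in> V" using X' inv[OF k] by (auto simp: W_def)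
    ultimately show "X \<in> W" by (simp add: W_def)
  qed
  moreover have "u \<in> W"
  proof -
    have "b u Y = a * Q u Y" if Y: "Y \<in> V" for Y
    proof -
      define p where "p = a * Q u Y - b u Y"
      define q where "q = a * Q Y Y - b Y Y"
      have quad: "2 * s * p + s * s * q \<ge> 0" for s :: real
      proof -
        have "u + s *\<^sub>R Y \<in> V" using u0 Y sV by (simp add: subspace_add subspace_scale)
        from le[OF this] show ?thesis
          using eq by (simp add: bl Ql sym[of Y u] Q_sym[of Y u] p_def q_def algebra_simps)
      qed
      have "p = 0"
      proof (rule ccontr)
        assume p: "p \<noteq> 0"
        \<comment> \<open>Any positive \<open>D\<close> with \<open>q < 2 * D\<close> makes the
          quadratic in \<open>s\<close> negative at \<open>- p / D\<close>, contradicting maximality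
          at \<open>u\<close>.\<close>
        define D where "D = \<bar>q\<bar> + 1"
        have D: "D > 0" "q < 2 * D" by (auto simp: D_def)
        define s where "s = - p / D"
        have "2 * s * p + s * s * q = (p * p / D) * (q / D - 2)"
          by (simp add: s_def algebra_simps)
        moreover have "p * p / D > 0" using p D(1) by (intro divide_pos_pos) (auto simp: zero_less_mult_iff linorder_neq_iff)
        moreover have "q / D - 2 < 0" using D by (simp add: divide_less_eq)
        ultimately show False using quad[of s] mult_pos_neg by (metis not_less)
      qed
      then show ?thesis by (simp add: p_def)
    qed
    then show ?thesis using u0 by (simp add: W_def)
  qed
  ultimately have "W = V" using irr[of W] u0 by blast
  then show ?thesis unfolding W_def by blast
qed

text \<open>Through \<open>Q\<close> the form becomes an equivariant map \<open>T\<close> into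
  \<open>W\<close>. If \<open>b\<close> were nonzero on the two subspaces, irreducibility would
  force the kernel of \<open>T\<close> on \<open>V\<close> to be zero and its image to be
  \<open>W\<close>, an equivalence.\<close>

lemma schur_inequivalent:
  assumes V: "irreducible_rep K \<rho> V" and W: "irreducible_rep K \<rho> W" and b: "invariant_form b"
    and ne: "\<not> equivalent_reps K \<rho> V W" and X: "X \<in> V" and Y: "Y \<in> W"
  shows "b X Y = 0"
proof (rule ccontr)
  assume nz: "b X Y \<noteq> 0"
  have sV: "subspace V" and invV: "\<And>k. k \<in> K \<Longrightarrow> \<rho> k ` V \<subseteq> V"
    and irrV: "\<And>W. subspace W \<Longrightarrow> W \<subseteq> V \<Longrightarrow> (\<And>k. k \<in> K \<Longrightarrow> \<rho> k ` W \<subseteq> W) \<Longrightarrow> W = {0} \<or> W = V"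
    using V unfolding irreducible_rep_def by blast+
  have sW: "subspace W" and invW: "\<And>k. k \<in> K \<Longrightarrow> \<rho> k ` W \<subseteq> W"
    and irrW: "\<And>U. subspace U \<Longrightarrow> U \<subseteq> W \<Longrightarrow> (\<And>k. k \<in> K \<Longrightarrow> \<rho> k ` U \<subseteq> U) \<Longrightarrow> U = {0} \<or> U = W"
    using W unfolding irreducible_rep_def by blast+
  have bb: "bilinear b" and binv: "\<And>k X Y. k \<in> K \<Longrightarrow> b (\<rho> k X) (\<rho> k Y) = b X Y"
    using b by (auto simp: invariant_form_def)
  note bl = bilinear_iff[OF bb]
  obtain F where F: "finite F" "F \<subseteq> W" "\<And>k l. k \<in> F \<Longrightarrow> l \<in> F \<Longrightarrow> Q k l = of_bool (k = l)" "span F = W"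
    using orthonormal_basis_exists[OF Q sW] by metis
  define T where "T v = (\<Sum>k\<in>F. b v k *\<^sub>R k)" for v
  have T_lin: "linear T"
    by (rule linearI) (auto simp: T_def bl scaleR_add_left sum.distrib scaleR_sum_right)
  have T_W: "T v \<in> W" for v unfolding T_def using F(2) sW by (intro subspace_sum) (auto intro: subspace_scale)
  have T: "Q (T v) w = b v w" if "w \<in> W" for v w
  proof -
    have w: "w = (\<Sum>k\<in>F. Q w k *\<^sub>R k)" using orthonormal_expansion[OF Q F(1,3)] that F(4) by blast
    have "b v w = (\<Sum>k\<in>F. Q w k * b v k)" by (subst w) (simp add: bilinear_sum_right[OF bb] bl)
    also have "\<dots> = Q (T v) w" unfolding T_def by (simp add: Q_sym[of _ w] bilinear_sum_right[OF Qb] Ql mult.commute)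
    finally show ?thesis by simp
  qed
  have T_eq: "z = z'" if "z \<in> W" "z' \<in> W" "\<And>w. w \<in> W \<Longrightarrow> Q z w = Q z' w" for z z'
    using that(3)[of "z - z'"] subspace_diff[OF sW that(1,2)] Q_pos[of "z - z'"] by (force simp: Ql)
  have T_eqv: "T (\<rho> k v) = \<rho> k (T v)" if k: "k \<in> K" for k v
  proof (rule T_eq[OF T_W])
    show "\<rho> k (T v) \<in> W" using T_W invW[OF k] by blast
    fix w assume "w \<in> W"
    then obtain w' where w': "w' \<in> W" "w = \<rho> k w'" using rho_preimage[OF k sW invW[OF k]] by metis
    show "Q (T (\<rho> k v)) w = Q (\<rho> k (T v)) w"
      using T[of w "\<rho> k v"] T[of w' v] w' \<open>w \<in> W\<close> by (simp add: binv[OF k] Q_inv[OF k])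
  qed
  have TX: "T X \<noteq> 0" using T[OF Y, of X] nz by (auto simp: Ql)
  have "{v \<in> V. T v = 0} = {0} \<or> {v \<in> V. T v = 0} = V"
  proof (rule irrV)
    show "subspace {v \<in> V. T v = 0}"
      using sV by (intro subspaceI) (auto simp: linear_0[OF T_lin] linear_add[OF T_lin] linear_cmul[OF T_lin] subspace_0 subspace_add subspace_scale)
    show "\<rho> k ` {v \<in> V. T v = 0} \<subseteq> {v \<in> V. T v = 0}" if "k \<in> K" for k
      using invV[OF that] T_eqv[OF that] linear_0[OF rho_linear[OF that]] by auto
  qed auto
  then have ker: "{v \<in> V. T v = 0} = {0}" using TX X by blast
  have inj: "inj_on T V"
  proof (rule inj_onI)
    fix v v' assume "v \<in> V" "v' \<in> V" "T v = T v'"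
    then have "v - v' \<in> {v \<in> V. T v = 0}" using subspace_diff[OF sV] by (simp add: linear_diff[OF T_lin])
    then show "v = v'" unfolding ker by simp
  qed
  have "T ` V = {0} \<or> T ` V = W"
  proof (rule irrW)
    show "subspace (T ` V)" by (rule linear_subspace_image[OF T_lin sV])
    show "\<rho> k ` T ` V \<subseteq> T ` V" if "k \<in> K" for k
      using invV[OF that] T_eqv[OF that] by (auto simp: image_iff) (metis image_subset_iff)
  qed (use T_W in auto)
  then have "T ` V = W" using TX X by blast
  then have "rep_equivalence K \<rho> V W T"
    unfolding rep_equivalence_def bij_betw_def using T_lin inj T_eqv by blast
  then show False using ne unfolding equivalent_reps_def by blast
qed

text \<open>The skew part of an invariant form on an orthogonal representation would, after rescaling, be
  a commuting complex structure, which splits the complexification.\<close>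
lemma schur_orthogonal:
  assumes V: "orthogonal_rep K \<rho> V" and b: "invariant_form b"
  shows "\<exists>a. \<forall>X\<in>V. \<forall>Y\<in>V. b X Y = a * Q X Y"
proof -
  have irr: "irreducible_rep K \<rho> V" and cpl: "complexification_irreducible K \<rho> V"
    using V by (auto simp: orthogonal_rep_def)
  have sV: "subspace V" and invV: "\<And>k. k \<in> K \<Longrightarrow> \<rho> k ` V \<subseteq> V" and V0: "V \<noteq> {0}"
    using irr unfolding irreducible_rep_def by blast+
  have bb: "bilinear b" and binv: "\<And>k X Y. k \<in> K \<Longrightarrow> b (\<rho> k X) (\<rho> k Y) = b X Y"
    using b by (auto simp: invariant_form_def)
  note bl = bilinear_iff[OF bb]
  have "invariant_form (\<lambda>X Y. (b X Y + b Y X) / 2)"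
    unfolding invariant_form_def bilinear_def using binv
    by (auto intro!: linearI simp: bl field_simps)
  from schur_symmetric[OF irr this] obtain a
    where a: "\<And>X Y. X \<in> V \<Longrightarrow> Y \<in> V \<Longrightarrow> (b X Y + b Y X) / 2 = a * Q X Y"
    by (auto simp: add.commute)
  obtain F where F: "finite F" "F \<subseteq> V" "\<And>k l. k \<in> F \<Longrightarrow> l \<in> F \<Longrightarrow> Q k l = of_bool (k = l)" "span F = V"
    using orthonormal_basis_exists[OF Q sV] by metis
  define s where "s X Y = (b X Y - b Y X) / 2" for X Y
  have sb: "bilinear s" unfolding bilinear_def s_def by (auto intro!: linearI simp: bl field_simps)
  note sl = bilinear_iff[OF sb]
  \<comment> \<open>The equivariant, \<open>Q\<close>-skew map on \<open>V\<close> that represents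
    the skew part \<open>s\<close> of the form.\<close>
  define T where "T v = (\<Sum>k\<in>F. s v k *\<^sub>R k)" for v
  have T_lin: "linear T"
    by (rule linearI) (auto simp: T_def sl scaleR_add_left sum.distrib scaleR_sum_right)
  have T_V: "T v \<in> V" for v unfolding T_def using F(2) sV by (intro subspace_sum) (auto intro: subspace_scale)
  have T: "Q (T v) w = s v w" if "w \<in> V" for v w
  proof -
    have w: "w = (\<Sum>k\<in>F. Q w k *\<^sub>R k)" using orthonormal_expansion[OF Q F(1,3)] that F(4) by blast
    have "s v w = (\<Sum>k\<in>F. Q w k * s v k)" by (subst w) (simp add: bilinear_sum_right[OF sb] sl)
    also have "\<dots> = Q (T v) w" unfolding T_def by (simp add: Q_sym[of _ w] bilinear_sum_right[OF Qb] Ql mult.commute)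
    finally show ?thesis by simp
  qed
  have T_eq: "z = z'" if "z \<in> V" "z' \<in> V" "\<And>w. w \<in> V \<Longrightarrow> Q z w = Q z' w" for z z'
    using that(3)[of "z - z'"] subspace_diff[OF sV that(1,2)] Q_pos[of "z - z'"] by (force simp: Ql)
  have T_eqv: "T (\<rho> k v) = \<rho> k (T v)" if k: "k \<in> K" for k v
  proof (rule T_eq[OF T_V])
    show "\<rho> k (T v) \<in> V" using T_V invV[OF k] by blast
    fix w assume "w \<in> V"
    then obtain w' where w': "w' \<in> V" "w = \<rho> k w'" using rho_preimage[OF k sV invV[OF k]] by metis
    show "Q (T (\<rho> k v)) w = Q (\<rho> k (T v)) w"
      using T[of w "\<rho> k v"] T[of w' v] w' \<open>w \<in> V\<close> by (simp add: s_def binv[OF k] Q_inv[OF k])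
  qed
  \<comment> \<open>This form is symmetric, so the symmetric case applies and shows that the square
    of \<open>T\<close> is \<open>- c\<close> on \<open>V\<close>.\<close>
  have "invariant_form (\<lambda>X Y. Q (T X) (T Y))"
    unfolding invariant_form_def bilinear_def using T_eqv Q_inv
    by (auto intro!: linearI simp: Ql linear_add[OF T_lin] linear_cmul[OF T_lin])
  from schur_symmetric[OF irr this Q_sym] obtain c
    where c: "\<And>X Y. X \<in> V \<Longrightarrow> Y \<in> V \<Longrightarrow> Q (T X) (T Y) = c * Q X Y" by blast
  have TT: "T (T v) = - c *\<^sub>R v" if v: "v \<in> V" for v
  proof (rule T_eq[OF T_V])
    show "- c *\<^sub>R v \<in> V" by (rule subspace_scale[OF sV v])
    fix w assume w: "w \<in> V"
    have "Q (T (T v)) w = s (T v) w" by (rule T[OF w])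
    also have "\<dots> = - s w (T v)" unfolding s_def by (metis minus_diff_eq minus_divide_left)
    also have "\<dots> = - Q (T w) (T v)" using T[OF T_V[of v], of w] by simp
    also have "\<dots> = Q (- c *\<^sub>R v) w" using c[OF w v] Q_sym[of w v] by (simp add: Ql)
    finally show "Q (T (T v)) w = Q (- c *\<^sub>R v) w" .
  qed
  obtain v0 where v0: "v0 \<in> V" "v0 \<noteq> 0" using V0 subspace_0[OF sV] by blast
  have c0: "c = 0"
  proof (rule ccontr)
    assume "c \<noteq> 0"
    moreover have "c * Q v0 v0 \<ge> 0" using c[OF v0(1) v0(1)] Q_pos[of "T v0"] by (cases "T v0 = 0") (auto simp: Ql)
    ultimately have cpos: "c > 0" using Q_pos[OF v0(2)] by (simp add: zero_le_mult_iff)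
    \<comment> \<open>Normalizes \<open>T\<close>: the square of \<open>r *\<^sub>R T\<close> is
      minus the identity on \<open>V\<close>.\<close>
    define r where "r = 1 / sqrt c"
    have r: "r * r * c = 1" using cpos by (simp add: r_def)
    \<comment> \<open>The graph of a commuting complex structure is an invariant complex subspace of
      the complexification, an eigenspace of that structure. It is neither zero nor
      everything.\<close>
    define W where "W = (\<lambda>v. (v, r *\<^sub>R T v)) ` V"
    have "W = {0} \<or> W = V \<times> V"
    proof -
      have "linear (\<lambda>v. (v, r *\<^sub>R T v))"
        by (rule linearI) (auto simp: linear_add[OF T_lin] linear_cmul[OF T_lin] algebra_simps)
      then have "subspace W" unfolding W_def by (rule linear_subspace_image[OF _ sV])
      moreover have "W \<subseteq> V \<times> V" using T_V sV by (auto simp: W_def intro: subspace_scale)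
      moreover have "(\<lambda>(v, w). (- w, v)) ` W \<subseteq> W"
      proof -
        have "(- (r *\<^sub>R T v), v) \<in> W" if v: "v \<in> V" for v
        proof -
          have "r *\<^sub>R T (- (r *\<^sub>R T v)) = (r * r * c) *\<^sub>R v"
            by (simp add: linear_neg[OF T_lin] linear_cmul[OF T_lin] TT[OF v] algebra_simps)
          then have "(- (r *\<^sub>R T v), v) = (\<lambda>v. (v, r *\<^sub>R T v)) (- (r *\<^sub>R T v))" by (simp add: r)
          moreover have "- (r *\<^sub>R T v) \<in> V" using T_V sV by (simp add: subspace_neg subspace_scale)
          ultimately show ?thesis unfolding W_def by blast
        qed
        then show ?thesis by (auto simp: W_def)
      qed
      moreover have "map_prod (\<rho> k) (\<rho> k) ` W \<subseteq> W" if k: "k \<in> K" for k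
      proof -
        have "(\<rho> k v, \<rho> k (r *\<^sub>R T v)) \<in> W" if v: "v \<in> V" for v
        proof -
          have "(\<rho> k v, \<rho> k (r *\<^sub>R T v)) = (\<lambda>v. (v, r *\<^sub>R T v)) (\<rho> k v)"
            by (simp add: T_eqv[OF k] linear_cmul[OF rho_linear[OF k]])
          then show ?thesis unfolding W_def using invV[OF k] v by blast
        qed
        then show ?thesis by (auto simp: W_def)
      qed
      ultimately show ?thesis using cpl unfolding complexification_irreducible_def by blast
    qed
    moreover have "(v0, r *\<^sub>R T v0) \<in> W" using v0 by (auto simp: W_def)
    moreover have "(0, v0) \<notin> W" using v0 linear_0[OF T_lin] by (auto simp: W_def)
    moreover have "(0, v0) \<in> V \<times> V" using v0 subspace_0[OF sV] by simp
    ultimately show False using v0(2) by (auto simp: zero_prod_def)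
  qed
  have "b X Y = a * Q X Y" if "X \<in> V" "Y \<in> V" for X Y
  proof -
    have "T X = 0" using c[OF that(1) that(1)] c0 Q_pos[of "T X"] by force
    then have "s X Y = 0" using T[OF that(2), of X] by (simp add: Ql)
    then show ?thesis using a[OF that] by (simp add: s_def)
  qed
  then show ?thesis by blast
qed

end

section \<open>Transport of representation properties along equivalences\<close>

lemma rep_equivalence_trans:
  assumes "rep_equivalence K \<rho> U V f" and "rep_equivalence K \<rho> V W f'"
  shows "rep_equivalence K \<rho> U W (f' \<circ> f)"
  using assms unfolding rep_equivalence_def
  by (auto intro: linear_compose bij_betw_trans simp: bij_betwE)

text \<open>Invariant subspaces of \<open>W\<close> pull back to invariant subspaces of
  \<open>V\<close>. This and its two companions serve the rotated summands, which are images of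
  \<open>P 1\<close>.\<close>

lemma irreducible_rep_transport:
  assumes f: "rep_equivalence K \<rho> V W f" and V: "irreducible_rep K \<rho> V"
  shows "irreducible_rep K \<rho> W"
proof -
  have lin: "linear f" and inj: "inj_on f V" and im: "f ` V = W" and eqv: "\<And>k v. k \<in> K \<Longrightarrow> v \<in> V \<Longrightarrow> f (\<rho> k v) = \<rho> k (f v)"
    using f by (auto simp: rep_equivalence_def bij_betw_def)
  have sV: "subspace V" and V0: "V \<noteq> {0}" and inv: "\<And>k. k \<in> K \<Longrightarrow> \<rho> k ` V \<subseteq> V"
    and irr: "\<And>W. subspace W \<Longrightarrow> W \<subseteq> V \<Longrightarrow> (\<And>k. k \<in> K \<Longrightarrow> \<rho> k ` W \<subseteq> W) \<Longrightarrow> W = {0} \<or> W = V"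
    using V unfolding irreducible_rep_def by blast+
  have f0: "f v = 0 \<longleftrightarrow> v = 0" if "v \<in> V" for v
    using inj_onD[OF inj, of v 0] that subspace_0[OF sV] linear_0[OF lin] by auto
  have inv_W: "\<rho> k ` W \<subseteq> W" if "k \<in> K" for k
    unfolding im[symmetric] using eqv[OF that] inv[OF that] by (auto simp: image_iff) (metis image_subset_iff)
  have "U = {0} \<or> U = W" if U: "subspace U" "U \<subseteq> W" "\<And>k. k \<in> K \<Longrightarrow> \<rho> k ` U \<subseteq> U" for U
  proof -
    define U' where "U' = {v \<in> V. f v \<in> U}"
    have fU: "f ` U' = U" using U(2) im by (auto simp: U'_def)
    have "U' = {0} \<or> U' = V"
    proof (rule irr)
      show "subspace U'" unfolding U'_def using sV U(1)
        by (intro subspaceI) (auto simp: linear_0[OF lin] linear_add[OF lin] linear_cmul[OF lin] subspace_0 subspace_add subspace_scale)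
      show "\<rho> k ` U' \<subseteq> U'" if "k \<in> K" for k
        unfolding U'_def using inv[OF that] U(3)[OF that] eqv[OF that] by auto
    qed (auto simp: U'_def)
    then show ?thesis using fU im linear_0[OF lin] by auto
  qed
  moreover have "W \<noteq> {0}" using f0 V0 im subspace_0[OF sV] by auto
  ultimately show ?thesis
    unfolding irreducible_rep_def using linear_subspace_image[OF lin sV] im inv_W by blast
qed

lemma complexification_irreducible_transport:
  assumes f: "rep_equivalence K \<rho> V W f" and V: "complexification_irreducible K \<rho> V" and sV: "subspace V"
    and inv: "\<And>k. k \<in> K \<Longrightarrow> \<rho> k ` V \<subseteq> V"
  shows "complexification_irreducible K \<rho> W"
proof -
  have lin: "linear f" and inj: "inj_on f V" and im: "f ` V = W" and eqv: "\<And>k v. k \<in> K \<Longrightarrow> v \<in> V \<Longrightarrow> f (\<rho> k v) = \<rho> k (f v)"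
    using f by (auto simp: rep_equivalence_def bij_betw_def)
  have V0: "V \<noteq> {0}"
    and irr: "\<And>W. subspace W \<Longrightarrow> W \<subseteq> V \<times> V \<Longrightarrow> (\<lambda>(v, w). (- w, v)) ` W \<subseteq> W \<Longrightarrow>
      (\<And>k. k \<in> K \<Longrightarrow> map_prod (\<rho> k) (\<rho> k) ` W \<subseteq> W) \<Longrightarrow> W = {0} \<or> W = V \<times> V"
    using V unfolding complexification_irreducible_def by blast+
  have main: "U = {0} \<or> U = W \<times> W" if U: "subspace U" "U \<subseteq> W \<times> W" "(\<lambda>(v, w). (- w, v)) ` U \<subseteq> U"
    "\<And>k. k \<in> K \<Longrightarrow> map_prod (\<rho> k) (\<rho> k) ` U \<subseteq> U" for U
  proof -
    define U' where "U' = {v \<in> V \<times> V. map_prod f f v \<in> U}"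
    have lin2: "linear (map_prod f f)"
      by (rule linearI) (auto simp: linear_add[OF lin] linear_cmul[OF lin])
    have sVV: "subspace (V \<times> V)" by (rule subspace_Times[OF sV sV])
    have fU: "map_prod f f ` U' = U"
    proof
      show "U \<subseteq> map_prod f f ` U'"
      proof
        fix u assume u: "u \<in> U"
        then obtain v w where "v \<in> V" "w \<in> V" "u = (f v, f w)" using U(2) im by (cases u) blast
        then show "u \<in> map_prod f f ` U'" using u by (intro image_eqI[of _ _ "(v, w)"]) (auto simp: U'_def)
      qed
    qed (auto simp: U'_def)
    have "U' = {0} \<or> U' = V \<times> V"
    proof (rule irr)
      show "subspace U'" unfolding U'_def using subspace_inter[OF sVV linear_subspace_vimage[OF lin2 U(1)]]
        by (simp add: vimage_def Int_def)
      show "(\<lambda>(v, w). (- w, v)) ` U' \<subseteq> U'"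
        using U(3) sV by (auto simp: U'_def subspace_neg linear_neg[OF lin])
      show "map_prod (\<rho> k) (\<rho> k) ` U' \<subseteq> U'" if k: "k \<in> K" for k
      proof
        fix w assume "w \<in> map_prod (\<rho> k) (\<rho> k) ` U'"
        then obtain v v' where v: "v \<in> V" "v' \<in> V" "(f v, f v') \<in> U" "w = (\<rho> k v, \<rho> k v')" by (auto simp: U'_def)
        have "map_prod (\<rho> k) (\<rho> k) (f v, f v') \<in> U" using U(4)[OF k] v(3) by blast
        then show "w \<in> U'" using v inv[OF k] by (auto simp: U'_def eqv[OF k])
      qed
    qed (auto simp: U'_def)
    then show ?thesis
    proof
      assume "U' = {0}"
      then have "U = map_prod f f ` {0}" using fU by metis
      then show ?thesis using linear_0[OF lin2] by simp
    next
      assume "U' = V \<times> V"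
      then show ?thesis using fU map_prod_surj_on[OF im im] by metis
    qed
  qed
  have "W \<noteq> {0}"
  proof -
    obtain v where "v \<in> V" "v \<noteq> 0" using V0 subspace_0[OF sV] by blast
    then have "f v \<noteq> 0" using inj_onD[OF inj, of v 0] subspace_0[OF sV] linear_0[OF lin] by metis
    moreover have "f v \<in> W" using im \<open>v \<in> V\<close> by blast
    ultimately show ?thesis by blast
  qed
  then show ?thesis
    unfolding complexification_irreducible_def by (intro conjI allI impI) (simp, elim conjE, rule main, auto)
qed

lemma orthogonal_rep_transport:
  assumes f: "rep_equivalence K \<rho> V W f" and V: "orthogonal_rep K \<rho> V"
  shows "orthogonal_rep K \<rho> W"
proof -
  have irr: "irreducible_rep K \<rho> V" and c: "complexification_irreducible K \<rho> V"
    using V by (auto simp: orthogonal_rep_def)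
  have "subspace V" and "\<And>k. k \<in> K \<Longrightarrow> \<rho> k ` V \<subseteq> V" using irr unfolding irreducible_rep_def by blast+
  then show ?thesis
    unfolding orthogonal_rep_def
    using irreducible_rep_transport[OF f irr] complexification_irreducible_transport[OF f c] by blast
qed

section \<open>Two equivalent orthogonal summands\<close>

locale two_summands = einstein_normal G AG \<psi> AM g act K I \<gamma> \<Lambda>
  for G :: "('g::{t2_space, second_countable_topology}) monoid"
    and AG :: "('g, 'l::euclidean_space) chart set" and \<psi> :: "('g, 'l) chart"
    and AM :: "('m::{t2_space, second_countable_topology}, 'e::euclidean_space) chart set"
    and g :: "('m, 'e) metric_tensor" and act :: "'g \<Rightarrow> 'm \<Rightarrow> 'm"
    and K :: "'g set" and I :: "real set" and \<gamma> :: "real \<Rightarrow> 'm" and \<Lambda> :: real +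
  fixes Q :: "'l \<Rightarrow> 'l \<Rightarrow> real" and m d :: nat and P :: "nat \<Rightarrow> 'l set" and Y1 Y2 :: "nat \<Rightarrow> 'l"
    and f :: "'l \<Rightarrow> 'l"
  assumes Q_bi: "bi_invariant_inner_product G \<psi> Q"
    and dec: "isotropy_decomposition G \<psi> K Q m P"
    and two: "two_equivalent_orthogonal_summands G \<psi> K m P"
    and Y1_orth: "k \<in> {1..d} \<Longrightarrow> l \<in> {1..d} \<Longrightarrow> Q (Y1 k) (Y1 l) = of_bool (k = l)"
    and Y2_orth: "k \<in> {1..d} \<Longrightarrow> l \<in> {1..d} \<Longrightarrow> Q (Y2 k) (Y2 l) = of_bool (k = l)"
    and span_Y1: "span (Y1 ` {1..d}) = P 1" and span_Y2: "span (Y2 ` {1..d}) = P 2"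
    and f: "rep_equivalence K (Ad G \<psi>) (P 1) (P 2) f" and f_Y: "k \<in> {1..d} \<Longrightarrow> f (Y1 k) = Y2 k"
begin

sublocale rep: invariant_inner_product K "Ad G \<psi>" Q
  using Ad_linear Q_bi by (intro invariant_inner_product.intro) (auto simp: bi_invariant_inner_product_def carr)

lemma m2: "2 \<le> m" using two by (simp add: two_equivalent_orthogonal_summands_def)

lemma irr: "i \<in> {1..m} \<Longrightarrow> irreducible_rep K (Ad G \<psi>) (P i)"
  using dec by (simp add: isotropy_decomposition_def)

lemma P_subspace: "i \<in> {1..m} \<Longrightarrow> subspace (P i)" using irr by (simp add: irreducible_rep_def)

lemma Q_kk: "X \<in> \<kk> \<Longrightarrow> i \<in> {1..m} \<Longrightarrow> Y \<in> P i \<Longrightarrow> Q X Y = 0"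
  using dec by (simp add: isotropy_decomposition_def)

lemma Q_PP: "i \<in> {1..m} \<Longrightarrow> j \<in> {1..m} \<Longrightarrow> i \<noteq> j \<Longrightarrow> X \<in> P i \<Longrightarrow> Y \<in> P j \<Longrightarrow> Q X Y = 0"
  using dec by (simp add: isotropy_decomposition_def)

lemma Y_P: "k \<in> {1..d} \<Longrightarrow> Y1 k \<in> P 1" "k \<in> {1..d} \<Longrightarrow> Y2 k \<in> P 2"
  unfolding span_Y1[symmetric] span_Y2[symmetric] by (auto intro: span_base)

lemma Q12: "X \<in> P 1 \<Longrightarrow> Y \<in> P 2 \<Longrightarrow> Q X Y = 0" "X \<in> P 1 \<Longrightarrow> Y \<in> P 2 \<Longrightarrow> Q Y X = 0"
  using Q_PP[of 1 2 X Y] Q_PP[of 2 1 Y X] m2 by auto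

lemma d1: "1 \<in> {1..d}"
proof -
  have "P 1 \<noteq> {0}" using irr[of 1] m2 by (simp add: irreducible_rep_def)
  then have "d \<noteq> 0" using span_Y1 by (cases d) auto
  then show ?thesis by simp
qed

lemma Y_inj: "inj_on Y1 {1..d}" "inj_on Y2 {1..d}"
proof -
  have "inj_on Y {1..d}" if Y: "\<And>k l. k \<in> {1..d} \<Longrightarrow> l \<in> {1..d} \<Longrightarrow> Q (Y k) (Y l) = of_bool (k = l)" for Y
  proof (rule inj_onI)
    fix k l assume kl: "k \<in> {1..d}" "l \<in> {1..d}" "Y k = Y l"
    have "of_bool (k = l) = Q (Y l) (Y l)" using Y[OF kl(1,2)] kl(3) by simp
    also have "\<dots> = 1" using Y[OF kl(2,2)] by simp
    finally show "k = l" by (cases "k = l") auto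
  qed
  then show "inj_on Y1 {1..d}" "inj_on Y2 {1..d}" using Y1_orth Y2_orth by auto
qed

lemma P1_expand: "X \<in> P 1 \<Longrightarrow> X = (\<Sum>k\<in>{1..d}. Q X (Y1 k) *\<^sub>R Y1 k)"
proof -
  assume X: "X \<in> P 1"
  have "X = (\<Sum>k\<in>Y1 ` {1..d}. Q X k *\<^sub>R k)"
  proof (rule orthonormal_expansion[OF rep.Q])
    show "Q k l = of_bool (k = l)" if "k \<in> Y1 ` {1..d}" "l \<in> Y1 ` {1..d}" for k l
      using that by (auto simp: Y1_orth inj_on_eq_iff[OF Y_inj(1)])
  qed (use X in \<open>simp_all only: span_Y1 finite_imageI finite_atLeastAtMost\<close>)
  then show ?thesis by (simp only: sum.reindex[OF Y_inj(1)] o_def)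
qed

text \<open>These are the factors that Schur's lemma provides. Reading them off at fixed unit
  vectors makes them differentiable in \<open>t\<close>.\<close>

definition "h11 t = B t (Y1 1) (Y1 1)"
definition "h12 t = B t (Y1 1) (Y2 1)"
definition "h22 t = B t (Y2 1) (Y2 1)"
definition "Eb i = (SOME F. finite F \<and> F \<subseteq> P i \<and> (\<forall>k\<in>F. \<forall>l\<in>F. Q k l = of_bool (k = l)) \<and> span F = P i)"
definition "w i = (SOME v. v \<in> Eb i)"
definition "A t i = B t (w i) (w i)"

lemma
  assumes i: "i \<in> {3..m}"
  shows Eb_finite: "finite (Eb i)" and Eb_P: "Eb i \<subseteq> P i" and span_Eb: "span (Eb i) = P i"
    and Eb_orth: "k \<in> Eb i \<Longrightarrow> l \<in> Eb i \<Longrightarrow> Q k l = of_bool (k = l)" and w_Eb: "w i \<in> Eb i"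
proof -
  have im: "i \<in> {1..m}" using i by auto
  have "\<exists>F. finite F \<and> F \<subseteq> P i \<and> (\<forall>k\<in>F. \<forall>l\<in>F. Q k l = of_bool (k = l)) \<and> span F = P i"
    using orthonormal_basis_exists[OF rep.Q P_subspace[OF im]] by metis
  from someI_ex[OF this]
  have *: "finite (Eb i) \<and> Eb i \<subseteq> P i \<and> (\<forall>k\<in>Eb i. \<forall>l\<in>Eb i. Q k l = of_bool (k = l)) \<and> span (Eb i) = P i"
    unfolding Eb_def .
  then show "finite (Eb i)" "Eb i \<subseteq> P i" "span (Eb i) = P i"
    "k \<in> Eb i \<Longrightarrow> l \<in> Eb i \<Longrightarrow> Q k l = of_bool (k = l)" by auto
  have "P i \<noteq> {0}" using irr[OF im] by (simp add: irreducible_rep_def)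
  then have "Eb i \<noteq> {}" using * by auto
  then show "w i \<in> Eb i" unfolding w_def using someI_ex[of "\<lambda>v. v \<in> Eb i"] by blast
qed

lemma B_invariant: "t \<in> I \<Longrightarrow> rep.invariant_form (B t)"
  unfolding rep.invariant_form_def using B_bilinear B_Ad by blast

lemma B_pos_P: "t \<in> I \<Longrightarrow> i \<in> {1..m} \<Longrightarrow> X \<in> P i \<Longrightarrow> X \<noteq> 0 \<Longrightarrow> B t X X > 0"
  using B_pos[of t X] Q_kk[of X i X] rep.Q_pos[of X] by fastforce

lemma B11:
  assumes t: "t \<in> I" and "X \<in> P 1" "Y \<in> P 1"
  shows "B t X Y = h11 t * Q X Y"
proof -
  obtain a where a: "\<And>X Y. X \<in> P 1 \<Longrightarrow> Y \<in> P 1 \<Longrightarrow> B t X Y = a * Q X Y"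
    using rep.schur_symmetric[OF irr B_invariant[OF t] B_sym[OF t], of 1] m2 by auto
  have "a = h11 t" using a[OF Y_P(1)[OF d1] Y_P(1)[OF d1]] d1 by (simp add: h11_def Y1_orth)
  then show ?thesis using a assms by simp
qed

lemma B22:
  assumes t: "t \<in> I" and "X \<in> P 2" "Y \<in> P 2"
  shows "B t X Y = h22 t * Q X Y"
proof -
  obtain a where a: "\<And>X Y. X \<in> P 2 \<Longrightarrow> Y \<in> P 2 \<Longrightarrow> B t X Y = a * Q X Y"
    using rep.schur_symmetric[OF irr B_invariant[OF t] B_sym[OF t], of 2] m2 by auto
  have "a = h22 t" using a[OF Y_P(2)[OF d1] Y_P(2)[OF d1]] d1 by (simp add: h22_def Y2_orth)
  then show ?thesis using a assms by simp
qed

lemma Bii: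
  assumes t: "t \<in> I" and i: "i \<in> {3..m}" and "X \<in> P i" "Y \<in> P i"
  shows "B t X Y = A t i * Q X Y"
proof -
  obtain a where a: "\<And>X Y. X \<in> P i \<Longrightarrow> Y \<in> P i \<Longrightarrow> B t X Y = a * Q X Y"
    using rep.schur_symmetric[OF irr B_invariant[OF t] B_sym[OF t], of i] i by auto
  have "w i \<in> P i" using w_Eb[OF i] Eb_P[OF i] by blast
  then have "a = A t i" using a[of "w i" "w i"] Eb_orth[OF i w_Eb[OF i] w_Eb[OF i]] by (simp add: A_def)
  then show ?thesis using a assms by simp
qed

lemma f_lin: "linear f" using f by (simp add: rep_equivalence_def)
lemma f_P: "X \<in> P 1 \<Longrightarrow> f X \<in> P 2" using f by (auto simp: rep_equivalence_def bij_betw_def)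
lemma f_surj: "Z \<in> P 2 \<Longrightarrow> \<exists>X\<in>P 1. Z = f X" using f by (auto simp: rep_equivalence_def bij_betw_def)
lemma f_Ad: "k \<in> K \<Longrightarrow> X \<in> P 1 \<Longrightarrow> f (Ad G \<psi> k X) = Ad G \<psi> k (f X)" using f by (simp add: rep_equivalence_def)
lemma P1_inv: "k \<in> K \<Longrightarrow> X \<in> P 1 \<Longrightarrow> Ad G \<psi> k X \<in> P 1"
  using irr[of 1] m2 by (auto simp: irreducible_rep_def)

lemma Q_f:
  assumes "X \<in> P 1" "Y \<in> P 1"
  shows "Q (f X) (f Y) = Q X Y"
proof -
  have fY: "f Y = (\<Sum>k\<in>{1..d}. Q Y (Y1 k) *\<^sub>R Y2 k)" if "Y \<in> P 1" for Y
    by (subst P1_expand[OF that]) (auto simp: linear_sum[OF f_lin] linear_cmul[OF f_lin] f_Y intro!: sum.cong)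
  have "Q (f X) (Y2 l) = Q X (Y1 l)" if "l \<in> {1..d}" for l
    unfolding fY[OF assms(1)] bilinear_sum_left[OF rep.Qb] using that
    by (subst sum.cong[OF refl, where h = "\<lambda>k. if k = l then Q X (Y1 k) else 0"]) (auto simp: rep.Ql Y2_orth)
  then have "Q (f X) (f Y) = (\<Sum>l\<in>{1..d}. Q Y (Y1 l) * Q X (Y1 l))"
    unfolding fY[OF assms(2)] bilinear_sum_right[OF rep.Qb] by (intro sum.cong) (auto simp: rep.Ql)
  also have "\<dots> = Q X (\<Sum>k\<in>{1..d}. Q Y (Y1 k) *\<^sub>R Y1 k)"
    by (simp add: bilinear_sum_right[OF rep.Qb] rep.Ql)
  finally show ?thesis using P1_expand[OF assms(2)] by simp
qed

text \<open>The form \<open>B t X (f Y)\<close> on \<open>P 1\<close> is invariant but not known to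
  be symmetric, so this is where the orthogonality of the representation enters.\<close>

lemma B12:
  assumes t: "t \<in> I" and "X \<in> P 1" "Y \<in> P 1"
  shows "B t X (f Y) = h12 t * Q X Y"
proof -
  let ?p = "\<lambda>X. \<Sum>k\<in>{1..d}. Q X (Y1 k) *\<^sub>R Y1 k"
  \<comment> \<open>\<open>f\<close> is equivariant on \<open>P 1\<close> only, so the form is precomposed with the orthogonal projection.\<close>
  define p where "p = ?p"
  have p_lin: "linear p" unfolding p_def
    by (rule linearI) (auto simp: rep.Ql scaleR_add_left sum.distrib scaleR_sum_right)
  have p_P: "p X \<in> P 1" for X
    unfolding p_def using P_subspace[of 1] m2 Y_P(1) by (intro subspace_sum) (auto intro: subspace_scale)
  have p_Q: "Q (p X) Z = Q X Z" if "Z \<in> P 1" for X Z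
  proof -
    have "Q (p X) Z = Q X (p Z)"
      by (simp add: p_def bilinear_sum_left[OF rep.Qb] bilinear_sum_right[OF rep.Qb] rep.Ql rep.Q_sym[of "Y1 _" Z] mult.commute)
    moreover have "p Z = Z" using P1_expand[OF that] by (simp add: p_def)
    ultimately show ?thesis by simp
  qed
  have p_eq: "Z = p X" if "Z \<in> P 1" "\<And>W. W \<in> P 1 \<Longrightarrow> Q Z W = Q X W" for Z X
  proof -
    have "Z - p X \<in> P 1" using P_subspace[of 1] m2 that(1) p_P by (simp add: subspace_diff)
    then have "Q (Z - p X) (Z - p X) = 0" using that(2) p_Q by (simp add: rep.Ql(5))
    then show ?thesis using rep.Q_pos[of "Z - p X"] by force
  qed
  have p_Ad: "p (Ad G \<psi> k X) = Ad G \<psi> k (p X)" if k: "k \<in> K" for k X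
  proof (rule p_eq[symmetric])
    show "Ad G \<psi> k (p X) \<in> P 1" by (rule P1_inv[OF k p_P])
    fix W assume "W \<in> P 1"
    moreover have "Ad G \<psi> k ` P 1 \<subseteq> P 1" using P1_inv[OF k] by blast
    ultimately obtain W' where "W' \<in> P 1" "W = Ad G \<psi> k W'"
      using rep.rho_preimage[OF k P_subspace[of 1]] m2 by (metis atLeastAtMost_iff le_refl one_le_numeral order_trans)
    then show "Q (Ad G \<psi> k (p X)) W = Q (Ad G \<psi> k X) W" by (simp add: rep.Q_inv[OF k] p_Q)
  qed
  have "rep.invariant_form (\<lambda>X Y. B t (p X) (f (p Y)))"
    unfolding rep.invariant_form_def bilinear_def
    using bilinear_iff[OF B_bilinear[OF t]] B_Ad[OF t] f_Ad p_P p_Ad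
    by (auto intro!: linearI simp: linear_add[OF p_lin] linear_cmul[OF p_lin] linear_add[OF f_lin] linear_cmul[OF f_lin])
  moreover have "orthogonal_rep K (Ad G \<psi>) (P 1)"
    using two by (simp add: two_equivalent_orthogonal_summands_def)
  ultimately obtain a where a': "\<forall>X\<in>P 1. \<forall>Y\<in>P 1. B t (p X) (f (p Y)) = a * Q X Y"
    using rep.schur_orthogonal by blast
  have a: "B t X (f Y) = a * Q X Y" if XY: "X \<in> P 1" "Y \<in> P 1" for X Y
  proof -
    have "p X = X" "p Y = Y" using P1_expand XY by (simp_all add: p_def)
    then show ?thesis using a' XY by metis
  qed
  have "a = h12 t" using a[OF Y_P(1)[OF d1] Y_P(1)[OF d1]] d1 by (simp add: h12_def Y1_orth f_Y)
  then show ?thesis using a assms by simp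
qed

lemma P1_inequivalent: "i \<in> {3..m} \<Longrightarrow> \<not> equivalent_reps K (Ad G \<psi>) (P 1) (P i)"
  using two by (simp add: two_equivalent_orthogonal_summands_def)

lemma P2_inequivalent: "i \<in> {3..m} \<Longrightarrow> \<not> equivalent_reps K (Ad G \<psi>) (P 2) (P i)"
  using P1_inequivalent rep_equivalence_trans[OF f] unfolding equivalent_reps_def by blast

lemma Bij:
  assumes t: "t \<in> I" and ij: "i \<in> {1..m}" "j \<in> {1..m}" "i \<noteq> j" "{i, j} \<noteq> {1, 2}" and "X \<in> P i" "Y \<in> P j"
  shows "B t X Y = 0"
proof -
  have *: "B t X Y = 0" if "i \<in> {1..m}" "j \<in> {3..m}" "i \<noteq> j" "X \<in> P i" "Y \<in> P j" for i j X Y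
  proof -
    have "\<not> equivalent_reps K (Ad G \<psi>) (P i) (P j)"
    proof (cases "i \<in> {3..m}")
      case True
      then show ?thesis using two that by (simp add: two_equivalent_orthogonal_summands_def)
    next
      case False
      then have "i = 1 \<or> i = 2" using that(1) by auto
      then show ?thesis using P1_inequivalent P2_inequivalent that(2) by blast
    qed
    then show ?thesis using rep.schur_inequivalent[OF irr irr B_invariant[OF t], of i j X Y] that by auto
  qed
  show ?thesis
  proof (cases "j \<in> {3..m}")
    case True
    then show ?thesis using * assms by blast
  next
    case False
    then have "j = 1 \<or> j = 2" using ij(2) by auto
    then have "i \<in> {3..m}" using ij by auto
    then show ?thesis using *[of j i Y X] assms B_sym[OF t, of X Y] by simp
  qed
qed

definition "F = Y1 ` {1..d} \<union> Y2 ` {1..d} \<union> (\<Union>i\<in>{3..m}. Eb i)"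

lemma F_finite: "finite F" unfolding F_def using Eb_finite by auto

lemma F_cases:
  assumes "k \<in> F"
  obtains j where "j \<in> {1..d}" "k = Y1 j" | j where "j \<in> {1..d}" "k = Y2 j" | i where "i \<in> {3..m}" "k \<in> Eb i"
  using assms unfolding F_def by blast

lemma Q_Eb:
  assumes "i \<in> {3..m}" "v \<in> Eb i"
  shows "j \<in> {1..d} \<Longrightarrow> Q (Y1 j) v = 0" "j \<in> {1..d} \<Longrightarrow> Q (Y2 j) v = 0"
    "j \<in> {1..d} \<Longrightarrow> Q v (Y1 j) = 0" "j \<in> {1..d} \<Longrightarrow> Q v (Y2 j) = 0"
    "i' \<in> {3..m} \<Longrightarrow> i' \<noteq> i \<Longrightarrow> v' \<in> Eb i' \<Longrightarrow> Q v v' = 0"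
proof -
  have vP: "v \<in> P i" and i: "i \<in> {1..m}" "1 \<noteq> i" "2 \<noteq> i" and m: "1 \<in> {1..m}" "2 \<in> {1..m}"
    using assms Eb_P m2 by auto
  show "Q (Y1 j) v = 0" "Q v (Y1 j) = 0" if "j \<in> {1..d}"
    using Q_PP[OF m(1) i(1,2) Y_P(1)[OF that] vP] rep.Q_sym by auto
  show "Q (Y2 j) v = 0" "Q v (Y2 j) = 0" if "j \<in> {1..d}"
    using Q_PP[OF m(2) i(1,3) Y_P(2)[OF that] vP] rep.Q_sym by auto
  show "Q v v' = 0" if "i' \<in> {3..m}" "i' \<noteq> i" "v' \<in> Eb i'"
  proof -
    have "v' \<in> P i'" "i' \<in> {1..m}" using that Eb_P by auto
    then show ?thesis using Q_PP[OF i(1) _ _ vP] that(2) by blast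
  qed
qed

lemma Y12: "j \<in> {1..d} \<Longrightarrow> j' \<in> {1..d} \<Longrightarrow> Y1 j \<noteq> Y2 j'"
  using Q12(1)[OF Y_P(1)[of j] Y_P(2)[of j']] Y1_orth[of j j] by auto

lemma YE:
  assumes "j \<in> {1..d}" "i \<in> {3..m}" "v \<in> Eb i"
  shows "Y1 j \<noteq> v" "Y2 j \<noteq> v"
  using Q_Eb(1,2)[OF assms(2,3,1)] Eb_orth[OF assms(2,3,3)] by auto

lemma EE:
  assumes "i \<in> {3..m}" "v \<in> Eb i" "i' \<in> {3..m}" "v' \<in> Eb i'" "i' \<noteq> i"
  shows "v \<noteq> v'"
  using Q_Eb(5)[OF assms(1,2,3,5,4)] Eb_orth[OF assms(1,2,2)] by auto

lemma F_orth:
  assumes "k \<in> F" "l \<in> F"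
  shows "Q k l = of_bool (k = l)"
proof -
  show ?thesis
    using assms(1)
  proof (cases rule: F_cases)
    case k: (1 j)
    from assms(2) show ?thesis
    proof (cases rule: F_cases)
      case (1 j')
      then show ?thesis using k Y1_orth[of j j'] inj_on_eq_iff[OF Y_inj(1), of j j'] by simp
    next
      case (2 j')
      then show ?thesis using k Q12(1)[OF Y_P(1)[of j] Y_P(2)[of j']] Y12[of j j'] by simp
    next
      case (3 i)
      then show ?thesis using k Q_Eb(1)[OF 3, of j] YE(1)[OF k(1) 3] by simp
    qed
  next
    case k: (2 j)
    from assms(2) show ?thesis
    proof (cases rule: F_cases)
      case (1 j')
      then show ?thesis using k Q12(2)[OF Y_P(1)[of j'] Y_P(2)[of j]] Y12[of j' j] by simp
    next
      case (2 j')
      then show ?thesis using k Y2_orth[of j j'] inj_on_eq_iff[OF Y_inj(2), of j j'] by simp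
    next
      case (3 i)
      then show ?thesis using k Q_Eb(2)[OF 3, of j] YE(2)[OF k(1) 3] by simp
    qed
  next
    case k: (3 i)
    from assms(2) show ?thesis
    proof (cases rule: F_cases)
      case (1 j)
      then show ?thesis using Q_Eb(3)[OF k, of j] YE(1)[OF 1(1) k] by simp
    next
      case (2 j)
      then show ?thesis using Q_Eb(4)[OF k, of j] YE(2)[OF 2(1) k] by simp
    next
      case (3 i')
      then show ?thesis using k EE[OF k 3] Q_Eb(5)[OF k 3(1) _ 3(2)] Eb_orth[OF k(1), of k l]
        by (cases "i' = i") auto
    qed
  qed
qed

lemma span_F: "X \<in> span (\<kk> \<union> F)"
proof -
  have "P i \<subseteq> span (\<kk> \<union> F)" if "i \<in> {1..m}" for i
  proof -
    have sp: "span S \<subseteq> span (\<kk> \<union> F)" if "S \<subseteq> F" for S using that by (intro span_mono) auto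
    have "i = 1 \<or> i = 2 \<or> i \<in> {3..m}" using that by auto
    then show ?thesis
    proof (elim disjE)
      assume "i = 1"
      then show ?thesis using sp[of "Y1 ` {1..d}"] span_Y1 by (auto simp: F_def)
    next
      assume "i = 2"
      then show ?thesis using sp[of "Y2 ` {1..d}"] span_Y2 by (auto simp: F_def)
    next
      assume i: "i \<in> {3..m}"
      have "Eb i \<subseteq> F" using i by (auto simp: F_def)
      then show ?thesis using sp[of "Eb i"] span_Eb[OF i] by blast
    qed
  qed
  then have "\<kk> \<union> (\<Union>i\<in>{1..m}. P i) \<subseteq> span (\<kk> \<union> F)" using span_superset[of "\<kk> \<union> F"] by blast
  then have "span (\<kk> \<union> (\<Union>i\<in>{1..m}. P i)) \<subseteq> span (\<kk> \<union> F)" by (intro span_minimal) auto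
  then show ?thesis using dec unfolding isotropy_decomposition_def by blast
qed

lemma Q_kk_F: "X \<in> \<kk> \<Longrightarrow> k \<in> F \<Longrightarrow> Q X k = 0"
proof -
  assume X: "X \<in> \<kk>" and "k \<in> F"
  from this(2) show "Q X k = 0"
  proof (cases rule: F_cases)
    case (1 j)
    then show ?thesis using Q_kk[OF X, of 1] Y_P(1) m2 by simp
  next
    case (2 j)
    then show ?thesis using Q_kk[OF X, of 2] Y_P(2) m2 by simp
  next
    case (3 i)
    then have "k \<in> P i" and "i \<in> {1..m}" using Eb_P by auto
    then show ?thesis using Q_kk[OF X] by blast
  qed
qed

lemma F_expand: "X - (\<Sum>k\<in>F. Q X k *\<^sub>R k) \<in> \<kk>"
proof -
  have "X \<in> {X. X - (\<Sum>k\<in>F. Q X k *\<^sub>R k) \<in> \<kk>}"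
  proof (rule subsetD[OF span_minimal span_F])
    show "\<kk> \<union> F \<subseteq> {X. X - (\<Sum>k\<in>F. Q X k *\<^sub>R k) \<in> \<kk>}"
    proof -
      have "X - (\<Sum>k\<in>F. Q X k *\<^sub>R k) = 0" if "X \<in> F" for X
        using orthonormal_expansion[OF rep.Q F_finite F_orth span_base[OF that]] by simp
      then show ?thesis using Q_kk_F subspace_0[OF isotropy_subspace] by auto
    qed
    have "linear (\<lambda>X. X - (\<Sum>k\<in>F. Q X k *\<^sub>R k))"
      by (rule linearI) (auto simp: rep.Ql scaleR_add_left sum.distrib scaleR_sum_right algebra_simps)
    from linear_subspace_vimage[OF this isotropy_subspace]
    show "subspace {X. X - (\<Sum>k\<in>F. Q X k *\<^sub>R k) \<in> \<kk>}" by (simp add: vimage_def)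
  qed
  then show ?thesis by simp
qed

lemma sum_F:
  "(\<Sum>k\<in>F. \<phi> k) = (\<Sum>j\<in>{1..d}. \<phi> (Y1 j)) + (\<Sum>j\<in>{1..d}. \<phi> (Y2 j)) + (\<Sum>i\<in>{3..m}. \<Sum>e\<in>Eb i. \<phi> e)"
proof -
  have 1: "Y1 ` {1..d} \<inter> Y2 ` {1..d} = {}" using Y12 by blast
  have 2: "(Y1 ` {1..d} \<union> Y2 ` {1..d}) \<inter> (\<Union>i\<in>{3..m}. Eb i) = {}" using YE by blast
  have 3: "(\<Sum>k\<in>(\<Union>i\<in>{3..m}. Eb i). \<phi> k) = (\<Sum>i\<in>{3..m}. \<Sum>e\<in>Eb i. \<phi> e)"
    by (rule sum.UNION_disjoint) (use Eb_finite EE in blast)+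
  have fin: "finite (\<Union>i\<in>{3..m}. Eb i)" using Eb_finite by blast
  have "(\<Sum>k\<in>F. \<phi> k) = (\<Sum>k\<in>Y1 ` {1..d} \<union> Y2 ` {1..d}. \<phi> k) + (\<Sum>i\<in>{3..m}. \<Sum>e\<in>Eb i. \<phi> e)"
    unfolding F_def 3[symmetric] by (rule sum.union_disjoint[OF _ fin 2]) simp
  also have "(\<Sum>k\<in>Y1 ` {1..d} \<union> Y2 ` {1..d}. \<phi> k) = (\<Sum>k\<in>Y1 ` {1..d}. \<phi> k) + (\<Sum>k\<in>Y2 ` {1..d}. \<phi> k)"
    by (rule sum.union_disjoint[OF _ _ 1]) simp_all
  finally show ?thesis unfolding sum.reindex[OF Y_inj(1)] sum.reindex[OF Y_inj(2)] o_def .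
qed

lemma linear_F:
  fixes \<phi> :: "'l \<Rightarrow> real"
  assumes "linear \<phi>" and "\<And>Z. Z \<in> \<kk> \<Longrightarrow> \<phi> Z = 0"
  shows "\<phi> X = (\<Sum>k\<in>F. Q X k * \<phi> k)"
  using assms(2)[OF F_expand[of X]]
  by (simp add: linear_diff[OF assms(1)] linear_sum[OF assms(1)] linear_cmul[OF assms(1)])

end

section \<open>The dual basis and the differential algebra of the metric coefficients\<close>

context two_summands
begin

lemma linear_F_eqI:
  fixes \<phi> \<phi>' :: "'l \<Rightarrow> real"
  assumes "linear \<phi>" "linear \<phi>'" and "\<And>Z. Z \<in> \<kk> \<Longrightarrow> \<phi> Z = 0" "\<And>Z. Z \<in> \<kk> \<Longrightarrow> \<phi>' Z = 0"
    and "\<And>j. j \<in> {1..d} \<Longrightarrow> \<phi> (Y1 j) = \<phi>' (Y1 j)" and "\<And>j. j \<in> {1..d} \<Longrightarrow> \<phi> (Y2 j) = \<phi>' (Y2 j)"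
    and "\<And>i v. i \<in> {3..m} \<Longrightarrow> v \<in> Eb i \<Longrightarrow> \<phi> v = \<phi>' v"
  shows "\<phi> X = \<phi>' X"
proof -
  have "\<phi> k = \<phi>' k" if "k \<in> F" for k using that by (cases rule: F_cases) (use assms(5-7) in blast)+
  then show ?thesis using linear_F[OF assms(1,3), of X] linear_F[OF assms(2,4), of X] by simp
qed

lemma Y_F: "j \<in> {1..d} \<Longrightarrow> Y1 j \<in> F" "j \<in> {1..d} \<Longrightarrow> Y2 j \<in> F" "i \<in> {3..m} \<Longrightarrow> v \<in> Eb i \<Longrightarrow> v \<in> F"
  by (auto simp: F_def)

lemma B_linear: "t \<in> I \<Longrightarrow> linear (\<lambda>X. B t X Z)" using B_bilinear by (simp add: bilinear_def)

lemma Q_linear: "linear (\<lambda>X. Q X Z)" using rep.Qb by (simp add: bilinear_def)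

lemma B_E_zero:
  assumes "t \<in> I" "i \<in> {3..m}" "v \<in> Eb i"
  shows "j \<in> {1..d} \<Longrightarrow> B t (Y1 j) v = 0 \<and> B t v (Y1 j) = 0" "j \<in> {1..d} \<Longrightarrow> B t (Y2 j) v = 0 \<and> B t v (Y2 j) = 0"
proof -
  have v: "v \<in> P i" "i \<in> {1..m}" "{1, i} \<noteq> {1, 2}" "{2, i} \<noteq> {1, 2}" "1 \<noteq> i" "2 \<noteq> i" and m: "1 \<in> {1..m}" "2 \<in> {1..m}"
    using assms Eb_P m2 by (auto simp: doubleton_eq_iff)
  show "B t (Y1 j) v = 0 \<and> B t v (Y1 j) = 0" if "j \<in> {1..d}"
    using Bij[OF assms(1) m(1) v(2,5,3) Y_P(1)[OF that] v(1)] B_sym[OF assms(1)] by metis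
  show "B t (Y2 j) v = 0 \<and> B t v (Y2 j) = 0" if "j \<in> {1..d}"
    using Bij[OF assms(1) m(2) v(2,6,4) Y_P(2)[OF that] v(1)] B_sym[OF assms(1)] by metis
qed

lemma B_Y:
  assumes t: "t \<in> I" and j: "j \<in> {1..d}" and j': "j' \<in> {1..d}"
  shows "B t (Y1 j) (Y1 j') = h11 t * of_bool (j = j')" "B t (Y1 j) (Y2 j') = h12 t * of_bool (j = j')"
    "B t (Y2 j) (Y1 j') = h12 t * of_bool (j = j')" "B t (Y2 j) (Y2 j') = h22 t * of_bool (j = j')"
proof -
  have 12: "B t (Y1 j) (Y2 j') = h12 t * of_bool (j = j')" if "j \<in> {1..d}" "j' \<in> {1..d}" for j j'
    using B12[OF t Y_P(1)[OF that(1)] Y_P(1)[OF that(2)]] by (simp only: f_Y[OF that(2)] Y1_orth[OF that])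
  show "B t (Y1 j) (Y1 j') = h11 t * of_bool (j = j')" "B t (Y2 j) (Y2 j') = h22 t * of_bool (j = j')"
    by (simp_all only: B11[OF t Y_P(1)[OF j] Y_P(1)[OF j']] B22[OF t Y_P(2)[OF j] Y_P(2)[OF j']] Y1_orth[OF j j'] Y2_orth[OF j j'])
  show "B t (Y1 j) (Y2 j') = h12 t * of_bool (j = j')" by (rule 12[OF j j'])
  show "B t (Y2 j) (Y1 j') = h12 t * of_bool (j = j')" using 12[OF j' j] B_sym[OF t] by (simp add: eq_commute)
qed

lemma lin2: "linear (\<lambda>X. a * Q X Z + b * Q X Z')"
  by (rule linearI) (auto simp: rep.Ql algebra_simps)

lemma
  assumes t: "t \<in> I" and j: "j \<in> {1..d}"
  shows B_Y1: "B t X (Y1 j) = h11 t * Q X (Y1 j) + h12 t * Q X (Y2 j)" (is "?B1 X = ?R1 X")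
    and B_Y2: "B t X (Y2 j) = h12 t * Q X (Y1 j) + h22 t * Q X (Y2 j)" (is "?B2 X = ?R2 X")
proof -
  have kk: "?B1 Z = 0" "?B2 Z = 0" "?R1 Z = 0" "?R2 Z = 0" if "Z \<in> \<kk>" for Z
    using B_kernel[OF t that] Q_kk_F[OF that Y_F(1)[OF j]] Q_kk_F[OF that Y_F(2)[OF j]] by simp_all
  have Y1: "?B1 (Y1 k) = ?R1 (Y1 k)" "?B2 (Y1 k) = ?R2 (Y1 k)" if "k \<in> {1..d}" for k
    unfolding B_Y[OF t that j] Y1_orth[OF that j] Q12(1)[OF Y_P(1)[OF that] Y_P(2)[OF j]] by simp_all
  have Y2: "?B1 (Y2 k) = ?R1 (Y2 k)" "?B2 (Y2 k) = ?R2 (Y2 k)" if "k \<in> {1..d}" for k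
    unfolding B_Y[OF t that j] Y2_orth[OF that j] Q12(2)[OF Y_P(1)[OF j] Y_P(2)[OF that]] by simp_all
  have E: "?B1 v = ?R1 v" "?B2 v = ?R2 v" if "i \<in> {3..m}" "v \<in> Eb i" for i v
    using B_E_zero[OF t that j] unfolding Q_Eb(3,4)[OF that j] by simp_all
  show "?B1 X = ?R1 X" by (rule linear_F_eqI[OF B_linear[OF t] lin2 kk(1,3) Y1(1) Y2(1) E(1)])
  show "?B2 X = ?R2 X" by (rule linear_F_eqI[OF B_linear[OF t] lin2 kk(2,4) Y1(2) Y2(2) E(2)])
qed

lemma B_E:
  assumes t: "t \<in> I" and i: "i \<in> {3..m}" and v: "v \<in> Eb i"
  shows "B t X v = A t i * Q X v"
proof (rule linear_F_eqI[OF B_linear[OF t]])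
  show "linear (\<lambda>X. A t i * Q X v)" by (rule linearI) (auto simp: rep.Ql algebra_simps)
  show "B t Z v = 0" "A t i * Q Z v = 0" if "Z \<in> \<kk>" for Z
    using B_kernel[OF t that] Q_kk_F[OF that Y_F(3)[OF i v]] by auto
  show "B t (Y1 j) v = A t i * Q (Y1 j) v" "B t (Y2 j) v = A t i * Q (Y2 j) v" if "j \<in> {1..d}" for j
    using B_E_zero[OF t i v that] Q_Eb(1,2)[OF i v that] by auto
  show "B t u v = A t i * Q u v" if i': "i' \<in> {3..m}" and u: "u \<in> Eb i'" for i' u
  proof (cases "i' = i")
    case True
    then show ?thesis using Bii[OF t i] u v Eb_P[OF i] by blast
  next
    case False
    have "u \<in> P i'" "v \<in> P i" "i' \<in> {1..m}" "i \<in> {1..m}" "{i', i} \<noteq> {1, 2}"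
      using i i' u v Eb_P by (auto simp: doubleton_eq_iff)
    then show ?thesis using Bij[OF t _ _ False] Q_Eb(5)[OF i' u i _ v] False by auto
  qed
qed

definition "del t = h11 t * h22 t - h12 t * h12 t"
text \<open>Reciprocals become generators of their own, because the function algebra has no
  division.\<close>

definition "idel t = 1 / del t"
definition "iA i t = 1 / A t i"

lemma del_pos:
  assumes t: "t \<in> I"
  shows "del t > 0"
proof -
  have Y0: "Y1 1 \<noteq> 0" "Y2 1 \<noteq> 0" using Y1_orth[OF d1 d1] Y2_orth[OF d1 d1] by (auto simp: rep.Ql)
  have h: "h22 t > 0" unfolding h22_def
    using B_pos_P[OF t _ Y_P(2)[OF d1] Y0(2)] m2 by simp
  \<comment> \<open>The test vector that completes the square: \<open>B t v v\<close> is
    \<open>h22 t * del t\<close>.\<close>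
  define v where "v = h22 t *\<^sub>R Y1 1 - h12 t *\<^sub>R Y2 1"
  note bl = bilinear_iff[OF B_bilinear[OF t]]
  have Qv: "Q v (Y1 1) = h22 t"
    using Y1_orth[OF d1 d1] Q12(2)[OF Y_P(1)[OF d1] Y_P(2)[OF d1]] by (simp add: v_def rep.Ql)
  have "v \<notin> \<kk>" using Q_kk_F[OF _ Y_F(1)[OF d1], of v] Qv h by auto
  then have "B t v v > 0" by (rule B_pos[OF t])
  moreover have "B t v v = h22 t * del t"
    unfolding v_def del_def using B_sym[OF t, of "Y2 1" "Y1 1"]
    by (simp add: bl h11_def h12_def h22_def algebra_simps)
  ultimately show ?thesis using h by (simp add: zero_less_mult_iff)
qed

lemma A_pos:
  assumes t: "t \<in> I" and i: "i \<in> {3..m}"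
  shows "A t i > 0"
proof -
  have "w i \<noteq> 0" using Eb_orth[OF i w_Eb[OF i] w_Eb[OF i]] by (auto simp: rep.Ql)
  moreover have "w i \<in> P i" "i \<in> {1..m}" using w_Eb[OF i] Eb_P[OF i] i by auto
  ultimately show ?thesis unfolding A_def using B_pos_P[OF t] by blast
qed

text \<open>The inverse of the matrix of \<open>B t\<close> relative to \<open>Q\<close>: the
  inverse of the 2 by 2 block on each pair \<open>Y1 j\<close>, \<open>Y2 j\<close>, and division by
  \<open>A t i\<close> on the other summands.\<close>

definition "N t X = (\<Sum>j\<in>{1..d}. ((h22 t * Q X (Y1 j) - h12 t * Q X (Y2 j)) * idel t) *\<^sub>R Y1 j
    + ((h11 t * Q X (Y2 j) - h12 t * Q X (Y1 j)) * idel t) *\<^sub>R Y2 j)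
  + (\<Sum>i\<in>{3..m}. \<Sum>v\<in>Eb i. (Q X v * iA i t) *\<^sub>R v)"

lemma N_apply:
  fixes \<phi> :: "'l \<Rightarrow> real"
  assumes "linear \<phi>"
  shows "\<phi> (N t X) = (\<Sum>j\<in>{1..d}. ((h22 t * Q X (Y1 j) - h12 t * Q X (Y2 j)) * idel t) * \<phi> (Y1 j)
    + ((h11 t * Q X (Y2 j) - h12 t * Q X (Y1 j)) * idel t) * \<phi> (Y2 j))
  + (\<Sum>i\<in>{3..m}. \<Sum>v\<in>Eb i. (Q X v * iA i t) * \<phi> v)"
  unfolding N_def by (simp only: linear_add[OF assms] linear_sum[OF assms] linear_cmul[OF assms] real_scaleR_def)

lemma sum_F_delta:
  fixes \<beta> :: "'l \<Rightarrow> real"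
  assumes "z \<in> F" shows "(\<Sum>k\<in>F. Q k z * \<beta> k) = \<beta> z"
proof -
  have "(\<Sum>k\<in>F. Q k z * \<beta> k) = (\<Sum>k\<in>F. if k = z then \<beta> z else 0)"
    by (rule sum.cong) (auto simp: F_orth assms)
  then show ?thesis using assms F_finite by simp
qed

lemma N_span: "N t X \<in> span F"
  unfolding N_def using Y_F
  by (intro span_add span_sum span_scale span_base) auto

lemma N_dual:
  assumes t: "t \<in> I" and k: "k \<in> F"
  shows "B t X (N t k) = Q X k"
proof -
  have lin: "linear (B t X)" using B_bilinear[OF t] by (simp add: bilinear_def)
  have idel: "idel t * del t = 1" using del_pos[OF t] by (simp add: idel_def)
  have 1: "((h22 t * Q k (Y1 j) - h12 t * Q k (Y2 j)) * idel t) * B t X (Y1 j)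
      + ((h11 t * Q k (Y2 j) - h12 t * Q k (Y1 j)) * idel t) * B t X (Y2 j)
      = Q k (Y1 j) * Q X (Y1 j) + Q k (Y2 j) * Q X (Y2 j)" if j: "j \<in> {1..d}" for j
  proof -
    have "((h22 t * Q k (Y1 j) - h12 t * Q k (Y2 j)) * idel t) * B t X (Y1 j)
      + ((h11 t * Q k (Y2 j) - h12 t * Q k (Y1 j)) * idel t) * B t X (Y2 j)
      = (idel t * del t) * (Q k (Y1 j) * Q X (Y1 j) + Q k (Y2 j) * Q X (Y2 j))"
      unfolding B_Y1[OF t j] B_Y2[OF t j] del_def by (simp add: algebra_simps)
    then show ?thesis unfolding idel by simp
  qed
  have 2: "Q k v * iA i t * B t X v = Q k v * Q X v" if i: "i \<in> {3..m}" and v: "v \<in> Eb i" for i v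
    using A_pos[OF t i] unfolding B_E[OF t i v] iA_def by simp
  have "B t X (N t k) = (\<Sum>j\<in>{1..d}. Q k (Y1 j) * Q X (Y1 j) + Q k (Y2 j) * Q X (Y2 j))
     + (\<Sum>i\<in>{3..m}. \<Sum>v\<in>Eb i. Q k v * Q X v)"
    unfolding N_apply[OF lin]
    using sum.cong[OF refl 1, of "{1..d}"] sum.cong[OF refl sum.cong[OF refl 2], of "{3..m}"] by simp
  also have "\<dots> = (\<Sum>l\<in>F. Q l k * Q X l)"
    unfolding sum_F by (simp add: sum.distrib rep.Q_sym[of k])
  finally show ?thesis unfolding sum_F_delta[OF k] .
qed

lemma N_dual_basis:
  assumes t: "t \<in> I" shows "dual_basis Q t F (N t)"
proof -
  have lin: "linear (\<lambda>Z. Q Z X)" for X by (rule Q_linear)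
  have sym: "Q (N t X) Y = Q (N t Y) X" for X Y
    unfolding N_apply[OF lin]
    by (rule arg_cong2[of _ _ _ _ "(+)"]) (rule sum.cong[OF refl], simp add: rep.Q_sym[of X] rep.Q_sym[of Y] algebra_simps)+
  have "N t k = (\<Sum>l\<in>F. Q (N t k) l *\<^sub>R l)" for k
    by (rule orthonormal_expansion[OF rep.Q F_finite F_orth N_span])
  then show ?thesis
    unfolding dual_basis_def using F_finite F_orth F_expand N_dual[OF t] sym by blast
qed

text \<open>Including \<open>\<Omega>\<close> turns the second order Einstein equation into a first
  order system; the reciprocals are there because \<open>N\<close> occurs in it.\<close>

definition "gens = (\<lambda>(k, l) t. B t k l) ` (F \<times> F) \<union> (\<lambda>(k, l) t. \<Omega> t k l) ` (F \<times> F) \<union> {idel} \<union> iA ` {3..m}"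

abbreviation "\<R> \<equiv> function_algebra I gens"

text \<open>By uniqueness of derivatives, formulas for \<open>B\<close> that hold throughout
  \<open>I\<close> pass to \<open>\<Omega>\<close>.\<close>

lemma Omega_eqI:
  assumes t: "t \<in> I" and "\<And>s. s \<in> I \<Longrightarrow> B s X Y = \<phi> s" and "(\<phi> has_real_derivative - 2 * D) (at t)"
  shows "\<Omega> t X Y = D"
proof -
  have "(\<phi> has_real_derivative - 2 * \<Omega> t X Y) (at t)"
    by (rule has_field_derivative_transform_within_open[OF B_deriv[OF t] I_props(2) t]) (rule assms(2))
  from DERIV_unique[OF this assms(3)] show ?thesis by simp
qed

lemma
  assumes t: "t \<in> I"
  shows Omega_sym: "\<Omega> t X Y = \<Omega> t Y X" and Omega_kernel: "X \<in> \<kk> \<Longrightarrow> \<Omega> t X Y = 0"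
    and Omega_linear: "linear (\<lambda>X. \<Omega> t X Y)"
proof -
  show "\<Omega> t X Y = \<Omega> t Y X"
    by (rule Omega_eqI[OF t _ B_deriv[OF t]]) (rule B_sym)
  show "\<Omega> t X Y = 0" if "X \<in> \<kk>"
    by (rule Omega_eqI[OF t, where \<phi> = "\<lambda>_. 0"]) (auto simp: B_kernel that)
  show "linear (\<lambda>X. \<Omega> t X Y)"
  proof (rule linearI)
    fix x y r
    show "\<Omega> t (x + y) Y = \<Omega> t x Y + \<Omega> t y Y"
      by (rule Omega_eqI[OF t, where \<phi> = "\<lambda>s. B s x Y + B s y Y"])
        (auto intro!: derivative_eq_intros B_deriv t simp: bilinear_iff[OF B_bilinear])
    show "\<Omega> t (r *\<^sub>R x) Y = r *\<^sub>R \<Omega> t x Y"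
      by (rule Omega_eqI[OF t, where \<phi> = "\<lambda>s. r * B s x Y"])
        (auto intro!: derivative_eq_intros B_deriv t simp: bilinear_iff[OF B_bilinear])
  qed
qed

lemma Omega_linear2: "t \<in> I \<Longrightarrow> linear (\<Omega> t X)"
  using Omega_linear[of t X] by (simp add: Omega_sym[of t _ X])

definition "o11 t = \<Omega> t (Y1 1) (Y1 1)"
definition "o12 t = \<Omega> t (Y1 1) (Y2 1)"
definition "o22 t = \<Omega> t (Y2 1) (Y2 1)"
definition "oA t i = \<Omega> t (w i) (w i)"

lemma h_deriv:
  assumes t: "t \<in> I"
  shows "(h11 has_real_derivative - 2 * o11 t) (at t)" "(h12 has_real_derivative - 2 * o12 t) (at t)"
    "(h22 has_real_derivative - 2 * o22 t) (at t)" "((\<lambda>t. A t i) has_real_derivative - 2 * oA t i) (at t)"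
  unfolding h11_def[abs_def] h12_def[abs_def] h22_def[abs_def] A_def o11_def o12_def o22_def oA_def
  by (rule B_deriv[OF t])+

lemma Omega_Y1:
  assumes t: "t \<in> I" and j: "j \<in> {1..d}"
  shows "\<Omega> t X (Y1 j) = o11 t * Q X (Y1 j) + o12 t * Q X (Y2 j)"
  by (rule Omega_eqI[OF t B_Y1[OF _ j]])
    (auto intro!: derivative_eq_intros h_deriv t simp: algebra_simps)

lemma Omega_Y2:
  assumes t: "t \<in> I" and j: "j \<in> {1..d}"
  shows "\<Omega> t X (Y2 j) = o12 t * Q X (Y1 j) + o22 t * Q X (Y2 j)"
  by (rule Omega_eqI[OF t B_Y2[OF _ j]])
    (auto intro!: derivative_eq_intros h_deriv t simp: algebra_simps)

lemma Omega_E: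
  assumes t: "t \<in> I" and i: "i \<in> {3..m}" and v: "v \<in> Eb i"
  shows "\<Omega> t X v = oA t i * Q X v"
  by (rule Omega_eqI[OF t B_E[OF _ i v]])
    (auto intro!: derivative_eq_intros h_deriv t simp: algebra_simps)

lemma bilinear_algebra:
  assumes lin1: "\<And>t Y. t \<in> I \<Longrightarrow> linear (\<lambda>X. b t X Y)" and lin2: "\<And>t X. t \<in> I \<Longrightarrow> linear (b t X)"
    and ker: "\<And>t X Y. t \<in> I \<Longrightarrow> X \<in> \<kk> \<Longrightarrow> b t X Y = 0" "\<And>t X Y. t \<in> I \<Longrightarrow> X \<in> \<kk> \<Longrightarrow> b t Y X = 0"
    and gen: "\<And>k l. k \<in> F \<Longrightarrow> l \<in> F \<Longrightarrow> (\<lambda>t. b t k l) \<in> \<R>"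
  shows "(\<lambda>t. b t X Y) \<in> \<R>"
proof (rule function_algebra.cong)
  show "(\<lambda>t. \<Sum>k\<in>F. Q X k * (\<Sum>l\<in>F. Q Y l * b t k l)) \<in> \<R>"
    by (intro function_algebra_sum F_finite function_algebra_cmul gen)
  fix t assume t: "t \<in> I"
  show "(\<Sum>k\<in>F. Q X k * (\<Sum>l\<in>F. Q Y l * b t k l)) = b t X Y"
    using linear_F[OF lin1[OF t] ker(1)[OF t], of X Y] linear_F[OF lin2[OF t] ker(2)[OF t], of _ Y] by simp
qed

lemma B_algebra: "(\<lambda>t. B t X Y) \<in> \<R>"
proof (rule bilinear_algebra)
  show "linear (B t X)" "linear (\<lambda>X. B t X Y)" if "t \<in> I" for t X Y
    using B_bilinear[OF that] by (auto simp: bilinear_def)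
  show "B t X Y = 0" "B t Y X = 0" if "t \<in> I" "X \<in> \<kk>" for t X Y
    using B_kernel[OF that] B_sym[OF that(1), of Y X] by auto
  show "(\<lambda>t. B t k l) \<in> \<R>" if "k \<in> F" "l \<in> F" for k l
    using that by (intro function_algebra.gen) (auto simp: gens_def)
qed

lemma Omega_algebra: "(\<lambda>t. \<Omega> t X Y) \<in> \<R>"
proof (rule bilinear_algebra[OF Omega_linear Omega_linear2 Omega_kernel])
  show "\<Omega> t Y X = 0" if "t \<in> I" "X \<in> \<kk>" for t X Y
    using Omega_kernel[OF that] Omega_sym[OF that(1), of Y X] by simp
  show "(\<lambda>t. \<Omega> t k l) \<in> \<R>" if "k \<in> F" "l \<in> F" for k l
    using that by (intro function_algebra.gen) (auto simp: gens_def)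
qed

lemma idel_algebra: "idel \<in> \<R>" and iA_algebra: "i \<in> {3..m} \<Longrightarrow> iA i \<in> \<R>"
  by (auto intro: function_algebra.gen simp: gens_def)

lemma h_algebra: "h11 \<in> \<R>" "h12 \<in> \<R>" "h22 \<in> \<R>"
  unfolding h11_def[abs_def] h12_def[abs_def] h22_def[abs_def] by (rule B_algebra)+

lemma N_algebra:
  assumes lin: "\<And>t. t \<in> I \<Longrightarrow> linear (\<phi> t)" and \<phi>: "\<And>l. (\<lambda>t. \<phi> t l) \<in> \<R>"
  shows "(\<lambda>t. \<phi> t (N t k)) \<in> \<R>"
proof (rule function_algebra.cong)
  show "(\<lambda>t. (\<Sum>j\<in>{1..d}. ((Q k (Y1 j) * h22 t - Q k (Y2 j) * h12 t) * idel t) * \<phi> t (Y1 j)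
    + ((Q k (Y2 j) * h11 t - Q k (Y1 j) * h12 t) * idel t) * \<phi> t (Y2 j))
    + (\<Sum>i\<in>{3..m}. \<Sum>v\<in>Eb i. (Q k v * iA i t) * \<phi> t v)) \<in> \<R>"
    by (intro function_algebra.add function_algebra_sum function_algebra.mult function_algebra_diff function_algebra_cmul
        h_algebra idel_algebra iA_algebra \<phi> finite_atLeastAtMost Eb_finite)
qed (use N_apply[OF lin] in \<open>simp add: mult.commute\<close>)

lemma alpha_linear:
  assumes t: "t \<in> I"
  shows "linear (\<alpha> t X Y)" and "linear (\<lambda>Y. \<alpha> t X Y Z)"
  unfolding \<alpha>_def using bilinear_iff[OF B_bilinear[OF t]] bilinear_iff[OF br_bilinear]
  by (auto intro!: linearI simp: field_simps)

lemma alpha_algebra: "(\<lambda>t. \<alpha> t X Y Z) \<in> \<R>"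
  unfolding \<alpha>_def
  using function_algebra_cmul[of _ I gens "1/2"] B_algebra
  by (simp add: function_algebra_diff)

lemma alpha_N_algebra: "(\<lambda>t. \<alpha> t X Y (N t k)) \<in> \<R>" "(\<lambda>t. \<alpha> t X (N t k) Z) \<in> \<R>"
  using N_algebra[OF alpha_linear(1) alpha_algebra] N_algebra[OF alpha_linear(2) alpha_algebra] by blast+

lemma Omega_N_algebra: "(\<lambda>t. \<Omega> t X (N t k)) \<in> \<R>"
  by (rule N_algebra[OF Omega_linear2 Omega_algebra])

text \<open>Here the Einstein equation yields analyticity: \<open>Omega_einstein\<close> writes the
  derivative of \<open>\<Omega>\<close> by elements of the algebra, the derivative of
  \<open>B\<close> is \<open>\<Omega>\<close> up to a factor, and a reciprocal differentiates to a
  multiple of its square.\<close>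

sublocale differential_algebra I gens
proof
  show "open I" by (rule I_props(2))
  show "finite gens" unfolding gens_def using F_finite by simp
  fix \<phi> assume "\<phi> \<in> gens"
  then consider k l where "k \<in> F" "l \<in> F" "\<phi> = (\<lambda>t. B t k l)" | k l where "k \<in> F" "l \<in> F" "\<phi> = (\<lambda>t. \<Omega> t k l)"
    | "\<phi> = idel" | i where "i \<in> {3..m}" "\<phi> = iA i"
    unfolding gens_def by auto
  then show "\<exists>\<phi>'\<in>\<R>. \<forall>t\<in>I. (\<phi> has_real_derivative \<phi>' t) (at t)"
  proof cases
    case (1 k l)
    have "(\<lambda>t. - 2 * \<Omega> t k l) \<in> \<R>" by (rule function_algebra_cmul[OF Omega_algebra])
    moreover have "\<forall>t\<in>I. (\<phi> has_real_derivative - 2 * \<Omega> t k l) (at t)" unfolding 1(3) using B_deriv by blast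
    ultimately show ?thesis by (intro bexI[of _ "\<lambda>t. - 2 * \<Omega> t k l"])
  next
    case (2 X Y)
    let ?D = "\<lambda>t. \<Lambda> * B t X Y
    - (\<Sum>k\<in>F. (\<Sum>l\<in>F. \<alpha> t k Y (N t l) * \<alpha> t X (N t k) l) + \<Omega> t k Y * \<Omega> t X (N t k)
        - ((\<Sum>l\<in>F. \<alpha> t X Y (N t l) * \<alpha> t k (N t k) l) + \<Omega> t X Y * \<Omega> t k (N t k))
        - \<alpha> t (br k X) Y (N t k))
    - (\<Sum>l\<in>F. \<Omega> t Y (N t l) * \<Omega> t X l)"
    have "?D \<in> \<R>"
      by (intro function_algebra_diff function_algebra.add function_algebra_sum function_algebra.mult
          function_algebra.const B_algebra Omega_algebra alpha_N_algebra Omega_N_algebra F_finite)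
    moreover have "\<forall>t\<in>I. (\<phi> has_real_derivative ?D t) (at t)"
      unfolding 2(3) using Omega_einstein[OF _ Q_bi N_dual_basis] by blast
    ultimately show ?thesis by (intro bexI[of _ ?D])
  next
    case 3
    let ?D = "\<lambda>t. - (((- 2 * o11 t) * h22 t + (- 2 * o22 t) * h11 t) - ((- 2 * o12 t) * h12 t + (- 2 * o12 t) * h12 t)) * (idel t * idel t)"
    have "?D \<in> \<R>"
      unfolding o11_def o12_def o22_def
      by (intro function_algebra.mult function_algebra_minus function_algebra_diff function_algebra.add
          function_algebra_cmul Omega_algebra h_algebra idel_algebra)
    moreover have "(idel has_real_derivative ?D t) (at t)" if t: "t \<in> I" for t
      unfolding idel_def[abs_def] del_def using del_pos[OF t]
      by (auto intro!: derivative_eq_intros h_deriv[OF t] simp: del_def field_simps)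
    ultimately show ?thesis unfolding 3 by (intro bexI[of _ ?D]) blast
  next
    case (4 i)
    let ?D = "\<lambda>t. - (- 2 * oA t i) * (iA i t * iA i t)"
    have "?D \<in> \<R>"
      unfolding oA_def using 4(1)
      by (intro function_algebra.mult function_algebra_minus function_algebra_cmul Omega_algebra iA_algebra)
    moreover have "(iA i has_real_derivative ?D t) (at t)" if t: "t \<in> I" for t
      unfolding iA_def[abs_def] using A_pos[OF t 4(1)]
      by (auto intro!: derivative_eq_intros h_deriv[OF t] simp: field_simps)
    ultimately show ?thesis unfolding 4(2) by (intro bexI[of _ ?D]) blast
  qed
qed

text \<open>The mixed Einstein equation says that \<open>P\<^sup>-\<^sup>1P'\<close> is symmetric up to the factor \<open>Q(X, Z)\<close>, where
  \<open>Z\<close> is the sum of the brackets; take \<open>X = Z\<close>.\<close>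
lemma wronskian:
  assumes t: "t \<in> I" and Z: "(\<Sum>k=1..d. br (Y1 k) (Y2 k)) \<noteq> 0"
  shows "(h11 t - h22 t) * deriv h12 t = h12 t * deriv (\<lambda>t. h11 t - h22 t) t"
proof -
  define X where "X = (\<Sum>k=1..d. br (Y1 k) (Y2 k))"
  note ad = Q_ad_skew[OF Q_bi]
  have self: "Q (br v X) v = 0" for v
  proof -
    have "Q (br v X) v = - Q (br X v) v" using br_skew[of v X] by (simp add: rep.Ql)
    moreover have "Q (br X v) v = - Q (br X v) v" using ad[of X v v] rep.Q_sym by metis
    ultimately show ?thesis by simp
  qed
  \<comment> \<open>The \<open>c j\<close> sum to \<open>Q X X\<close>, which is positive by the
    choice of \<open>X\<close>. They do not depend on the metric at time \<open>t\<close>.\<close>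
  define c where "c j = Q X (br (Y1 j) (Y2 j))" for j
  have c1: "Q (br (Y1 j) X) (Y2 j) = - c j" for j using ad[of "Y1 j" X "Y2 j"] by (simp add: c_def)
  have c2: "Q (br (Y2 j) X) (Y1 j) = c j" for j
    using ad[of "Y2 j" X "Y1 j"] br_skew[of "Y2 j" "Y1 j"] by (simp add: c_def rep.Ql)
  have "(\<Sum>j\<in>{1..d}. c j) = Q X X"
    unfolding c_def bilinear_sum_right[OF rep.Qb, symmetric] X_def[symmetric] ..
  then have cpos: "(\<Sum>j\<in>{1..d}. c j) > 0" using rep.Q_pos Z unfolding X_def[symmetric] by simp
  have brl: "linear (\<lambda>k. br k X)" using br_bilinear by (simp add: bilinear_def)
  have swap: "(\<Sum>k\<in>F. (\<Sum>j\<in>{1..d}. \<phi> k j) + (\<Sum>i\<in>{3..m}. \<Sum>v\<in>Eb i. \<theta> k i v))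
      = (\<Sum>j\<in>{1..d}. \<Sum>k\<in>F. \<phi> k j) + (\<Sum>i\<in>{3..m}. \<Sum>v\<in>Eb i. \<Sum>k\<in>F. \<theta> k i v)"
    for \<phi> :: "'l \<Rightarrow> nat \<Rightarrow> real" and \<theta>
  proof -
    have "(\<Sum>k\<in>F. \<Sum>i\<in>{3..m}. \<Sum>v\<in>Eb i. \<theta> k i v) = (\<Sum>i\<in>{3..m}. \<Sum>k\<in>F. \<Sum>v\<in>Eb i. \<theta> k i v)"
      by (rule sum.swap)
    also have "\<dots> = (\<Sum>i\<in>{3..m}. \<Sum>v\<in>Eb i. \<Sum>k\<in>F. \<theta> k i v)" by (intro sum.cong refl sum.swap)
    finally show ?thesis unfolding sum.distrib by (subst sum.swap) simp
  qed
  have "0 = (\<Sum>k\<in>F. \<Omega> t (br k X) (N t k))"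
    using mixed_einstein[OF t Q_bi N_dual_basis[OF t]] by simp
  also have "\<dots> = (\<Sum>k\<in>F. (\<Sum>j\<in>{1..d}. ((h22 t * Q k (Y1 j) - h12 t * Q k (Y2 j)) * idel t) * \<Omega> t (br k X) (Y1 j)
    + ((h11 t * Q k (Y2 j) - h12 t * Q k (Y1 j)) * idel t) * \<Omega> t (br k X) (Y2 j))
    + (\<Sum>i\<in>{3..m}. \<Sum>v\<in>Eb i. (Q k v * iA i t) * \<Omega> t (br k X) v))"
    unfolding N_apply[OF Omega_linear2[OF t]] ..
  also have "\<dots> = (\<Sum>j\<in>{1..d}. \<Sum>k\<in>F. ((h22 t * Q k (Y1 j) - h12 t * Q k (Y2 j)) * idel t) * \<Omega> t (br k X) (Y1 j)
    + ((h11 t * Q k (Y2 j) - h12 t * Q k (Y1 j)) * idel t) * \<Omega> t (br k X) (Y2 j))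
    + (\<Sum>i\<in>{3..m}. \<Sum>v\<in>Eb i. \<Sum>k\<in>F. (Q k v * iA i t) * \<Omega> t (br k X) v)"
    by (rule swap)
  also have "\<dots> = (\<Sum>j\<in>{1..d}. idel t * ((h11 t - h22 t) * o12 t - h12 t * (o11 t - o22 t)) * c j) + (\<Sum>i\<in>{3..m}. \<Sum>v\<in>Eb i. 0)"
  proof (rule arg_cong2[of _ _ _ _ "(+)"]; rule sum.cong[OF refl])
    fix j assume j: "j \<in> {1..d}"
    have "(\<Sum>k\<in>F. ((h22 t * Q k (Y1 j) - h12 t * Q k (Y2 j)) * idel t) * \<Omega> t (br k X) (Y1 j)
      + ((h11 t * Q k (Y2 j) - h12 t * Q k (Y1 j)) * idel t) * \<Omega> t (br k X) (Y2 j))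
      = (\<Sum>k\<in>F. Q k (Y1 j) * (idel t * (h22 t * \<Omega> t (br k X) (Y1 j) - h12 t * \<Omega> t (br k X) (Y2 j))))
      + (\<Sum>k\<in>F. Q k (Y2 j) * (idel t * (h11 t * \<Omega> t (br k X) (Y2 j) - h12 t * \<Omega> t (br k X) (Y1 j))))"
      unfolding sum.distrib[symmetric] by (intro sum.cong refl) (simp add: algebra_simps)
    also have "\<dots> = idel t * (h22 t * \<Omega> t (br (Y1 j) X) (Y1 j) - h12 t * \<Omega> t (br (Y1 j) X) (Y2 j))
      + idel t * (h11 t * \<Omega> t (br (Y2 j) X) (Y2 j) - h12 t * \<Omega> t (br (Y2 j) X) (Y1 j))"
      unfolding sum_F_delta[OF Y_F(1)[OF j]] sum_F_delta[OF Y_F(2)[OF j]] ..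
    \<comment> \<open>The diagonal pairings vanish by \<open>self\<close>; the cross pairings are
      \<open>- c j\<close> and \<open>c j\<close>, and their opposite signs produce the Wronskian
      combination.\<close>
    also have "\<dots> = idel t * ((h11 t - h22 t) * o12 t - h12 t * (o11 t - o22 t)) * c j"
      unfolding Omega_Y1[OF t j] Omega_Y2[OF t j] c1 c2 self by (simp add: algebra_simps)
    finally show "(\<Sum>k\<in>F. ((h22 t * Q k (Y1 j) - h12 t * Q k (Y2 j)) * idel t) * \<Omega> t (br k X) (Y1 j)
      + ((h11 t * Q k (Y2 j) - h12 t * Q k (Y1 j)) * idel t) * \<Omega> t (br k X) (Y2 j))
      = idel t * ((h11 t - h22 t) * o12 t - h12 t * (o11 t - o22 t)) * c j" .
  next
    fix i assume i: "i \<in> {3..m}"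
    show "(\<Sum>v\<in>Eb i. \<Sum>k\<in>F. (Q k v * iA i t) * \<Omega> t (br k X) v) = (\<Sum>v\<in>Eb i. 0)"
    proof (rule sum.cong[OF refl])
      fix v assume v: "v \<in> Eb i"
      have "(\<Sum>k\<in>F. (Q k v * iA i t) * \<Omega> t (br k X) v) = (\<Sum>k\<in>F. Q k v * (iA i t * \<Omega> t (br k X) v))"
        by (simp add: mult.assoc)
      then show "(\<Sum>k\<in>F. (Q k v * iA i t) * \<Omega> t (br k X) v) = 0"
        unfolding sum_F_delta[OF Y_F(3)[OF i v]] Omega_E[OF t i v] self by simp
    qed
  qed
  also have "\<dots> = idel t * ((h11 t - h22 t) * o12 t - h12 t * (o11 t - o22 t)) * (\<Sum>j\<in>{1..d}. c j)"
    by (simp add: sum_distrib_left)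
  finally have "(h11 t - h22 t) * o12 t = h12 t * (o11 t - o22 t)"
    using cpos del_pos[OF t] by (simp add: idel_def)
  moreover have "deriv h12 t = - 2 * o12 t" "deriv (\<lambda>t. h11 t - h22 t) t = - 2 * (o11 t - o22 t)"
    using DERIV_imp_deriv[OF h_deriv(2)[OF t]] DERIV_imp_deriv[OF DERIV_diff[OF h_deriv(1,3)[OF t]]] by auto
  ultimately show ?thesis by (simp only: mult.left_commute[of _ "- 2"])
qed

lemma constant_direction:
  assumes Z: "(\<Sum>k=1..d. br (Y1 k) (Y2 k)) \<noteq> 0"
  shows "\<exists>x y. (x, y) \<noteq> (0, 0) \<and> (\<forall>t\<in>I. x * (h11 t - h22 t) + y * h12 t = 0)"
proof (rule wronskian_dependent)
  show "(\<lambda>t. h11 t - h22 t) \<in> \<R>" "h12 \<in> \<R>" by (intro function_algebra_diff h_algebra)+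
  show "connected I" using I_props(1) is_interval_connected by blast
qed (rule wronskian[OF _ Z])

end

section \<open>Rotation of the two equivalent summands\<close>

context two_summands
begin

text \<open>For a unit vector \<open>(a, b)\<close> this embeds \<open>P 1\<close> isometrically and
  equivariantly into \<open>P 1\<close> plus \<open>P 2\<close>. The pairs \<open>(c, s)\<close> and
  \<open>(- s, c)\<close> give the two rotated summands.\<close>

definition rot :: "real \<Rightarrow> real \<Rightarrow> 'l \<Rightarrow> 'l" where
  "rot a b v = a *\<^sub>R v + b *\<^sub>R f v"

lemma rot_linear: "linear (rot a b)"
  by (rule linearI) (auto simp: rot_def linear_add[OF f_lin] linear_cmul[OF f_lin] algebra_simps)

lemma Q_rot:
  assumes "v \<in> P 1" "u \<in> P 1"
  shows "Q (rot a b v) (rot a' b' u) = (a * a' + b * b') * Q v u"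
  using Q12(1)[OF assms(1) f_P[OF assms(2)]] Q12(2)[OF assms(2) f_P[OF assms(1)]] Q_f[OF assms]
  by (simp add: rot_def rep.Ql algebra_simps)

lemma B_rot:
  assumes t: "t \<in> I" and "v \<in> P 1" "u \<in> P 1"
  shows "B t (rot a b v) (rot a' b' u) = (a * a' * h11 t + (a * b' + b * a') * h12 t + b * b' * h22 t) * Q v u"
  using B11[OF t assms(2,3)] B22[OF t f_P[OF assms(2)] f_P[OF assms(3)]] Q_f[OF assms(2,3)]
    B12[OF t assms(2,3)] B12[OF t assms(3,2)] B_sym[OF t, of "f v" u] rep.Q_sym[of u v]
  by (simp add: rot_def bilinear_iff[OF B_bilinear[OF t]] algebra_simps)

lemma rot_equivalence:
  assumes "a * a + b * b = 1"
  shows "rep_equivalence K (Ad G \<psi>) (P 1) (rot a b ` P 1) (rot a b)"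
proof -
  have "inj_on (rot a b) (P 1)"
  proof (rule inj_onI)
    fix v u assume vu: "v \<in> P 1" "u \<in> P 1" "rot a b v = rot a b u"
    have d: "v - u \<in> P 1" using vu P_subspace[of 1] m2 by (simp add: subspace_diff)
    have "rot a b (v - u) = 0" using vu(3) by (simp add: linear_diff[OF rot_linear])
    then have "Q (v - u) (v - u) = 0" using Q_rot[OF d d, of a b a b] assms by (simp add: rep.Ql(9))
    then show "v = u" using rep.Q_pos[of "v - u"] by force
  qed
  moreover have "rot a b (Ad G \<psi> k v) = Ad G \<psi> k (rot a b v)" if "k \<in> K" "v \<in> P 1" for k v
    by (simp add: rot_def f_Ad[OF that] linear_add[OF Ad_linear] linear_cmul[OF Ad_linear])
  ultimately show ?thesis unfolding rep_equivalence_def bij_betw_def using rot_linear by blast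
qed

lemma span_rot: "span ((\<lambda>k. rot a b (Y1 k)) ` {1..d}) = rot a b ` P 1"
  using linear_span_image[OF rot_linear, of a b "Y1 ` {1..d}"] by (simp only: span_Y1 image_image)

text \<open>The off-diagonal coefficient after rotation is
  \<open>(c * c - s * s) * h12 t - c * s * (h11 t - h22 t)\<close>, which the hypothesis makes zero
  for all times at once.\<close>

lemma diagonalize:
  assumes cs: "c * c + s * s = 1" and diag: "\<And>t. t \<in> I \<Longrightarrow> (c * c - s * s) * h12 t = c * s * (h11 t - h22 t)"
  shows "diagonalizable_metric G \<psi> AM g act K Q m d I \<gamma>"
proof -
  let ?r1 = "rot c s" and ?r2 = "rot (- s) c"
  define P' where "P' i = (if i = 1 then ?r1 ` P 1 else if i = 2 then ?r2 ` P 1 else P i)" for i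
  define Z1 where "Z1 k = ?r1 (Y1 k)" for k
  define Z2 where "Z2 k = ?r2 (Y1 k)" for k
  have P'1: "P' 1 = ?r1 ` P 1" and P'2: "P' 2 = ?r2 ` P 1" and P'i: "\<And>i. i \<in> {3..m} \<Longrightarrow> P' i = P i"
    by (auto simp: P'_def)
  have e1: "rep_equivalence K (Ad G \<psi>) (P 1) (P' 1) ?r1" unfolding P'1 by (rule rot_equivalence[OF cs])
  have e2: "rep_equivalence K (Ad G \<psi>) (P 1) (P' 2) ?r2" unfolding P'2 by (rule rot_equivalence) (use cs in simp)
  have orth: "orthogonal_rep K (Ad G \<psi>) (P 1)" using two by (simp add: two_equivalent_orthogonal_summands_def)
  have i_cases: "i = 1 \<or> i = 2 \<or> i \<in> {3..m}" if "i \<in> {1..m}" for i using that by auto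
  have rot_zero: "\<beta> (rot a b v) = 0" if "linear \<beta>" "\<beta> v = 0" "\<beta> (f v) = (0::real)" for \<beta> a b v
    using that by (simp add: rot_def linear_add linear_cmul)
  have f': "\<exists>f'. rep_equivalence K (Ad G \<psi>) (P' 1) (P' 2) f' \<and> (\<forall>k\<in>{1..d}. f' (Z1 k) = Z2 k)"
  proof -
    \<comment> \<open>On \<open>P' 1\<close> this is \<open>?r2\<close> after the inverse of
      \<open>?r1\<close>. The expansion in \<open>Z1\<close> extends it to the whole Lie algebra,
      since \<open>rep_equivalence\<close> requires a globally linear map.\<close>
    define f' where "f' X = (\<Sum>k\<in>{1..d}. Q X (Z1 k) *\<^sub>R Z2 k)" for X
    have lin: "linear f'"
      by (rule linearI) (auto simp: f'_def rep.Ql scaleR_add_left sum.distrib scaleR_sum_right)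
    have rr: "f' (?r1 v) = ?r2 v" if v: "v \<in> P 1" for v
    proof -
      have "f' (?r1 v) = (\<Sum>k\<in>{1..d}. Q v (Y1 k) *\<^sub>R ?r2 (Y1 k))"
        unfolding f'_def Z1_def Z2_def using Q_rot[OF v Y_P(1), of _ c s c s] cs by (intro sum.cong refl) simp
      also have "\<dots> = ?r2 (\<Sum>k\<in>{1..d}. Q v (Y1 k) *\<^sub>R Y1 k)"
        by (simp add: linear_sum[OF rot_linear] linear_cmul[OF rot_linear])
      finally show ?thesis using P1_expand[OF v] by simp
    qed
    have "rep_equivalence K (Ad G \<psi>) (P' 1) (P' 2) f'"
      unfolding rep_equivalence_def
    proof (intro conjI lin ballI)
      have inj: "inj_on ?r2 (P 1)" using e2 by (simp add: rep_equivalence_def bij_betw_def)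
      show "bij_betw f' (P' 1) (P' 2)"
        unfolding bij_betw_def P'1 P'2
      proof
        show "inj_on f' (?r1 ` P 1)"
        proof (rule inj_onI)
          fix X X' assume "X \<in> ?r1 ` P 1" "X' \<in> ?r1 ` P 1" and eq: "f' X = f' X'"
          then obtain v u where v: "v \<in> P 1" "X = ?r1 v" and u: "u \<in> P 1" "X' = ?r1 u" by (elim imageE)
          have "?r2 v = ?r2 u" using eq rr[OF v(1)] rr[OF u(1)] unfolding v(2) u(2) by (rule box_equals)
          then show "X = X'" using inj_onD[OF inj _ v(1) u(1)] v(2) u(2) by (simp only:)
        qed
        show "f' ` ?r1 ` P 1 = ?r2 ` P 1" unfolding image_image using rr by (intro image_cong refl)
      qed
      fix k X assume k: "k \<in> K" and "X \<in> P' 1"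
      then obtain v where v: "v \<in> P 1" "X = ?r1 v" unfolding P'1 by blast
      have "Ad G \<psi> k X = ?r1 (Ad G \<psi> k v)" "Ad G \<psi> k (?r2 v) = ?r2 (Ad G \<psi> k v)"
        using e1 e2 k v(1) unfolding rep_equivalence_def v(2) by (metis, metis)
      then show "f' (Ad G \<psi> k X) = Ad G \<psi> k (f' X)" using rr[OF v(1)] rr[OF P1_inv[OF k v(1)]] v(2) by simp
    qed
    then show ?thesis using rr[OF Y_P(1)] by (auto simp: Z1_def Z2_def)
  qed
  have "isotropy_decomposition G \<psi> K Q m P'"
    unfolding isotropy_decomposition_def
  proof (intro conjI ballI impI)
    show "irreducible_rep K (Ad G \<psi>) (P' i)" if "i \<in> {1..m}" for i
      using i_cases[OF that] irreducible_rep_transport[OF e1] irreducible_rep_transport[OF e2] irr[of 1] m2 P'i irr[OF that]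
      by auto
    show "Q X Y = 0" if i: "i \<in> {1..m}" and X: "X \<in> \<kk>" and Y: "Y \<in> P' i" for i X Y
    proof -
      have lin: "linear (Q X)" using rep.Qb by (simp add: bilinear_def)
      have "Q X (rot a b v) = 0" if "v \<in> P 1" for a b v
        by (rule rot_zero[OF lin]) (use Q_kk[OF X, of 1] Q_kk[OF X, of 2] f_P that m2 in auto)
      then show ?thesis using i_cases[OF i] Y P'1 P'2 P'i Q_kk[OF X i] by auto
    qed
    show "Q X Y = 0" if i: "i \<in> {1..m}" and j: "j \<in> {1..m}" and ij: "i \<noteq> j" and X: "X \<in> P' i" and Y: "Y \<in> P' j" for i j X Y
    proof -
      have 12: "Q X Y = 0" if "X \<in> P' 1" "Y \<in> P' 2" for X Y
        using that Q_rot[of _ _ c s "- s" c] unfolding P'1 P'2 by (auto elim!: imageE)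
      have r: "Q (rot a b v) Y = 0" if v: "v \<in> P 1" and j: "j \<in> {3..m}" "Y \<in> P j" for a b v j Y
        by (rule rot_zero[OF Q_linear]) (use Q_PP[of 1 j v Y] Q_PP[of 2 j "f v" Y] f_P[OF v] v j m2 in auto)
      have l3: "Q X Y = 0" if "X \<in> P' 1 \<or> X \<in> P' 2" "j \<in> {3..m}" "Y \<in> P' j" for j X Y
        using that(1) r[OF _ that(2)] that(3) unfolding P'1 P'2 P'i[OF that(2)] by auto
      show ?thesis
        using i_cases[OF i]
      proof (elim disjE)
        assume "i = 1"
        then show ?thesis using i_cases[OF j] ij X Y 12 l3 by blast
      next
        assume "i = 2"
        then show ?thesis using i_cases[OF j] ij X Y 12[of Y X] l3 rep.Q_sym[of X Y] by auto
      next
        assume i3: "i \<in> {3..m}"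
        then show ?thesis
          using i_cases[OF j] ij X Y l3[OF _ i3 X, of Y] rep.Q_sym[of X Y] P'i Q_PP[OF i j ij] by auto
      qed
    qed
    show "span (\<kk> \<union> (\<Union>i\<in>{1..m}. P' i)) = UNIV"
    proof -
      let ?S = "span (\<kk> \<union> (\<Union>i\<in>{1..m}. P' i))"
      have mem: "X \<in> ?S" if "i \<in> {1..m}" "X \<in> P' i" for i X using that by (intro span_base) auto
      have r: "?r1 v \<in> ?S" "?r2 v \<in> ?S" if "v \<in> P 1" for v
        using mem[of 1 "?r1 v", unfolded P'1] mem[of 2 "?r2 v", unfolded P'2] that m2 by auto
      \<comment> \<open>The inverse rotation recovers \<open>P 1\<close> and \<open>P 2\<close> from
        the rotated summands.\<close>
      have v1: "v = c *\<^sub>R ?r1 v - s *\<^sub>R ?r2 v" and v2: "f v = s *\<^sub>R ?r1 v + c *\<^sub>R ?r2 v" for v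
      proof -
        have "c *\<^sub>R ?r1 v - s *\<^sub>R ?r2 v = (c * c + s * s) *\<^sub>R v" "s *\<^sub>R ?r1 v + c *\<^sub>R ?r2 v = (c * c + s * s) *\<^sub>R f v"
          by (simp_all add: rot_def algebra_simps)
        then show "v = c *\<^sub>R ?r1 v - s *\<^sub>R ?r2 v" "f v = s *\<^sub>R ?r1 v + c *\<^sub>R ?r2 v" by (simp_all add: cs)
      qed
      have "X \<in> ?S" if i: "i \<in> {1..m}" and X: "X \<in> P i" for i X
        using i_cases[OF i]
      proof (elim disjE)
        assume "i = 1"
        then show ?thesis using X r by (subst v1) (auto intro!: span_diff span_scale)
      next
        assume "i = 2"
        then obtain v where "v \<in> P 1" "X = f v" using f_surj X by blast
        then show ?thesis using v2[of v] r by (auto intro!: span_add span_scale)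
      next
        assume "i \<in> {3..m}"
        then show ?thesis using mem[OF i] X P'i by blast
      qed
      then have "\<kk> \<union> (\<Union>i\<in>{1..m}. P i) \<subseteq> ?S" using span_base[of _ "\<kk> \<union> (\<Union>i\<in>{1..m}. P' i)"] by blast
      then have "span (\<kk> \<union> (\<Union>i\<in>{1..m}. P i)) \<subseteq> ?S" by (intro span_minimal) auto
      then show ?thesis using dec by (auto simp: isotropy_decomposition_def)
    qed
  qed
  moreover have "two_equivalent_orthogonal_summands G \<psi> K m P'"
  proof -
    have "\<not> equivalent_reps K (Ad G \<psi>) (P' 1) (P' i)" if "i \<in> {3..m}" for i
      using P1_inequivalent[OF that] rep_equivalence_trans[OF e1] P'i[OF that] unfolding equivalent_reps_def by metis
    then show ?thesis
      unfolding two_equivalent_orthogonal_summands_def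
      using orthogonal_rep_transport[OF e1 orth] orthogonal_rep_transport[OF e2 orth] f' P'i m2 two
      by (auto simp: equivalent_reps_def two_equivalent_orthogonal_summands_def)
  qed
  moreover have "corresponding_bases G \<psi> K Q P' d Z1 Z2"
    unfolding corresponding_bases_def
  proof (intro conjI ballI f')
    show "Q (Z1 k) (Z1 l) = of_bool (k = l)" "Q (Z2 k) (Z2 l) = of_bool (k = l)" if "k \<in> {1..d}" "l \<in> {1..d}" for k l
      unfolding Z1_def Z2_def Q_rot[OF Y_P(1)[OF that(1)] Y_P(1)[OF that(2)]] Y1_orth[OF that] using cs by simp_all
    show "span (Z1 ` {1..d}) = P' 1" "span (Z2 ` {1..d}) = P' 2"
      unfolding Z1_def Z2_def P'1 P'2 by (rule span_rot)+
  qed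
  moreover have "invariant_metric_form Q m P' d Z1 Z2 (orbit_metric G \<psi> AM g act (\<gamma> t))
      (c * c * h11 t + 2 * c * s * h12 t + s * s * h22 t) 0 (s * s * h11 t - 2 * c * s * h12 t + c * c * h22 t) (A t)"
    if t: "t \<in> I" for t
  proof -
    have B_eq: "orbit_metric G \<psi> AM g act (\<gamma> t) = B t" by (auto simp: B_def fun_eq_iff)
    have 0: "c * (- s) * h11 t + (c * c + s * (- s)) * h12 t + s * c * h22 t = 0"
      using diag[OF t] by (simp add: algebra_simps)
    show ?thesis
      unfolding invariant_metric_form_def B_eq
    proof (intro conjI ballI impI)
      fix k l assume k: "k \<in> {1..d}" and l: "l \<in> {1..d}"
      note BB = B_rot[OF t Y_P(1)[OF k] Y_P(1)[OF l], unfolded Y1_orth[OF k l]]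
      show "B t (Z1 k) (Z1 l) = (c * c * h11 t + 2 * c * s * h12 t + s * s * h22 t) * of_bool (k = l)"
        "B t (Z2 k) (Z2 l) = (s * s * h11 t - 2 * c * s * h12 t + c * c * h22 t) * of_bool (k = l)"
        unfolding Z1_def Z2_def BB by (simp_all add: algebra_simps)
      show "B t (Z1 k) (Z2 l) = 0 * of_bool (k = l)" unfolding Z1_def Z2_def BB 0 ..
      have "(- s) * c * h11 t + ((- s) * s + c * c) * h12 t + c * s * h22 t = 0" using 0 by (simp add: algebra_simps)
      then show "B t (Z2 k) (Z1 l) = 0 * of_bool (k = l)" unfolding Z1_def Z2_def BB by simp
    next
      show "B t X Y = A t i * Q X Y" if "i \<in> {3..m}" "X \<in> P' i" "Y \<in> P' i" for i X Y
        using Bii[OF t that(1)] that P'i by auto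
    next
      fix i j X Y assume i: "i \<in> {1..m}" and j: "j \<in> {1..m}" and ij: "i \<noteq> j \<and> {i, j} \<noteq> {1, 2}"
        and X: "X \<in> P' i" and Y: "Y \<in> P' j"
      have r: "B t (rot a b v) Y = 0" if v: "v \<in> P 1" and j: "j \<in> {3..m}" "Y \<in> P j" for a b v j Y
        by (rule rot_zero[OF B_linear[OF t]])
          (use Bij[OF t, of 1 j v Y] Bij[OF t, of 2 j "f v" Y] f_P[OF v] v j m2 in \<open>auto simp: doubleton_eq_iff\<close>)
      have l3: "B t X Y = 0" if "X \<in> P' 1 \<or> X \<in> P' 2" "j \<in> {3..m}" "Y \<in> P' j" for j X Y
        using that(1) r[OF _ that(2)] that(3) unfolding P'1 P'2 P'i[OF that(2)] by auto
      show "B t X Y = 0"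
      proof (cases "i \<in> {3..m}")
        case i3: True
        show ?thesis
        proof (cases "j \<in> {3..m}")
          case True
          then show ?thesis using Bij[OF t i j] ij X Y P'i i3 by blast
        next
          case False
          then have "Y \<in> P' 1 \<or> Y \<in> P' 2" using i_cases[OF j] Y by auto
          then show ?thesis using l3[OF _ i3 X, of Y] B_sym[OF t, of X Y] by simp
        qed
      next
        case False
        then have "X \<in> P' 1 \<or> X \<in> P' 2" "j \<in> {3..m}" using i_cases[OF i] i_cases[OF j] X ij by auto
        then show ?thesis using l3 Y by blast
      qed
    qed
  qed
  ultimately show ?thesis
    unfolding diagonalizable_metric_def
    by (intro exI[where x = P'] exI[where x = Z1] exI[where x = Z2] conjI ballI
        exI[where x = "\<lambda>t. c * c * h11 t + 2 * c * s * h12 t + s * s * h22 t"] exI[where x = "\<lambda>t. 0"]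
        exI[where x = "\<lambda>t. s * s * h11 t - 2 * c * s * h12 t + c * c * h22 t"] exI[where x = A]) auto
qed

lemma isotropy_complement:
  assumes "X \<in> \<kk>" and "X \<in> span (\<Union>i\<in>{1..m}. P i)"
  shows "X = 0"
proof -
  have "subspace {Y. Q X Y = 0}" by (rule subspaceI) (auto simp: rep.Ql)
  then have "span (\<Union>i\<in>{1..m}. P i) \<subseteq> {Y. Q X Y = 0}"
    using Q_kk[OF assms(1)] by (intro span_minimal) auto
  then have "Q X X = 0" using assms(2) by blast
  then show ?thesis using rep.Q_pos[of X] by force
qed

text \<open>Used in contrapositive form: a nonzero component in the complement shows that the sum of
  brackets is nonzero. The definite description is resolved because the isotropy algebra meets the
  complement only in 0.\<close>

lemma p_part_zero: "p_part G \<psi> K m P 0 = 0"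
  unfolding p_part_def
proof (rule the_equality)
  show "0 \<in> span (\<Union>i\<in>{1..m}. P i) \<and> 0 - 0 \<in> \<kk>" using subspace_0[OF isotropy_subspace] span_zero by simp
  show "X = 0" if "X \<in> span (\<Union>i\<in>{1..m}. P i) \<and> 0 - X \<in> \<kk>" for X
    using that isotropy_complement[of X] subspace_neg[OF isotropy_subspace, of "0 - X"] by simp
qed

end

text \<open>A rotation by an angle turns the trace-free part \<open>(p / 2, q)\<close> of a
  symmetric 2 by 2 matrix by twice that angle, hence the half angle in \<open>c\<close> and
  \<open>s\<close>.\<close>

lemma diagonalizing_rotation:
  fixes x y :: real
  assumes "(x, y) \<noteq> (0, 0)"
  shows "\<exists>c s. c * c + s * s = 1 \<and> (\<forall>p q. x * p + y * q = 0 \<longrightarrow> (c * c - s * s) * q = c * s * p)"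
proof -
  \<comment> \<open>With cosine \<open>y / r\<close> and sine \<open>- (2 * x) / r\<close>, the
    required equation becomes a multiple of \<open>x * p + y * q = 0\<close>; the 2 comes from the
    double angle formula for the sine.\<close>
  define r where "r = sqrt (y\<^sup>2 + (2 * x)\<^sup>2)"
  have "y\<^sup>2 + (2 * x)\<^sup>2 > 0" using assms unfolding sum_power2_gt_zero_iff by auto
  then have r: "r > 0" "r\<^sup>2 = y\<^sup>2 + (2 * x)\<^sup>2" by (auto simp: r_def)
  have "(y / r)\<^sup>2 + (- (2 * x) / r)\<^sup>2 = 1"
    using \<open>y\<^sup>2 + (2 * x)\<^sup>2 > 0\<close> r(2) by (simp add: power_divide add_divide_distrib[symmetric])
  then obtain \<theta> where \<theta>: "y / r = cos \<theta>" "- (2 * x) / r = sin \<theta>" using sincos_total_2pi by metis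
  define c s where "c = cos (\<theta> / 2)" and "s = sin (\<theta> / 2)"
  have cs: "c * c + s * s = 1" unfolding c_def s_def by (simp add: power2_eq_square[symmetric])
  have y: "y = r * (c * c - s * s)"
  proof -
    have "cos \<theta> = c * c - s * s" using cos_double[of "\<theta> / 2"] by (simp add: c_def s_def power2_eq_square)
    then have "y / r = c * c - s * s" using \<theta>(1) by simp
    then show ?thesis using r(1) by (simp add: divide_eq_eq mult.commute)
  qed
  have x: "x = - (r * (c * s))"
  proof -
    have "sin \<theta> = 2 * (c * s)" using sin_double[of "\<theta> / 2"] by (simp add: c_def s_def)
    then show ?thesis using \<theta>(2) r(1) by (simp add: field_simps)
  qed
  have "(c * c - s * s) * q = c * s * p" if "x * p + y * q = 0" for p q
  proof -
    have "r * ((c * c - s * s) * q - c * s * p) = 0" using that unfolding x y by (simp add: algebra_simps)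
    then show ?thesis using r(1) by simp
  qed
  then show ?thesis using cs by blast
qed

theorem theorem3p1:
  fixes G :: "('g::{t2_space, second_countable_topology}) monoid"
    and AG :: "('g, 'l::euclidean_space) chart set"
    and \<psi> :: "('g, 'l) chart"
    and AM :: "('m::{t2_space, second_countable_topology}, 'e::euclidean_space) chart set"
    and g :: "('m, 'e) metric_tensor"
    and act :: "'g \<Rightarrow> 'm \<Rightarrow> 'm"
    and K :: "'g set" and Q :: "'l \<Rightarrow> 'l \<Rightarrow> real"
    and I :: "real set" and \<gamma> :: "real \<Rightarrow> 'm"
    and m d :: nat and P :: "nat \<Rightarrow> 'l set" and Y1 Y2 :: "nat \<Rightarrow> 'l"
  assumes "lie_group G AG" and "compact (UNIV :: 'g set)" and "connected (UNIV :: 'g set)"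
    and "\<psi> \<in> AG" and "\<one>\<^bsub>G\<^esub> \<in> fst \<psi>"
    and "smooth_atlas AM" and "connected (UNIV :: 'm set)"
    and "einstein_metric AM g"
    and "isometric_action G AG AM g act"
    and "cohomogeneity_one G \<psi> AM act"
    and "normal_curve G \<psi> AM g act K I \<gamma>"
    and "bi_invariant_inner_product G \<psi> Q"
    and "isotropy_decomposition G \<psi> K Q m P"
    and "two_equivalent_orthogonal_summands G \<psi> K m P"
    and "dim (P 1) = d"
    and "corresponding_bases G \<psi> K Q P d Y1 Y2"
    and "p_part G \<psi> K m P (\<Sum>k=1..d. lie_bracket G \<psi> (Y1 k) (Y2 k)) \<noteq> 0"
  shows "diagonalizable_metric G \<psi> AM g act K Q m d I \<gamma>"
proof -
  obtain \<Lambda> where \<Lambda>: "\<And>c p v w. c \<in> AM \<Longrightarrow> p \<in> fst c \<Longrightarrow> ricci (metric_coeff g c) (snd c p) v w = \<Lambda> * g c p v w"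
    and metric: "riemannian_metric AM g"
    using assms(8) unfolding einstein_metric_def by blast
  obtain f where f: "rep_equivalence K (Ad G \<psi>) (P 1) (P 2) f" "\<And>k. k \<in> {1..d} \<Longrightarrow> f (Y1 k) = Y2 k"
    and bases: "\<And>k l. k \<in> {1..d} \<Longrightarrow> l \<in> {1..d} \<Longrightarrow> Q (Y1 k) (Y1 l) = of_bool (k = l)"
      "\<And>k l. k \<in> {1..d} \<Longrightarrow> l \<in> {1..d} \<Longrightarrow> Q (Y2 k) (Y2 l) = of_bool (k = l)"
      "span (Y1 ` {1..d}) = P 1" "span (Y2 ` {1..d}) = P 2"
    using assms(16) unfolding corresponding_bases_def by blast
  interpret lie_action G AG \<psi> AM g act
    by (rule lie_action.intro) (fact assms metric)+
  interpret einstein_normal G AG \<psi> AM g act K I \<gamma> \<Lambda>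
    by (rule einstein_normal.intro[OF lie_action_axioms einstein_normal_axioms.intro]) (fact assms \<Lambda>)+
  interpret two_summands G AG \<psi> AM g act K I \<gamma> \<Lambda> Q m d P Y1 Y2 f
    by (rule two_summands.intro[OF einstein_normal_axioms two_summands_axioms.intro]) (fact assms f bases)+
  have "(\<Sum>k=1..d. br (Y1 k) (Y2 k)) \<noteq> 0"
    using assms(17) p_part_zero unfolding lie_bracket_eq by metis
  then obtain x y where xy: "(x, y) \<noteq> (0, 0)" "\<And>t. t \<in> I \<Longrightarrow> x * (h11 t - h22 t) + y * h12 t = 0"
    using constant_direction by blast
  obtain c s where "c * c + s * s = 1" "\<And>p q. x * p + y * q = 0 \<Longrightarrow> (c * c - s * s) * q = c * s * p"
    using diagonalizing_rotation[OF xy(1)] by blast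
  then show ?thesis using xy(2) by (intro diagonalize) auto
qed

end
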